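(* Let $X$ be a simply-laced root system with all irreducible components having the same Coxeter number $m$. Then there exists at most one vector-valued mock modular form $h^X=(h^X_r)_{r\in\mathbb{Z}/2m\mathbb{Z}}$ of weight $1/2$ for $SL_2(\mathbb{Z})$ with shadow $S^X$ that satisfies the optimal growth condition $$q^{1/4m}h^X_r(\tau)=O(1)\quad\text{as }\tau\to i\infty,\ \text{for all } r\in\mathbb{Z}/2m\mathbb{Z}.$$
   Context: Notation: $\tau\in\mathbb{H}$, $z\in\mathbb{C}$, $e(x)=e^{2\pi ix}$, $q=e(\tau)$, $y=e(z)$; $\theta_{m,r}(\tau,z)=\sum_{k\equiv r\,(\mathrm{mod}\,2m)}q^{k^2/4m}y^k$ and $S_{m,r}(\tau)=\frac1{2\pi i}\frac{\partial}{\partial z}\theta_{m,r}(\tau,z)\big|_{z=0}=\sum_{k\equiv r\,(2m)}k\,q^{k^2/4m}$. Matrices: for $n|m$ let $\Omega_m(n)$ be the $2m\times2m$ matrix indexed by $\mathbb{Z}/2m\mathbb{Z}$ with $\Omega_m(n)_{r,r'}=1$ if $r+r'\equiv0\ (\mathrm{mod}\ 2n)$ and $r-r'\equiv0\ (\mathrm{mod}\ 2m/n)$, and $0$ otherwise. Put $\Omega^{A_{m-1}}=\Omega_m(1)$; $\Omega^{D_{m/2+1}}=\Omega_m(1)+\Omega_m(m/2)$; $\Omega^{E_6}=\Omega_{12}(1)+\Omega_{12}(4)+\Omega_{12}(6)$; $\Omega^{E_7}=\Omega_{18}(1)+\Omega_{18}(6)+\Omega_{18}(9)$; $\Omega^{E_8}=\Omega_{30}(1)+\Omega_{30}(6)+\Omega_{30}(10)+\Omega_{30}(15)$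 (the Coxeter numbers being $m,m,12,18,30$). For a union $X=\bigcup_iX_i$ of irreducible simply-laced root systems with the same Coxeter number $m$, $\Omega^X=\sum_i\Omega^{X_i}$. Define $S^X=(S^X_r)$ by $S^X_r=\sum_{r'\,(\mathrm{mod}\,2m)}\Omega^X_{r,r'}S_{m,r'}$, a vector-valued cusp form of weight $3/2$ for $SL_2(\mathbb{Z})$. Mock modular form with shadow $S^X$: a vector $h=(h_r)_{r\in\mathbb{Z}/2m\mathbb{Z}}$ of holomorphic functions on $\mathbb{H}$, with at most exponential growth at the cusp, such that the completion $$\widehat h_r(\tau)=h_r(\tau)+e(-\tfrac18)\frac1{\sqrt{2m}}\int_{-\bar\tau}^{i\infty}(\tau'+\tau)^{-1/2}\,\overline{S^X_r(-\bar\tau')}\,d\tau'$$ transforms as a vector-valued modular form of weight $1/2$ for $SL_2(\mathbb{Z})$ with multiplier system inverse to that of $S_m=(S_{m,r})$ (and of $S^X$); equivalently, $\sum_r\widehat h_r(\tau)\theta_{m,r}(\tau,z)$ is invariant under $f(\tau,z)\mapsto e\left(-m\frac{cz^2}{c\tau+d}\right)(c\tau+d)^{-1}f\left(\frac{a\tau+b}{c\tau+d},\frac z{c\tau+d}\right)$ for all $\begin{pmatrix}a&b\\c&d\end{pmatrix}\in SL_2(\mathbb{Z})$. Powers use the principal branch. *)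

theory Defs
  imports "HOL-Analysis.Analysis" "HOL-Library.Landau_Symbols"
begin

section \<open>Root systems\<close>

definition root_reflection :: "'a::euclidean_space \<Rightarrow> 'a \<Rightarrow> 'a" where
  "root_reflection \<alpha> v = v - (2 * (v \<bullet> \<alpha>) / (\<alpha> \<bullet> \<alpha>)) *\<^sub>R \<alpha>"

text \<open>Reduced crystallographic root systems. The roots are not required to span the ambient
  space: \<open>X\<close> is regarded as a root system in \<open>span X\<close>, so that the irreducible components of
  \<open>X\<close> are again root systems.\<close>

definition root_system :: "'a::euclidean_space set \<Rightarrow> bool" where
  "root_system X \<longleftrightarrow> finite X \<and> 0 \<notin> X \<and>
     (\<forall>\<alpha>\<in>X. root_reflection \<alpha> ` X \<subseteq> X) \<and>
     (\<forall>\<alpha>\<in>X. \<forall>c::real. c *\<^sub>R \<alpha> \<in> X \<longleftrightarrow> c = 1 \<or> c = -1) \<and>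
     (\<forall>\<alpha>\<in>X. \<forall>\<beta>\<in>X. 2 * (\<beta> \<bullet> \<alpha>) / (\<alpha> \<bullet> \<alpha>) \<in> \<int>)"

definition irreducible_roots :: "'a::euclidean_space set \<Rightarrow> bool" where
  "irreducible_roots C \<longleftrightarrow> C \<noteq> {} \<and>
     (\<forall>D\<subseteq>C. (\<forall>\<alpha>\<in>D. \<forall>\<beta>\<in>C - D. \<alpha> \<bullet> \<beta> = 0) \<longrightarrow> D = {} \<or> D = C)"

definition irreducible_components :: "'a::euclidean_space set \<Rightarrow> 'a set set" where
  "irreducible_components X =
     {C. C \<subseteq> X \<and> irreducible_roots C \<and> (\<forall>\<alpha>\<in>C. \<forall>\<beta>\<in>X - C. \<alpha> \<bullet> \<beta> = 0)}"

text \<open>Roots in different components may have different lengths.\<close>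

definition simply_laced :: "'a::euclidean_space set \<Rightarrow> bool" where
  "simply_laced X \<longleftrightarrow>
     (\<forall>C\<in>irreducible_components X. \<forall>\<alpha>\<in>C. \<forall>\<beta>\<in>C. norm \<alpha> = norm \<beta>)"

text \<open>The simple roots of a base, in some order.\<close>

definition simple_roots :: "'a::euclidean_space set \<Rightarrow> 'a list \<Rightarrow> bool" where
  "simple_roots C bs \<longleftrightarrow> distinct bs \<and> set bs \<subseteq> C \<and> independent (set bs) \<and>
     (\<forall>\<alpha>\<in>C. \<exists>k::'a \<Rightarrow> nat. \<alpha> = (\<Sum>\<beta>\<in>set bs. real (k \<beta>) *\<^sub>R \<beta>) \<or>
                            \<alpha> = - (\<Sum>\<beta>\<in>set bs. real (k \<beta>) *\<^sub>R \<beta>))"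

definition coxeter_element :: "'a::euclidean_space list \<Rightarrow> 'a \<Rightarrow> 'a" where
  "coxeter_element bs = foldr (\<circ>) (map root_reflection bs) id"

text \<open>The Coxeter number of an irreducible root system is the order of a Coxeter element. All
  Coxeter elements are conjugate, so it does not depend on the choice of \<open>bs\<close>.\<close>

definition has_coxeter_number :: "'a::euclidean_space set \<Rightarrow> nat \<Rightarrow> bool" where
  "has_coxeter_number C m \<longleftrightarrow> (\<exists>bs. simple_roots C bs \<and> m > 0 \<and>
     coxeter_element bs ^^ m = id \<and> (\<forall>k. 0 < k \<and> k < m \<longrightarrow> coxeter_element bs ^^ k \<noteq> id))"

section \<open>ADE types\<close>

datatype ade = A_type nat | D_type nat | E6 | E7 | E8

fun valid_ade :: "ade \<Rightarrow> bool" where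
  "valid_ade (A_type n) \<longleftrightarrow> n \<ge> 1"
| "valid_ade (D_type n) \<longleftrightarrow> n \<ge> 4"
| "valid_ade E6 \<longleftrightarrow> True"
| "valid_ade E7 \<longleftrightarrow> True"
| "valid_ade E8 \<longleftrightarrow> True"

fun ade_rank :: "ade \<Rightarrow> nat" where
  "ade_rank (A_type n) = n"
| "ade_rank (D_type n) = n"
| "ade_rank E6 = 6"
| "ade_rank E7 = 7"
| "ade_rank E8 = 8"

text \<open>Edges \<open>{i, j}\<close> with \<open>i < j\<close> of the Dynkin diagram on the nodes \<open>0, \<dots>, n - 1\<close>. For types
  \<open>D\<close> and \<open>E\<close> the nodes \<open>0, \<dots>, n - 2\<close> form a chain and the node \<open>n - 1\<close> is attached to the
  node \<open>n - 3\<close>, respectively \<open>2\<close>.\<close>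

fun dynkin_edge :: "ade \<Rightarrow> nat \<Rightarrow> nat \<Rightarrow> bool" where
  "dynkin_edge (A_type n) i j \<longleftrightarrow> j = i + 1 \<and> j < n"
| "dynkin_edge (D_type n) i j \<longleftrightarrow> j = i + 1 \<and> j < n - 1 \<or> i = n - 3 \<and> j = n - 1"
| "dynkin_edge E6 i j \<longleftrightarrow> j = i + 1 \<and> j < 5 \<or> i = 2 \<and> j = 5"
| "dynkin_edge E7 i j \<longleftrightarrow> j = i + 1 \<and> j < 6 \<or> i = 2 \<and> j = 6"
| "dynkin_edge E8 i j \<longleftrightarrow> j = i + 1 \<and> j < 7 \<or> i = 2 \<and> j = 7"

definition has_ade_type :: "'a::euclidean_space set \<Rightarrow> ade \<Rightarrow> bool" where
  "has_ade_type C t \<longleftrightarrow> valid_ade t \<and> (\<exists>bs. simple_roots C bs \<and> length bs = ade_rank t \<and>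
     (\<forall>i<length bs. \<forall>j<length bs. i \<noteq> j \<longrightarrow>
        2 * (bs ! i \<bullet> bs ! j) / (bs ! j \<bullet> bs ! j) =
          (if dynkin_edge t i j \<or> dynkin_edge t j i then -1 else 0)))"

text \<open>Well defined on irreducible simply-laced root systems, by their classification.\<close>

definition ade_type :: "'a::euclidean_space set \<Rightarrow> ade" where
  "ade_type C = (THE t. has_ade_type C t)"

section \<open>The matrices \<open>\<Omega>\<close>\<close>

text \<open>Objects indexed by \<open>\<int>/2m\<int>\<close> are functions on \<^typ>\<open>int\<close> of period \<open>2 * m\<close>. The matrix
  \<open>\<Omega>\<^sub>m(n)\<close> is only used for \<open>n\<close> dividing \<open>m\<close>.\<close>

definition Omega :: "nat \<Rightarrow> nat \<Rightarrow> int \<Rightarrow> int \<Rightarrow> int" where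
  "Omega m n r r' = (if int (2 * n) dvd r + r' \<and> int (2 * m div n) dvd r - r' then 1 else 0)"

text \<open>The first argument of \<^const>\<open>Omega\<close> is the Coxeter number of the given type:
  \<open>n + 1\<close>, \<open>2n - 2\<close>, 12, 18 and 30.\<close>

fun Omega_ade :: "ade \<Rightarrow> int \<Rightarrow> int \<Rightarrow> int" where
  "Omega_ade (A_type n) r r' = Omega (n + 1) 1 r r'"
| "Omega_ade (D_type n) r r' = Omega (2 * n - 2) 1 r r' + Omega (2 * n - 2) (n - 1) r r'"
| "Omega_ade E6 r r' = Omega 12 1 r r' + Omega 12 4 r r' + Omega 12 6 r r'"
| "Omega_ade E7 r r' = Omega 18 1 r r' + Omega 18 6 r r' + Omega 18 9 r r'"
| "Omega_ade E8 r r' =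
     Omega 30 1 r r' + Omega 30 6 r r' + Omega 30 10 r r' + Omega 30 15 r r'"

definition Omega_root_system :: "'a::euclidean_space set \<Rightarrow> int \<Rightarrow> int \<Rightarrow> int" where
  "Omega_root_system X r r' = (\<Sum>C\<in>irreducible_components X. Omega_ade (ade_type C) r r')"

section \<open>Theta functions and the shadow\<close>

definition e2pi :: "complex \<Rightarrow> complex" where
  "e2pi x = exp (2 * of_real pi * \<i> * x)"

definition theta :: "nat \<Rightarrow> int \<Rightarrow> complex \<Rightarrow> complex \<Rightarrow> complex" where
  "theta m r \<tau> z =
     (\<Sum>\<^sub>\<infinity>k\<in>{k::int. int (2 * m) dvd k - r}.
        e2pi (\<tau> * of_int k ^ 2 / (4 * of_nat m)) * e2pi (of_int k * z))"

definition unary_theta :: "nat \<Rightarrow> int \<Rightarrow> complex \<Rightarrow> complex" where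
  "unary_theta m r \<tau> = deriv (\<lambda>z. theta m r \<tau> z) 0 / (2 * of_real pi * \<i>)"

definition umbral_shadow :: "nat \<Rightarrow> 'a::euclidean_space set \<Rightarrow> int \<Rightarrow> complex \<Rightarrow> complex" where
  "umbral_shadow m X r \<tau> =
     (\<Sum>r'\<in>{0..<2 * int m}. of_int (Omega_root_system X r r') * unary_theta m r' \<tau>)"

section \<open>Vector-valued mock modular forms of weight \<open>1/2\<close>\<close>

definition upper_half_plane :: "complex set" where
  "upper_half_plane = {\<tau>. Im \<tau> > 0}"

text \<open>The path from \<open>-cnj \<tau>\<close> to \<open>\<i>\<infinity>\<close> is the vertical half-line \<open>\<tau>' = -cnj \<tau> + \<i> t\<close>,
  \<open>0 < t < \<infinity>\<close>; the factor \<open>\<i>\<close> at the end of the integrand is \<open>d\<tau>'/dt\<close>.\<close>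

definition completion ::
  "nat \<Rightarrow> (int \<Rightarrow> complex \<Rightarrow> complex) \<Rightarrow> (int \<Rightarrow> complex \<Rightarrow> complex) \<Rightarrow> int \<Rightarrow> complex \<Rightarrow> complex"
where
  "completion m S h r \<tau> = h r \<tau> + e2pi (- 1 / 8) * (1 / of_real (sqrt (2 * real m))) *
     (LINT t:{0<..}|lborel.
        (let \<tau>' = - cnj \<tau> + \<i> * of_real t
         in (\<tau>' + \<tau>) powr (- 1 / 2) * cnj (S r (- cnj \<tau>')) * \<i>))"

definition theta_pairing ::
  "nat \<Rightarrow> (int \<Rightarrow> complex \<Rightarrow> complex) \<Rightarrow> complex \<Rightarrow> complex \<Rightarrow> complex" where
  "theta_pairing m g \<tau> z = (\<Sum>r\<in>{0..<2 * int m}. g r \<tau> * theta m r \<tau> z)"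

text \<open>Weight \<open>1/2\<close> for \<open>SL\<^sub>2(\<int>)\<close> with multiplier system inverse to that of \<^const>\<open>unary_theta\<close>
  (which is the multiplier system of \<^const>\<open>theta\<close>): the pairing with \<^const>\<open>theta\<close> is invariant
  under the weight 1, index \<open>m\<close> action.\<close>

definition weight_half_modular :: "nat \<Rightarrow> (int \<Rightarrow> complex \<Rightarrow> complex) \<Rightarrow> bool" where
  "weight_half_modular m g \<longleftrightarrow>
     (\<forall>a b c d :: int. a * d - b * c = 1 \<longrightarrow> (\<forall>\<tau>\<in>upper_half_plane. \<forall>z.
        (let j = of_int c * \<tau> + of_int d in
         e2pi (- of_nat m * (of_int c * z ^ 2 / j)) * inverse j *
         theta_pairing m g ((of_int a * \<tau> + of_int b) / j) (z / j)
         = theta_pairing m g \<tau> z)))"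

text \<open>The filter \<^term>\<open>filtercomap Im at_top\<close> is \<open>\<tau> \<rightarrow> \<i>\<infinity>\<close>, uniformly in \<open>Re \<tau>\<close>.\<close>

definition mock_modular_form ::
  "nat \<Rightarrow> (int \<Rightarrow> complex \<Rightarrow> complex) \<Rightarrow> (int \<Rightarrow> complex \<Rightarrow> complex) \<Rightarrow> bool" where
  "mock_modular_form m S h \<longleftrightarrow>
     (\<forall>r. h (r + 2 * int m) = h r) \<and>
     (\<forall>r. h r holomorphic_on upper_half_plane) \<and>
     (\<forall>r. \<exists>c::real. h r \<in> O[filtercomap Im at_top](\<lambda>\<tau>. of_real (exp (c * Im \<tau>)))) \<and>
     weight_half_modular m (completion m S h)"

definition optimal_growth :: "nat \<Rightarrow> (int \<Rightarrow> complex \<Rightarrow> complex) \<Rightarrow> bool" where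
  "optimal_growth m h \<longleftrightarrow>
     (\<forall>r. (\<lambda>\<tau>. e2pi (\<tau> / (4 * of_nat m)) * h r \<tau>) \<in> O[filtercomap Im at_top](\<lambda>_. 1))"

end

theory Submission
  imports Defs "HOL-Complex_Analysis.Complex_Analysis" "HOL-Number_Theory.Number_Theory" "HOL-Computational_Algebra.Nth_Powers"
begin

text \<open>The shadow cancels in the difference of two such mock modular forms, which is therefore a
  vector-valued modular form of weight 1/2, or equivalently, by pairing with the theta functions
  \<open>\<theta>\<^sub>m\<^sub>,\<^sub>r\<close>, an array \<open>c(n, r)\<close> of coefficients of a weak Jacobi form of weight 1 and index \<open>m\<close>. A
  polar term \<open>r\<^sup>2 - 4mn = 1\<close> would be the constant term of a form of weight 2, which vanishes. So it
  suffices that there is no holomorphic Jacobi form of weight 1 (Skoruppa's theorem). We follow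
  Serre and Stark instead of using the Weil representation:
  \<^item> pairing with derivatives of unary theta series gives a recursion, which expresses all
    coefficients by finitely many of them with coefficients in some \<open>\<int>[1/N]\<close>;
  \<^item> hence a large prime \<open>p\<close> can be used \<open>p\<close>-adically: the coefficients along \<open>(p\<^sup>2\<^sup>kn, p\<^sup>kr)\<close> satisfy a
    recursion with eigenvalues 1 and \<open>p\<close> up to sign, and boundedness of denominators gives
    \<open>c(p\<^sup>2n, pr) = (D/p) c(n, r)\<close> if \<open>p\<close> does not divide \<open>D = r\<^sup>2 - 4mn\<close>;
  \<^item> thus \<open>c(n, r)\<close> is part of an eigenvector with eigenvalue determined by \<open>(D/p)\<close>, and, by
    quadratic reciprocity, one can pass to a form on whose support either all \<open>-D \<noteq> 0\<close> are squares
    or twice squares, or a fixed odd prime \<open>l\<close> divides all \<open>-D \<noteq> 0\<close> to an odd power;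
  \<^item> a common divisor \<open>g\<close> of all \<open>r\<close> in the support satisfies \<open>g\<^sup>2 dvd m\<close>. This excludes the first
    case, and reduces the second one to \<open>norm (h\<^sub>r(\<tau> + 1/l)) = norm (h\<^sub>r(\<tau>))\<close>. Then
    \<open>y\<^sup>1\<^sup>/\<^sup>2 \<Sum>\<^sub>r (norm (h\<^sub>r))\<^sup>2\<close> is invariant under \<open>\<tau> \<mapsto> l\<^sup>2\<tau>\<close>, which is incompatible with the growth of
    \<open>h\<close> at infinity.\<close>

text \<open>The eigenvalues show on an eigenform of T = \<open>hecke\<close> - 1 with eigenvalue
  \<lambda>. Its coefficients a_j at (p^(2j) n, p^j r) satisfy p a_1 = (\<lambda> - \<eta>) a_0 and
  p a_(j+2) = \<lambda> a_(j+1) - a_j, where \<eta> is the Legendre symbol of D. The roots of p X^2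
  - \<lambda> X + 1 have product 1/p. If \<lambda> is a p-adic unit, one root has valuation -1 and
  is excluded by bounded denominators; then the other one is \<eta>, a_1 = \<eta> a_0 and \<lambda>
  = (p + 1) \<eta>. Eigenforms would bring in algebraic extensions, and complex numbers have no
  p-adic size. So Q-linear functionals into the rationals are used, abstract sets \<open>I e\<close>
  of multiples of p^e, and a pigeonhole argument that makes T invertible modulo p. The multiplier of
  weight 1/2 never has to be named: the laws are stated for functions of \<tau> and z, and pass to
  the components h_r because theta functions are linearly independent. The base q^(1/8m)
  accommodates q^(r^2/4m) and the cube of eta; division by the latter gives weight 0, where
  \<tau>-derivatives behave well.\<close>

abbreviation tpi :: complex where "tpi \<equiv> 2 * of_real pi * \<i>"

abbreviation res :: "nat \<Rightarrow> int set" where "res m \<equiv> {0..<2 * int m}"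

abbreviation disc :: "nat \<Rightarrow> int \<Rightarrow> complex" where
  "disc m r \<equiv> of_int r ^ 2 / (4 * of_nat m)"

abbreviation thetaexp :: "complex \<Rightarrow> complex \<Rightarrow> int \<Rightarrow> complex" where
  "thetaexp \<tau> z n \<equiv> e2pi (\<tau> * of_int n ^ 2 / 2 + of_int n * z)"

abbreviation kexp :: "nat \<Rightarrow> int \<Rightarrow> complex \<Rightarrow> complex" where
  "kexp m k \<tau> \<equiv> e2pi (\<tau> * of_int k ^ 2 / (4 * of_nat m))"

abbreviation weil :: "nat \<Rightarrow> int \<Rightarrow> int \<Rightarrow> complex" where
  "weil m r s \<equiv> e2pi (- (of_int r * of_int s) / (2 * of_nat m))"

abbreviation fexp :: "int \<Rightarrow> int \<Rightarrow> complex \<Rightarrow> complex \<Rightarrow> complex" where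
  "fexp n r \<tau> z \<equiv> e2pi (of_int n * \<tau> + of_int r * z)"

abbreviation hexp :: "nat \<Rightarrow> int \<Rightarrow> int \<Rightarrow> complex \<Rightarrow> complex" where
  "hexp m n r \<tau> \<equiv> e2pi (of_int n * \<tau> - disc m r * \<tau>)"

section \<open>Exponentials, unordered sums and uniqueness of Fourier coefficients\<close>

lemma e2pi_add: "e2pi (x + y) = e2pi x * e2pi y"
  by (simp add: e2pi_def exp_add distrib_left)

lemma e2pi_minus: "e2pi (- x) = inverse (e2pi x)"
  by (simp add: e2pi_def exp_minus)

lemma e2pi_diff: "e2pi (x - y) = e2pi x / e2pi y"
  by (simp add: e2pi_def exp_diff right_diff_distrib)

lemma e2pi_nz [simp]: "e2pi x \<noteq> 0"
  by (simp add: e2pi_def)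

lemma e2pi_0 [simp]: "e2pi 0 = 1"
  by (simp add: e2pi_def)

lemma e2pi_eq_1_iff: "e2pi x = 1 \<longleftrightarrow> x \<in> \<int>"
proof -
  have "e2pi x = 1 \<longleftrightarrow> (\<exists>n::int. x = of_int n)" unfolding e2pi_def exp_eq_1 by (auto simp: complex_eq_iff)
  thus ?thesis by (auto simp: Ints_def)
qed

lemma e2pi_of_int [simp]: "e2pi (of_int n) = 1"
  by (simp add: e2pi_eq_1_iff)

lemma e2pi_half [simp]: "e2pi (1 / 2) = -1"
  by (simp add: e2pi_def mult.assoc [symmetric])

lemma e2pi_mult_of_nat: "e2pi (of_nat n * x) = e2pi x ^ n"
  unfolding e2pi_def by (simp add: exp_of_nat_mult [symmetric] mult_ac)

lemma norm_e2pi: "norm (e2pi x) = exp (- 2 * pi * Im x)"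
  by (simp add: e2pi_def)

lemma e2pi_has_field_derivative [derivative_intros]:
  assumes "(f has_field_derivative f') (at x within S)"
  shows "((\<lambda>x. e2pi (f x)) has_field_derivative (tpi * f' * e2pi (f x))) (at x within S)"
  unfolding e2pi_def by (rule derivative_eq_intros refl assms | simp)+

lemma e2pi_holomorphic [holomorphic_intros]:
  "f holomorphic_on S \<Longrightarrow> (\<lambda>x. e2pi (f x)) holomorphic_on S"
  unfolding e2pi_def by (intro holomorphic_intros)

lemma upper_half_plane_iff [simp]: "\<tau> \<in> upper_half_plane \<longleftrightarrow> Im \<tau> > 0"
  by (simp add: upper_half_plane_def)

lemma open_upper_half_plane [simp]: "open upper_half_plane"
  by (simp add: upper_half_plane_def open_halfspace_Im_gt)

lemma convex_upper_half_plane [simp]: "convex upper_half_plane"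
  by (simp add: upper_half_plane_def convex_halfspace_Im_gt)

lemma Im_neg_inverse: "Im (- 1 / \<tau>) = Im \<tau> / (norm \<tau>)\<^sup>2"
  by (simp add: Im_divide cmod_power2)

lemma uhp_neg_inverse: "Im \<tau> > 0 \<Longrightarrow> Im (- 1 / \<tau>) > 0"
  unfolding Im_neg_inverse by (auto simp: zero_less_divide_iff)

text \<open>A locally uniform limit of holomorphic functions may be differentiated termwise, so a
  local majorant of the terms suffices and none is asked for \<open>f'\<close>.\<close>

lemma infsum_has_field_derivative:
  fixes f :: "'i \<Rightarrow> complex \<Rightarrow> complex"
  assumes S: "open S" "z \<in> S"
    and der: "\<And>n w. w \<in> S \<Longrightarrow> (f n has_field_derivative f' n w) (at w)"
    and bound: "\<And>w. w \<in> S \<Longrightarrow> \<exists>r>0. \<exists>M. cball w r \<subseteq> S \<and> M summable_on A \<and> (\<forall>n\<in>A. \<forall>v\<in>cball w r. norm (f n v) \<le> M n)"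
  shows "((\<lambda>w. \<Sum>\<^sub>\<infinity>n\<in>A. f n w) has_field_derivative (\<Sum>\<^sub>\<infinity>n\<in>A. f' n z)) (at z)"
    and "((\<lambda>n. f' n z) has_sum (\<Sum>\<^sub>\<infinity>n\<in>A. f' n z)) A"
proof -
  obtain r M where r: "r > 0" "cball z r \<subseteq> S" "M summable_on A"
    "\<And>n v. n \<in> A \<Longrightarrow> v \<in> cball z r \<Longrightarrow> norm (f n v) \<le> M n" using bound[OF S(2)] by blast
  have ul: "uniform_limit (cball z r) (\<lambda>X y. \<Sum>x\<in>X. f x y) (\<lambda>y. \<Sum>\<^sub>\<infinity>x\<in>A. f x y) (finite_subsets_at_top A)"
    by (rule Weierstrass_m_test_general[where M = M]) (use r(3,4) in blast)+
  have ev: "eventually (\<lambda>X. continuous_on (cball z r) (\<lambda>y. \<Sum>x\<in>X. f x y) \<and>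
       (\<forall>w\<in>ball z r. ((\<lambda>y. \<Sum>x\<in>X. f x y) has_field_derivative (\<Sum>x\<in>X. f' x w)) (at w))) (finite_subsets_at_top A)"
  proof (rule always_eventually, rule allI, rule conjI)
    fix X
    show "continuous_on (cball z r) (\<lambda>y. \<Sum>x\<in>X. f x y)"
    proof (rule continuous_on_sum)
      fix x
      have "((\<lambda>y. f x y) has_field_derivative f' x w) (at w within cball z r)" if "w \<in> cball z r" for w
        by (rule has_field_derivative_at_within, rule der) (use r(2) that in blast)
      thus "continuous_on (cball z r) (f x)" by (rule DERIV_continuous_on)
    qed
    show "\<forall>w\<in>ball z r. ((\<lambda>y. \<Sum>x\<in>X. f x y) has_field_derivative (\<Sum>x\<in>X. f' x w)) (at w)"
    proof
      fix w assume "w \<in> ball z r"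
      hence "w \<in> S" using r(2) by auto
      thus "((\<lambda>y. \<Sum>x\<in>X. f x y) has_field_derivative (\<Sum>x\<in>X. f' x w)) (at w)" by (intro DERIV_sum der)
    qed
  qed
  obtain g' where g': "\<And>w. w \<in> ball z r \<Longrightarrow> ((\<lambda>y. \<Sum>\<^sub>\<infinity>x\<in>A. f x y) has_field_derivative (g' w)) (at w) \<and> ((\<lambda>X. \<Sum>x\<in>X. f' x w) \<longlongrightarrow> g' w) (finite_subsets_at_top A)"
    using has_complex_derivative_uniform_limit[OF ev ul _ r(1)] by auto
  have "((\<lambda>n. f' n z) has_sum g' z) A" using g'[of z] r(1) by (auto simp: has_sum_def)
  thus s: "((\<lambda>n. f' n z) has_sum (\<Sum>\<^sub>\<infinity>n\<in>A. f' n z)) A" by (metis infsumI)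
  show "((\<lambda>w. \<Sum>\<^sub>\<infinity>n\<in>A. f n w) has_field_derivative (\<Sum>\<^sub>\<infinity>n\<in>A. f' n z)) (at z)"
    using g'[of z] r(1) s \<open>((\<lambda>n. f' n z) has_sum g' z) A\<close> by (metis centre_in_ball infsumI)
qed

lemma summable_on_int_geometric:
  "(\<lambda>n::int. exp (- \<bar>real_of_int n\<bar>)) summable_on UNIV"
proof -
  have geo: "(\<lambda>n::nat. exp (- real n)) summable_on UNIV"
  proof -
    have "summable (\<lambda>n::nat. exp (- 1 :: real) ^ n)" by (rule summable_geometric) simp
    moreover have "exp (- 1 :: real) ^ n = exp (- real n)" for n by (simp add: exp_of_nat_mult [symmetric])
    ultimately show ?thesis by (subst summable_on_UNIV_nonneg_real_iff) auto
  qed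
  have 1: "(\<lambda>n::int. exp (- \<bar>real_of_int n\<bar>)) summable_on {0..}"
    using geo by (subst summable_on_reindex_bij_witness[of _ int nat UNIV "\<lambda>n. exp (- real n)"]) auto
  have 2: "(\<lambda>n::int. exp (- \<bar>real_of_int n\<bar>)) summable_on {..<0}"
  proof (rule summable_on_subset_banach)
    show "(\<lambda>n::int. exp (- \<bar>real_of_int n\<bar>)) summable_on {..0}"
      using geo by (subst summable_on_reindex_bij_witness[of _ "\<lambda>n. - int n" "\<lambda>n. nat (-n)" UNIV "\<lambda>n. exp (- real n)"]) auto
  qed auto
  have "(UNIV :: int set) = {0..} \<union> {..<0}" by auto
  thus ?thesis using summable_on_Un_disjoint[OF 1 2] by (simp add: disjoint_iff)
qed

lemma gauss_summable_real:
  fixes a b :: real assumes "a > 0"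
  shows "(\<lambda>n::int. exp (- a * (of_int n)\<^sup>2 + b * \<bar>of_int n\<bar>)) summable_on UNIV"
proof -
  have bd: "exp (- a * (of_int n)\<^sup>2 + b * \<bar>of_int n\<bar>) \<le> exp ((b+1)\<^sup>2/(4*a)) * exp (- \<bar>real_of_int n\<bar>)" for n :: int
  proof -
    \<comment> \<open>Completing the square puts the quadratic exponent below a constant minus
      \<bar>n\<bar>, which leaves a geometric series.\<close>
    have "0 \<le> a * (\<bar>real_of_int n\<bar> - (b+1)/(2*a))\<^sup>2" using assms by simp
    also have "\<dots> = a * (of_int n)\<^sup>2 - (b+1) * \<bar>of_int n\<bar> + (b+1)\<^sup>2/(4*a)"
    proof -
      have "a * (t - (b+1)/(2*a))\<^sup>2 = a * t\<^sup>2 - (b+1) * t + (b+1)\<^sup>2/(4*a)" for t :: real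
        using assms by (simp add: field_simps power2_eq_square)
      from this[of "\<bar>real_of_int n\<bar>"] show ?thesis by simp
    qed
    finally have "- a * (of_int n)\<^sup>2 + b * \<bar>of_int n\<bar> \<le> (b+1)\<^sup>2/(4*a) - \<bar>real_of_int n\<bar>"
      by (simp add: algebra_simps)
    thus ?thesis by (simp add: exp_add [symmetric] exp_diff [symmetric])
  qed
  show ?thesis
  proof (rule summable_on_comparison_test)
    show "(\<lambda>n::int. exp ((b+1)\<^sup>2/(4*a)) * exp (- \<bar>real_of_int n\<bar>)) summable_on UNIV"
      by (intro summable_on_cmult_right summable_on_int_geometric)
  qed (use bd in auto)
qed

lemma has_sum_sum:
  fixes f :: "'i \<Rightarrow> 'b \<Rightarrow> complex"
  assumes "\<And>i. i \<in> I \<Longrightarrow> (f i has_sum s i) A"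
  shows "((\<lambda>x. \<Sum>i\<in>I. f i x) has_sum (\<Sum>i\<in>I. s i)) A"
  using assms
proof (induction I rule: infinite_finite_induct)
  case (insert i I)
  thus ?case by (simp add: has_sum_add)
qed auto

lemma has_sum_diff:
  fixes f g :: "'b \<Rightarrow> complex"
  assumes "(f has_sum a) A" "(g has_sum b) A"
  shows "((\<lambda>x. f x - g x) has_sum (a - b)) A"
  using has_sum_add[OF assms(1), of "\<lambda>x. - g x" "- b"] assms(2) by (simp add: has_sum_uminus)

text \<open>Averaging over the \<open>N\<close>-th roots of unity isolates the residue class of \<open>k0\<close> modulo
  \<open>N\<close>, and the rest of this class leaves every finite set as \<open>N\<close> grows.\<close>

lemma exp_sum_unique:
  fixes a :: "int \<Rightarrow> complex"
  assumes a: "a summable_on UNIV"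
    and zero: "\<And>x::real. ((\<lambda>k. a k * e2pi (of_int k * of_real x)) has_sum 0) UNIV"
  shows "a k0 = 0"
proof (rule ccontr)
  assume nz: "a k0 \<noteq> 0"
  have na: "(\<lambda>k. norm (a k)) summable_on UNIV" using a by (simp add: summable_on_iff_abs_summable_on_complex)
  have "norm (a k0) / 2 > 0" using nz by simp
  obtain F where F: "finite F" "dist (sum (\<lambda>k. norm (a k)) F) (infsum (\<lambda>k. norm (a k)) UNIV) \<le> norm (a k0) / 2"
    using infsum_finite_approximation[OF na \<open>norm (a k0) / 2 > 0\<close>] by auto
  \<comment> \<open>\<open>N\<close> exceeds the distance of every element of \<open>F\<close> from
    \<open>k0\<close>, so \<open>F\<close> contains no other element of the class of
    \<open>k0\<close> modulo \<open>N\<close>. The inserted 1 keeps the maximum defined when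
    \<open>F\<close> is empty.\<close>
  define N where "N = nat (Max (insert 1 ((\<lambda>k. \<bar>k - k0\<bar>) ` F)) + 1)"
  have N: "N > 0" "\<And>k. k \<in> F \<Longrightarrow> \<bar>k - k0\<bar> < int N"
  proof -
    have "1 \<le> Max (insert 1 ((\<lambda>k. \<bar>k - k0\<bar>) ` F))" using F(1) by simp
    thus "N > 0" by (simp add: N_def)
    fix k assume "k \<in> F"
    hence "\<bar>k - k0\<bar> \<le> Max (insert 1 ((\<lambda>k. \<bar>k - k0\<bar>) ` F))" using F(1) by simp
    thus "\<bar>k - k0\<bar> < int N" by (simp add: N_def)
  qed
  have avg: "(\<Sum>j<N. e2pi (of_int k * of_real (real j / real N)) * e2pi (- of_int k0 * of_real (real j / real N)))
     = (if int N dvd k - k0 then of_nat N else 0)" for k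
  proof -
    have "e2pi (of_int k * of_real (real j / real N)) * e2pi (- of_int k0 * of_real (real j / real N)) =
      e2pi (of_int (k - k0) / of_nat N) ^ j" for j
    proof -
      have "of_int k * of_real (real j / real N) + - of_int k0 * of_real (real j / real N) =
          of_nat j * (of_int (k - k0) / (of_nat N :: complex))" by (simp add: diff_divide_distrib algebra_simps)
      thus ?thesis by (simp only: e2pi_add [symmetric] e2pi_mult_of_nat [symmetric])
    qed
    hence "(\<Sum>j<N. e2pi (of_int k * of_real (real j / real N)) * e2pi (- of_int k0 * of_real (real j / real N)))
       = (\<Sum>j<N. e2pi (of_int (k - k0) / of_nat N) ^ j)" by simp
    also have "\<dots> = (if int N dvd k - k0 then of_nat N else 0)"
    proof (cases "int N dvd k - k0")
      case True
      then obtain l where "k - k0 = int N * l" by auto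
      hence "e2pi (of_int (k - k0) / of_nat N) = 1" using N(1) by simp
      thus ?thesis using True by simp
    next
      case False
      have ne: "e2pi (of_int (k - k0) / of_nat N) \<noteq> 1"
      proof
        assume "e2pi (of_int (k - k0) / of_nat N) = 1"
        then obtain l where "of_int (k - k0) / of_nat N = (of_int l :: complex)" by (auto simp: e2pi_eq_1_iff Ints_def)
        hence "(of_int (k - k0) :: complex) = of_int (l * int N)" using N(1) by (simp add: field_simps)
        hence "k - k0 = l * int N" by (simp only: of_int_eq_iff)
        thus False using False by simp
      qed
      have "e2pi (of_int (k - k0) / of_nat N) ^ N = 1" using N(1) by (simp flip: e2pi_mult_of_nat) (simp flip: of_int_diff)
      thus ?thesis using ne False by (simp add: geometric_sum)
    qed
    finally show ?thesis .
  qed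
  have "((\<lambda>k. \<Sum>j<N. e2pi (- of_int k0 * of_real (real j / real N)) * (a k * e2pi (of_int k * of_real (real j / real N)))) has_sum
      (\<Sum>j<N. e2pi (- of_int k0 * of_real (real j / real N)) * 0)) UNIV" by (intro has_sum_sum has_sum_cmult_right zero)
  also have "(\<lambda>k. \<Sum>j<N. e2pi (- of_int k0 * of_real (real j / real N)) * (a k * e2pi (of_int k * of_real (real j / real N)))) =
     (\<lambda>k. a k * (if int N dvd k - k0 then of_nat N else 0))" unfolding avg [symmetric] by (simp add: sum_distrib_left mult_ac)
  finally have "((\<lambda>k. a k * (if int N dvd k - k0 then of_nat N else 0)) has_sum 0) UNIV" by simp
  hence *: "((\<lambda>k. inverse (of_nat N) * (a k * (if int N dvd k - k0 then of_nat N else 0))) has_sum inverse (of_nat N) * 0) UNIV"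
    by (rule has_sum_cmult_right)
  hence hs: "((\<lambda>k. if int N dvd k - k0 then a k else 0) has_sum 0) UNIV"
  proof -
    have "inverse (of_nat N) * (a k * (if int N dvd k - k0 then of_nat N else 0)) = (if int N dvd k - k0 then a k else 0)" for k using N(1) by simp
    with * show ?thesis by simp
  qed
  have "((\<lambda>k. if k = k0 then a k0 else 0) has_sum a k0) UNIV"
    using has_sum_finite_neutralI[of "{k0}" UNIV "\<lambda>k. if k = k0 then a k0 else 0" "a k0"] by auto
  from has_sum_diff[OF hs this]
  have hs2: "((\<lambda>k. (if int N dvd k - k0 then a k else 0) - (if k = k0 then a k0 else 0)) has_sum - a k0) UNIV" by simp
  \<comment> \<open>What averaging leaves besides \<open>a k0\<close>: it is supported off
    \<open>F\<close>, where the absolute values of \<open>a\<close> add up to at most half of that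
    of \<open>a k0\<close>.\<close>
  define b where "b = (\<lambda>k. (if int N dvd k - k0 then a k else 0) - (if k = k0 then a k0 else 0))"
  have bF: "b k = 0" if "k \<in> F" for k
  proof (cases "k = k0")
    case False
    have "\<not> int N dvd k - k0" using N(2)[OF that] False zdvd_not_zless[of "\<bar>k - k0\<bar>" "int N"] by auto
    thus ?thesis using False by (simp add: b_def)
  qed (simp add: b_def)
  have hb: "(b has_sum - a k0) (UNIV - F)"
  proof -
    have "(b has_sum - a k0) UNIV" using hs2 by (simp add: b_def)
    also have "?this \<longleftrightarrow> ?thesis" by (rule has_sum_cong_neutral) (use bF in auto)
    finally show ?thesis .
  qed
  have naF: "((\<lambda>k. norm (a k)) has_sum (infsum (\<lambda>k. norm (a k)) UNIV - sum (\<lambda>k. norm (a k)) F)) (UNIV - F)"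
    by (rule has_sum_Diff) (use na F(1) in auto)
  have "norm (- a k0) \<le> infsum (\<lambda>k. norm (a k)) UNIV - sum (\<lambda>k. norm (a k)) F"
  proof -
    have nb: "(\<lambda>k. norm (b k)) summable_on (UNIV - F)"
      using has_sum_imp_summable[OF hb] by (simp add: summable_on_iff_abs_summable_on_complex)
    have "norm (- a k0) \<le> infsum (\<lambda>k. norm (b k)) (UNIV - F)" by (rule norm_has_sum_bound[OF has_sum_infsum[OF nb] hb])
    also have "\<dots> \<le> infsum (\<lambda>k. norm (a k)) (UNIV - F)" by (rule infsum_mono[OF nb has_sum_imp_summable[OF naF]]) (auto simp: b_def)
    finally show ?thesis using infsumI[OF naF] by simp
  qed
  also have "\<dots> \<le> norm (a k0) / 2" using F(2) unfolding dist_real_def by linarith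
  finally show False using nz by simp
qed

section \<open>The theta function\<close>

text \<open>Jacobi's theta function theta_3, to which \<open>theta m r\<close> reduces by
  \<open>theta_eq_Theta\<close>.\<close>

definition Theta :: "complex \<Rightarrow> complex \<Rightarrow> complex" where
  "Theta \<tau> z = (\<Sum>\<^sub>\<infinity>n::int. thetaexp \<tau> z n)"

lemma norm_theta_term:
  "norm (thetaexp \<tau> z n) = exp (- pi * Im \<tau> * (of_int n)\<^sup>2 - 2 * pi * of_int n * Im z)"
proof -
  have "Im (\<tau> * of_int n ^ 2 / 2 + of_int n * z) = Im \<tau> * (of_int n)\<^sup>2 / 2 + of_int n * Im z" by (simp flip: of_int_power)
  thus ?thesis by (simp add: norm_e2pi algebra_simps)
qed

lemma norm_theta_term_le:
  assumes "Im \<tau> \<ge> y" "\<bar>Im z\<bar> \<le> b"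
  shows "norm (thetaexp \<tau> z n) \<le> exp (- (pi * y) * (of_int n)\<^sup>2 + 2 * pi * b * \<bar>of_int n\<bar>)"
proof -
  have 1: "pi * y * (of_int n)\<^sup>2 \<le> pi * Im \<tau> * (of_int n)\<^sup>2" using assms(1) by (intro mult_right_mono mult_left_mono) auto
  have "- (real_of_int n * Im z) \<le> \<bar>of_int n\<bar> * b"
    using assms(2) by (metis abs_ge_minus_self abs_ge_zero abs_mult dual_order.trans mult_left_mono)
  hence "2 * pi * (- (real_of_int n * Im z)) \<le> 2 * pi * (\<bar>of_int n\<bar> * b)" by (intro mult_left_mono) auto
  with 1 have "- pi * Im \<tau> * (of_int n)\<^sup>2 - 2 * pi * of_int n * Im z \<le> - (pi * y) * (of_int n)\<^sup>2 + 2 * pi * b * \<bar>of_int n\<bar>"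
    by (simp only: mult_minus_left mult_minus_right mult.assoc mult.commute[of "\<bar>real_of_int n\<bar>" b])
  thus ?thesis unfolding norm_theta_term by simp
qed

lemma Theta_has_sum:
  assumes "Im \<tau> > 0"
  shows "((\<lambda>n::int. thetaexp \<tau> z n) has_sum Theta \<tau> z) UNIV"
proof -
  have "(\<lambda>n::int. norm (thetaexp \<tau> z n)) summable_on UNIV"
  proof (rule summable_on_comparison_test)
    show "(\<lambda>n::int. exp (- (pi * Im \<tau>) * (of_int n)\<^sup>2 + 2 * pi * \<bar>Im z\<bar> * \<bar>of_int n\<bar>)) summable_on UNIV"
      by (rule gauss_summable_real) (use assms in auto)
  qed (use norm_theta_term_le[of "Im \<tau>" \<tau> z "\<bar>Im z\<bar>"] in auto)
  hence "(\<lambda>n::int. thetaexp \<tau> z n) summable_on UNIV" by (simp add: summable_on_iff_abs_summable_on_complex)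
  thus ?thesis unfolding Theta_def by (rule has_sum_infsum)
qed

lemma abs_le_exp_abs: "\<bar>real_of_int n\<bar> \<le> exp \<bar>of_int n\<bar>"
  using exp_ge_add_one_self[of "\<bar>real_of_int n\<bar>"] by linarith

definition Theta' :: "complex \<Rightarrow> complex \<Rightarrow> complex" where
  "Theta' \<tau> z = (\<Sum>\<^sub>\<infinity>n::int. tpi * of_int n * thetaexp \<tau> z n)"

text \<open>Heat equation: up to constants this is both the second z-derivative of
  \<open>Theta\<close> at z = 0 and the \<tau>-derivative of \<open>Theta \<tau> 0\<close>.\<close>

definition Theta2 :: "complex \<Rightarrow> complex" where
  "Theta2 \<tau> = (\<Sum>\<^sub>\<infinity>n::int. of_int n ^ 2 * e2pi (\<tau> * of_int n ^ 2 / 2))"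

lemma abs_Im_cball:
  assumes "v \<in> cball w r" shows "\<bar>Im v\<bar> \<le> \<bar>Im w\<bar> + r" "Im v \<ge> Im w - r"
proof -
  have "\<bar>Im (w - v)\<bar> \<le> r" using assms abs_Im_le_cmod[of "w - v"] by (simp add: dist_norm)
  thus "\<bar>Im v\<bar> \<le> \<bar>Im w\<bar> + r" "Im v \<ge> Im w - r" by auto
qed

lemma Theta_has_field_derivative_z:
  assumes "Im \<tau> > 0"
  shows "(Theta \<tau> has_field_derivative Theta' \<tau> z) (at z)"
    and "((\<lambda>n::int. tpi * of_int n * thetaexp \<tau> z n) has_sum Theta' \<tau> z) UNIV"
proof -
  have b: "\<exists>r>0. \<exists>M. cball w r \<subseteq> (UNIV :: complex set) \<and> M summable_on (UNIV :: int set) \<and>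
      (\<forall>n\<in>UNIV. \<forall>v\<in>cball w r. norm (thetaexp \<tau> v n) \<le> M n)" for w
  proof (intro exI conjI ballI)
    show "(\<lambda>n::int. exp (- (pi * Im \<tau>) * (of_int n)\<^sup>2 + 2 * pi * (\<bar>Im w\<bar> + 1) * \<bar>of_int n\<bar>)) summable_on UNIV"
      by (rule gauss_summable_real) (use assms in auto)
    fix n :: int and v assume "v \<in> cball w (1::real)"
    thus "norm (thetaexp \<tau> v n) \<le> exp (- (pi * Im \<tau>) * (of_int n)\<^sup>2 + 2 * pi * (\<bar>Im w\<bar> + 1) * \<bar>of_int n\<bar>)"
      by (intro norm_theta_term_le) (use abs_Im_cball in auto)
  qed auto
  have d: "((\<lambda>z. thetaexp \<tau> z n) has_field_derivative 2 * of_real pi * \<i> * of_int n * thetaexp \<tau> w n) (at w)" for n :: int and w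
    by (rule derivative_eq_intros refl | simp)+
  have T: "Theta \<tau> = (\<lambda>w. \<Sum>\<^sub>\<infinity>n::int. thetaexp \<tau> w n)" by (simp add: fun_eq_iff Theta_def)
  show "(Theta \<tau> has_field_derivative Theta' \<tau> z) (at z)"
    unfolding T Theta'_def by (rule infsum_has_field_derivative(1)[OF open_UNIV UNIV_I d b])
  show "((\<lambda>n::int. tpi * of_int n * thetaexp \<tau> z n) has_sum Theta' \<tau> z) UNIV"
    unfolding Theta'_def by (rule infsum_has_field_derivative(2)[OF open_UNIV UNIV_I d b])
qed

lemma Theta'_has_field_derivative_z0:
  assumes "Im \<tau> > 0"
  shows "(Theta' \<tau> has_field_derivative (- 4 * of_real pi ^ 2 * Theta2 \<tau>)) (at 0)"
proof -
  have b: "\<exists>r>0. \<exists>M. cball w r \<subseteq> (UNIV :: complex set) \<and> M summable_on (UNIV :: int set) \<and>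
      (\<forall>n\<in>UNIV. \<forall>v\<in>cball w r. norm (tpi * of_int n * thetaexp \<tau> v n) \<le> M n)" for w
  proof (intro exI conjI ballI)
    \<comment> \<open>The extra 1 in the linear coefficient absorbs the factor \<bar>n\<bar> \<le>
      exp \<bar>n\<bar> that comes from differentiation; the 1 next to
      \<open>\<bar>Im w\<bar>\<close> is the radius of the disc.\<close>
    show "(\<lambda>n::int. 2 * pi * exp (- (pi * Im \<tau>) * (of_int n)\<^sup>2 + (2 * pi * (\<bar>Im w\<bar> + 1) + 1) * \<bar>of_int n\<bar>)) summable_on UNIV"
      by (intro summable_on_cmult_right gauss_summable_real) (use assms in auto)
    fix n :: int and v assume v: "v \<in> cball w (1::real)"
    have "norm (thetaexp \<tau> v n) \<le> exp (- (pi * Im \<tau>) * (of_int n)\<^sup>2 + 2 * pi * (\<bar>Im w\<bar> + 1) * \<bar>of_int n\<bar>)"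
      by (intro norm_theta_term_le) (use v abs_Im_cball in auto)
    hence "\<bar>of_int n\<bar> * norm (thetaexp \<tau> v n) \<le> exp \<bar>of_int n\<bar> * exp (- (pi * Im \<tau>) * (of_int n)\<^sup>2 + 2 * pi * (\<bar>Im w\<bar> + 1) * \<bar>of_int n\<bar>)"
      by (intro mult_mono abs_le_exp_abs) auto
    also have "\<dots> = exp (- (pi * Im \<tau>) * (of_int n)\<^sup>2 + (2 * pi * (\<bar>Im w\<bar> + 1) + 1) * \<bar>of_int n\<bar>)"
      unfolding exp_add [symmetric] by (rule arg_cong[of _ _ exp]) (simp add: algebra_simps)
    finally have *: "\<bar>of_int n\<bar> * norm (thetaexp \<tau> v n) \<le> exp (- (pi * Im \<tau>) * (of_int n)\<^sup>2 + (2 * pi * (\<bar>Im w\<bar> + 1) + 1) * \<bar>of_int n\<bar>)" .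
    have "norm (tpi * of_int n * thetaexp \<tau> v n) = 2 * pi * (\<bar>of_int n\<bar> * norm (thetaexp \<tau> v n))"
      by (simp only: norm_mult norm_numeral norm_of_real norm_ii norm_of_int abs_of_pos[OF pi_gt_zero] mult.assoc mult_1)
    also have "\<dots> \<le> 2 * pi * exp (- (pi * Im \<tau>) * (of_int n)\<^sup>2 + (2 * pi * (\<bar>Im w\<bar> + 1) + 1) * \<bar>of_int n\<bar>)"
      by (rule mult_left_mono[OF *]) simp
    finally show "norm (tpi * of_int n * thetaexp \<tau> v n) \<le> 2 * pi * exp (- (pi * Im \<tau>) * (of_int n)\<^sup>2 + (2 * pi * (\<bar>Im w\<bar> + 1) + 1) * \<bar>of_int n\<bar>)" .
  qed auto
  have d: "((\<lambda>z. tpi * of_int n * thetaexp \<tau> z n) has_field_derivative - 4 * of_real pi ^ 2 * (of_int n ^ 2 * thetaexp \<tau> w n)) (at w)" for n :: int and w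
  proof -
    have d0: "((\<lambda>z. thetaexp \<tau> z n) has_field_derivative 2 * of_real pi * \<i> * of_int n * thetaexp \<tau> w n) (at w)"
      by (rule derivative_eq_intros refl | simp)+
    have sq: "tpi * tpi = - 4 * (of_real pi ^ 2 :: complex)" by (simp add: power2_eq_square)
    have eq: "(tpi * of_int n) * (tpi * of_int n * X) = - 4 * of_real pi ^ 2 * (of_int n ^ 2 * X)" for X :: complex
    proof -
      have "(c * k) * (c * k * X) = (c * c) * (k ^ 2 * X)" for c k X :: complex by (simp add: power2_eq_square mult_ac)
      thus ?thesis unfolding sq [symmetric] .
    qed
    show ?thesis using DERIV_cmult[OF d0, of "tpi * of_int n"] unfolding eq .
  qed
  have T: "Theta' \<tau> = (\<lambda>w. \<Sum>\<^sub>\<infinity>n::int. tpi * of_int n * thetaexp \<tau> w n)" by (simp add: fun_eq_iff Theta'_def)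
  have "- 4 * of_real pi ^ 2 * Theta2 \<tau> = (\<Sum>\<^sub>\<infinity>n::int. - 4 * of_real pi ^ 2 * (of_int n ^ 2 * thetaexp \<tau> 0 n))"
    unfolding Theta2_def by (subst infsum_cmult_right') simp
  thus ?thesis unfolding T using infsum_has_field_derivative(1)[OF open_UNIV UNIV_I d b, of 0] by simp
qed

lemma Theta_has_field_derivative_tau:
  assumes "Im \<tau> > 0"
  shows "((\<lambda>\<tau>. Theta \<tau> 0) has_field_derivative of_real pi * \<i> * Theta2 \<tau>) (at \<tau>)"
proof -
  have b: "\<exists>r>0. \<exists>M. cball w r \<subseteq> upper_half_plane \<and> M summable_on (UNIV :: int set) \<and>
      (\<forall>n\<in>UNIV. \<forall>v\<in>cball w r. norm (thetaexp v 0 n) \<le> M n)" if w: "w \<in> upper_half_plane" for w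
  proof (intro exI conjI ballI)
    show "Im w / 2 > 0" using w by simp
    show "(\<lambda>n::int. exp (- (pi * (Im w / 2)) * (of_int n)\<^sup>2 + 2 * pi * 0 * \<bar>of_int n\<bar>)) summable_on UNIV"
      by (rule gauss_summable_real) (use w in auto)
    show "cball w (Im w / 2) \<subseteq> upper_half_plane"
    proof
      fix v assume "v \<in> cball w (Im w / 2)"
      from abs_Im_cball(2)[OF this] show "v \<in> upper_half_plane" using w by simp
    qed
    fix n :: int and v assume "v \<in> cball w (Im w / 2)"
    from abs_Im_cball(2)[OF this] show "norm (thetaexp v 0 n) \<le> exp (- (pi * (Im w / 2)) * (of_int n)\<^sup>2 + 2 * pi * 0 * \<bar>of_int n\<bar>)"
      by (intro norm_theta_term_le) auto
  qed
  have d: "((\<lambda>\<tau>. thetaexp \<tau> 0 n) has_field_derivative of_real pi * \<i> * (of_int n ^ 2 * thetaexp w 0 n)) (at w)" for n :: int and w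
    by (rule derivative_eq_intros refl | simp)+
  have "of_real pi * \<i> * Theta2 \<tau> = (\<Sum>\<^sub>\<infinity>n::int. of_real pi * \<i> * (of_int n ^ 2 * thetaexp \<tau> 0 n))"
    unfolding Theta2_def by (subst infsum_cmult_right') simp
  thus ?thesis unfolding Theta_def using infsum_has_field_derivative(1)[OF open_upper_half_plane _ d b, of \<tau>] assms by simp
qed

lemma Theta_entire: "Im \<tau> > 0 \<Longrightarrow> Theta \<tau> holomorphic_on S"
  by (meson Theta_has_field_derivative_z(1) field_differentiable_at_within field_differentiable_def holomorphic_on_def)

lemma Theta_add_1: "Theta \<tau> (z + 1) = Theta \<tau> z"
proof -
  have "thetaexp \<tau> (z + 1) n = thetaexp \<tau> z n" for n by (simp add: distrib_left add.assoc [symmetric] e2pi_add)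
  thus ?thesis by (simp add: Theta_def)
qed

lemma Theta_add_tau: "Theta \<tau> (z + \<tau>) = e2pi (- \<tau> / 2 - z) * Theta \<tau> z"
proof -
  have "Theta \<tau> (z + \<tau>) = (\<Sum>\<^sub>\<infinity>n::int. e2pi (- \<tau> / 2 - z) * thetaexp \<tau> z n)" unfolding Theta_def
    by (rule infsum_reindex_bij_witness[of _ "\<lambda>n. n - 1" "\<lambda>n. n + 1"])
       (auto simp: e2pi_add [symmetric] power2_eq_square field_simps intro!: arg_cong[of _ _ e2pi])
  thus ?thesis by (simp add: infsum_cmult_right' Theta_def)
qed

lemma Theta_minus: "Theta \<tau> (- z) = Theta \<tau> z"
  unfolding Theta_def
  by (rule infsum_reindex_bij_witness[of _ "\<lambda>n. - n" "\<lambda>n. - n"]) auto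

lemma Theta_not_identically_0:
  assumes "Im \<tau> > 0" shows "\<exists>z. Theta \<tau> z \<noteq> 0"
proof (rule ccontr)
  assume "\<not> ?thesis"
  hence z: "Theta \<tau> z = 0" for z by blast
  have "e2pi (\<tau> * of_int 0 ^ 2 / 2) = 0"
  proof (rule exp_sum_unique[of "\<lambda>n. e2pi (\<tau> * of_int n ^ 2 / 2)"])
    show "(\<lambda>n::int. e2pi (\<tau> * of_int n ^ 2 / 2)) summable_on UNIV" using Theta_has_sum[OF assms, of 0] by (auto simp: summable_on_def)
    show "((\<lambda>k::int. e2pi (\<tau> * of_int k ^ 2 / 2) * e2pi (of_int k * of_real x)) has_sum 0) UNIV" for x
      using Theta_has_sum[OF assms, of "of_real x"] by (simp add: z e2pi_add)
  qed
  thus False by simp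
qed

text \<open>Up to a constant, \<^const>\<open>Theta\<close> is the only entire function with its quasi-periods. The
  comparison function is \<open>E(Qy) E(Q/y)\<close> with \<open>Q = e(\<tau>/2)\<close>, where \<open>E(w) = \<Prod>(1 + q\<^sup>n w)\<close> is written
  as Euler's power series so that \<open>E(w) = (1 + w) E(q w)\<close> can be read off the coefficients.\<close>

definition qexp_fps :: "complex \<Rightarrow> complex fps" where
  "qexp_fps q = Abs_fps (\<lambda>k. \<Prod>i<k. q ^ i / (1 - q ^ Suc i))"

definition qexp :: "complex \<Rightarrow> complex \<Rightarrow> complex" where
  "qexp q w = eval_fps (qexp_fps q) w"

context
  fixes q :: complex
  assumes q: "norm q < 1"
begin

lemma one_minus_qpow_nz: "1 - q ^ Suc i \<noteq> 0"
proof
  assume "1 - q ^ Suc i = 0"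
  hence "norm (q ^ Suc i) = 1" by (metis eq_iff_diff_eq_0 norm_one)
  moreover have "norm (q ^ Suc i) < 1" unfolding norm_power by (rule power_less_one_iff[THEN iffD2]) (use q in auto)
  ultimately show False by simp
qed

lemma qexp_fps_Suc: "fps_nth (qexp_fps q) (Suc k) * (1 - q ^ Suc k) = fps_nth (qexp_fps q) k * q ^ k"
proof -
  have "fps_nth (qexp_fps q) (Suc k) = fps_nth (qexp_fps q) k * (q ^ k / (1 - q ^ Suc k))" by (simp add: qexp_fps_def del: power_Suc)
  thus ?thesis using one_minus_qpow_nz[of k] by (simp del: power_Suc)
qed

lemma qexp_fps_conv_radius: "fps_conv_radius (qexp_fps q) = \<infinity>"
  unfolding fps_conv_radius_def
proof (rule conv_radius_inftyI'')
  fix z :: complex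
  have "(\<lambda>k. norm (q ^ k / (1 - q ^ Suc k)) * norm z) \<longlonglongrightarrow> norm (0 / (1 - 0) :: complex) * norm z"
    using LIMSEQ_power_zero[OF q] LIMSEQ_Suc[OF LIMSEQ_power_zero[OF q]]
    by (intro tendsto_mult tendsto_norm tendsto_divide tendsto_diff tendsto_const) auto
  hence "(\<lambda>k. norm (q ^ k / (1 - q ^ Suc k)) * norm z) \<longlonglongrightarrow> 0" by simp
  hence "eventually (\<lambda>k. norm (q ^ k / (1 - q ^ Suc k)) * norm z < 1 / 2) sequentially" by (rule order_tendstoD) auto
  then obtain N where N: "\<And>k. k \<ge> N \<Longrightarrow> norm (q ^ k / (1 - q ^ Suc k)) * norm z < 1 / 2"
    by (auto simp: eventually_sequentially)
  show "summable (\<lambda>n. fps_nth (qexp_fps q) n * z ^ n)"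
  proof (rule summable_ratio_test[of "1 / 2" N])
    fix n assume "n \<ge> N"
    have "norm (fps_nth (qexp_fps q) (Suc n) * z ^ Suc n) = (norm (q ^ n / (1 - q ^ Suc n)) * norm z) * norm (fps_nth (qexp_fps q) n * z ^ n)"
    proof -
      have c: "fps_nth (qexp_fps q) (Suc n) = fps_nth (qexp_fps q) n * (q ^ n / (1 - q ^ Suc n))" by (simp add: qexp_fps_def del: power_Suc)
      show ?thesis unfolding c power_Suc[of z] norm_mult by (simp only: mult_ac)
    qed
    also have "\<dots> \<le> 1 / 2 * norm (fps_nth (qexp_fps q) n * z ^ n)"
      by (rule mult_right_mono[OF less_imp_le[OF N[OF \<open>n \<ge> N\<close>]]]) simp
    finally show "norm (fps_nth (qexp_fps q) (Suc n) * z ^ Suc n) \<le> 1 / 2 * norm (fps_nth (qexp_fps q) n * z ^ n)" .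
  qed auto
qed

lemma qexp_summable: "summable (\<lambda>n. fps_nth (qexp_fps q) n * z ^ n)"
  by (rule summable_fps) (simp add: qexp_fps_conv_radius)

lemma qexp_entire: "qexp q holomorphic_on S"
  unfolding qexp_def by (intro holomorphic_intros) (auto simp: qexp_fps_conv_radius)

lemma qexp_0: "qexp q 0 = 1"
  by (simp add: qexp_def eval_fps_at_0 qexp_fps_def)

lemma qexp_rec: "qexp q w = (1 + w) * qexp q (q * w)"
proof -
  let ?e = "fps_nth (qexp_fps q)"
  have s: "(\<lambda>n. ?e n * (q * w) ^ n) sums qexp q (q * w)" "(\<lambda>n. ?e n * w ^ n) sums qexp q w"
    unfolding qexp_def eval_fps_def by (intro summable_sums qexp_summable)+
  have "(\<lambda>n. case n of 0 \<Rightarrow> 0 | Suc k \<Rightarrow> w * (?e k * (q * w) ^ k)) sums (w * qexp q (q * w))"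
    using sums_Suc[of "\<lambda>n. case n of 0 \<Rightarrow> 0 | Suc k \<Rightarrow> w * (?e k * (q * w) ^ k)"] sums_mult[OF s(1), of w] by simp
  from sums_add[OF this s(1)]
  have "(\<lambda>n. (case n of 0 \<Rightarrow> 0 | Suc k \<Rightarrow> w * (?e k * (q * w) ^ k)) + ?e n * (q * w) ^ n) sums ((1 + w) * qexp q (q * w))"
    by (simp add: algebra_simps)
  also have "(\<lambda>n. (case n of 0 \<Rightarrow> 0 | Suc k \<Rightarrow> w * (?e k * (q * w) ^ k)) + ?e n * (q * w) ^ n) = (\<lambda>n. ?e n * w ^ n)"
  proof
    fix n show "(case n of 0 \<Rightarrow> 0 | Suc k \<Rightarrow> w * (?e k * (q * w) ^ k)) + ?e n * (q * w) ^ n = ?e n * w ^ n"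
    proof (cases n)
      case (Suc k)
      have "?e (Suc k) * w ^ Suc k = (?e k * q ^ k + ?e (Suc k) * q ^ Suc k) * w ^ Suc k" using qexp_fps_Suc[of k] by (simp add: algebra_simps)
      thus ?thesis by (simp add: Suc power_mult_distrib algebra_simps)
    qed simp
  qed
  finally show ?thesis using s(2) sums_unique2 by blast
qed

text \<open>Otherwise \<open>qexp_rec\<close> propagates the zero to all q^i w, which tend to 0,
  where \<open>qexp q\<close> has the value 1.\<close>

lemma qexp_eq_0D:
  assumes "qexp q w = 0" shows "\<exists>i. q ^ i * w = -1"
proof (rule ccontr)
  assume neg: "\<not> ?thesis"
  have z: "qexp q (q ^ i * w) = 0" for i
  proof (induction i)
    case (Suc i)
    have "(1 + q ^ i * w) * qexp q (q * (q ^ i * w)) = 0" using qexp_rec[of "q ^ i * w"] Suc by simp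
    moreover have "1 + q ^ i * w \<noteq> 0" using neg by (metis add.commute eq_neg_iff_add_eq_0)
    ultimately show ?case by (simp add: mult_ac)
  qed (use assms in simp)
  have "(\<lambda>i. q ^ i * w) \<longlonglongrightarrow> 0 * w" by (intro tendsto_intros LIMSEQ_power_zero q)
  moreover have "isCont (qexp q) 0" using qexp_entire[of UNIV] holomorphic_on_imp_continuous_on continuous_on_eq_continuous_at open_UNIV by blast
  ultimately have "(\<lambda>i. qexp q (q ^ i * w)) \<longlonglongrightarrow> qexp q 0" by (metis isCont_tendsto_compose mult_zero_left)
  thus False using z qexp_0 by (simp add: LIMSEQ_const_iff)
qed

lemma qexp_minus_q_nz: "qexp q (- q) \<noteq> 0"
proof
  assume "qexp q (- q) = 0"
  then obtain i where "q ^ i * (- q) = -1" using qexp_eq_0D by blast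
  hence "1 - q ^ Suc i = 0" by (simp add: mult.commute)
  thus False using one_minus_qpow_nz by blast
qed

text \<open>When \<open>qexp_rec\<close> is differentiated at -1, only the derivative of the
  vanishing factor 1 + w survives. With \<open>qexp_minus_q_nz\<close> the zero is simple.\<close>

lemma qexp_deriv_minus_1: "(qexp q has_field_derivative qexp q (- q)) (at (- 1))"
proof -
  have d: "(qexp q has_field_derivative deriv (qexp q) w) (at w)" for w using qexp_entire[of UNIV] holomorphic_derivI by blast
  have "((\<lambda>w. (1 + w) * qexp q (q * w)) has_field_derivative (1 * qexp q (q * (-1)) + deriv (qexp q) (q * (-1)) * q * (1 + (-1)))) (at (-1))"
    by (rule derivative_eq_intros DERIV_chain2[OF d] refl | simp)+
  moreover have "(\<lambda>w. (1 + w) * qexp q (q * w)) = qexp q" by (rule ext) (rule qexp_rec [symmetric])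
  ultimately show ?thesis by simp
qed

end

text \<open>Sections of a line bundle of degree 1 on the elliptic curve with periods 1 and \<tau>,
  written as entire functions.\<close>

definition theta_like :: "complex \<Rightarrow> (complex \<Rightarrow> complex) \<Rightarrow> bool" where
  "theta_like \<tau> f \<longleftrightarrow> (f holomorphic_on UNIV) \<and> (\<forall>z. f (z + 1) = f z) \<and>
     (\<forall>z. f (z + \<tau>) = e2pi (- \<tau> / 2 - z) * f z)"

lemma theta_like_shift:
  assumes "theta_like \<tau> f"
  shows "f (z + of_int a + of_int b * \<tau>) = e2pi (- (of_int b ^ 2) * \<tau> / 2 - of_int b * z) * f z"
proof -
  have 1: "f (z + of_int a) = f z" for z a
  proof -
    have n: "f (z + of_nat n) = f z" for z n
    proof (induction n)
      case (Suc n)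
      have "f (z + of_nat (Suc n)) = f ((z + of_nat n) + 1)" by (simp add: ac_simps)
      also have "\<dots> = f (z + of_nat n)" using assms unfolding theta_like_def by blast
      finally show ?case using Suc by simp
    qed simp
    show ?thesis
    proof (cases "a \<ge> 0")
      case True thus ?thesis using n[of z "nat a"] by simp
    next
      case False
      thus ?thesis using n[of "z + of_int a" "nat (- a)"] by simp
    qed
  qed
  have tn: "f (z + of_nat n * \<tau>) = e2pi (- (of_nat n ^ 2) * \<tau> / 2 - of_nat n * z) * f z" for z n
  proof (induction n)
    case (Suc n)
    have "f (z + of_nat (Suc n) * \<tau>) = f ((z + of_nat n * \<tau>) + \<tau>)" by (simp add: algebra_simps)
    also have "\<dots> = e2pi (- \<tau> / 2 - (z + of_nat n * \<tau>)) * f (z + of_nat n * \<tau>)" using assms unfolding theta_like_def by blast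
    also have "\<dots> = (e2pi (- \<tau> / 2 - (z + of_nat n * \<tau>)) * e2pi (- (of_nat n ^ 2) * \<tau> / 2 - of_nat n * z)) * f z"
      by (simp add: Suc)
    also have "e2pi (- \<tau> / 2 - (z + of_nat n * \<tau>)) * e2pi (- (of_nat n ^ 2) * \<tau> / 2 - of_nat n * z) = e2pi (- (of_nat (Suc n) ^ 2) * \<tau> / 2 - of_nat (Suc n) * z)"
      unfolding e2pi_add [symmetric] by (rule arg_cong[of _ _ e2pi]) (simp add: field_simps power2_eq_square)
    finally show ?case .
  qed simp
  show ?thesis
  proof (cases "b \<ge> 0")
    case True
    have "f (z + of_int a + of_int b * \<tau>) = f (z + of_int b * \<tau> + of_int a)" by (simp add: ac_simps)
    also have "\<dots> = f (z + of_nat (nat b) * \<tau>)" using 1[of "z + of_int b * \<tau>" a] True by simp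
    finally show ?thesis using tn[of z "nat b"] True by simp
  next
    case False
    \<comment> \<open>For negative b, the formula for -b is applied at the translated point
      \<open>w\<close> and solved for \<open>f w\<close>.\<close>
    define w where "w = z + of_int b * \<tau>"
    have "f z = f (w + of_nat (nat (-b)) * \<tau>)" using False by (simp add: w_def)
    also have "\<dots> = e2pi (- (of_int b ^ 2) * \<tau> / 2 + of_int b * w) * f w" using tn[of w "nat (-b)"] False by simp
    finally have fz: "f z = e2pi (- (of_int b ^ 2) * \<tau> / 2 + of_int b * w) * f w" .
    have "e2pi (- (of_int b ^ 2) * \<tau> / 2 - of_int b * z) * e2pi (- (of_int b ^ 2) * \<tau> / 2 + of_int b * w) = e2pi 0"
      unfolding e2pi_add [symmetric] w_def by (rule arg_cong[of _ _ e2pi]) (simp add: field_simps power2_eq_square)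
    hence "e2pi (- (of_int b ^ 2) * \<tau> / 2 - of_int b * z) * f z = f w" by (simp add: fz mult.assoc [symmetric])
    moreover have "f (z + of_int a + of_int b * \<tau>) = f w" using 1[of w a] by (simp add: w_def ac_simps)
    ultimately show ?thesis by simp
  qed
qed

text \<open>The point (1 + \<tau>)/2 and its negative differ by a period whose multiplier there is
  e(1/2) = -1, against the evenness.\<close>

lemma theta_like_even_zero:
  assumes "theta_like \<tau> f" "f (- ((1 + \<tau>) / 2)) = f ((1 + \<tau>) / 2)"
  shows "f ((1 + \<tau>) / 2) = 0"
proof -
  let ?z = "(1 + \<tau>) / 2"
  have "f ?z = f (- ?z + of_int 1 + of_int 1 * \<tau>)" by (rule arg_cong[of _ _ f]) (simp add: field_simps)
  also have "\<dots> = e2pi (- (of_int 1 ^ 2) * \<tau> / 2 - of_int 1 * (- ?z)) * f (- ?z)" by (rule theta_like_shift[OF assms(1)])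
  also have "- (of_int 1 ^ 2) * \<tau> / 2 - of_int 1 * (- ?z) = 1 / 2" by (simp add: field_simps)
  finally have "f ?z = - f ?z" using assms(2) by simp
  thus ?thesis by simp
qed

text \<open>All zeros of \<open>g\<close> are simple and shared by \<open>f\<close>, so every
  singularity of the quotient is removable.\<close>

lemma entire_division:
  fixes f g :: "complex \<Rightarrow> complex"
  assumes f: "f holomorphic_on UNIV" and g: "g holomorphic_on UNIV"
    and z: "\<And>z. g z = 0 \<Longrightarrow> f z = 0 \<and> deriv g z \<noteq> 0"
  shows "\<exists>F. F holomorphic_on UNIV \<and> (\<forall>z. f z = F z * g z)"
proof -
  \<comment> \<open>At a zero of \<open>g\<close> the value is the limit given by l'Hopital's rule,
    which makes \<open>F\<close> continuous.\<close>
  define F where "F = (\<lambda>z. if g z = 0 then deriv f z / deriv g z else f z / g z)"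
  have df: "(f has_field_derivative deriv f z) (at z)" and dg: "(g has_field_derivative deriv g z) (at z)" for z
    using f g holomorphic_derivI by blast+
  have nz: "eventually (\<lambda>w. g w \<noteq> 0) (at z)" for z
  proof (cases "g z = 0")
    case True
    have "((\<lambda>w. (g w - g z) / (w - z)) \<longlongrightarrow> deriv g z) (at z)" using dg[of z] by (simp add: has_field_derivative_iff)
    moreover have "deriv g z \<noteq> 0" using z True by blast
    ultimately have "eventually (\<lambda>w. (g w - g z) / (w - z) \<noteq> 0) (at z)" by (rule tendsto_imp_eventually_ne)
    thus ?thesis by eventually_elim (use True in auto)
  next
    case False
    have "isCont g z" using dg DERIV_isCont by blast
    hence "(g \<longlongrightarrow> g z) (at z)" by (simp add: isCont_def)
    thus ?thesis using False by (rule tendsto_imp_eventually_ne)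
  qed
  have lim: "(F \<longlongrightarrow> F z) (at z)" for z
  proof (cases "g z = 0")
    case True
    have "((\<lambda>w. f w / g w) \<longlongrightarrow> deriv f z / deriv g z) (at z)"
      by (rule lhopital_complex_simple[OF df dg]) (use True z in auto)
    moreover have "eventually (\<lambda>w. F w = f w / g w) (at z)" using nz[of z] by eventually_elim (simp add: F_def)
    ultimately show ?thesis using True by (simp add: F_def tendsto_cong)
  next
    case False
    have "((\<lambda>w. f w / g w) \<longlongrightarrow> f z / g z) (at z)"
      using DERIV_isCont[OF df] DERIV_isCont[OF dg] False by (intro tendsto_divide) (auto simp: isCont_def)
    moreover have "eventually (\<lambda>w. F w = f w / g w) (at z)" using nz[of z] by eventually_elim (simp add: F_def)
    ultimately show ?thesis using False by (simp add: F_def tendsto_cong)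
  qed
  have "F field_differentiable at z" for z
  proof -
    obtain S where S: "open S" "z \<in> S" "\<And>w. w \<in> S \<Longrightarrow> w \<noteq> z \<Longrightarrow> g w \<noteq> 0"
      using nz[of z] unfolding eventually_at_topological by blast
    have "F holomorphic_on S"
    proof (rule no_isolated_singularity[where K = "{z}"])
      show "continuous_on S F" using lim by (metis continuous_at_imp_continuous_on isCont_def)
      have "(\<lambda>w. f w / g w) holomorphic_on (S - {z})" using f g S(3) by (intro holomorphic_intros) (auto intro: holomorphic_on_subset)
      thus "F holomorphic_on (S - {z})" by (rule holomorphic_transform) (use S(3) in \<open>auto simp: F_def\<close>)
    qed (use S in auto)
    thus ?thesis using S holomorphic_on_imp_differentiable_at by blast
  qed
  hence "F holomorphic_on UNIV" by (auto simp: holomorphic_on_def field_differentiable_at_within)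
  moreover have "f z = F z * g z" for z using z[of z] by (auto simp: F_def)
  ultimately show ?thesis by blast
qed

text \<open>The quotient is entire and has the periods 1 and \<tau>, hence it is bounded, and
  constant by Liouville's theorem. What is assumed at the zero (1 + \<tau>)/2 spreads to all zeros
  of \<open>g\<close> by quasi-periodicity.\<close>

lemma theta_like_proportional:
  assumes tau: "Im \<tau> > 0" and f: "theta_like \<tau> f" and g: "theta_like \<tau> g"
    and zeros: "\<And>z. g z = 0 \<Longrightarrow> \<exists>a b::int. z = (1 + \<tau>) / 2 + of_int a + of_int b * \<tau>"
    and simple: "deriv g ((1 + \<tau>) / 2) \<noteq> 0" and g0: "g ((1 + \<tau>) / 2) = 0" and f0: "f ((1 + \<tau>) / 2) = 0"
  shows "\<exists>c. \<forall>z. f z = c * g z"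
proof -
  let ?z0 = "(1 + \<tau>) / 2"
  have hol: "f holomorphic_on UNIV" "g holomorphic_on UNIV" using f g by (auto simp: theta_like_def)
  have zz: "f z = 0 \<and> deriv g z \<noteq> 0" if gz: "g z = 0" for z
  proof -
    obtain a b :: int where z: "z = ?z0 + of_int a + of_int b * \<tau>" using zeros[OF gz] by blast
    define u where "u = (\<lambda>z. e2pi (- (of_int b ^ 2) * \<tau> / 2 - of_int b * z))"
    have "f z = 0" unfolding z theta_like_shift[OF f] by (simp add: f0)
    have dg: "(g has_field_derivative deriv g w) (at w)" for w using hol(2) holomorphic_derivI by blast
    have du: "\<exists>u'. (u has_field_derivative u') (at ?z0)" unfolding u_def by (rule exI, (rule derivative_eq_intros refl)+)
    then obtain u' where u': "(u has_field_derivative u') (at ?z0)" by blast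
    have "((\<lambda>w. u w * g w) has_field_derivative (u' * g ?z0 + deriv g ?z0 * u ?z0)) (at ?z0)" by (rule DERIV_mult[OF u' dg])
    moreover have "(\<lambda>w. u w * g w) = (\<lambda>w. g (w + (of_int a + of_int b * \<tau>)))"
      using theta_like_shift[OF g, of _ a b] by (simp add: u_def add.assoc)
    ultimately have 1: "((\<lambda>w. g (w + (of_int a + of_int b * \<tau>))) has_field_derivative (deriv g ?z0 * u ?z0)) (at ?z0)" by (simp add: g0)
    have "((\<lambda>w. g (w + (of_int a + of_int b * \<tau>))) has_field_derivative deriv g z) (at ?z0)"
      using dg[of z] unfolding z by (simp add: DERIV_shift add.assoc)
    hence "deriv g z = deriv g ?z0 * u ?z0" using 1 DERIV_unique by blast
    thus ?thesis using \<open>f z = 0\<close> simple by (simp add: u_def)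
  qed
  obtain F where F: "F holomorphic_on UNIV" "\<And>z. f z = F z * g z" using entire_division[OF hol zz] by blast
  have contF: "continuous_on UNIV F" using F(1) holomorphic_on_imp_continuous_on by blast
  \<comment> \<open>The closed period parallelogram.\<close>
  define K where "K = (\<lambda>(s, t). of_real s + of_real t * \<tau>) ` ({0..1::real} \<times> {0..1::real})"
  have "compact K" unfolding K_def
    by (intro compact_continuous_image compact_Times compact_Icc) (auto intro!: continuous_intros simp: case_prod_unfold)
  hence "bounded (F ` K)" by (intro compact_imp_bounded compact_continuous_image) (use contF continuous_on_subset in auto)
  then obtain B where B: "\<And>z. z \<in> K \<Longrightarrow> norm (F z) \<le> B" by (auto simp: bounded_iff)
  have bd: "norm (F z) \<le> B" if "g z \<noteq> 0" for z
  proof -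
    define t where "t = Im z / Im \<tau>"
    define s where "s = Re z - t * Re \<tau>"
    have zst: "z = of_real s + of_real t * \<tau>" using tau by (simp add: complex_eq_iff s_def t_def)
    define w where "w = of_real (frac s) + of_real (frac t) * \<tau>"
    have zw: "z = w + of_int \<lfloor>s\<rfloor> + of_int \<lfloor>t\<rfloor> * \<tau>" by (simp add: zst w_def frac_def algebra_simps)
    have "w \<in> K" unfolding K_def w_def by (rule image_eqI[of _ _ "(frac s, frac t)"]) (auto simp: frac_lt_1 less_imp_le)
    define e where "e = e2pi (- (of_int \<lfloor>t\<rfloor> ^ 2) * \<tau> / 2 - of_int \<lfloor>t\<rfloor> * w)"
    have "f z = e * f w" "g z = e * g w" unfolding zw e_def by (rule theta_like_shift[OF f] theta_like_shift[OF g])+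
    moreover have "e \<noteq> 0" by (simp add: e_def)
    ultimately have "F z = F w" using F(2)[of z] F(2)[of w] that by (simp add: field_simps)
    thus ?thesis using B[OF \<open>w \<in> K\<close>] by simp
  qed
  \<comment> \<open>At zeros of \<open>g\<close> the identity f = F g says nothing about
    \<open>F\<close>. But a violation of the bound would persist on an open set, on which
    \<open>g\<close> would vanish, against the simplicity of its zeros.\<close>
  have "norm (F z) \<le> B" for z
  proof (rule ccontr)
    assume neg: "\<not> norm (F z) \<le> B"
    have "open {w. norm (F w) > B}" using contF by (intro open_Collect_less continuous_intros) auto
    moreover have "z \<in> {w. norm (F w) > B}" using neg by simp
    moreover have gw: "g w = 0" if "w \<in> {w. norm (F w) > B}" for w using bd[of w] that by force
    ultimately have "(g has_field_derivative 0) (at z)"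
      by (intro has_field_derivative_transform_within_open[of "\<lambda>_. 0" 0 z "{w. norm (F w) > B}" g]) auto
    hence "deriv g z = 0" by (rule DERIV_imp_deriv)
    thus False using zz[of z] gw[of z] neg by auto
  qed
  hence "bounded (range F)" by (auto simp: bounded_iff)
  hence "F constant_on UNIV" using Liouville_theorem[OF F(1)] by blast
  then obtain c where "\<And>z. F z = c" by (auto simp: constant_on_def)
  thus ?thesis using F(2) by auto
qed

text \<open>The variable part of Jacobi's triple product. The constant between it and
  \<open>Theta\<close> is shown to be nonzero and is not evaluated.\<close>

definition theta_prod :: "complex \<Rightarrow> complex \<Rightarrow> complex" where
  "theta_prod \<tau> z = qexp (e2pi \<tau>) (e2pi (\<tau> / 2 + z)) * qexp (e2pi \<tau>) (e2pi (\<tau> / 2 - z))"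

context
  fixes \<tau> :: complex
  assumes tau: "Im \<tau> > 0"
begin

lemma norm_q_less_1: "norm (e2pi \<tau>) < 1"
  using tau by (simp add: norm_e2pi)

lemma e2pi_eq_minus_1:
  assumes "e2pi x = -1" shows "\<exists>a::int. x = 1 / 2 + of_int a"
proof -
  have "e2pi (x - 1 / 2) = 1" using assms by (simp add: e2pi_diff)
  then obtain a where "x - 1 / 2 = of_int a" by (auto simp: e2pi_eq_1_iff Ints_def)
  thus ?thesis by (auto simp: field_simps intro!: exI[of _ a])
qed

lemma theta_like_prod: "theta_like \<tau> (theta_prod \<tau>)"
  unfolding theta_like_def
proof (intro conjI allI)
  have h: "(\<lambda>z. qexp (e2pi \<tau>) (k z)) holomorphic_on UNIV" if "k holomorphic_on UNIV" for k
    using holomorphic_on_compose[OF that qexp_entire[OF norm_q_less_1]] by (simp add: o_def)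
  show "theta_prod \<tau> holomorphic_on UNIV" unfolding theta_prod_def by (intro holomorphic_on_mult h holomorphic_intros)
  fix z
  show "theta_prod \<tau> (z + 1) = theta_prod \<tau> z"
    by (simp add: theta_prod_def add.assoc [symmetric] e2pi_add e2pi_diff e2pi_of_int[of 1, simplified])
  let ?Q = "e2pi (\<tau> / 2 + z)"
  have 1: "qexp (e2pi \<tau>) ?Q = (1 + ?Q) * qexp (e2pi \<tau>) (e2pi (\<tau> / 2 + (z + \<tau>)))"
    by (subst qexp_rec[OF norm_q_less_1]) (simp add: e2pi_add [symmetric] algebra_simps)
  have 2: "qexp (e2pi \<tau>) (e2pi (\<tau> / 2 - (z + \<tau>))) = (1 + inverse ?Q) * qexp (e2pi \<tau>) (e2pi (\<tau> / 2 - z))"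
  proof -
    have "\<tau> / 2 - (z + \<tau>) = - (\<tau> / 2 + z)" by (simp add: field_simps)
    hence "e2pi (\<tau> / 2 - (z + \<tau>)) = inverse ?Q" by (simp only: e2pi_minus)
    moreover have "e2pi \<tau> * inverse ?Q = e2pi (\<tau> / 2 - z)" unfolding e2pi_minus [symmetric] e2pi_add [symmetric] by (simp add: field_simps)
    ultimately show ?thesis using qexp_rec[OF norm_q_less_1, of "inverse ?Q"] by simp
  qed
  have 3: "e2pi (- \<tau> / 2 - z) = inverse ?Q"
  proof -
    have "- \<tau> / 2 - z = - (\<tau> / 2 + z)" by simp
    thus ?thesis by (simp only: e2pi_minus)
  qed
  have 4: "1 + inverse ?Q = inverse ?Q * (1 + ?Q)" by (simp add: field_simps)
  show "theta_prod \<tau> (z + \<tau>) = e2pi (- \<tau> / 2 - z) * theta_prod \<tau> z" unfolding theta_prod_def 3 2 4 using 1 by (simp add: mult_ac)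
qed

lemma theta_prod_zeros:
  assumes "theta_prod \<tau> z = 0"
  shows "\<exists>a b::int. z = (1 + \<tau>) / 2 + of_int a + of_int b * \<tau>"
proof -
  have "qexp (e2pi \<tau>) (e2pi (\<tau> / 2 + z)) = 0 \<or> qexp (e2pi \<tau>) (e2pi (\<tau> / 2 - z)) = 0" using assms by (simp add: theta_prod_def)
  thus ?thesis
  proof
    assume "qexp (e2pi \<tau>) (e2pi (\<tau> / 2 + z)) = 0"
    then obtain i where "e2pi \<tau> ^ i * e2pi (\<tau> / 2 + z) = -1" using qexp_eq_0D[OF norm_q_less_1] by blast
    hence "e2pi (of_nat i * \<tau> + (\<tau> / 2 + z)) = -1" by (simp add: e2pi_add e2pi_mult_of_nat)
    then obtain a where "of_nat i * \<tau> + (\<tau> / 2 + z) = 1 / 2 + of_int a" using e2pi_eq_minus_1 by blast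
    hence "z = (1 / 2 + of_int a) - of_nat i * \<tau> - \<tau> / 2" by (metis add_diff_cancel_left')
    moreover have "(1 / 2 + of_int a) - of_nat i * \<tau> - \<tau> / 2 = (1 + \<tau>) / 2 + of_int a + of_int (- int i - 1) * \<tau>"
      by (simp add: field_simps)
    ultimately have "z = (1 + \<tau>) / 2 + of_int a + of_int (- int i - 1) * \<tau>" by simp
    thus ?thesis by blast
  next
    assume "qexp (e2pi \<tau>) (e2pi (\<tau> / 2 - z)) = 0"
    then obtain i where "e2pi \<tau> ^ i * e2pi (\<tau> / 2 - z) = -1" using qexp_eq_0D[OF norm_q_less_1] by blast
    hence "e2pi (of_nat i * \<tau> + (\<tau> / 2 - z)) = -1" by (simp add: e2pi_add e2pi_mult_of_nat)
    then obtain a where "of_nat i * \<tau> + (\<tau> / 2 - z) = 1 / 2 + of_int a" using e2pi_eq_minus_1 by blast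
    moreover have "x + (y - z) = w \<Longrightarrow> z = x + y - w" for x y w :: complex by auto
    ultimately have "z = of_nat i * \<tau> + \<tau> / 2 - (1 / 2 + of_int a)" by blast
    moreover have "of_nat i * \<tau> + \<tau> / 2 - (1 / 2 + of_int a) = (1 + \<tau>) / 2 + of_int (- a - 1) + of_int (int i) * \<tau>"
      by (simp add: field_simps)
    ultimately have "z = (1 + \<tau>) / 2 + of_int (- a - 1) + of_int (int i) * \<tau>" by simp
    thus ?thesis by blast
  qed
qed

lemma theta_prod_simple_zero:
  "theta_prod \<tau> ((1 + \<tau>) / 2) = 0" "deriv (theta_prod \<tau>) ((1 + \<tau>) / 2) \<noteq> 0"
proof -
  let ?q = "e2pi \<tau>" let ?z = "(1 + \<tau>) / 2"
  have m: "e2pi (\<tau> / 2 - ?z) = -1" "e2pi (\<tau> / 2 + ?z) = - ?q"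
  proof -
    have "\<tau> / 2 - ?z = - (1 / 2)" "\<tau> / 2 + ?z = \<tau> + 1 / 2" by (simp_all add: field_simps)
    thus "e2pi (\<tau> / 2 - ?z) = -1" "e2pi (\<tau> / 2 + ?z) = - ?q" by (simp_all only: e2pi_minus e2pi_add) simp_all
  qed
  have z: "qexp ?q (-1) = 0" using qexp_rec[OF norm_q_less_1, of "-1"] by simp
  thus "theta_prod \<tau> ?z = 0" by (simp add: theta_prod_def m)
  have "((\<lambda>z. e2pi (\<tau> / 2 - z)) has_field_derivative 2 * of_real pi * \<i>) (at ?z)" by (rule derivative_eq_intros refl | simp add: m)+
  hence d1: "((\<lambda>z. qexp ?q (e2pi (\<tau> / 2 - z))) has_field_derivative qexp ?q (- ?q) * tpi) (at ?z)"
    by (rule DERIV_chain2[rotated]) (use qexp_deriv_minus_1[OF norm_q_less_1] m in simp)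
  have "(\<lambda>z. qexp ?q (e2pi (\<tau> / 2 + z))) holomorphic_on UNIV"
  proof -
    have "(\<lambda>z. e2pi (\<tau> / 2 + z)) holomorphic_on UNIV" by (intro holomorphic_intros)
    from holomorphic_on_compose[OF this qexp_entire[OF norm_q_less_1]] show ?thesis by (simp add: o_def)
  qed
  then obtain d where d2: "((\<lambda>z. qexp ?q (e2pi (\<tau> / 2 + z))) has_field_derivative d) (at ?z)" using holomorphic_derivI by blast
  have "(theta_prod \<tau> has_field_derivative d * qexp ?q (e2pi (\<tau> / 2 - ?z)) + qexp ?q (- ?q) * tpi * qexp ?q (e2pi (\<tau> / 2 + ?z))) (at ?z)"
    using DERIV_mult[OF d2 d1] unfolding theta_prod_def .
  hence "deriv (theta_prod \<tau>) ?z = qexp ?q (- ?q) * tpi * qexp ?q (- ?q)" by (simp add: m z DERIV_imp_deriv)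
  thus "deriv (theta_prod \<tau>) ?z \<noteq> 0" using qexp_minus_q_nz[OF norm_q_less_1] by simp
qed

lemma theta_like_even:
  assumes "theta_like \<tau> f" "\<And>z. f (- z) = f z"
  shows "\<exists>c. \<forall>z. f z = c * theta_prod \<tau> z"
  using theta_like_proportional[OF tau assms(1) theta_like_prod theta_prod_zeros theta_prod_simple_zero(2,1)]
    theta_like_even_zero[OF assms(1)] assms(2) by blast

lemma theta_like_Theta: "theta_like \<tau> (Theta \<tau>)"
  using Theta_entire[OF tau] Theta_add_1 Theta_add_tau by (auto simp: theta_like_def)

lemma Theta_eq_prod: "\<exists>c. c \<noteq> 0 \<and> (\<forall>z. Theta \<tau> z = c * theta_prod \<tau> z)"
  using theta_like_even[OF theta_like_Theta Theta_minus] Theta_not_identically_0[OF tau] by fastforce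

lemma Theta_zeros:
  assumes "Theta \<tau> z = 0"
  shows "\<exists>a b::int. z = (1 + \<tau>) / 2 + of_int a + of_int b * \<tau>"
  using Theta_eq_prod assms theta_prod_zeros[of z] by auto

lemma Theta_nz_real: "Theta \<tau> (of_real x) \<noteq> 0"
proof
  assume "Theta \<tau> (of_real x) = 0"
  then obtain a b :: int where "of_real x = (1 + \<tau>) / 2 + of_int a + of_int b * \<tau>" using Theta_zeros by blast
  hence "Im (of_real x) = Im ((1 + \<tau>) / 2 + of_int a + of_int b * \<tau>)" by simp
  hence "Im \<tau> * of_int (1 + 2 * b) = 0" by (simp add: algebra_simps)
  hence "1 + 2 * b = 0" using tau by (simp only: mult_eq_0_iff of_int_eq_0_iff) auto
  thus False by presburger
qed

lemma Theta_nz_half_tau: "Theta \<tau> (\<tau> / 2) \<noteq> 0"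
proof
  assume "Theta \<tau> (\<tau> / 2) = 0"
  then obtain a b :: int where ab: "\<tau> / 2 = (1 + \<tau>) / 2 + of_int a + of_int b * \<tau>" using Theta_zeros by blast
  have "Im \<tau> / 2 = Im \<tau> / 2 + of_int b * Im \<tau>" using arg_cong[OF ab, of Im] by simp
  hence "b = 0" using tau by simp
  hence "Re \<tau> / 2 = (1 + Re \<tau>) / 2 + of_int a" using arg_cong[OF ab, of Re] by simp
  hence "of_int (1 + 2 * a) = (0 :: real)" by (simp add: field_simps)
  hence "1 + 2 * a = 0" by (simp only: of_int_eq_0_iff)
  thus False by presburger
qed

end

text \<open>The square root of \<tau>/i that is positive on the imaginary axis. On the upper
  half-plane -i \<tau> has positive real part, so the principal branch is holomorphic there.\<close>

definition rt :: "complex \<Rightarrow> complex" where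
  "rt \<tau> = csqrt (- \<i> * \<tau>)"

lemma rt_squared: "rt \<tau> ^ 2 = - \<i> * \<tau>"
  by (simp add: rt_def)

lemma rt_nz: "\<tau> \<noteq> 0 \<Longrightarrow> rt \<tau> \<noteq> 0"
  by (simp add: rt_def)

lemma uhp_nz: "Im \<tau> > 0 \<Longrightarrow> \<tau> \<noteq> 0"
  by auto

lemma rt_has_field_derivative:
  assumes "Im \<tau> > 0"
  shows "(rt has_field_derivative rt \<tau> / (2 * \<tau>)) (at \<tau>)"
proof -
  have nz: "\<tau> \<noteq> 0" using assms by auto
  have "- \<i> * \<tau> \<notin> \<real>\<^sub>\<le>\<^sub>0" using assms by (auto simp: complex_nonpos_Reals_iff)
  hence "((\<lambda>\<tau>. csqrt (- \<i> * \<tau>)) has_field_derivative (- \<i>) / (2 * csqrt (- \<i> * \<tau>))) (at \<tau>)"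
    by (intro has_field_derivative_csqrt') (auto intro!: derivative_eq_intros)
  also have "(- \<i>) / (2 * csqrt (- \<i> * \<tau>)) = rt \<tau> / (2 * \<tau>)"
  proof -
    have e: "(- \<i>) * (2 * \<tau>) = rt \<tau> * (2 * rt \<tau>)" using rt_squared[of \<tau>] by (simp add: power2_eq_square mult_ac)
    have z: "2 * rt \<tau> \<noteq> 0" "2 * \<tau> \<noteq> 0" using nz rt_nz[OF nz] by auto
    have "(- \<i>) / (2 * rt \<tau>) = rt \<tau> / (2 * \<tau>)" unfolding frac_eq_eq[OF z] by (rule e)
    thus ?thesis by (simp only: rt_def)
  qed
  finally show ?thesis unfolding rt_def by simp
qed

lemma DERIV_e2pi_square:
  "((\<lambda>z. e2pi (c * z\<^sup>2)) has_field_derivative 2 * of_real pi * \<i> * (c * (2 * z)) * e2pi (c * z\<^sup>2)) (at z)"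
  by (rule derivative_eq_intros refl | simp)+

text \<open>With the Gaussian factor removed, the left side has the quasi-periods of
  \<open>Theta \<tau>\<close> and is even, so the two sides agree up to a factor a(\<tau>). The heat
  equation gives a' = a/(2 \<tau>), so a is a multiple of \<open>rt\<close>, and the fixed point
  \<tau> = i determines the multiple.\<close>

lemma Theta_inversion:
  assumes tau: "Im \<tau> > 0"
  shows "Theta (- 1 / \<tau>) (z / \<tau>) = rt \<tau> * e2pi (z\<^sup>2 / (2 * \<tau>)) * Theta \<tau> z"
proof -
  define a where "a = (\<lambda>\<tau>. Theta (- 1 / \<tau>) 0 / Theta \<tau> 0)"
  have nz0: "Theta \<tau> 0 \<noteq> 0" if "Im \<tau> > 0" for \<tau> using Theta_nz_real[OF that, of 0] by simp
  have main: "Theta (- 1 / \<tau>) (z / \<tau>) = a \<tau> * e2pi ((1 / (2 * \<tau>)) * z\<^sup>2) * Theta \<tau> z" if tau: "Im \<tau> > 0" for \<tau> z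
  proof -
    have nz: "\<tau> \<noteq> 0" using tau by auto
    define Psi where "Psi = (\<lambda>z. e2pi (- (z\<^sup>2) / (2 * \<tau>)) * Theta (- 1 / \<tau>) (z / \<tau>))"
    have "theta_like \<tau> Psi" unfolding theta_like_def
    proof (intro conjI allI)
      have "(\<lambda>z. Theta (- 1 / \<tau>) (z / \<tau>)) holomorphic_on UNIV"
      proof -
        have "(\<lambda>z. z / \<tau>) holomorphic_on UNIV" using nz by (intro holomorphic_intros) auto
        from holomorphic_on_compose[OF this Theta_entire[OF uhp_neg_inverse[OF tau]]] show ?thesis by (simp add: o_def)
      qed
      thus "Psi holomorphic_on UNIV" unfolding Psi_def using nz by (intro holomorphic_intros) auto
      fix z
      have t1: "Theta (- 1 / \<tau>) ((z + 1) / \<tau>) = e2pi (1 / (2 * \<tau>) + z / \<tau>) * Theta (- 1 / \<tau>) (z / \<tau>)"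
      proof -
        have "Theta (- 1 / \<tau>) (z / \<tau>) = Theta (- 1 / \<tau>) ((z + 1) / \<tau> + - 1 / \<tau>)"
          by (rule arg_cong[of _ _ "Theta (- 1 / \<tau>)"]) (simp add: add_divide_distrib)
        also have "\<dots> = e2pi (- (- 1 / \<tau>) / 2 - (z + 1) / \<tau>) * Theta (- 1 / \<tau>) ((z + 1) / \<tau>)" by (rule Theta_add_tau)
        also have "- (- 1 / \<tau>) / 2 - (z + 1) / \<tau> = - (1 / (2 * \<tau>) + z / \<tau>)" using nz by (simp add: field_simps)
        finally have h: "Theta (- 1 / \<tau>) (z / \<tau>) = e2pi (- (1 / (2 * \<tau>) + z / \<tau>)) * Theta (- 1 / \<tau>) ((z + 1) / \<tau>)" .
        have "a = inverse e * b \<Longrightarrow> e \<noteq> 0 \<Longrightarrow> b = e * a" for a b e :: complex by simp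
        from this[OF h[unfolded e2pi_minus] e2pi_nz] show ?thesis .
      qed
      have "Psi (z + 1) = (e2pi (- ((z + 1)\<^sup>2) / (2 * \<tau>)) * e2pi (1 / (2 * \<tau>) + z / \<tau>)) * Theta (- 1 / \<tau>) (z / \<tau>)"
        unfolding Psi_def t1 by (simp only: mult.assoc)
      also have "e2pi (- ((z + 1)\<^sup>2) / (2 * \<tau>)) * e2pi (1 / (2 * \<tau>) + z / \<tau>) = e2pi (- (z\<^sup>2) / (2 * \<tau>))"
        unfolding e2pi_add [symmetric] using nz by (intro arg_cong[of _ _ e2pi]) (simp add: field_simps power2_eq_square)
      finally show "Psi (z + 1) = Psi z" by (simp add: Psi_def)
      have t2: "Theta (- 1 / \<tau>) ((z + \<tau>) / \<tau>) = Theta (- 1 / \<tau>) (z / \<tau>)"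
      proof -
        have e: "(z + \<tau>) / \<tau> = z / \<tau> + 1" using nz by (simp add: add_divide_distrib)
        show ?thesis unfolding e by (rule Theta_add_1)
      qed
      have "e2pi (- ((z + \<tau>)\<^sup>2) / (2 * \<tau>)) = e2pi (- \<tau> / 2 - z) * e2pi (- (z\<^sup>2) / (2 * \<tau>))"
        unfolding e2pi_add [symmetric] using nz by (intro arg_cong[of _ _ e2pi]) (simp add: field_simps power2_eq_square)
      thus "Psi (z + \<tau>) = e2pi (- \<tau> / 2 - z) * Psi z" unfolding Psi_def t2 by (simp only: mult.assoc)
    qed
    moreover have "Psi (- z) = Psi z" for z using Theta_minus[of "- 1 / \<tau>" "z / \<tau>"] by (simp add: Psi_def)
    ultimately obtain c where c: "\<And>z. Psi z = c * theta_prod \<tau> z" using theta_like_even[OF tau] by blast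
    obtain c0 where c0: "c0 \<noteq> 0" "\<And>z. Theta \<tau> z = c0 * theta_prod \<tau> z" using Theta_eq_prod[OF tau] by blast
    have P: "Psi z = c / c0 * Theta \<tau> z" for z using c c0 by simp
    have "a \<tau> = c / c0" using P[of 0] nz0[OF tau] by (simp add: a_def Psi_def)
    hence "e2pi (- (z\<^sup>2) / (2 * \<tau>)) * Theta (- 1 / \<tau>) (z / \<tau>) = a \<tau> * Theta \<tau> z" using P by (simp add: Psi_def)
    moreover have "e2pi ((1 / (2 * \<tau>)) * z\<^sup>2) * e2pi (- (z\<^sup>2) / (2 * \<tau>)) = 1" unfolding e2pi_add [symmetric] by simp
    moreover have "T = k * q * S" if "p * T = k * S" "q * p = 1" for p q T k S :: complex
    proof -
      have "T = (q * p) * T" using that(2) by simp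
      also have "\<dots> = q * (k * S)" by (simp only: mult.assoc that(1))
      finally show ?thesis by (simp only: mult_ac)
    qed
    ultimately show ?thesis by blast
  qed
  have ode: "(a has_field_derivative a \<tau> / (2 * \<tau>)) (at \<tau>)" if tau: "Im \<tau> > 0" for \<tau>
  proof -
    have nz: "\<tau> \<noteq> 0" using tau by auto
    note tau' = uhp_neg_inverse[OF tau]
    define c where "c = 1 / (2 * \<tau>)"
    have dT: "((\<lambda>z. z / \<tau>) has_field_derivative 1 / \<tau>) (at z)" for z using nz by (auto intro!: derivative_eq_intros)
    have L: "((\<lambda>z. Theta (- 1 / \<tau>) (z / \<tau>)) has_field_derivative Theta' (- 1 / \<tau>) (z / \<tau>) * (1 / \<tau>)) (at z)" for z
      by (rule DERIV_chain2[OF Theta_has_field_derivative_z(1)[OF tau'] dT])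
    have R: "((\<lambda>z. a \<tau> * e2pi (c * z\<^sup>2) * Theta \<tau> z) has_field_derivative
         (a \<tau> * (tpi * (c * (2 * z)) * e2pi (c * z\<^sup>2))) * Theta \<tau> z + Theta' \<tau> z * (a \<tau> * e2pi (c * z\<^sup>2))) (at z)" for z
      by (rule DERIV_mult[OF DERIV_cmult[OF DERIV_e2pi_square] Theta_has_field_derivative_z(1)[OF tau]])
    have eq1: "(\<lambda>z. Theta (- 1 / \<tau>) (z / \<tau>)) = (\<lambda>z. a \<tau> * e2pi (c * z\<^sup>2) * Theta \<tau> z)"
      using main[OF tau] by (simp add: fun_eq_iff c_def)
    have D1: "Theta' (- 1 / \<tau>) (z / \<tau>) * (1 / \<tau>) = (a \<tau> * (tpi * (c * (2 * z)) * e2pi (c * z\<^sup>2))) * Theta \<tau> z + Theta' \<tau> z * (a \<tau> * e2pi (c * z\<^sup>2))" for z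
      using L[of z] R[of z] unfolding eq1 by (rule DERIV_unique)
    have L2: "((\<lambda>z. Theta' (- 1 / \<tau>) (z / \<tau>) * (1 / \<tau>)) has_field_derivative ((- 4 * of_real pi ^ 2 * Theta2 (- 1 / \<tau>)) * (1 / \<tau>)) * (1 / \<tau>)) (at 0)"
      by (rule DERIV_cmult_right, rule DERIV_chain2[OF _ dT])
         (use Theta'_has_field_derivative_z0[OF tau'] in simp)
    have d1: "((\<lambda>z. a \<tau> * (tpi * (c * (2 * z)) * e2pi (c * z\<^sup>2))) has_field_derivative a \<tau> * (tpi * (c * 2))) (at 0)"
      by (rule DERIV_cmult) ((rule derivative_eq_intros refl | simp)+)
    have d2: "((\<lambda>z. a \<tau> * e2pi (c * z\<^sup>2)) has_field_derivative a \<tau> * (tpi * (c * (2 * 0)) * e2pi (c * 0\<^sup>2))) (at 0)"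
      by (rule DERIV_cmult[OF DERIV_e2pi_square])
    have R2: "((\<lambda>z. (a \<tau> * (tpi * (c * (2 * z)) * e2pi (c * z\<^sup>2))) * Theta \<tau> z + Theta' \<tau> z * (a \<tau> * e2pi (c * z\<^sup>2))) has_field_derivative
       (a \<tau> * (tpi * (c * 2))) * Theta \<tau> 0 + (- 4 * of_real pi ^ 2 * Theta2 \<tau>) * a \<tau>) (at 0)"
      using DERIV_add[OF DERIV_mult[OF d1 Theta_has_field_derivative_z(1)[OF tau]] DERIV_mult[OF Theta'_has_field_derivative_z0[OF tau] d2]] by simp
    \<comment> \<open>The second z-derivatives of both sides of \<open>main\<close> at 0. By the
      heat equation the two values of \<open>Theta2\<close> are also \<tau>-derivatives, which turns
      this into a differential equation for \<open>a\<close>.\<close>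
    have D2: "((- 4 * of_real pi ^ 2 * Theta2 (- 1 / \<tau>)) * (1 / \<tau>)) * (1 / \<tau>) = (a \<tau> * (tpi * (c * 2))) * Theta \<tau> 0 + (- 4 * of_real pi ^ 2 * Theta2 \<tau>) * a \<tau>"
      using L2 R2 unfolding D1 by (rule DERIV_unique)
    have dinv: "((\<lambda>\<tau>. - 1 / \<tau>) has_field_derivative 1 / \<tau>\<^sup>2) (at \<tau>)"
      using nz by (auto intro!: derivative_eq_intros simp: power2_eq_square)
    have N: "((\<lambda>\<tau>. Theta (- 1 / \<tau>) 0) has_field_derivative of_real pi * \<i> * Theta2 (- 1 / \<tau>) * (1 / \<tau>\<^sup>2)) (at \<tau>)"
      by (rule DERIV_chain2[OF Theta_has_field_derivative_tau[OF tau'] dinv])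
    have "(a has_field_derivative (of_real pi * \<i> * Theta2 (- 1 / \<tau>) * (1 / \<tau>\<^sup>2) * Theta \<tau> 0 - Theta (- 1 / \<tau>) 0 * (of_real pi * \<i> * Theta2 \<tau>)) / (Theta \<tau> 0 * Theta \<tau> 0)) (at \<tau>)"
      unfolding a_def by (rule DERIV_divide[OF N Theta_has_field_derivative_tau[OF tau] nz0[OF tau]])
    also have "Theta (- 1 / \<tau>) 0 = a \<tau> * Theta \<tau> 0" using nz0[OF tau] by (simp add: a_def)
    also have "(of_real pi * \<i> * Theta2 (- 1 / \<tau>) * (1 / \<tau>\<^sup>2) * Theta \<tau> 0 - a \<tau> * Theta \<tau> 0 * (of_real pi * \<i> * Theta2 \<tau>)) / (Theta \<tau> 0 * Theta \<tau> 0)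
       = of_real pi * \<i> * (Theta2 (- 1 / \<tau>) * (1 / \<tau>\<^sup>2) - a \<tau> * Theta2 \<tau>) / Theta \<tau> 0"
      using nz0[OF tau] by (simp add: field_simps)
    also have "Theta2 (- 1 / \<tau>) * (1 / \<tau>\<^sup>2) - a \<tau> * Theta2 \<tau> = - (a \<tau> * (tpi * (c * 2)) * Theta \<tau> 0) / (4 * of_real pi ^ 2)"
    proof -
      have "Y - X = - Z / (4 * p)" if "((- 4 * p * Y')) = Z + (- 4 * p * X)" "Y' = Y" "p \<noteq> 0" for X Y Y' Z p :: complex
      proof -
        have "4 * p \<noteq> 0" using that(3) by simp
        moreover have "(Y - X) * (4 * p) = - Z" using that(1,2) by (simp add: algebra_simps)
        ultimately show ?thesis by (rule iffD2[OF nonzero_eq_divide_eq])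
      qed
      note gen = this
      have "- 4 * of_real pi ^ 2 * (Theta2 (- 1 / \<tau>) * (1 / \<tau>) * (1 / \<tau>)) = a \<tau> * (tpi * (c * 2)) * Theta \<tau> 0 + (- 4 * of_real pi ^ 2 * (a \<tau> * Theta2 \<tau>))"
        using D2 by (simp only: mult_ac)
      moreover have "Theta2 (- 1 / \<tau>) * (1 / \<tau>) * (1 / \<tau>) = Theta2 (- 1 / \<tau>) * (1 / \<tau>\<^sup>2)"
        by (simp add: power2_eq_square)
      ultimately show ?thesis by (rule gen) simp
    qed
    also have "of_real pi * \<i> * (- (a \<tau> * (tpi * (c * 2)) * Theta \<tau> 0) / (4 * of_real pi ^ 2)) / Theta \<tau> 0 = a \<tau> / (2 * \<tau>)"
      using nz0[OF tau] nz by (simp add: c_def power2_eq_square divide_simps)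
    finally show ?thesis .
  qed
  \<comment> \<open>\<open>a\<close> and \<open>rt\<close> satisfy the same linear differential
    equation of first order.\<close>
  have "((\<lambda>\<tau>. a \<tau> / rt \<tau>) has_field_derivative 0) (at \<tau> within upper_half_plane)" if "\<tau> \<in> upper_half_plane" for \<tau>
  proof -
    have tau: "Im \<tau> > 0" using that by simp
    hence nz: "\<tau> \<noteq> 0" by auto
    have "((\<lambda>\<tau>. a \<tau> / rt \<tau>) has_field_derivative (a \<tau> / (2 * \<tau>) * rt \<tau> - a \<tau> * (rt \<tau> / (2 * \<tau>))) / (rt \<tau> * rt \<tau>)) (at \<tau>)"
      by (rule DERIV_divide[OF ode[OF tau] rt_has_field_derivative[OF tau] rt_nz[OF nz]])
    thus ?thesis by (simp add: has_field_derivative_at_within)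
  qed
  then obtain k where k: "\<And>\<tau>. Im \<tau> > 0 \<Longrightarrow> a \<tau> / rt \<tau> = k"
    using has_field_derivative_zero_constant[OF convex_upper_half_plane, of "\<lambda>\<tau>. a \<tau> / rt \<tau>"] by auto
  have "- 1 / \<i> = \<i>" by (simp add: complex_eq_iff)
  hence "a \<i> = 1" using nz0[of \<i>] by (simp add: a_def)
  moreover have "rt \<i> = 1" by (simp add: rt_def)
  ultimately have "k = 1" using k[of \<i>] by simp
  hence "a \<tau> = rt \<tau>" using k[OF tau] rt_nz[OF uhp_nz[OF tau]] by simp
  thus ?thesis using main[OF tau, of z] by simp
qed

text \<open>As n^2 - n is even, e(n^2/2) = e(n/2).\<close>

lemma Theta_tau_add_1: "Theta (\<tau> + 1) z = Theta \<tau> (z + 1 / 2)"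
  unfolding Theta_def
proof (rule infsum_cong)
  fix n :: int
  have "even (n ^ 2 - n)" by simp
  then obtain l where "n ^ 2 - n = 2 * l" by blast
  hence "(of_int n ^ 2 :: complex) = of_int n + 2 * of_int l"
    by (metis add.commute add_diff_cancel_left' diff_add_cancel of_int_add of_int_mult of_int_numeral of_int_power)
  hence "(\<tau> + 1) * of_int n ^ 2 / 2 + of_int n * z = (\<tau> * of_int n ^ 2 / 2 + of_int n * (z + 1 / 2)) + of_int l" by (simp add: field_simps)
  thus "thetaexp (\<tau> + 1) z n = thetaexp \<tau> (z + 1 / 2) n" by (simp add: e2pi_add)
qed

section \<open>Theta constants\<close>

text \<open>Jacobi's theta constants. With the factor e(\<tau>/8) in \<open>th2\<close>, translation
  and inversion permute the three up to simple factors.\<close>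

definition th2 :: "complex \<Rightarrow> complex" where "th2 \<tau> = e2pi (\<tau> / 8) * Theta \<tau> (\<tau> / 2)"
definition th3 :: "complex \<Rightarrow> complex" where "th3 \<tau> = Theta \<tau> 0"
definition th4 :: "complex \<Rightarrow> complex" where "th4 \<tau> = Theta \<tau> (1 / 2)"

lemma th_nz: assumes "Im \<tau> > 0" shows "th2 \<tau> \<noteq> 0" "th3 \<tau> \<noteq> 0" "th4 \<tau> \<noteq> 0"
  using Theta_nz_half_tau[OF assms] Theta_nz_real[OF assms, of 0] Theta_nz_real[OF assms, of "1/2"]
  by (auto simp: th2_def th3_def th4_def)

lemma th_add_1:
  "th2 (\<tau> + 1) = e2pi (1 / 8) * th2 \<tau>" "th3 (\<tau> + 1) = th4 \<tau>" "th4 (\<tau> + 1) = th3 \<tau>"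
proof -
  have "(\<tau> + 1) / 2 + 1 / 2 = \<tau> / 2 + (1 :: complex)" by (simp add: field_simps)
  hence "Theta (\<tau> + 1) ((\<tau> + 1) / 2) = Theta \<tau> (\<tau> / 2)" unfolding Theta_tau_add_1 by (simp only: Theta_add_1)
  moreover have "e2pi ((\<tau> + 1) / 8) = e2pi (1 / 8) * e2pi (\<tau> / 8)" by (simp add: add_divide_distrib e2pi_add)
  ultimately show "th2 (\<tau> + 1) = e2pi (1 / 8) * th2 \<tau>" by (simp add: th2_def)
  show "th3 (\<tau> + 1) = th4 \<tau>" by (simp add: th3_def th4_def Theta_tau_add_1)
  show "th4 (\<tau> + 1) = th3 \<tau>" using Theta_add_1[of \<tau> 0] by (simp add: th3_def th4_def Theta_tau_add_1)
qed

lemma th_inversion: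
  assumes "Im \<tau> > 0"
  shows "th2 (- 1 / \<tau>) = rt \<tau> * th4 \<tau>" "th3 (- 1 / \<tau>) = rt \<tau> * th3 \<tau>" "th4 (- 1 / \<tau>) = rt \<tau> * th2 \<tau>"
proof -
  have nz: "\<tau> \<noteq> 0" using assms by auto
  show "th3 (- 1 / \<tau>) = rt \<tau> * th3 \<tau>" using Theta_inversion[OF assms, of 0] by (simp add: th3_def)
  have "(\<tau> / 2)\<^sup>2 / (2 * \<tau>) = \<tau> / 8" using nz by (simp add: field_simps power2_eq_square)
  moreover have "(\<tau> / 2) / \<tau> = 1 / 2" using nz by simp
  ultimately show "th4 (- 1 / \<tau>) = rt \<tau> * th2 \<tau>"
    using Theta_inversion[OF assms, of "\<tau> / 2"] unfolding th4_def th2_def by (simp only: mult.assoc)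
  have "Theta (- 1 / \<tau>) ((- 1 / \<tau>) / 2) = Theta (- 1 / \<tau>) ((- (1 / 2)) / \<tau>)"
    by (rule arg_cong[of _ _ "Theta (- 1 / \<tau>)"]) (simp add: field_simps)
  also have "\<dots> = rt \<tau> * e2pi ((- (1 / 2))\<^sup>2 / (2 * \<tau>)) * Theta \<tau> (- (1 / 2))" by (rule Theta_inversion[OF assms])
  also have "(- (1 / 2))\<^sup>2 / (2 * \<tau>) = - ((- 1 / \<tau>) / 8)" by (simp add: power2_eq_square)
  finally show "th2 (- 1 / \<tau>) = rt \<tau> * th4 \<tau>" using Theta_minus[of \<tau> "1 / 2"] by (simp add: th2_def th4_def e2pi_minus)
qed

text \<open>By classical identities this is the cube of Dedekind's eta function, and
  \<open>E4\<close>, \<open>E6'\<close> are the Eisenstein series of weights 4 and 6. Through theta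
  constants, the transformation laws, the nonvanishing of \<open>eta3\<close> and the integrality of
  expansions all come from \<open>Theta\<close>.\<close>

definition eta3 :: "complex \<Rightarrow> complex" where "eta3 \<tau> = th2 \<tau> * th3 \<tau> * th4 \<tau> / 2"
definition E4 :: "complex \<Rightarrow> complex" where "E4 \<tau> = (th2 \<tau> ^ 8 + th3 \<tau> ^ 8 + th4 \<tau> ^ 8) / 2"
definition E6' :: "complex \<Rightarrow> complex" where
  "E6' \<tau> = (th2 \<tau> ^ 4 + th3 \<tau> ^ 4) * (th3 \<tau> ^ 4 + th4 \<tau> ^ 4) * (th4 \<tau> ^ 4 - th2 \<tau> ^ 4) / 2"

text \<open>Of weight \<open>-2\<close> and \<open>0\<close>; the differential operator \<open>wfun \<cdot> d/d\<tau>\<close> therefore commutes with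
  the action of \<open>SL\<^sub>2(\<int>)\<close> in weight 0.\<close>

definition wfun :: "complex \<Rightarrow> complex" where "wfun \<tau> = E4 \<tau> * E6' \<tau> / eta3 \<tau> ^ 8"
definition jfun :: "complex \<Rightarrow> complex" where "jfun \<tau> = E4 \<tau> ^ 3 / eta3 \<tau> ^ 8"

lemma eta3_nz: "Im \<tau> > 0 \<Longrightarrow> eta3 \<tau> \<noteq> 0"
  using th_nz by (simp add: eta3_def)

lemma rt_power4: "rt \<tau> ^ 4 = - (\<tau> ^ 2)"
proof -
  have "rt \<tau> ^ 4 = (rt \<tau> ^ 2) ^ 2" by (simp flip: power_mult)
  thus ?thesis by (simp add: rt_squared power_mult_distrib)
qed

lemma rt_power8: "rt \<tau> ^ 8 = \<tau> ^ 4"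
proof -
  have "rt \<tau> ^ 8 = (rt \<tau> ^ 4) ^ 2" by (simp flip: power_mult)
  thus ?thesis by (simp add: rt_power4 flip: power_mult)
qed

lemma e2pi_eighth: "e2pi (1 / 8) ^ 8 = 1" "e2pi (1 / 8) ^ 4 = -1"
  by (simp_all flip: e2pi_mult_of_nat) (use e2pi_of_int[of 1] in simp)

lemma eta3_add_1: "eta3 (\<tau> + 1) = e2pi (1 / 8) * eta3 \<tau>"
  by (simp add: eta3_def th_add_1)

lemma eta3_inversion: "Im \<tau> > 0 \<Longrightarrow> eta3 (- 1 / \<tau>) = rt \<tau> ^ 3 * eta3 \<tau>"
  by (simp add: eta3_def th_inversion power3_eq_cube del: divide_minus_left)

lemma E4_add_1: "E4 (\<tau> + 1) = E4 \<tau>"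
  by (simp add: E4_def th_add_1 power_mult_distrib e2pi_eighth)

lemma E4_inversion: "Im \<tau> > 0 \<Longrightarrow> E4 (- 1 / \<tau>) = \<tau> ^ 4 * E4 \<tau>"
  by (simp add: E4_def th_inversion power_mult_distrib rt_power8 algebra_simps del: divide_minus_left)

lemma E6'_add_1: "E6' (\<tau> + 1) = E6' \<tau>"
proof -
  have "(- x + y) * (y + z) * (z - - x) = (x + z) * (z + y) * (y - x)" for x y z :: complex by (simp add: algebra_simps)
  thus ?thesis by (simp add: E6'_def th_add_1 power_mult_distrib e2pi_eighth)
qed

lemma E6'_inversion: "Im \<tau> > 0 \<Longrightarrow> E6' (- 1 / \<tau>) = \<tau> ^ 6 * E6' \<tau>"
proof -
  have "(- c * z + - c * y) * (- c * y + - c * x) * (- c * x - - c * z) = c ^ 3 * ((x + y) * (y + z) * (z - x))" for x y z c :: complex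
    by (simp add: power3_eq_cube algebra_simps)
  moreover have "(\<tau> ^ 2) ^ 3 = \<tau> ^ 6" by (simp flip: power_mult)
  moreover assume "Im \<tau> > 0"
  ultimately show ?thesis unfolding E6'_def by (simp only: th_inversion power_mult_distrib rt_power4 times_divide_eq_right)
qed

lemma eta3_power8_inversion: "Im \<tau> > 0 \<Longrightarrow> eta3 (- 1 / \<tau>) ^ 8 = \<tau> ^ 12 * eta3 \<tau> ^ 8"
proof -
  assume t: "Im \<tau> > 0"
  have "(rt \<tau> ^ 3) ^ 8 = (rt \<tau> ^ 8) ^ 3" by (simp flip: power_mult)
  also have "\<dots> = \<tau> ^ 12" unfolding rt_power8 by (simp flip: power_mult)
  finally show ?thesis by (simp add: eta3_inversion[OF t] power_mult_distrib del: divide_minus_left)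
qed

lemma eta3_power8_add_1: "eta3 (\<tau> + 1) ^ 8 = eta3 \<tau> ^ 8"
  by (simp add: eta3_add_1 power_mult_distrib e2pi_eighth)

lemma wfun_add_1: "wfun (\<tau> + 1) = wfun \<tau>"
  by (simp add: wfun_def E4_add_1 E6'_add_1 eta3_power8_add_1)

lemma jfun_add_1: "jfun (\<tau> + 1) = jfun \<tau>"
  by (simp add: jfun_def E4_add_1 eta3_power8_add_1)

lemma wfun_inversion: assumes "Im \<tau> > 0" shows "wfun (- 1 / \<tau>) = wfun \<tau> / \<tau>\<^sup>2"
proof -
  have nz: "\<tau> \<noteq> 0" using assms by auto
  have "wfun (- 1 / \<tau>) = (\<tau> ^ 4 * \<tau> ^ 6) * (E4 \<tau> * E6' \<tau>) / (\<tau> ^ 12 * eta3 \<tau> ^ 8)"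
    by (simp add: wfun_def E4_inversion[OF assms] E6'_inversion[OF assms] eta3_power8_inversion[OF assms] del: divide_minus_left)
  also have "\<tau> ^ 12 = \<tau> ^ 2 * (\<tau> ^ 4 * \<tau> ^ 6)" by (simp flip: power_add)
  also have "(\<tau> ^ 4 * \<tau> ^ 6) * (E4 \<tau> * E6' \<tau>) / (\<tau> ^ 2 * (\<tau> ^ 4 * \<tau> ^ 6) * eta3 \<tau> ^ 8) = E4 \<tau> * E6' \<tau> / eta3 \<tau> ^ 8 / \<tau> ^ 2"
  proof -
    have "x * y / (t * x * b) = y / b / t" if "x \<noteq> 0" for x y t b :: complex using that by (simp add: mult.commute)
    moreover have "\<tau> ^ 4 * \<tau> ^ 6 \<noteq> 0" using nz by simp
    ultimately show ?thesis by blast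
  qed
  finally show ?thesis by (simp only: wfun_def)
qed

lemma jfun_inversion: assumes "Im \<tau> > 0" shows "jfun (- 1 / \<tau>) = jfun \<tau>"
proof -
  have nz: "\<tau> \<noteq> 0" using assms by auto
  have "(\<tau> ^ 4) ^ 3 = \<tau> ^ 12" by (simp flip: power_mult)
  thus ?thesis using nz by (simp add: jfun_def E4_inversion[OF assms] eta3_power8_inversion[OF assms] power_mult_distrib del: divide_minus_left)
qed

section \<open>Theta series of index \<open>m\<close>\<close>

lemma e2pi_square_cong:
  assumes "int (2 * m) dvd k - r" "m > 0"
  shows "e2pi (disc m k) = e2pi (disc m r)"
proof -
  obtain l where l: "k = r + 2 * int m * l" using assms(1) by (auto simp: dvd_def algebra_simps)
  have "disc m k = disc m r + (of_int (r * l + int m * l ^ 2) :: complex)" using assms(2) by (simp add: l field_simps power2_eq_square)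
  thus ?thesis by (simp only: e2pi_add e2pi_of_int mult_1_right)
qed

lemma e2pi_mult_cong:
  assumes "int (2 * m) dvd k - s" "m > 0"
  shows "weil m r k = weil m r s"
proof -
  obtain l where l: "k = s + 2 * int m * l" using assms(1) by (auto simp: dvd_def algebra_simps)
  have "- (of_int r * of_int k) / (2 * of_nat m) = - (of_int r * of_int s) / (2 * of_nat m) + (of_int (- r * l) :: complex)"
    using assms(2) by (simp add: l field_simps)
  thus ?thesis by (simp only: e2pi_add e2pi_of_int mult_1_right)
qed

definition residue_class :: "nat \<Rightarrow> int \<Rightarrow> int set" where
  "residue_class m r = {k. int (2 * m) dvd k - r}"

lemma residue_class_iff: "k \<in> residue_class m r \<longleftrightarrow> int (2 * m) dvd k - r"
  by (simp add: residue_class_def)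

lemma residue_class_cong: "residue_class m (r + 2 * int m * l) = residue_class m r"
proof -
  have "int (2 * m) dvd k - (r + 2 * int m * l) \<longleftrightarrow> int (2 * m) dvd k - r" for k
  proof -
    have "k - (r + 2 * int m * l) = (k - r) - int (2 * m) * l" by simp
    thus ?thesis by (metis dvd_diff dvd_triv_left diff_add_cancel dvd_add)
  qed
  thus ?thesis by (simp add: residue_class_def)
qed

lemma residue_class_minus: "- k \<in> residue_class m r \<longleftrightarrow> k \<in> residue_class m (- r)"
proof -
  have "- k - r = - (k - - r)" by simp
  thus ?thesis unfolding residue_class_iff by (simp only: dvd_minus_iff)
qed

lemma sum_residue:
  assumes "m > 0"
  shows "(\<Sum>s\<in>res m. if int (2 * m) dvd k - s then f s else 0) = (f (k mod (2 * int m)) :: complex)"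
proof -
  have "int (2 * m) dvd k - s \<longleftrightarrow> s = k mod (2 * int m)" if "s \<in> res m" for s
    using that by (simp add: mod_eq_dvd_iff [symmetric]) auto
  hence "(\<Sum>s\<in>res m. if int (2 * m) dvd k - s then f s else 0) = (\<Sum>s\<in>res m. if s = k mod (2 * int m) then f s else 0)"
    by (intro sum.cong) auto
  also have "\<dots> = f (k mod (2 * int m))" using assms by (subst sum.delta) auto
  finally show ?thesis .
qed

text \<open>The residue classes partition the integers, so a combination of class sums is a single
  sum with periodic coefficients.\<close>

lemma has_sum_residue_sum:
  assumes m: "m > 0" and f: "\<And>s. (f has_sum S s) (residue_class m s)"
  shows "((\<lambda>k. g (k mod (2 * int m)) * f k) has_sum (\<Sum>s\<in>res m. g s * (S s :: complex))) UNIV"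
proof -
  have "((\<lambda>k. if int (2 * m) dvd k - s then g s * f k else 0) has_sum g s * S s) UNIV" for s
  proof -
    have "((\<lambda>k. g s * f k) has_sum g s * S s) (residue_class m s)" by (rule has_sum_cmult_right[OF f])
    also have "?this \<longleftrightarrow> ((\<lambda>k. if int (2 * m) dvd k - s then g s * f k else 0) has_sum g s * S s) UNIV"
      by (rule has_sum_cong_neutral) (auto simp: residue_class_iff)
    finally show ?thesis .
  qed
  hence "((\<lambda>k. \<Sum>s\<in>res m. if int (2 * m) dvd k - s then g s * f k else 0) has_sum (\<Sum>s\<in>res m. g s * S s)) UNIV"
    by (intro has_sum_sum)
  thus ?thesis using sum_residue[OF m, of _ "\<lambda>s. g s * f _"] by simp
qed

context
  fixes m :: nat
  assumes m: "m > 0"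
begin

lemma Im_div_2m: "Im \<tau> > 0 \<Longrightarrow> Im (\<tau> / (2 * of_nat m)) > 0"
proof -
  assume "Im \<tau> > 0"
  moreover have "\<tau> / (2 * of_nat m) = \<tau> / of_nat (2 * m)" by simp
  ultimately show ?thesis using m unfolding Im_divide_of_nat by simp
qed

lemma theta_term_eq: "kexp m k \<tau> * e2pi (of_int k * z) = thetaexp (\<tau> / (2 * of_nat m)) z k"
  by (simp add: e2pi_add)

lemma theta_has_sum_UNIV:
  assumes "Im \<tau> > 0"
  shows "(\<lambda>k. kexp m k \<tau> * e2pi (of_int k * z)) summable_on A"
proof -
  have "(\<lambda>k. kexp m k \<tau> * e2pi (of_int k * z)) summable_on UNIV"
    unfolding theta_term_eq using Theta_has_sum[OF Im_div_2m[OF assms]] by (auto simp: summable_on_def)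
  thus ?thesis by (rule summable_on_subset_banach) auto
qed

lemma theta_has_sum:
  assumes "Im \<tau> > 0"
  shows "((\<lambda>k. kexp m k \<tau> * e2pi (of_int k * z)) has_sum theta m r \<tau> z) (residue_class m r)"
  unfolding theta_def residue_class_def [symmetric] by (rule has_sum_infsum[OF theta_has_sum_UNIV[OF assms]])

lemma theta_tau_add_1: "theta m r (\<tau> + 1) z = e2pi (disc m r) * theta m r \<tau> z"
proof -
  have "theta m r (\<tau> + 1) z = (\<Sum>\<^sub>\<infinity>k\<in>{k. int (2 * m) dvd k - r}. e2pi (disc m r) * (kexp m k \<tau> * e2pi (of_int k * z)))"
    unfolding theta_def
  proof (rule infsum_cong)
    fix k assume "k \<in> {k. int (2 * m) dvd k - r}"
    hence "e2pi (disc m k) = e2pi (disc m r)" using e2pi_square_cong m by blast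
    thus "kexp m k (\<tau> + 1) * e2pi (of_int k * z) = e2pi (disc m r) * (kexp m k \<tau> * e2pi (of_int k * z))"
      by (simp add: distrib_right add_divide_distrib e2pi_add)
  qed
  thus ?thesis by (simp add: infsum_cmult_right' theta_def)
qed

lemma theta_eq_Theta:
  "theta m r \<tau> z = e2pi (of_int r ^ 2 * \<tau> / (4 * of_nat m) + of_int r * z) * Theta (2 * of_nat m * \<tau>) (2 * of_nat m * z + of_int r * \<tau>)"
proof -
  have "theta m r \<tau> z = (\<Sum>\<^sub>\<infinity>l::int. e2pi (of_int r ^ 2 * \<tau> / (4 * of_nat m) + of_int r * z) *
     e2pi (2 * of_nat m * \<tau> * of_int l ^ 2 / 2 + of_int l * (2 * of_nat m * z + of_int r * \<tau>)))" unfolding theta_def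
  proof (rule infsum_reindex_bij_witness[of _ "\<lambda>l. r + 2 * int m * l" "\<lambda>k. (k - r) div (2 * int m)"], goal_cases)
    case (5 k)
    then obtain l where l: "k = r + 2 * int m * l" by (auto simp: dvd_def algebra_simps)
    have "(k - r) div (2 * int m) = l" using m by (simp add: l)
    moreover have "of_int r ^ 2 * \<tau> / (4 * of_nat m) + of_int r * z + (2 * of_nat m * \<tau> * of_int l ^ 2 / 2 + of_int l * (2 * of_nat m * z + of_int r * \<tau>)) =
      \<tau> * of_int k ^ 2 / (4 * of_nat m) + of_int k * z" using m by (simp add: l field_simps power2_eq_square)
    ultimately show ?case by (simp add: e2pi_add [symmetric])
  qed (use m in auto)
  thus ?thesis by (simp add: infsum_cmult_right' Theta_def)
qed

text \<open>Translating z by -r/2m multiplies the k-th term by \<open>weil m r k\<close>, which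
  depends on k modulo 2m only.\<close>

lemma theta_split:
  assumes "Im \<tau> > 0"
  shows "Theta (\<tau> / (2 * of_nat m)) (z - of_int r / (2 * of_nat m)) =
    (\<Sum>s\<in>res m. weil m r s * theta m s \<tau> z)"
proof -
  have "((\<lambda>k. weil m r (k mod (2 * int m)) * (kexp m k \<tau> * e2pi (of_int k * z))) has_sum
     (\<Sum>s\<in>res m. weil m r s * theta m s \<tau> z)) UNIV" by (rule has_sum_residue_sum[OF m theta_has_sum[OF assms]])
  moreover have "weil m r (k mod (2 * int m)) * (kexp m k \<tau> * e2pi (of_int k * z)) =
     e2pi (\<tau> / (2 * of_nat m) * of_int k ^ 2 / 2 + of_int k * (z - of_int r / (2 * of_nat m)))" for k
  proof -
    have "int (2 * m) dvd k - k mod (2 * int m)" by (simp add: minus_mod_eq_mult_div)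
    from e2pi_mult_cong[OF this m, of r]
    have "weil m r (k mod (2 * int m)) = weil m r k" by simp
    moreover have "- (of_int r * of_int k) / (2 * of_nat m) + (\<tau> * of_int k ^ 2 / (4 * of_nat m) + of_int k * z) = \<tau> / (2 * of_nat m) * of_int k ^ 2 / 2 + of_int k * (z - of_int r / (2 * of_nat m))"
      using m by (simp add: field_simps)
    ultimately show ?thesis by (simp only: e2pi_add [symmetric])
  qed
  ultimately have "((\<lambda>k. e2pi (\<tau> / (2 * of_nat m) * of_int k ^ 2 / 2 + of_int k * (z - of_int r / (2 * of_nat m)))) has_sum
     (\<Sum>s\<in>res m. weil m r s * theta m s \<tau> z)) UNIV" by simp
  thus ?thesis unfolding Theta_def by (rule infsumI)
qed

text \<open>\<open>theta_eq_Theta\<close> at -1/\<tau> leads to \<open>Theta\<close> at -1/T with T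
  = \<tau>/2m; after \<open>Theta_inversion\<close> the value at T is split into residue classes
  again by \<open>theta_split\<close>.\<close>

lemma theta_inversion:
  assumes tau: "Im \<tau> > 0"
  shows "theta m r (- 1 / \<tau>) (z / \<tau>) = rt (\<tau> / (2 * of_nat m)) * e2pi (of_nat m * z\<^sup>2 / \<tau>) *
    (\<Sum>s\<in>res m. weil m r s * theta m s \<tau> z)"
proof -
  have nz: "\<tau> \<noteq> 0" using tau by auto
  define T where "T = \<tau> / (2 * of_nat m)"
  define Z where "Z = z - of_int r / (2 * of_nat m)"
  have T: "Im T > 0" using Im_div_2m[OF tau] by (simp add: T_def)
  have e1: "2 * of_nat m * (- 1 / \<tau>) = - 1 / T" using m by (simp add: T_def)
  have e2: "2 * of_nat m * (z / \<tau>) + of_int r * (- 1 / \<tau>) = Z / T" using m nz by (simp add: T_def Z_def field_simps)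
  have "theta m r (- 1 / \<tau>) (z / \<tau>) = e2pi (of_int r ^ 2 * (- 1 / \<tau>) / (4 * of_nat m) + of_int r * (z / \<tau>)) * Theta (- 1 / T) (Z / T)"
    unfolding theta_eq_Theta e1 e2 by (rule refl)
  also have "\<dots> = (e2pi (of_int r ^ 2 * (- 1 / \<tau>) / (4 * of_nat m) + of_int r * (z / \<tau>)) * e2pi (Z\<^sup>2 / (2 * T))) * (rt T * Theta T Z)"
    unfolding Theta_inversion[OF T] by (simp only: mult_ac)
  also have "e2pi (of_int r ^ 2 * (- 1 / \<tau>) / (4 * of_nat m) + of_int r * (z / \<tau>)) * e2pi (Z\<^sup>2 / (2 * T)) = e2pi (of_nat m * z\<^sup>2 / \<tau>)"
    unfolding e2pi_add [symmetric] by (rule arg_cong[of _ _ e2pi]) (use m nz in \<open>simp add: T_def Z_def field_simps power2_eq_square\<close>)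
  finally show ?thesis unfolding T_def Z_def theta_split[OF tau] by (simp only: mult_ac)
qed

lemma theta_independent:
  assumes tau: "Im \<tau> > 0" and zero: "\<And>x::real. (\<Sum>s\<in>res m. g s * theta m s \<tau> (of_real x)) = 0"
    and s: "s \<in> res m"
  shows "g s = 0"
proof -
  define a where "a = (\<lambda>k::int. g (k mod (2 * int m)) * kexp m k \<tau>)"
  have hs: "((\<lambda>k. a k * e2pi (of_int k * of_real x)) has_sum 0) UNIV" for x
    using has_sum_residue_sum[OF m theta_has_sum[OF tau], of g "of_real x"] unfolding zero a_def by (simp only: mult.assoc)
  have "a summable_on UNIV" using hs[of 0] by (auto simp: summable_on_def)
  from exp_sum_unique[OF this hs, of s] show ?thesis using s by (simp add: a_def)
qed

text \<open>The theta series S_(m,r) as a series rather than as a z-derivative, so that its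
  expansion can be read off.\<close>

definition unary :: "int \<Rightarrow> complex \<Rightarrow> complex" where
  "unary r \<tau> = (\<Sum>\<^sub>\<infinity>k\<in>residue_class m r. of_int k * kexp m k \<tau>)"

lemma unary_theta:
  assumes tau: "Im \<tau> > 0"
  shows "((\<lambda>z. theta m r \<tau> z) has_field_derivative 2 * of_real pi * \<i> * unary r \<tau>) (at 0)"
    and "((\<lambda>k. of_int k * kexp m k \<tau>) has_sum unary r \<tau>) (residue_class m r)"
proof -
  have b: "\<exists>r'>0. \<exists>M. cball w r' \<subseteq> (UNIV :: complex set) \<and> M summable_on residue_class m r \<and>
      (\<forall>n\<in>residue_class m r. \<forall>v\<in>cball w r'. norm (kexp m n \<tau> * e2pi (of_int n * v)) \<le> M n)" for w
  proof (intro exI conjI ballI)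
    show "(\<lambda>n::int. exp (- (pi * Im (\<tau> / (2 * of_nat m))) * (of_int n)\<^sup>2 + 2 * pi * (\<bar>Im w\<bar> + 1) * \<bar>of_int n\<bar>)) summable_on residue_class m r"
      using Im_div_2m[OF tau] pi_gt_zero by (intro summable_on_subset_banach[OF gauss_summable_real] mult_pos_pos) auto
    fix n :: int and v assume "v \<in> cball w (1::real)"
    thus "norm (kexp m n \<tau> * e2pi (of_int n * v)) \<le> exp (- (pi * Im (\<tau> / (2 * of_nat m))) * (of_int n)\<^sup>2 + 2 * pi * (\<bar>Im w\<bar> + 1) * \<bar>of_int n\<bar>)"
      unfolding theta_term_eq by (intro norm_theta_term_le) (use abs_Im_cball in auto)
  qed auto
  have d: "((\<lambda>z. kexp m n \<tau> * e2pi (of_int n * z)) has_field_derivative kexp m n \<tau> * (tpi * of_int n * e2pi (of_int n * w))) (at w)" for n :: int and w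
    by (rule DERIV_cmult) (rule derivative_eq_intros refl | simp)+
  note D = infsum_has_field_derivative[OF open_UNIV UNIV_I d b, of 0]
  have e: "(\<Sum>\<^sub>\<infinity>n\<in>residue_class m r. kexp m n \<tau> * (tpi * of_int n * e2pi (of_int n * 0))) = tpi * unary r \<tau>"
    unfolding unary_def infsum_cmult_right' [symmetric] by (rule infsum_cong) simp
  show "((\<lambda>z. theta m r \<tau> z) has_field_derivative 2 * of_real pi * \<i> * unary r \<tau>) (at 0)"
    using D(1) unfolding e theta_def residue_class_def [symmetric] .
  have cnz: "(tpi :: complex) \<noteq> 0" by simp
  have g1: "inverse c * (c * X) = X" if "c \<noteq> 0" for c X :: complex using that by (simp add: mult.assoc [symmetric])
  have g2: "inverse c * (E * (c * n * 1)) = n * E" if "c \<noteq> 0" for c E n :: complex using that by simp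
  have "((\<lambda>n. inverse tpi * (kexp m n \<tau> * (tpi * of_int n * e2pi (of_int n * 0)))) has_sum (inverse tpi * (tpi * unary r \<tau>))) (residue_class m r)"
    using has_sum_cmult_right[OF D(2)] unfolding e .
  thus "((\<lambda>k. of_int k * kexp m k \<tau>) has_sum unary r \<tau>) (residue_class m r)"
    unfolding g1[OF cnz] mult_zero_right e2pi_0 g2[OF cnz] .
qed

lemma unary_cong: "unary (r + 2 * int m * l) \<tau> = unary r \<tau>"
  unfolding unary_def residue_class_cong by (rule refl)

lemma unary_minus: "unary (- r) \<tau> = - unary r \<tau>"
proof -
  have "unary (- r) \<tau> = (\<Sum>\<^sub>\<infinity>k\<in>residue_class m r. - (of_int k * kexp m k \<tau>))" unfolding unary_def
  by (rule infsum_reindex_bij_witness[of _ uminus uminus]) (auto simp: residue_class_minus)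
  thus ?thesis by (simp add: infsum_uminus unary_def)
qed

lemma unary_tau_add_1: "unary r (\<tau> + 1) = e2pi (disc m r) * unary r \<tau>"
proof -
  have "unary r (\<tau> + 1) = (\<Sum>\<^sub>\<infinity>k\<in>residue_class m r. e2pi (disc m r) * (of_int k * kexp m k \<tau>))" unfolding unary_def
  proof (rule infsum_cong)
    fix k assume "k \<in> residue_class m r"
    hence "e2pi (disc m k) = e2pi (disc m r)" using e2pi_square_cong m unfolding residue_class_iff by blast
    thus "of_int k * kexp m k (\<tau> + 1) = e2pi (disc m r) * (of_int k * kexp m k \<tau>)" by (simp add: distrib_right add_divide_distrib e2pi_add)
  qed
  thus ?thesis by (simp add: infsum_cmult_right' unary_def)
qed

text \<open>The z-derivative of \<open>theta_inversion\<close> at 0: the Gaussian factor has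
  derivative 0 there, and z/\<tau> contributes the factor \<tau> that raises the weight from 1/2 to
  3/2.\<close>

lemma unary_inversion:
  assumes tau: "Im \<tau> > 0"
  shows "unary r (- 1 / \<tau>) = \<tau> * rt (\<tau> / (2 * of_nat m)) *
     (\<Sum>s\<in>res m. weil m r s * unary s \<tau>)"
proof -
  have nz: "\<tau> \<noteq> 0" using tau by auto
  let ?c = "tpi :: complex"
  let ?e = "\<lambda>s. weil m r s"
  have dT: "((\<lambda>z. z / \<tau>) has_field_derivative 1 / \<tau>) (at 0)" using nz by (auto intro!: derivative_eq_intros)
  have L: "((\<lambda>z. theta m r (- 1 / \<tau>) (z / \<tau>)) has_field_derivative ?c * unary r (- 1 / \<tau>) * (1 / \<tau>)) (at 0)"
    by (rule DERIV_chain2[OF _ dT]) (use unary_theta(1)[OF uhp_neg_inverse[OF tau]] in simp)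
  have d1: "((\<lambda>z. rt (\<tau> / (2 * of_nat m)) * e2pi ((of_nat m / \<tau>) * z\<^sup>2)) has_field_derivative 0) (at 0)"
    using DERIV_cmult[OF DERIV_e2pi_square[of "of_nat m / \<tau>" 0], of "rt (\<tau> / (2 * of_nat m))"] by simp
  have d2: "((\<lambda>z. \<Sum>s\<in>res m. ?e s * theta m s \<tau> z) has_field_derivative (\<Sum>s\<in>res m. ?e s * (?c * unary s \<tau>))) (at 0)"
    by (intro DERIV_sum DERIV_cmult unary_theta(1)[OF tau])
  have R: "((\<lambda>z. rt (\<tau> / (2 * of_nat m)) * e2pi ((of_nat m / \<tau>) * z\<^sup>2) * (\<Sum>s\<in>res m. ?e s * theta m s \<tau> z)) has_field_derivative
      (\<Sum>s\<in>res m. ?e s * (?c * unary s \<tau>)) * rt (\<tau> / (2 * of_nat m))) (at 0)" using DERIV_mult[OF d1 d2] by simp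
  have "(\<lambda>z. theta m r (- 1 / \<tau>) (z / \<tau>)) = (\<lambda>z. rt (\<tau> / (2 * of_nat m)) * e2pi ((of_nat m / \<tau>) * z\<^sup>2) * (\<Sum>s\<in>res m. ?e s * theta m s \<tau> z))"
    using theta_inversion[OF tau] by (simp add: fun_eq_iff)
  from L[unfolded this] R have "?c * unary r (- 1 / \<tau>) * (1 / \<tau>) = (\<Sum>s\<in>res m. ?e s * (?c * unary s \<tau>)) * rt (\<tau> / (2 * of_nat m))"
    by (rule DERIV_unique)
  also have "(\<Sum>s\<in>res m. ?e s * (?c * unary s \<tau>)) = ?c * (\<Sum>s\<in>res m. ?e s * unary s \<tau>)"
    unfolding sum_distrib_left by (intro sum.cong) simp_all
  finally have "?c * (unary r (- 1 / \<tau>) * (1 / \<tau>)) = ?c * ((\<Sum>s\<in>res m. ?e s * unary s \<tau>) * rt (\<tau> / (2 * of_nat m)))"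
    by (simp only: mult.assoc)
  moreover have c: "?c \<noteq> 0" by simp
  ultimately have "unary r (- 1 / \<tau>) * (1 / \<tau>) = (\<Sum>s\<in>res m. ?e s * unary s \<tau>) * rt (\<tau> / (2 * of_nat m))"
    using mult_left_cancel[OF c] by blast
  moreover have "A * (1 / \<tau>) = B * C \<Longrightarrow> A = \<tau> * C * B" for A B C using nz by (simp add: field_simps)
  ultimately show ?thesis by blast
qed

end

section \<open>Expansions with coefficients in \<open>\<int>[1/N]\<close>\<close>

text \<open>The ring Z[1/N]. It is polymorphic because it is used in the complex numbers and, after
  a rational functional has been applied, in \<open>rat\<close>.\<close>

definition zloc :: "nat \<Rightarrow> 'a :: field_char_0 set" where
  "zloc N = {x. \<exists>(a::int) k. x * of_nat N ^ k = of_int a}"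

lemma zloc_of_int [simp]: "of_int a \<in> zloc N"
  unfolding zloc_def by (rule CollectI, rule exI[of _ a], rule exI[of _ 0]) simp

lemma zloc_0 [simp]: "0 \<in> zloc N" and zloc_1 [simp]: "1 \<in> zloc N" and zloc_numeral [simp]: "numeral n \<in> zloc N"
  and zloc_of_nat [simp]: "of_nat k \<in> zloc N"
  using zloc_of_int[of 0] zloc_of_int[of 1] zloc_of_int[of "numeral n"] zloc_of_int[of "int k"] by simp_all

lemma zloc_add [intro]: assumes "x \<in> zloc N" "y \<in> zloc N" shows "x + y \<in> zloc N"
proof -
  obtain a j b k where "x * of_nat N ^ j = of_int a" "y * of_nat N ^ k = of_int b" using assms by (auto simp: zloc_def)
  hence "(x + y) * of_nat N ^ (j + k) = of_int (a * int N ^ k + b * int N ^ j)"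
    by (simp add: power_add algebra_simps flip: \<open>x * of_nat N ^ j = of_int a\<close> \<open>y * of_nat N ^ k = of_int b\<close>)
  thus ?thesis unfolding zloc_def by blast
qed

lemma zloc_mult [intro]: assumes "x \<in> zloc N" "y \<in> zloc N" shows "x * y \<in> zloc N"
proof -
  obtain a j b k where "x * of_nat N ^ j = of_int a" "y * of_nat N ^ k = of_int b" using assms by (auto simp: zloc_def)
  hence "(x * y) * of_nat N ^ (j + k) = of_int (a * b)"
    by (simp add: power_add algebra_simps flip: \<open>x * of_nat N ^ j = of_int a\<close> \<open>y * of_nat N ^ k = of_int b\<close>)
  thus ?thesis unfolding zloc_def by blast
qed

lemma zloc_uminus [intro]: "x \<in> zloc N \<Longrightarrow> - x \<in> zloc N"
  using zloc_mult[of "-1" N x] zloc_of_int[of "-1" N] by simp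

lemma zloc_diff [intro]: assumes "x \<in> zloc N" "y \<in> zloc N" shows "x - y \<in> zloc N"
  using zloc_add[OF assms(1) zloc_uminus[OF assms(2)]] by simp

lemma zloc_sum [intro]: "(\<And>i. i \<in> I \<Longrightarrow> f i \<in> zloc N) \<Longrightarrow> sum f I \<in> zloc N"
  by (induction I rule: infinite_finite_induct) auto

lemma zloc_inverse:
  assumes "N > 0" "a dvd int N ^ k" shows "(inverse (of_int a) :: 'a :: field_char_0) \<in> zloc N"
proof -
  obtain b where b: "int N ^ k = a * b" using assms(2) by auto
  have "(of_int a :: 'a) \<noteq> 0" using b assms(1) by auto
  moreover have "(of_nat N ^ k :: 'a) = of_int a * of_int b" using arg_cong[OF b, of "of_int :: int \<Rightarrow> 'a"] by simp
  ultimately have "inverse (of_int a) * of_nat N ^ k = (of_int b :: 'a)" by (simp add: mult.assoc [symmetric])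
  thus ?thesis unfolding zloc_def by blast
qed

section \<open>Expansions in powers of q^(1/8m)\<close>

context
  fixes m :: nat
  assumes m: "m > 0"
begin

text \<open>Exponents are counted in units of 1/8m: q^(r^2/4m) has exponent 2 r^2,
  \<open>eta3\<close> starts at m, and q itself is 8m.\<close>

definition qpow :: "int \<Rightarrow> complex \<Rightarrow> complex" where
  "qpow e \<tau> = e2pi (of_int e * \<tau> / (8 * of_nat m))"

lemma qpow_add: "qpow (a + b) \<tau> = qpow a \<tau> * qpow b \<tau>"
  by (simp add: qpow_def e2pi_add [symmetric] distrib_right add_divide_distrib)

lemma qpow_0: "qpow 0 \<tau> = 1" by (simp add: qpow_def)

lemma qpow_nz: "qpow e \<tau> \<noteq> 0" by (simp add: qpow_def)

lemma qpow_minus: "qpow (- a) \<tau> = inverse (qpow a \<tau>)"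
  by (simp add: qpow_def e2pi_minus [symmetric])

lemma qpow_nat: "qpow (int n) \<tau> = qpow 1 \<tau> ^ n"
  by (simp add: qpow_def e2pi_mult_of_nat [symmetric])

lemma norm_qpow_less_1: "Im \<tau> > 0 \<Longrightarrow> norm (qpow 1 \<tau>) < 1"
proof -
  assume "Im \<tau> > 0"
  moreover have "\<tau> / (8 * of_nat m) = \<tau> / of_nat (8 * m)" by simp
  ultimately show ?thesis using m unfolding qpow_def norm_e2pi by (simp add: Im_divide_of_nat del: of_nat_mult)
qed

text \<open>Transfers statements about the upper half-plane to the punctured unit disc, where the
  power series live.\<close>

lemma qpow_surj:
  assumes "q \<noteq> 0" "norm q < 1" shows "\<exists>\<tau>. Im \<tau> > 0 \<and> qpow 1 \<tau> = q"
proof (intro exI conjI)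
  define \<tau> where "\<tau> = of_nat (8 * m) * (Ln q / tpi)"
  have "Ln q / tpi = Ln q * (- \<i>) / of_real (2 * pi)" by (simp add: field_simps)
  hence "Im (Ln q / tpi) = - ln (norm q) / (2 * pi)" using assms(1) by (simp only: Im_divide_of_real) simp
  moreover have "ln (norm q) < 0" using assms by simp
  ultimately have "Im (Ln q / tpi) > 0" by (simp add: divide_neg_pos)
  moreover have "Im (of_nat n * w) = real n * Im w" for n w by simp
  hence "Im \<tau> = real (8 * m) * Im (Ln q / tpi)" unfolding \<tau>_def by blast
  ultimately show "Im \<tau> > 0" using m by simp
  have "of_int 1 * \<tau> / (8 * of_nat m) = Ln q / tpi" using m by (simp add: \<tau>_def)
  hence "qpow 1 \<tau> = e2pi (Ln q / tpi)" by (simp only: qpow_def)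
  thus "qpow 1 \<tau> = q" using assms(1) by (simp add: e2pi_def)
qed

lemma qpow_has_field_derivative:
  "(qpow e has_field_derivative (tpi * (of_int e / (8 * of_nat m)) * qpow e \<tau>)) (at \<tau>)"
  unfolding qpow_def by (intro e2pi_has_field_derivative DERIV_cdivide DERIV_cmult_Id)

text \<open>\<open>qx A e l F\<close>: in the variable \<open>Q = q\<^bsup>1/8m\<^esup>\<close>, the function \<open>F\<close> is \<open>Q\<^sup>e\<close> times a power series
  with coefficients in \<open>A\<close> and constant term \<open>l\<close>.\<close>

definition qx :: "complex set \<Rightarrow> int \<Rightarrow> complex \<Rightarrow> (complex \<Rightarrow> complex) \<Rightarrow> bool" where
  "qx A e l F \<longleftrightarrow> (\<exists>f. (\<forall>n. fps_nth f n \<in> A) \<and> fps_conv_radius f \<ge> 1 \<and> fps_nth f 0 = l \<and>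
     (\<forall>\<tau>. Im \<tau> > 0 \<longrightarrow> F \<tau> = qpow e \<tau> * eval_fps f (qpow 1 \<tau>)))"

lemma qxI:
  assumes "\<And>n. fps_nth f n \<in> A" "fps_conv_radius f \<ge> 1" "fps_nth f 0 = l"
    "\<And>\<tau>. Im \<tau> > 0 \<Longrightarrow> F \<tau> = qpow e \<tau> * eval_fps f (qpow 1 \<tau>)"
  shows "qx A e l F"
  unfolding qx_def using assms by blast

lemma ereal_less_radius: "1 \<le> r \<Longrightarrow> x < 1 \<Longrightarrow> ereal x < r"
  by (rule order_less_le_trans[of _ 1]) (simp_all add: one_ereal_def)

lemma less_conv_radius: "fps_conv_radius f \<ge> 1 \<Longrightarrow> Im \<tau> > 0 \<Longrightarrow> ereal (norm (qpow 1 \<tau>)) < fps_conv_radius f"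
  by (intro ereal_less_radius norm_qpow_less_1)

lemma qx_mult:
  assumes "qx (zloc N) a k F" "qx (zloc N) b l G"
  shows "qx (zloc N) (a + b) (k * l) (\<lambda>\<tau>. F \<tau> * G \<tau>)"
proof -
  obtain f where f: "\<forall>n. fps_nth f n \<in> zloc N" "fps_conv_radius f \<ge> 1" "fps_nth f 0 = k"
      "\<forall>\<tau>. Im \<tau> > 0 \<longrightarrow> F \<tau> = qpow a \<tau> * eval_fps f (qpow 1 \<tau>)"
    using assms(1) unfolding qx_def by blast
  obtain g where g: "\<forall>n. fps_nth g n \<in> zloc N" "fps_conv_radius g \<ge> 1" "fps_nth g 0 = l"
      "\<forall>\<tau>. Im \<tau> > 0 \<longrightarrow> G \<tau> = qpow b \<tau> * eval_fps g (qpow 1 \<tau>)"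
    using assms(2) unfolding qx_def by blast
  show ?thesis
  proof (rule qxI[of "f * g"])
    show "fps_nth (f * g) n \<in> zloc N" for n unfolding fps_mult_nth using f(1) g(1) by auto
    show "fps_conv_radius (f * g) \<ge> 1" using fps_conv_radius_mult[of f g] f(2) g(2) by (meson min.boundedI order_trans)
    show "fps_nth (f * g) 0 = k * l" using f(3) g(3) by simp
    show "F \<tau> * G \<tau> = qpow (a + b) \<tau> * eval_fps (f * g) (qpow 1 \<tau>)" if "Im \<tau> > 0" for \<tau>
      unfolding qpow_add eval_fps_mult[OF less_conv_radius[OF f(2) that] less_conv_radius[OF g(2) that]] using f(4) g(4) that by simp
  qed
qed

lemma qx_add:
  assumes "qx (zloc N) a k F" "qx (zloc N) a l G"
  shows "qx (zloc N) a (k + l) (\<lambda>\<tau>. F \<tau> + G \<tau>)"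
proof -
  obtain f where f: "\<forall>n. fps_nth f n \<in> zloc N" "fps_conv_radius f \<ge> 1" "fps_nth f 0 = k"
      "\<forall>\<tau>. Im \<tau> > 0 \<longrightarrow> F \<tau> = qpow a \<tau> * eval_fps f (qpow 1 \<tau>)"
    using assms(1) unfolding qx_def by blast
  obtain g where g: "\<forall>n. fps_nth g n \<in> zloc N" "fps_conv_radius g \<ge> 1" "fps_nth g 0 = l"
      "\<forall>\<tau>. Im \<tau> > 0 \<longrightarrow> G \<tau> = qpow a \<tau> * eval_fps g (qpow 1 \<tau>)"
    using assms(2) unfolding qx_def by blast
  show ?thesis
  proof (rule qxI[of "f + g"])
    show "fps_nth (f + g) n \<in> zloc N" for n using f(1) g(1) by auto
    show "fps_conv_radius (f + g) \<ge> 1" using fps_conv_radius_add[of f g] f(2) g(2) by (meson min.boundedI order_trans)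
    show "fps_nth (f + g) 0 = k + l" using f(3) g(3) by simp
    show "F \<tau> + G \<tau> = qpow a \<tau> * eval_fps (f + g) (qpow 1 \<tau>)" if "Im \<tau> > 0" for \<tau>
      unfolding eval_fps_add[OF less_conv_radius[OF f(2) that] less_conv_radius[OF g(2) that]] using f(4) g(4) that by (simp add: distrib_left)
  qed
qed

lemma qx_const: "c \<in> A \<Longrightarrow> 0 \<in> A \<Longrightarrow> qx A 0 c (\<lambda>_. c)"
  by (rule qxI[of "fps_const c"]) (auto simp: qpow_0)

lemma qx_cmult: "c \<in> zloc N \<Longrightarrow> qx (zloc N) a l F \<Longrightarrow> qx (zloc N) a (c * l) (\<lambda>\<tau>. c * F \<tau>)"
  using qx_mult[OF qx_const[of c]] by simp

lemma qx_diff: "qx (zloc N) a k F \<Longrightarrow> qx (zloc N) a l G \<Longrightarrow> qx (zloc N) a (k - l) (\<lambda>\<tau>. F \<tau> - G \<tau>)"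
  using qx_add[OF _ qx_cmult[of "-1"], of N a k F l G] zloc_of_int[of "-1" N] by simp

lemma qx_power: "qx (zloc N) a l F \<Longrightarrow> qx (zloc N) (int n * a) (l ^ n) (\<lambda>\<tau>. F \<tau> ^ n)"
proof (induction n)
  case 0
  show ?case using qx_const[of 1 "zloc N"] by simp
next
  case (Suc n)
  from qx_mult[OF Suc.prems Suc.IH[OF Suc.prems]] show ?case by (simp add: algebra_simps)
qed

text \<open>A function with larger leading exponent counts as one with exponent \<open>a\<close> and
  constant term 0, so that it can be added to others.\<close>

lemma qx_raise:
  assumes "qx (zloc N) (a + int (Suc n)) l F" shows "qx (zloc N) a 0 F"
proof -
  obtain f where f: "\<forall>n. fps_nth f n \<in> zloc N" "fps_conv_radius f \<ge> 1"
      "\<forall>\<tau>. Im \<tau> > 0 \<longrightarrow> F \<tau> = qpow (a + int (Suc n)) \<tau> * eval_fps f (qpow 1 \<tau>)"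
    using assms unfolding qx_def by blast
  show ?thesis
  proof (rule qxI[of "fps_X ^ Suc n * f"])
    show "fps_nth (fps_X ^ Suc n * f) k \<in> zloc N" for k using f(1) by (simp add: fps_X_power_mult_nth del: power_Suc)
    show "fps_conv_radius (fps_X ^ Suc n * f) \<ge> 1"
      by (rule order_trans[OF _ fps_conv_radius_mult]) (use f(2) in \<open>simp del: power_Suc\<close>)
    show "fps_nth (fps_X ^ Suc n * f) 0 = 0" by simp
    show "F \<tau> = qpow a \<tau> * eval_fps (fps_X ^ Suc n * f) (qpow 1 \<tau>)" if t: "Im \<tau> > 0" for \<tau>
    proof -
      have "eval_fps (fps_X ^ Suc n * f) (qpow 1 \<tau>) = qpow 1 \<tau> ^ Suc n * eval_fps f (qpow 1 \<tau>)"
        by (subst eval_fps_mult) (use less_conv_radius[OF f(2) t] in \<open>simp_all del: power_Suc\<close>)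
      thus ?thesis using f(3) t by (simp add: qpow_add qpow_nat del: power_Suc of_nat_Suc)
    qed
  qed
qed

text \<open>The recursion for the inverse series only divides by the constant term 1.\<close>

lemma zloc_fps_inverse:
  fixes f :: "complex fps"
  assumes "\<And>n. fps_nth f n \<in> zloc N" "fps_nth f 0 = 1"
  shows "fps_nth (inverse f) n \<in> zloc N"
proof (induction n rule: less_induct)
  case (less n)
  show ?case
  proof (cases n)
    case 0 thus ?thesis using assms(2) by simp
  next
    case (Suc k)
    have "inverse f * f = 1" by (rule inverse_mult_eq_1) (simp add: assms(2))
    hence "0 = fps_nth (inverse f * f) n" by (simp add: Suc)
    also have "\<dots> = (\<Sum>i=0..n. fps_nth (inverse f) i * fps_nth f (n - i))" by (rule fps_mult_nth)
    also have "\<dots> = (\<Sum>i=0..k. fps_nth (inverse f) i * fps_nth f (n - i)) + fps_nth (inverse f) n" by (simp add: Suc assms(2))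
    finally have "fps_nth (inverse f) n = - (\<Sum>i=0..k. fps_nth (inverse f) i * fps_nth f (n - i))" by (simp add: eq_neg_iff_add_eq_0 add.commute)
    moreover have "(\<Sum>i=0..k. fps_nth (inverse f) i * fps_nth f (n - i)) \<in> zloc N" using less Suc assms(1) by (intro zloc_sum zloc_mult) auto
    ultimately show ?thesis by (simp add: zloc_uminus)
  qed
qed

text \<open>By \<open>qpow_surj\<close>, absence of zeros in the upper half-plane means that the
  power series has no zero in the unit disc, so its inverse converges there too.\<close>

lemma qx_inverse:
  assumes F: "qx (zloc N) a 1 F" and nz: "\<And>\<tau>. Im \<tau> > 0 \<Longrightarrow> F \<tau> \<noteq> 0"
  shows "qx (zloc N) (- a) 1 (\<lambda>\<tau>. inverse (F \<tau>))"
proof -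
  obtain f where f: "\<And>n. fps_nth f n \<in> zloc N" "fps_conv_radius f \<ge> 1" "fps_nth f 0 = 1"
      "\<And>\<tau>. Im \<tau> > 0 \<Longrightarrow> F \<tau> = qpow a \<tau> * eval_fps f (qpow 1 \<tau>)" using F unfolding qx_def by blast
  have fnz: "eval_fps f q \<noteq> 0" if q1: "norm q < 1" for q
  proof (cases "q = 0")
    case True thus ?thesis using f(3) by (simp add: eval_fps_at_0)
  next
    case False
    then obtain \<tau> where "Im \<tau> > 0" "qpow 1 \<tau> = q" using qpow_surj[OF False q1] by blast
    thus ?thesis using nz[OF \<open>Im \<tau> > 0\<close>] f(4)[OF \<open>Im \<tau> > 0\<close>] by simp
  qed
  have f1: "ereal (norm q) < fps_conv_radius f" if "norm q < 1" for q by (rule ereal_less_radius[OF f(2) that])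
  have hol: "(\<lambda>q. inverse (eval_fps f q)) holomorphic_on ball 0 1" using f1 fnz by (intro holomorphic_intros) (auto simp: subset_iff)
  have "eval_fps f has_fps_expansion f" using f1[of 0] by (intro eval_fps_has_fps_expansion) (simp add: zero_ereal_def)
  hence ex: "(\<lambda>q. inverse (eval_fps f q)) has_fps_expansion inverse f" by (rule has_fps_expansion_inverse) (simp add: f(3))
  show ?thesis
  proof (rule qxI[of "inverse f"])
    show "fps_nth (inverse f) n \<in> zloc N" for n using zloc_fps_inverse f(1,3) by blast
    have "fps_conv_radius (inverse f) \<ge> ereal 1" by (rule holomorphic_on_imp_fps_conv_radius_ge[OF ex]) (use hol in simp)
    thus "fps_conv_radius (inverse f) \<ge> 1" by (simp add: one_ereal_def)
    show "fps_nth (inverse f) 0 = 1" by (simp add: f(3))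
    show "inverse (F \<tau>) = qpow (- a) \<tau> * eval_fps (inverse f) (qpow 1 \<tau>)" if "Im \<tau> > 0" for \<tau>
    proof -
      have "eval_fps (inverse f) (qpow 1 \<tau>) = inverse (eval_fps f (qpow 1 \<tau>))"
        by (rule has_fps_expansion_imp_eval_fps_eq[OF ex _ hol]) (rule norm_qpow_less_1[OF that])
      thus ?thesis using f(4)[OF that] by (simp add: qpow_minus)
    qed
  qed
qed

lemma qpow_eval_has_field_derivative:
  assumes "fps_conv_radius f \<ge> 1" "Im \<tau> > 0"
  shows "((\<lambda>\<tau>. qpow e \<tau> * eval_fps f (qpow 1 \<tau>)) has_field_derivative
     tpi * (qpow e \<tau> * (of_int e / (8 * of_nat m) * eval_fps f (qpow 1 \<tau>) + 1 / (8 * of_nat m) * (qpow 1 \<tau> * eval_fps (fps_deriv f) (qpow 1 \<tau>))))) (at \<tau>)"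
proof -
  have "((\<lambda>\<tau>. eval_fps f (qpow 1 \<tau>)) has_field_derivative eval_fps (fps_deriv f) (qpow 1 \<tau>) * (tpi * (of_int 1 / (8 * of_nat m)) * qpow 1 \<tau>)) (at \<tau>)"
    by (rule DERIV_chain2[OF has_field_derivative_eval_fps[OF less_conv_radius[OF assms]] qpow_has_field_derivative])
  from DERIV_mult[OF qpow_has_field_derivative this, of e] show ?thesis by (rule DERIV_cong) (simp add: algebra_simps)
qed

lemma qx_holomorphic:
  assumes "qx A e l F" shows "F holomorphic_on upper_half_plane"
proof -
  obtain f where f: "fps_conv_radius f \<ge> 1" "\<And>\<tau>. Im \<tau> > 0 \<Longrightarrow> F \<tau> = qpow e \<tau> * eval_fps f (qpow 1 \<tau>)"
    using assms unfolding qx_def by blast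
  have "(\<lambda>\<tau>. qpow e \<tau> * eval_fps f (qpow 1 \<tau>)) holomorphic_on upper_half_plane"
    unfolding holomorphic_on_open[OF open_upper_half_plane] by (intro ballI exI, rule qpow_eval_has_field_derivative[OF f(1)]) simp
  thus ?thesis by (rule holomorphic_transform) (use f(2) in auto)
qed

text \<open>The operator q d/dq multiplies the term with exponent j by j/8m.\<close>

lemma qx_deriv:
  assumes F: "qx (zloc N) e l F" and N: "1 / (8 * of_nat m) \<in> (zloc N :: complex set)"
  shows "qx (zloc N) e (of_int e / (8 * of_nat m) * l) (\<lambda>\<tau>. deriv F \<tau> / tpi)"
proof -
  obtain f where f: "\<And>n. fps_nth f n \<in> zloc N" "fps_conv_radius f \<ge> 1" "fps_nth f 0 = l"
      "\<And>\<tau>. Im \<tau> > 0 \<Longrightarrow> F \<tau> = qpow e \<tau> * eval_fps f (qpow 1 \<tau>)" using F unfolding qx_def by blast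
  define g where "g = fps_const (of_int e / (8 * of_nat m)) * f + fps_const (1 / (8 * of_nat m)) * (fps_X * fps_deriv f)"
  have N': "of_int e / (8 * of_nat m) \<in> (zloc N :: complex set)" using zloc_mult[OF zloc_of_int[of e] N] by simp
  have rd: "fps_conv_radius (fps_deriv f) \<ge> 1" using f(2) fps_conv_radius_deriv order_trans by blast
  have r1: "fps_conv_radius (fps_X * fps_deriv f) \<ge> 1" by (rule order_trans[OF _ fps_conv_radius_mult]) (use rd in simp)
  have r2: "fps_conv_radius (fps_const c * h) \<ge> 1" if "fps_conv_radius h \<ge> 1" for c and h :: "complex fps"
    by (rule order_trans[OF _ fps_conv_radius_mult]) (use that in simp)
  show ?thesis
  proof (rule qxI[of g])
    show "fps_nth g n \<in> zloc N" for n
    proof -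
      have "fps_nth (fps_X * fps_deriv f) n = of_nat n * fps_nth f n" by (cases n) (simp_all)
      hence "fps_nth g n = of_int e / (8 * of_nat m) * fps_nth f n + 1 / (8 * of_nat m) * (of_nat n * fps_nth f n)"
        unfolding g_def by (simp only: fps_add_nth fps_mult_left_const_nth)
      thus ?thesis using f(1)[of n] N N' by (simp only:) (intro zloc_add zloc_mult zloc_of_nat)
    qed
    show "fps_conv_radius g \<ge> 1" unfolding g_def by (rule order_trans[OF _ fps_conv_radius_add]) (use r2[OF f(2)] r2[OF r1] in simp)
    show "fps_nth g 0 = of_int e / (8 * of_nat m) * l" by (simp add: g_def f(3))
    fix \<tau> :: complex assume t: "Im \<tau> > 0"
    have "(F has_field_derivative 2 * of_real pi * \<i> * (qpow e \<tau> * (of_int e / (8 * of_nat m) * eval_fps f (qpow 1 \<tau>) + 1 / (8 * of_nat m) * (qpow 1 \<tau> * eval_fps (fps_deriv f) (qpow 1 \<tau>))))) (at \<tau>)"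
      by (rule has_field_derivative_transform_within_open[OF qpow_eval_has_field_derivative[OF f(2) t] open_upper_half_plane])
         (use t f(4) in auto)
    hence d: "deriv F \<tau> = tpi * (qpow e \<tau> * (of_int e / (8 * of_nat m) * eval_fps f (qpow 1 \<tau>) + 1 / (8 * of_nat m) * (qpow 1 \<tau> * eval_fps (fps_deriv f) (qpow 1 \<tau>))))"
      by (rule DERIV_imp_deriv)
    have "eval_fps (fps_const c * h) (qpow 1 \<tau>) = c * eval_fps h (qpow 1 \<tau>)" if "fps_conv_radius h \<ge> 1" for c h
      by (subst eval_fps_mult) (use less_conv_radius[OF that t] in auto)
    moreover have "eval_fps (fps_X * fps_deriv f) (qpow 1 \<tau>) = qpow 1 \<tau> * eval_fps (fps_deriv f) (qpow 1 \<tau>)"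
      by (subst eval_fps_mult) (use less_conv_radius[OF rd t] in auto)
    ultimately have "eval_fps g (qpow 1 \<tau>) = of_int e / (8 * of_nat m) * eval_fps f (qpow 1 \<tau>) + 1 / (8 * of_nat m) * (qpow 1 \<tau> * eval_fps (fps_deriv f) (qpow 1 \<tau>))"
      unfolding g_def by (subst eval_fps_add) (use less_conv_radius[OF r2[OF f(2)] t] less_conv_radius[OF r2[OF r1] t] f(2) r1 in auto)
    thus "deriv F \<tau> / tpi = qpow e \<tau> * eval_fps g (qpow 1 \<tau>)" by (simp add: d)
  qed
qed

text \<open>A primitive of a form of weight 2 is invariant up to constants under \<open>\<tau> \<mapsto> \<tau> + 1\<close> and
  \<open>\<tau> \<mapsto> -1/\<tau>\<close>; evaluation at the fixed points \<open>i\<close> and \<open>e(1/3)\<close> shows that both constants vanish.\<close>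

lemma weight_2_constant_term:
  assumes f: "fps_conv_radius f \<ge> 1"
    and F: "\<And>\<tau>. Im \<tau> > 0 \<Longrightarrow> F \<tau> = qpow (- int M) \<tau> * eval_fps f (qpow 1 \<tau>)"
    and T: "\<And>\<tau>. Im \<tau> > 0 \<Longrightarrow> F (\<tau> + 1) = F \<tau>"
    and S: "\<And>\<tau>. Im \<tau> > 0 \<Longrightarrow> F (- 1 / \<tau>) = \<tau>\<^sup>2 * F \<tau>"
  shows "fps_nth f M = 0"
proof -
  have "(\<lambda>\<tau>. qpow (- int M) \<tau> * eval_fps f (qpow 1 \<tau>)) holomorphic_on upper_half_plane"
    unfolding holomorphic_on_open[OF open_upper_half_plane] by (intro ballI exI, rule qpow_eval_has_field_derivative[OF f]) simp
  hence "F holomorphic_on upper_half_plane" by (rule holomorphic_transform) (use F in auto)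
  then obtain G where "\<And>\<tau>. \<tau> \<in> upper_half_plane \<Longrightarrow> (G has_field_derivative F \<tau>) (at \<tau> within upper_half_plane)"
    using holomorphic_convex_primitive'[OF convex_upper_half_plane open_upper_half_plane] by blast
  hence G: "(G has_field_derivative F \<tau>) (at \<tau>)" if "Im \<tau> > 0" for \<tau>
    using that by (metis at_within_open open_upper_half_plane upper_half_plane_iff)
  have const: "\<exists>c. \<forall>\<tau>. Im \<tau> > 0 \<longrightarrow> H \<tau> = c" if "\<And>\<tau>. Im \<tau> > 0 \<Longrightarrow> (H has_field_derivative 0) (at \<tau>)" for H
    using has_field_derivative_zero_constant[OF convex_upper_half_plane, of H] that by (auto simp: has_field_derivative_at_within)
  have "((\<lambda>\<tau>. G (\<tau> + 1) - G \<tau>) has_field_derivative F (\<tau> + 1) * 1 - F \<tau>) (at \<tau>)" if "Im \<tau> > 0" for \<tau>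
    by (intro DERIV_diff DERIV_chain2[OF G] G) (use that in \<open>auto intro!: derivative_eq_intros\<close>)
  hence "\<exists>a. \<forall>\<tau>. Im \<tau> > 0 \<longrightarrow> G (\<tau> + 1) - G \<tau> = a" using T by (intro const) simp
  then obtain a where a: "\<And>\<tau>. Im \<tau> > 0 \<Longrightarrow> G (\<tau> + 1) = G \<tau> + a" by (metis diff_add_cancel add.commute)
  have "((\<lambda>\<tau>. G (- 1 / \<tau>) - G \<tau>) has_field_derivative 0) (at \<tau>)" if t: "Im \<tau> > 0" for \<tau>
  proof -
    have nz: "\<tau> \<noteq> 0" using t by auto
    have "((\<lambda>\<tau>. - 1 / \<tau>) has_field_derivative 1 / \<tau>\<^sup>2) (at \<tau>)"
      using nz by (auto intro!: derivative_eq_intros simp: power2_eq_square)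
    from DERIV_diff[OF DERIV_chain2[OF G[OF uhp_neg_inverse[OF t]] this] G[OF t]]
    show ?thesis using S[OF t] nz by (simp del: divide_minus_left)
  qed
  hence "\<exists>b. \<forall>\<tau>. Im \<tau> > 0 \<longrightarrow> G (- 1 / \<tau>) - G \<tau> = b" by (rule const)
  then obtain b where b: "\<And>\<tau>. Im \<tau> > 0 \<Longrightarrow> G (- 1 / \<tau>) - G \<tau> = b" by blast
  have "- 1 / \<i> = \<i>" by (simp add: complex_eq_iff)
  hence "b = 0" using b[of \<i>] by simp
  \<comment> \<open>The third root of unity e(1/3), fixed by \<tau> \<mapsto> -1/(\<tau> +
    1).\<close>
  define \<rho> where "\<rho> = Complex (- 1 / 2) (sqrt 3 / 2)"
  have \<rho>: "Im \<rho> > 0" "- 1 / (\<rho> + 1) = \<rho>"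
  proof -
    show "Im \<rho> > 0" by (simp add: \<rho>_def)
    have "\<rho> * (\<rho> + 1) = - 1" by (simp add: \<rho>_def complex_eq_iff)
    moreover have "\<rho> + 1 \<noteq> 0" by (simp add: \<rho>_def complex_eq_iff)
    ultimately show "- 1 / (\<rho> + 1) = \<rho>" by (metis nonzero_divide_eq_eq)
  qed
  have "G (- 1 / (\<rho> + 1)) - G (\<rho> + 1) = b" using \<rho>(1) by (intro b) simp
  hence "a = 0" using a[OF \<rho>(1)] \<open>b = 0\<close> \<rho>(2) by simp
  have per: "G (\<tau> + of_nat n) = G \<tau>" if "Im \<tau> > 0" for \<tau> n
  proof (induction n)
    case (Suc n)
    have "G (\<tau> + of_nat (Suc n)) = G ((\<tau> + of_nat n) + 1)" by (simp add: ac_simps)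
    also have "\<dots> = G (\<tau> + of_nat n)" using a[of "\<tau> + of_nat n"] \<open>a = 0\<close> that by simp
    finally show ?case using Suc by simp
  qed simp
  define g where "g = fps_shift (Suc M) f"
  have rg: "fps_conv_radius g \<ge> 1" using f by (simp add: g_def)
  have "eval_fps g holomorphic_on ball 0 1" using ereal_less_radius[OF rg] by (intro holomorphic_intros) (auto simp: subset_iff)
  then obtain P where "\<And>q. q \<in> ball 0 1 \<Longrightarrow> (P has_field_derivative eval_fps g q) (at q within ball 0 1)"
    using holomorphic_convex_primitive'[OF convex_ball open_ball] by blast
  hence P: "(P has_field_derivative eval_fps g q) (at q)" if "norm q < 1" for q using that by (metis at_within_open open_ball mem_ball_0)
  define c where "c = tpi / (8 * of_nat m)"
  have c: "c \<noteq> 0" using m by (simp add: c_def)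
  have dq: "(qpow e has_field_derivative c * of_int e * qpow e \<tau>) (at \<tau>)" for e \<tau>
    by (rule DERIV_cong[OF qpow_has_field_derivative]) (simp add: c_def)
  \<comment> \<open>A termwise primitive of \<open>F\<close> without its constant term. Both
    \<open>H\<close> and \<open>G\<close> are unchanged from i to i + 8m, so the linear term by
    which \<open>G - H\<close> differs from a constant must vanish.\<close>
  define H where "H = (\<lambda>\<tau>. (\<Sum>n<M. fps_nth f n / (c * of_int (int n - int M)) * qpow (int n - int M) \<tau>) + P (qpow 1 \<tau>) / c)"
  have split: "F \<tau> = (\<Sum>n<M. fps_nth f n * qpow (int n - int M) \<tau>) + fps_nth f M + qpow 1 \<tau> * eval_fps g (qpow 1 \<tau>)"
    if t: "Im \<tau> > 0" for \<tau>
  proof -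
    let ?q = "qpow 1 \<tau>"
    have "summable (\<lambda>n. fps_nth f n * ?q ^ n)" by (rule summable_fps[OF less_conv_radius[OF f t]])
    hence "eval_fps f ?q = (\<Sum>n. fps_nth f (n + Suc M) * ?q ^ (n + Suc M)) + (\<Sum>n<Suc M. fps_nth f n * ?q ^ n)"
      unfolding eval_fps_def by (rule suminf_split_initial_segment)
    also have "(\<Sum>n. fps_nth f (n + Suc M) * ?q ^ (n + Suc M)) = ?q ^ Suc M * eval_fps g ?q" unfolding eval_fps_def g_def
      by (subst suminf_mult [symmetric]) (use summable_fps[OF less_conv_radius[OF rg t]] in \<open>auto simp: g_def power_add mult_ac intro!: suminf_cong\<close>)
    finally have "F \<tau> = (\<Sum>n<Suc M. fps_nth f n * (qpow (- int M) \<tau> * ?q ^ n)) + (qpow (- int M) \<tau> * ?q ^ Suc M) * eval_fps g ?q"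
      unfolding F[OF t] by (simp add: distrib_left sum_distrib_left mult_ac)
    moreover have "qpow (- int M) \<tau> * ?q ^ n = qpow (int n - int M) \<tau>" for n by (simp add: qpow_nat [symmetric] qpow_add [symmetric])
    ultimately show ?thesis by (simp add: qpow_0)
  qed
  have dH: "(H has_field_derivative F \<tau> - fps_nth f M) (at \<tau>)" if t: "Im \<tau> > 0" for \<tau>
  proof -
    have "((\<lambda>\<tau>. \<Sum>n<M. fps_nth f n / (c * of_int (int n - int M)) * qpow (int n - int M) \<tau>) has_field_derivative
        (\<Sum>n<M. fps_nth f n / (c * of_int (int n - int M)) * (c * of_int (int n - int M) * qpow (int n - int M) \<tau>))) (at \<tau>)"
      by (intro DERIV_sum DERIV_cmult dq)
    moreover have "((\<lambda>\<tau>. P (qpow 1 \<tau>) / c) has_field_derivative eval_fps g (qpow 1 \<tau>) * (c * of_int 1 * qpow 1 \<tau>) / c) (at \<tau>)"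
      by (intro DERIV_cdivide DERIV_chain2[OF P dq] norm_qpow_less_1 t)
    ultimately have "(H has_field_derivative (\<Sum>n<M. fps_nth f n / (c * of_int (int n - int M)) * (c * of_int (int n - int M) * qpow (int n - int M) \<tau>)) + eval_fps g (qpow 1 \<tau>) * (c * of_int 1 * qpow 1 \<tau>) / c) (at \<tau>)"
      unfolding H_def by (rule DERIV_add)
    also have "(\<Sum>n<M. fps_nth f n / (c * of_int (int n - int M)) * (c * of_int (int n - int M) * qpow (int n - int M) \<tau>)) = (\<Sum>n<M. fps_nth f n * qpow (int n - int M) \<tau>)"
      by (rule sum.cong) (use c in auto)
    also have "eval_fps g (qpow 1 \<tau>) * (c * of_int 1 * qpow 1 \<tau>) / c = qpow 1 \<tau> * eval_fps g (qpow 1 \<tau>)" using c by simp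
    finally show ?thesis using split[OF t] by (simp add: algebra_simps)
  qed
  have "((\<lambda>\<tau>. G \<tau> - H \<tau> - fps_nth f M * \<tau>) has_field_derivative F \<tau> - (F \<tau> - fps_nth f M) - fps_nth f M * 1) (at \<tau>)" if "Im \<tau> > 0" for \<tau>
    by (intro DERIV_diff G dH that DERIV_cmult DERIV_ident)
  hence "\<exists>k. \<forall>\<tau>. Im \<tau> > 0 \<longrightarrow> G \<tau> - H \<tau> - fps_nth f M * \<tau> = k" by (intro const) simp
  then obtain k where k: "\<And>\<tau>. Im \<tau> > 0 \<Longrightarrow> G \<tau> - H \<tau> - fps_nth f M * \<tau> = k" by blast
  have qper: "qpow e (\<i> + of_nat (8 * m)) = qpow e \<i>" for e
  proof -
    have "of_int e * (\<i> + of_nat (8 * m)) / (8 * of_nat m) = of_int e * \<i> / (8 * of_nat m) + (of_int e :: complex)"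
      using m by (simp add: field_simps)
    thus ?thesis unfolding qpow_def by (simp only: e2pi_add e2pi_of_int mult_1_right)
  qed
  have "H (\<i> + of_nat (8 * m)) = H \<i>" unfolding H_def qper by (rule refl)
  moreover have "G (\<i> + of_nat (8 * m)) = G \<i>" by (rule per) simp
  moreover have "G (\<i> + of_nat (8 * m)) - H (\<i> + of_nat (8 * m)) - fps_nth f M * (\<i> + of_nat (8 * m)) = k" by (rule k) simp
  moreover have "G \<i> - H \<i> - fps_nth f M * \<i> = k" by (rule k) simp
  ultimately have "fps_nth f M * of_nat (8 * m) = 0" by (simp add: algebra_simps)
  thus ?thesis using m by simp
qed

end

context
  fixes m :: nat
  assumes m: "m > 0"
begin

text \<open>Terms with equal exponents are collected. For the radius, convergence at one point of
  each modulus r < 1 is enough, and \<open>qpow_surj\<close> supplies such a point.\<close>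

lemma exponent_sum_fps:
  fixes a :: "int \<Rightarrow> complex"
  assumes fin: "\<And>n. finite {k\<in>K. d k = n}"
    and sum: "\<And>\<tau>. Im \<tau> > 0 \<Longrightarrow> ((\<lambda>k. a k * qpow m (e + int (d k)) \<tau>) has_sum F \<tau>) K"
  shows "fps_conv_radius (Abs_fps (\<lambda>n. \<Sum>k\<in>{k\<in>K. d k = n}. a k)) \<ge> 1"
    and "Im \<tau> > 0 \<Longrightarrow> F \<tau> = qpow m e \<tau> * eval_fps (Abs_fps (\<lambda>n. \<Sum>k\<in>{k\<in>K. d k = n}. a k)) (qpow m 1 \<tau>)"
proof -
  define c where "c = (\<lambda>n. \<Sum>k\<in>{k\<in>K. d k = n}. a k)"
  have main: "(\<lambda>n. c n * qpow m 1 \<tau> ^ n) sums (F \<tau> / qpow m e \<tau>)" if t: "Im \<tau> > 0" for \<tau>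
  proof -
    let ?g = "\<lambda>k. a k * qpow m 1 \<tau> ^ d k"
    have eq: "(\<lambda>k. a k * qpow m (e + int (d k)) \<tau>) = (\<lambda>k. qpow m e \<tau> * ?g k)"
      by (simp add: qpow_add[OF m] qpow_nat[OF m] fun_eq_iff)
    have "((\<lambda>k. inverse (qpow m e \<tau>) * (qpow m e \<tau> * ?g k)) has_sum inverse (qpow m e \<tau>) * F \<tau>) K"
      using sum[OF t, unfolded eq] by (rule has_sum_cmult_right)
    moreover have "inverse (qpow m e \<tau>) * (qpow m e \<tau> * x) = x" for x using qpow_nz[OF m, of e \<tau>] by (simp add: mult.assoc [symmetric])
    moreover have "inverse (qpow m e \<tau>) * F \<tau> = F \<tau> / qpow m e \<tau>" by (simp only: divide_inverse mult.commute)
    ultimately have h: "(?g has_sum F \<tau> / qpow m e \<tau>) K" by simp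
    have "((\<lambda>(n, k). ?g k) has_sum F \<tau> / qpow m e \<tau>) (Sigma UNIV (\<lambda>n. {k\<in>K. d k = n}))"
      using h by (subst has_sum_reindex_bij_witness[of _ "\<lambda>k. (d k, k)" snd K ?g]) auto
    moreover have "((\<lambda>k. case (n, k) of (n, k) \<Rightarrow> ?g k) has_sum c n * qpow m 1 \<tau> ^ n) {k\<in>K. d k = n}" for n
      using has_sum_finiteI[OF fin[of n], of _ ?g] by (simp add: c_def sum_distrib_right)
    ultimately have "((\<lambda>n. c n * qpow m 1 \<tau> ^ n) has_sum F \<tau> / qpow m e \<tau>) UNIV" by (rule has_sum_Sigma')
    thus ?thesis by (rule has_sum_imp_sums)
  qed
  show "fps_conv_radius (Abs_fps (\<lambda>n. \<Sum>k\<in>{k\<in>K. d k = n}. a k)) \<ge> 1" unfolding fps_conv_radius_def c_def [symmetric]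
  proof (rule conv_radius_geI_ex)
    fix r :: real assume r: "0 < r" "ereal r < 1"
    obtain \<tau> where t: "Im \<tau> > 0" "qpow m 1 \<tau> = of_real r" using qpow_surj[OF m, of "of_real r"] r by (auto simp: one_ereal_def)
    show "\<exists>z. norm z = r \<and> summable (\<lambda>n. fps_nth (Abs_fps c) n * z ^ n)"
      by (intro exI[of _ "of_real r"]) (use main[OF t(1)] r in \<open>auto simp: t(2) summable_def\<close>)
  qed
  show "F \<tau> = qpow m e \<tau> * eval_fps (Abs_fps (\<lambda>n. \<Sum>k\<in>{k\<in>K. d k = n}. a k)) (qpow m 1 \<tau>)" if "Im \<tau> > 0"
    unfolding c_def [symmetric] eval_fps_def using sums_unique[OF main[OF that]] qpow_nz[OF m, of e \<tau>] by (simp add: field_simps)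
qed

lemma qx_exponent_sum:
  fixes a :: "int \<Rightarrow> complex"
  assumes fin: "\<And>n. finite {k\<in>K. d k = n}" and A: "\<And>k. a k \<in> zloc N" and l: "(\<Sum>k\<in>{k\<in>K. d k = 0}. a k) = l"
    and sum: "\<And>\<tau>. Im \<tau> > 0 \<Longrightarrow> ((\<lambda>k. a k * qpow m (e + int (d k)) \<tau>) has_sum F \<tau>) K"
  shows "qx m (zloc N) e l F"
  by (rule qxI[OF m, of "Abs_fps (\<lambda>n. \<Sum>k\<in>{k\<in>K. d k = n}. a k)"])
     (use exponent_sum_fps[OF fin sum] A l in \<open>auto intro!: zloc_sum\<close>)

lemma finite_quadratic_fibre: "finite {k::int. nat (f k) = n \<and> k ^ 2 \<le> f k + c}"
proof (rule finite_subset)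
  show "{k. nat (f k) = n \<and> k ^ 2 \<le> f k + c} \<subseteq> {- (int n + \<bar>c\<bar>)..int n + \<bar>c\<bar>}"
  proof
    fix k assume "k \<in> {k. nat (f k) = n \<and> k ^ 2 \<le> f k + c}"
    hence k: "k ^ 2 \<le> int n + \<bar>c\<bar>" by auto
    have "\<bar>k\<bar> \<le> k ^ 2"
    proof (cases "k = 0")
      case False
      hence "\<bar>k\<bar> * 1 \<le> \<bar>k\<bar> * \<bar>k\<bar>" by (intro mult_left_mono) auto
      thus ?thesis by (simp add: power2_eq_square)
    qed simp
    with k show "k \<in> {- (int n + \<bar>c\<bar>)..int n + \<bar>c\<bar>}" by auto
  qed
qed simp

lemma finite_fibre:
  assumes "\<And>k. k \<in> K \<Longrightarrow> k ^ 2 \<le> f k + c" shows "finite {k \<in> K. nat (f k) = n}"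
  by (rule finite_subset[OF _ finite_quadratic_fibre[of f n c]]) (use assms in auto)

lemma square_le_4m_square: "k ^ 2 \<le> 4 * int m * k ^ 2 + 0"
  using m mult_right_mono[of 1 "4 * int m" "k ^ 2"] by auto

lemma qx_th3: "qx m (zloc N) 0 1 th3"
proof (rule qx_exponent_sum[where K = UNIV and d = "\<lambda>k. nat (4 * int m * k ^ 2)" and a = "\<lambda>_. 1"])
  show "finite {k \<in> UNIV. nat (4 * int m * k ^ 2) = n}" for n by (rule finite_fibre[OF square_le_4m_square])
  have "{k \<in> UNIV. nat (4 * int m * k ^ 2) = 0} = {0 :: int}" using m by (auto simp: mult_le_0_iff)
  thus "(\<Sum>k\<in>{k \<in> UNIV. nat (4 * int m * k ^ 2) = 0}. 1) = (1 :: complex)" by simp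
  fix \<tau> :: complex assume t: "Im \<tau> > 0"
  have "1 * qpow m (0 + int (nat (4 * int m * k ^ 2))) \<tau> = thetaexp \<tau> 0 k" for k unfolding qpow_def[OF m] using m by (simp add: field_simps)
  thus "((\<lambda>k. 1 * qpow m (0 + int (nat (4 * int m * k ^ 2))) \<tau>) has_sum th3 \<tau>) UNIV"
    using Theta_has_sum[OF t, of 0] by (simp add: th3_def)
qed simp

lemma qx_th4: "qx m (zloc N) 0 1 th4"
proof (rule qx_exponent_sum[where K = UNIV and d = "\<lambda>k. nat (4 * int m * k ^ 2)" and a = "\<lambda>k. if even k then 1 else -1"])
  show "finite {k \<in> UNIV. nat (4 * int m * k ^ 2) = n}" for n by (rule finite_fibre[OF square_le_4m_square])
  have "{k \<in> UNIV. nat (4 * int m * k ^ 2) = 0} = {0 :: int}" using m by (auto simp: mult_le_0_iff)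
  thus "(\<Sum>k\<in>{k \<in> UNIV. nat (4 * int m * k ^ 2) = 0}. if even k then 1 else -1) = (1 :: complex)" by simp
  show "(if even k then 1 else -1) \<in> zloc N" for k :: int by (auto intro: zloc_uminus)
  fix \<tau> :: complex assume t: "Im \<tau> > 0"
  have "(if even k then 1 else -1) * qpow m (0 + int (nat (4 * int m * k ^ 2))) \<tau> = thetaexp \<tau> (1 / 2) k" for k
  proof -
    have "e2pi (of_int k * (1 / 2)) = (if even k then 1 else -1)"
    proof (cases "even k")
      case True
      then obtain l where "k = 2 * l" by blast
      thus ?thesis by simp
    next
      case False
      then obtain l where "k = 2 * l + 1" by (rule oddE)
      hence "of_int k * (1 / 2) = of_int l + (1 / 2 :: complex)" by (simp add: field_simps)
      thus ?thesis using False by (simp only: e2pi_add e2pi_of_int) simp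
    qed
    moreover have "qpow m (0 + int (nat (4 * int m * k ^ 2))) \<tau> = e2pi (\<tau> * of_int k ^ 2 / 2)"
      unfolding qpow_def[OF m] using m by (simp add: field_simps)
    ultimately show ?thesis by (simp only: e2pi_add mult.commute)
  qed
  thus "((\<lambda>k. (if even k then 1 else -1) * qpow m (0 + int (nat (4 * int m * k ^ 2))) \<tau>) has_sum th4 \<tau>) UNIV"
    using Theta_has_sum[OF t, of "1 / 2"] by (simp add: th4_def)
qed

lemma qx_th2: "qx m (zloc N) (int m) 2 th2"
proof (rule qx_exponent_sum[where K = UNIV and d = "\<lambda>k. nat (4 * int m * (k * (k + 1)))" and a = "\<lambda>_. 1"])
  have nn: "k * (k + 1) \<ge> 0" for k :: int by (cases "k \<ge> 0") (auto intro: mult_nonpos_nonpos)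
  have "k ^ 2 \<le> 4 * int m * (k * (k + 1)) + 1" for k
  proof -
    have "1 * (k * (k + 1)) \<le> int m * (k * (k + 1))" using m nn[of k] by (intro mult_right_mono) auto
    moreover have "k ^ 2 \<le> 4 * (k * (k + 1)) + 1"
    proof -
      have "0 \<le> (k + 1) * (3 * k + 1)" by (cases "k \<ge> 0") (auto intro: mult_nonpos_nonpos)
      thus ?thesis by (simp add: power2_eq_square algebra_simps)
    qed
    ultimately show ?thesis by simp
  qed
  thus "finite {k \<in> UNIV. nat (4 * int m * (k * (k + 1))) = n}" for n by (rule finite_fibre)
  \<comment> \<open>Both k = 0 and k = -1 attain the least exponent, whence the leading coefficient
    2, which the denominator in \<open>eta3\<close> cancels.\<close>
  have "nat (4 * int m * (k * (k + 1))) = 0 \<longleftrightarrow> k = 0 \<or> k = -1" for k using m nn[of k] by (auto simp: mult_le_0_iff)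
  hence "{k \<in> UNIV. nat (4 * int m * (k * (k + 1))) = 0} = {0, -1 :: int}" by auto
  thus "(\<Sum>k\<in>{k \<in> UNIV. nat (4 * int m * (k * (k + 1))) = 0}. 1) = (2 :: complex)" by simp
  fix \<tau> :: complex assume t: "Im \<tau> > 0"
  have "1 * qpow m (int m + int (nat (4 * int m * (k * (k + 1))))) \<tau> = e2pi (\<tau> / 8) * thetaexp \<tau> (\<tau> / 2) k" for k
  proof -
    have "int (nat (4 * int m * (k * (k + 1)))) = 4 * int m * (k * (k + 1))" using nn[of k] by simp
    thus ?thesis unfolding qpow_def[OF m] e2pi_add [symmetric] using m
      by (simp only: mult_1_left) (rule arg_cong[of _ _ e2pi], simp add: field_simps power2_eq_square)
  qed
  thus "((\<lambda>k. 1 * qpow m (int m + int (nat (4 * int m * (k * (k + 1))))) \<tau>) has_sum th2 \<tau>) UNIV"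
    using has_sum_cmult_right[OF Theta_has_sum[OF t, of "\<tau> / 2"], of "e2pi (\<tau> / 8)"] by (simp add: th2_def)
qed simp

context
  fixes N :: nat
  assumes half: "1 / 2 \<in> (zloc N :: complex set)" and unit8m: "1 / (8 * of_nat m) \<in> (zloc N :: complex set)"
begin

lemma qx_eta3: "qx m (zloc N) (int m) 1 eta3"
proof -
  have "qx m (zloc N) (int m + 0 + 0) (1 / 2 * (2 * 1 * 1)) (\<lambda>\<tau>. 1 / 2 * (th2 \<tau> * th3 \<tau> * th4 \<tau>))"
    by (intro qx_cmult[OF m] qx_mult[OF m] qx_th2 qx_th3 qx_th4 half)
  thus ?thesis by (simp add: eta3_def[abs_def])
qed

lemma qx_th2_power: assumes "j > 0" shows "qx m (zloc N) 0 0 (\<lambda>\<tau>. th2 \<tau> ^ j)"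
proof (rule qx_raise[OF m])
  have "qx m (zloc N) (int j * int m) (2 ^ j) (\<lambda>\<tau>. th2 \<tau> ^ j)" by (rule qx_power[OF m qx_th2])
  moreover have "int j * int m = 0 + int (Suc (j * m - 1))" using m assms by simp
  ultimately show "qx m (zloc N) (0 + int (Suc (j * m - 1))) (2 ^ j) (\<lambda>\<tau>. th2 \<tau> ^ j)" by simp
qed

lemma qx_th34_power: "qx m (zloc N) 0 1 (\<lambda>\<tau>. th3 \<tau> ^ j)" "qx m (zloc N) 0 1 (\<lambda>\<tau>. th4 \<tau> ^ j)"
  using qx_power[OF m qx_th3, of N j] qx_power[OF m qx_th4, of N j] by simp_all

lemma qx_E4: "qx m (zloc N) 0 1 E4"
proof -
  have "qx m (zloc N) 0 (1 / 2 * (0 + 1 + 1)) (\<lambda>\<tau>. 1 / 2 * (th2 \<tau> ^ 8 + th3 \<tau> ^ 8 + th4 \<tau> ^ 8))"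
    by (intro qx_cmult[OF m] qx_add[OF m] qx_th2_power qx_th34_power half) simp
  thus ?thesis by (simp add: E4_def[abs_def])
qed

lemma qx_E6': "qx m (zloc N) 0 1 E6'"
proof -
  have "qx m (zloc N) (0 + 0 + 0) (1 / 2 * ((0 + 1) * (1 + 1) * (1 - 0))) (\<lambda>\<tau>. 1 / 2 * ((th2 \<tau> ^ 4 + th3 \<tau> ^ 4) * (th3 \<tau> ^ 4 + th4 \<tau> ^ 4) * (th4 \<tau> ^ 4 - th2 \<tau> ^ 4)))"
    by (intro qx_cmult[OF m] qx_add[OF m] qx_mult[OF m] qx_diff[OF m] qx_th2_power qx_th34_power half) simp_all
  thus ?thesis by (simp add: E6'_def[abs_def])
qed

lemma qx_eta3_inverse: "qx m (zloc N) (- int m) 1 (\<lambda>\<tau>. inverse (eta3 \<tau>))"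
  by (rule qx_inverse[OF m qx_eta3 eta3_nz])

lemma qx_wfun: "qx m (zloc N) (- (8 * int m)) 1 wfun"
proof -
  have "qx m (zloc N) (0 + 0 + int 8 * (- int m)) (1 * 1 * 1 ^ 8) (\<lambda>\<tau>. E4 \<tau> * E6' \<tau> * inverse (eta3 \<tau>) ^ 8)"
    by (intro qx_mult[OF m] qx_E4 qx_E6' qx_power[OF m] qx_eta3_inverse)
  thus ?thesis by (simp add: wfun_def[abs_def] divide_inverse power_inverse)
qed

lemma qx_jfun: "qx m (zloc N) (- (8 * int m)) 1 jfun"
proof -
  have "qx m (zloc N) (int 3 * 0 + int 8 * (- int m)) (1 ^ 3 * 1 ^ 8) (\<lambda>\<tau>. E4 \<tau> ^ 3 * inverse (eta3 \<tau>) ^ 8)"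
    by (intro qx_mult[OF m] qx_E4 qx_power[OF m] qx_eta3_inverse)
  thus ?thesis by (simp add: jfun_def[abs_def] divide_inverse power_inverse)
qed

end

lemma unary_exponent:
  assumes "Im \<tau> > 0"
  shows "((\<lambda>k. of_int k * qpow m (2 * k ^ 2) \<tau>) has_sum unary m r \<tau>) (residue_class m r)"
proof -
  have eq: "of_int k * qpow m (2 * k ^ 2) \<tau> = of_int k * kexp m k \<tau>" for k unfolding qpow_def[OF m] using m by (simp add: field_simps)
  show ?thesis unfolding eq by (rule unary_theta(2)[OF m assms])
qed

lemma residue_class_abs:
  assumes "k \<in> residue_class m r" "\<bar>r\<bar> < int m" shows "\<bar>r\<bar> \<le> \<bar>k\<bar>" "\<bar>k\<bar> = \<bar>r\<bar> \<Longrightarrow> k = r"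
proof -
  obtain l where "k - r = int (2 * m) * l" using assms(1) unfolding residue_class_iff by blast
  hence l: "k = r + 2 * int m * l" by simp
  have "k = r \<or> \<bar>k\<bar> > \<bar>r\<bar>"
  proof (cases "l = 0")
    case False
    hence "2 * int m * 1 \<le> 2 * int m * \<bar>l\<bar>" by (intro mult_left_mono) auto
    hence "2 * int m \<le> \<bar>2 * int m * l\<bar>" by (simp add: abs_mult)
    hence "\<bar>k\<bar> > \<bar>r\<bar>" using l assms(2) by linarith
    thus ?thesis ..
  qed (simp add: l)
  thus "\<bar>r\<bar> \<le> \<bar>k\<bar>" "\<bar>k\<bar> = \<bar>r\<bar> \<Longrightarrow> k = r" by auto
qed

text \<open>The strict bound makes r the only element of least absolute value in its class, so r is
  the leading coefficient.\<close>

lemma qx_unary: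
  assumes r: "\<bar>r\<bar> < int m"
  shows "qx m (zloc N) (2 * r ^ 2) (of_int r) (unary m r)"
proof (rule qx_exponent_sum[where K = "residue_class m r" and d = "\<lambda>k. nat (2 * k ^ 2 - 2 * r ^ 2)" and a = of_int])
  show "finite {k \<in> residue_class m r. nat (2 * k ^ 2 - 2 * r ^ 2) = n}" for n by (rule finite_fibre[where c = "2 * r ^ 2"]) simp
  have sq: "r ^ 2 \<le> k ^ 2" if "k \<in> residue_class m r" for k using residue_class_abs(1)[OF that r] by (simp add: abs_le_square_iff)
  have "{k \<in> residue_class m r. nat (2 * k ^ 2 - 2 * r ^ 2) = 0} = {r}"
  proof (intro equalityI subsetI)
    fix k assume "k \<in> {k \<in> residue_class m r. nat (2 * k ^ 2 - 2 * r ^ 2) = 0}"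
    hence k: "k \<in> residue_class m r" "k ^ 2 = r ^ 2" using sq[of k] by auto
    hence "\<bar>k\<bar> = \<bar>r\<bar>" by (metis power2_eq_iff abs_minus_cancel)
    thus "k \<in> {r}" using residue_class_abs(2)[OF k(1) r] by simp
  qed (auto simp: residue_class_iff)
  thus "(\<Sum>k\<in>{k \<in> residue_class m r. nat (2 * k ^ 2 - 2 * r ^ 2) = 0}. of_int k) = (of_int r :: complex)" by simp
  fix \<tau> :: complex assume t: "Im \<tau> > 0"
  have eq: "of_int k * qpow m (2 * r ^ 2 + int (nat (2 * k ^ 2 - 2 * r ^ 2))) \<tau> = of_int k * qpow m (2 * k ^ 2) \<tau>" if "k \<in> residue_class m r" for k
    using sq[OF that] by simp
  show "((\<lambda>k. of_int k * qpow m (2 * r ^ 2 + int (nat (2 * k ^ 2 - 2 * r ^ 2))) \<tau>) has_sum unary m r \<tau>) (residue_class m r)"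
    by (rule iffD2[OF has_sum_cong[OF eq] unary_exponent[OF t]])
qed simp

end

section \<open>Jacobi forms of weight 1\<close>

lemma has_sum_UNIV_prod:
  fixes f :: "'a \<Rightarrow> 'b \<Rightarrow> complex"
  assumes "((\<lambda>(x, y). f x y) has_sum S) UNIV"
  shows "((\<lambda>x. \<Sum>\<^sub>\<infinity>y. f x y) has_sum S) UNIV"
    and "(f x has_sum (\<Sum>\<^sub>\<infinity>y. f x y)) UNIV"
    and "((\<lambda>y. \<Sum>\<^sub>\<infinity>x. f x y) has_sum S) UNIV"
    and "((\<lambda>x. f x y) has_sum (\<Sum>\<^sub>\<infinity>x. f x y)) UNIV"
proof -
  have row: "(f x has_sum (\<Sum>\<^sub>\<infinity>y. f x y)) UNIV" if "((\<lambda>(x, y). f x y) has_sum S) UNIV" for f :: "'c \<Rightarrow> 'd \<Rightarrow> complex" and x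
  proof -
    have "(\<lambda>(x, y). f x y) summable_on (Pair x ` UNIV)" by (rule summable_on_subset_banach[OF has_sum_imp_summable[OF that]]) auto
    hence "f x summable_on UNIV" by (subst (asm) summable_on_reindex) (auto simp: o_def inj_on_def)
    thus ?thesis by (rule has_sum_infsum)
  qed
  have rows: "((\<lambda>x. \<Sum>\<^sub>\<infinity>y. f x y) has_sum S) UNIV" if "((\<lambda>(x, y). f x y) has_sum S) UNIV" for f :: "'c \<Rightarrow> 'd \<Rightarrow> complex"
    by (rule has_sum_Sigma'[where B = "\<lambda>_. UNIV" and f = "\<lambda>(x, y). f x y"]) (use that row[OF that] in auto)
  have swap: "((\<lambda>(y, x). f x y) has_sum S) UNIV"
    using assms by (subst has_sum_reindex_bij_witness[of _ "\<lambda>(x, y). (y, x)" "\<lambda>(x, y). (y, x)" UNIV "\<lambda>(x, y). f x y"]) auto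
  show "((\<lambda>x. \<Sum>\<^sub>\<infinity>y. f x y) has_sum S) UNIV" "(f x has_sum (\<Sum>\<^sub>\<infinity>y. f x y)) UNIV"
    using rows[OF assms] row[OF assms] by auto
  show "((\<lambda>y. \<Sum>\<^sub>\<infinity>x. f x y) has_sum S) UNIV" "((\<lambda>x. f x y) has_sum (\<Sum>\<^sub>\<infinity>x. f x y)) UNIV"
    using rows[OF swap] row[OF swap] by auto
qed

text \<open>\<open>exp_sum_unique\<close> in the first variable shows that every row sums to zero
  for all y; in the second variable it then kills the coefficients of the rows.\<close>

lemma double_exp_sum_unique:
  fixes a :: "int \<Rightarrow> int \<Rightarrow> complex"
  assumes zero: "\<And>x y::real. ((\<lambda>(n, r). a n r * fexp n r (of_real x) (of_real y)) has_sum 0) UNIV"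
  shows "a n r = 0"
proof -
  have s: "((\<lambda>(n, r). a n r) has_sum 0) UNIV" using zero[of 0 0] by simp
  have b: "(\<Sum>\<^sub>\<infinity>r. a n r * e2pi (of_int r * of_real y)) = 0" for n and y :: real
  proof (rule exp_sum_unique)
    have h: "((\<lambda>n. \<Sum>\<^sub>\<infinity>r. a n r * fexp n r (of_real x) (of_real y)) has_sum 0) UNIV" for x :: real
      by (rule has_sum_UNIV_prod(1)[OF zero])
    have e: "(\<Sum>\<^sub>\<infinity>r. a n r * fexp n r (of_real x) (of_real y)) = (\<Sum>\<^sub>\<infinity>r. a n r * e2pi (of_int r * of_real y)) * e2pi (of_int n * of_real x)" for n and x :: real
      unfolding infsum_cmult_left' [symmetric] by (rule infsum_cong) (simp add: e2pi_add)
    show "((\<lambda>n. (\<Sum>\<^sub>\<infinity>r. a n r * e2pi (of_int r * of_real y)) * e2pi (of_int n * of_real x)) has_sum 0) UNIV" for x :: real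
      using h[of x] unfolding e .
    from this[of 0] show "(\<lambda>n. \<Sum>\<^sub>\<infinity>r. a n r * e2pi (of_int r * of_real y)) summable_on UNIV"
      by (auto simp: summable_on_def)
  qed
  show ?thesis
  proof (rule exp_sum_unique)
    show "a n summable_on UNIV" using has_sum_UNIV_prod(2)[OF s, of n] by (rule has_sum_imp_summable)
    have z0: "((\<lambda>(n, r). a n r * e2pi (of_int r * of_real y)) has_sum 0) UNIV" for y :: real using zero[of 0 y] by simp
    show "((\<lambda>k. a n k * e2pi (of_int k * of_real y)) has_sum 0) UNIV" for y :: real using has_sum_UNIV_prod(2)[OF z0, of n y] unfolding b .
  qed
qed

definition jphi :: "(int \<Rightarrow> int \<Rightarrow> complex) \<Rightarrow> complex \<Rightarrow> complex \<Rightarrow> complex" where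
  "jphi c \<tau> z = (\<Sum>\<^sub>\<infinity>(n, r)\<in>UNIV. c n r * fexp n r \<tau> z)"

abbreviation jact :: "nat \<Rightarrow> int \<Rightarrow> int \<Rightarrow> int \<Rightarrow> int \<Rightarrow> (int \<Rightarrow> int \<Rightarrow> complex) \<Rightarrow> complex \<Rightarrow> complex \<Rightarrow> complex" where
  "jact m p q r s c \<tau> z \<equiv> e2pi (- of_nat m * (of_int r * z ^ 2 / (of_int r * \<tau> + of_int s))) * inverse (of_int r * \<tau> + of_int s) *
     jphi c ((of_int p * \<tau> + of_int q) / (of_int r * \<tau> + of_int s)) (z / (of_int r * \<tau> + of_int s))"

text \<open>The Fourier coefficients \<open>c(n, r)\<close> of Jacobi forms of weight 1 and index \<open>m\<close>, with
  \<open>r\<^sup>2 - 4mn \<le> B\<close> on the support.\<close>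

definition jform :: "nat \<Rightarrow> int \<Rightarrow> (int \<Rightarrow> int \<Rightarrow> complex) \<Rightarrow> bool" where
  "jform m B c \<longleftrightarrow>
     (\<forall>n r. c n r \<noteq> 0 \<longrightarrow> r ^ 2 \<le> 4 * int m * n + B) \<and>
     (\<forall>n r l. c (n + r * l + int m * l ^ 2) (r + 2 * int m * l) = c n r) \<and>
     (\<forall>\<tau> z. Im \<tau> > 0 \<longrightarrow> (\<lambda>(n, r). c n r * fexp n r \<tau> z) summable_on UNIV) \<and>
     (\<forall>p q r s::int. p * s - q * r = 1 \<longrightarrow> (\<forall>\<tau> z. Im \<tau> > 0 \<longrightarrow>
        jact m p q r s c \<tau> z = jphi c \<tau> z))"

text \<open>The component h_r of the theta decomposition. Under the elliptic law a term depends only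
  on n - r^2/4m and on r modulo 2m.\<close>

definition hcomp :: "nat \<Rightarrow> (int \<Rightarrow> int \<Rightarrow> complex) \<Rightarrow> int \<Rightarrow> complex \<Rightarrow> complex" where
  "hcomp m c r \<tau> = (\<Sum>\<^sub>\<infinity>n. c n r * hexp m n r \<tau>)"

lemma sum_residues_reindex:
  fixes F :: "int \<Rightarrow> 'a :: comm_monoid_add"
  assumes M: "M > 0" and F: "\<And>r. F (r mod M) = F r"
    and g: "\<And>r s. g r mod M = g s mod M \<Longrightarrow> r mod M = s mod M"
  shows "(\<Sum>r\<in>{0..<M}. F (g r)) = (\<Sum>r\<in>{0..<M}. F r)"
proof -
  have inj: "inj_on (\<lambda>r. g r mod M) {0..<M}"
  proof (rule inj_onI)
    fix r s assume "r \<in> {0..<M}" "s \<in> {0..<M}" "g r mod M = g s mod M"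
    thus "r = s" using g[of r s] by simp
  qed
  have "(\<lambda>r. g r mod M) ` {0..<M} = {0..<M}" by (rule endo_inj_surj[OF _ _ inj]) (use M in auto)
  hence "(\<Sum>r\<in>{0..<M}. F r) = (\<Sum>r\<in>{0..<M}. F (g r mod M))" using sum.reindex[OF inj, of F] by (simp add: o_def)
  thus ?thesis using F by simp
qed

text \<open>The part of a Jacobi form that does not involve the modular law:
  \<open>jform_of_components\<close> uses the theta decomposition in order to establish that
  law.\<close>

locale theta_expansion =
  fixes m :: nat and c :: "int \<Rightarrow> int \<Rightarrow> complex"
  assumes m: "m > 0"
    and elliptic: "c (n + r * l + int m * l ^ 2) (r + 2 * int m * l) = c n r"
    and jphi_summable: "Im \<tau> > 0 \<Longrightarrow> (\<lambda>(n, r). c n r * fexp n r \<tau> z) summable_on UNIV"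
begin

lemma jphi_has_sum:
  "Im \<tau> > 0 \<Longrightarrow> ((\<lambda>(n, r). c n r * fexp n r \<tau> z) has_sum jphi c \<tau> z) UNIV"
  using jphi_summable unfolding jphi_def by (rule has_sum_infsum)

lemma hcomp_has_sum:
  assumes "Im \<tau> > 0"
  shows "((\<lambda>n. c n r * hexp m n r \<tau>) has_sum hcomp m c r \<tau>) UNIV"
proof -
  have "((\<lambda>n. c n r * fexp n r \<tau> 0) has_sum (\<Sum>\<^sub>\<infinity>n. c n r * fexp n r \<tau> 0)) UNIV"
    by (rule has_sum_UNIV_prod(4)[OF jphi_has_sum[OF assms]])
  hence "((\<lambda>n. c n r * fexp n r \<tau> 0 * e2pi (- (disc m r * \<tau>))) summable_on UNIV)"
    using has_sum_cmult_left has_sum_imp_summable by blast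
  moreover have "c n r * fexp n r \<tau> 0 * e2pi (- (disc m r * \<tau>)) = c n r * hexp m n r \<tau>" for n
  proof -
    have "of_int n * \<tau> - disc m r * \<tau> = (of_int n * \<tau> + of_int r * 0) + - (disc m r * \<tau>)" by simp
    thus ?thesis by (simp only: e2pi_add mult.assoc)
  qed
  ultimately show ?thesis unfolding hcomp_def by (intro has_sum_infsum) (simp only:)
qed

lemma hcomp_cong: "hcomp m c (r + 2 * int m * l) \<tau> = hcomp m c r \<tau>"
  unfolding hcomp_def
proof (rule infsum_reindex_bij_witness[of _ "\<lambda>n. n + r * l + int m * l ^ 2" "\<lambda>n. n - r * l - int m * l ^ 2"])
  fix n :: int
  define n' where "n' = n - r * l - int m * l ^ 2"
  have n: "n = n' + r * l + int m * l ^ 2" by (simp add: n'_def)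
  have "of_int n * \<tau> - disc m (r + 2 * int m * l) * \<tau> = of_int n' * \<tau> - disc m r * \<tau>"
    using m by (simp add: n field_simps power2_eq_square)
  thus "c (n - r * l - int m * l ^ 2) r * hexp m (n - r * l - int m * l ^ 2) r \<tau> = c n (r + 2 * int m * l) * hexp m n (r + 2 * int m * l) \<tau>"
    unfolding n'_def [symmetric] using elliptic[of n' r l] n by simp
qed auto

lemma hcomp_mod: "hcomp m c (r mod (2 * int m)) \<tau> = hcomp m c r \<tau>"
  using hcomp_cong[of "r mod (2 * int m)" "r div (2 * int m)" \<tau>] by (simp add: mult.commute)

lemma hcomp_tau_add_1: "hcomp m c r (\<tau> + 1) = e2pi (- (of_int r ^ 2) / (4 * of_nat m)) * hcomp m c r \<tau>"
proof -
  have "hcomp m c r (\<tau> + 1) = (\<Sum>\<^sub>\<infinity>n. e2pi (- (of_int r ^ 2) / (4 * of_nat m)) * (c n r * hexp m n r \<tau>))"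
    unfolding hcomp_def
  proof (rule infsum_cong)
    fix n :: int
    have "of_int n * (\<tau> + 1) - disc m r * (\<tau> + 1) = - (of_int r ^ 2) / (4 * of_nat m) + (of_int n * \<tau> - disc m r * \<tau>) + of_int n"
      by (simp add: distrib_left)
    hence "hexp m n r (\<tau> + 1) = e2pi (- (of_int r ^ 2) / (4 * of_nat m)) * hexp m n r \<tau>" by (simp only: e2pi_add e2pi_of_int mult_1_right)
    thus "c n r * hexp m n r (\<tau> + 1) = e2pi (- (of_int r ^ 2) / (4 * of_nat m)) * (c n r * hexp m n r \<tau>)" by (simp only: mult_ac)
  qed
  thus ?thesis unfolding hcomp_def infsum_cmult_right' .
qed

text \<open>Summing over n first leaves h_r, which has period 2m in r, times the r-th term of a
  theta series; the r are then grouped by residue classes.\<close>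

lemma jphi_decomp:
  assumes t: "Im \<tau> > 0"
  shows "jphi c \<tau> z = (\<Sum>r\<in>res m. hcomp m c r \<tau> * theta m r \<tau> z)"
proof -
  have "((\<lambda>r. \<Sum>\<^sub>\<infinity>n. c n r * fexp n r \<tau> z) has_sum jphi c \<tau> z) UNIV"
    by (rule has_sum_UNIV_prod(3)[OF jphi_has_sum[OF t]])
  moreover have "(\<Sum>\<^sub>\<infinity>n. c n r * fexp n r \<tau> z) =
      hcomp m c (r mod (2 * int m)) \<tau> * (kexp m r \<tau> * e2pi (of_int r * z))" for r
    unfolding hcomp_mod unfolding hcomp_def infsum_cmult_left' [symmetric]
  proof (rule infsum_cong)
    fix n :: int
    have "of_int n * \<tau> + of_int r * z = (of_int n * \<tau> - disc m r * \<tau>) + (\<tau> * of_int r ^ 2 / (4 * of_nat m) + of_int r * z)"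
      by simp
    thus "c n r * fexp n r \<tau> z = c n r * hexp m n r \<tau> * (kexp m r \<tau> * e2pi (of_int r * z))" by (simp only: e2pi_add mult.assoc)
  qed
  ultimately have "((\<lambda>r. hcomp m c (r mod (2 * int m)) \<tau> * (kexp m r \<tau> * e2pi (of_int r * z))) has_sum jphi c \<tau> z) UNIV"
    by simp
  moreover have "((\<lambda>r. hcomp m c (r mod (2 * int m)) \<tau> * (kexp m r \<tau> * e2pi (of_int r * z))) has_sum (\<Sum>r\<in>res m. hcomp m c r \<tau> * theta m r \<tau> z)) UNIV"
    by (rule has_sum_residue_sum[OF m theta_has_sum[OF m t]])
  ultimately show ?thesis by (rule has_sum_unique)
qed

end

locale jacobi_form =
  fixes m :: nat and B :: int and c :: "int \<Rightarrow> int \<Rightarrow> complex"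
  assumes m: "m > 0" and form: "jform m B c"
begin

sublocale theta_expansion m c
proof
  show "c (n + r * l + int m * l ^ 2) (r + 2 * int m * l) = c n r" for n r l using form unfolding jform_def by blast
  show "(\<lambda>(n, r). c n r * fexp n r \<tau> z) summable_on UNIV" if "Im \<tau> > 0" for \<tau> z using form that unfolding jform_def by blast
qed (rule m)

lemma support: "c n r \<noteq> 0 \<Longrightarrow> r ^ 2 \<le> 4 * int m * n + B"
  using form unfolding jform_def by blast

lemma modular:
  "p * s - q * r = 1 \<Longrightarrow> Im \<tau> > 0 \<Longrightarrow>
     jact m p q r s c \<tau> z = jphi c \<tau> z"
  using form unfolding jform_def by blast

lemma jphi_inversion:
  assumes "Im \<tau> > 0"
  shows "e2pi (- of_nat m * (z ^ 2 / \<tau>)) * inverse \<tau> * jphi c (- 1 / \<tau>) (z / \<tau>) = jphi c \<tau> z"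
  using modular[of 0 0 "-1" 1 \<tau> z] assms by simp

text \<open>Minus the identity fixes \<tau>, and the odd weight contributes the sign.\<close>

lemma jphi_minus: "Im \<tau> > 0 \<Longrightarrow> jphi c \<tau> (- z) = - jphi c \<tau> z"
  using modular[of "-1" "-1" 0 0 \<tau> z] by simp (metis minus_equation_iff)

lemma odd_coeff: "c n (- r) = - c n r"
proof -
  \<comment> \<open>On the line Im \<tau> = 1 and for real z the expansion is a double Fourier
    series; the factor e(n i) comes from that line.\<close>
  have "(c n r + c n (- r)) * e2pi (of_int n * \<i>) = 0"
  proof (rule double_exp_sum_unique[of "\<lambda>n r. (c n r + c n (- r)) * e2pi (of_int n * \<i>)"])
    fix x y :: real
    define \<tau> where "\<tau> = \<i> + of_real x"
    have t: "Im \<tau> > 0" by (simp add: \<tau>_def)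
    have 2: "((\<lambda>(n, r). c n (- r) * fexp n r \<tau> (of_real y)) has_sum jphi c \<tau> (- of_real y)) UNIV"
      using jphi_has_sum[OF t, of "- of_real y"]
      by (subst has_sum_reindex_bij_witness[of _ "\<lambda>(n, r). (n, - r)" "\<lambda>(n, r). (n, - r)" UNIV "\<lambda>(n, r). c n r * fexp n r \<tau> (- of_real y)"]) auto
    have "((\<lambda>p. (case p of (n, r) \<Rightarrow> c n r * fexp n r \<tau> (of_real y)) + (case p of (n, r) \<Rightarrow> c n (- r) * fexp n r \<tau> (of_real y))) has_sum 0) UNIV"
      using has_sum_add[OF jphi_has_sum[OF t, of "of_real y"] 2] by (simp add: jphi_minus[OF t])
    moreover have "(\<lambda>p. (case p of (n, r) \<Rightarrow> c n r * fexp n r \<tau> (of_real y)) + (case p of (n, r) \<Rightarrow> c n (- r) * fexp n r \<tau> (of_real y))) =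
       (\<lambda>(n, r). (c n r + c n (- r)) * e2pi (of_int n * \<i>) * fexp n r (of_real x) (of_real y))"
      by (auto simp: fun_eq_iff \<tau>_def e2pi_add distrib_left distrib_right)
    ultimately show "((\<lambda>(n, r). (c n r + c n (- r)) * e2pi (of_int n * \<i>) * fexp n r (of_real x) (of_real y)) has_sum 0) UNIV" by simp
  qed
  hence "c n r + c n (- r) = 0" by simp
  thus ?thesis by (simp add: add_eq_0_iff)
qed

lemma hcomp_minus: "hcomp m c (- r) \<tau> = - hcomp m c r \<tau>"
  unfolding hcomp_def infsum_uminus [symmetric] by (rule infsum_cong) (simp add: odd_coeff)

text \<open>Both sides of the law for \<open>jphi\<close> are expanded in theta functions at \<tau>,
  by \<open>theta_inversion\<close>, and compared by linear independence. Values at \<tau> are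
  expressed through those at -1/\<tau>, the direction in which they pair with theta series.\<close>

lemma hcomp_inversion:
  assumes t: "Im \<tau> > 0"
  shows "hcomp m c s \<tau> = inverse \<tau> * rt (\<tau> / (2 * of_nat m)) *
     (\<Sum>r\<in>res m. weil m r s * hcomp m c r (- 1 / \<tau>))"
proof -
  let ?R = "{0..<2 * int m}"
  let ?e = "\<lambda>r s. weil m r s"
  let ?k = "inverse \<tau> * rt (\<tau> / (2 * of_nat m))"
  define g where "g = (\<lambda>s. ?k * (\<Sum>r\<in>?R. ?e r s * hcomp m c r (- 1 / \<tau>)) - hcomp m c s \<tau>)"
  have "(\<Sum>s\<in>?R. g s * theta m s \<tau> z) = 0" for z
  proof -
    have "jphi c \<tau> z = e2pi (- of_nat m * (z ^ 2 / \<tau>)) * inverse \<tau> * (\<Sum>r\<in>?R. hcomp m c r (- 1 / \<tau>) * theta m r (- 1 / \<tau>) (z / \<tau>))"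
      using jphi_inversion[OF t, of z] unfolding jphi_decomp[OF uhp_neg_inverse[OF t]] by simp
    also have "\<dots> = (e2pi (- of_nat m * (z ^ 2 / \<tau>)) * e2pi (of_nat m * z\<^sup>2 / \<tau>)) * ?k * (\<Sum>r\<in>?R. \<Sum>s\<in>?R. hcomp m c r (- 1 / \<tau>) * ?e r s * theta m s \<tau> z)"
      unfolding theta_inversion[OF m t] by (simp add: sum_distrib_left sum_distrib_right mult_ac)
    also have "e2pi (- of_nat m * (z ^ 2 / \<tau>)) * e2pi (of_nat m * z\<^sup>2 / \<tau>) = 1" unfolding e2pi_add [symmetric] by simp
    also have "(\<Sum>r\<in>?R. \<Sum>s\<in>?R. hcomp m c r (- 1 / \<tau>) * ?e r s * theta m s \<tau> z) = (\<Sum>s\<in>?R. \<Sum>r\<in>?R. hcomp m c r (- 1 / \<tau>) * ?e r s * theta m s \<tau> z)"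
      by (rule sum.swap)
    finally have "(\<Sum>s\<in>?R. hcomp m c s \<tau> * theta m s \<tau> z) = ?k * (\<Sum>s\<in>?R. \<Sum>r\<in>?R. hcomp m c r (- 1 / \<tau>) * ?e r s * theta m s \<tau> z)"
      unfolding jphi_decomp[OF t] by simp
    thus ?thesis unfolding g_def left_diff_distrib sum_subtractf by (simp add: sum_distrib_left sum_distrib_right mult_ac)
  qed
  hence g0: "g s = 0" if "s \<in> ?R" for s using theta_independent[OF m t _ that] by blast
  have "g (s mod (2 * int m)) = 0" by (rule g0) (use m in auto)
  moreover have "?e r (s mod (2 * int m)) = ?e r s" for r
    using e2pi_mult_cong[OF _ m, of s "s mod (2 * int m)" r] by (simp add: minus_mod_eq_mult_div)
  ultimately show ?thesis by (simp add: g_def hcomp_mod)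
qed

end

section \<open>A recursion for the coefficients\<close>

lemma csqrt_divide_of_real:
  assumes "k > 0" shows "csqrt (z / of_real k) = csqrt z / of_real (sqrt k)"
proof (rule csqrt_unique)
  have "(of_real (sqrt k) :: complex) ^ 2 = of_real k" using assms by (simp flip: of_real_power)
  thus "(csqrt z / of_real (sqrt k))\<^sup>2 = z / of_real k" by (simp add: power_divide)
  show "0 < Re (csqrt z / of_real (sqrt k)) \<or> Re (csqrt z / of_real (sqrt k)) = 0 \<and> 0 \<le> Im (csqrt z / of_real (sqrt k))"
    using csqrt_principal[of z] assms by (auto simp: Re_divide_of_real Im_divide_of_real zero_less_divide_iff zero_le_divide_iff)
qed

text \<open>The factors of weight 3/2 of \<open>unary\<close> and \<open>eta3\<close> cancel up to a
  constant, so the quotients form a vector of weight 0.\<close>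

lemma rt_ratio:
  assumes "Im \<tau> > 0" "m > 0"
  shows "\<tau> * rt (\<tau> / (2 * of_nat m)) / rt \<tau> ^ 3 = \<i> / of_real (sqrt (2 * real m))"
proof -
  have nz: "\<tau> \<noteq> 0" using uhp_nz[OF assms(1)] .
  have "rt (\<tau> / (2 * of_nat m)) = csqrt ((- \<i> * \<tau>) / of_real (2 * real m))" by (simp add: rt_def)
  also have "\<dots> = rt \<tau> / of_real (sqrt (2 * real m))" using assms(2) by (subst csqrt_divide_of_real) (simp_all add: rt_def)
  finally have e: "rt (\<tau> / (2 * of_nat m)) = rt \<tau> / of_real (sqrt (2 * real m))" .
  have p: "rt \<tau> ^ 3 = rt \<tau> * (- \<i> * \<tau>)" unfolding rt_squared [symmetric] by (simp only: power3_eq_cube power2_eq_square mult.assoc)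
  have "x * (R / S) / (R * (k * x)) = (1 / k) / S" if "x \<noteq> 0" "R \<noteq> 0" for x R S k :: complex using that by simp
  from this[OF nz rt_nz[OF nz], of _ "- \<i>"] show ?thesis unfolding e p by simp
qed

text \<open>One step combines two operations that preserve weight 0 and have leading term q^(-1).
  The constant is the leading exponent of component s after the previous steps, so the leading term
  of that component is annihilated, and those of the others change by a factor.\<close>

fun Rop :: "nat \<Rightarrow> int list \<Rightarrow> int \<Rightarrow> complex \<Rightarrow> complex" where
  "Rop m [] r \<tau> = unary m r \<tau> * inverse (eta3 \<tau>)"
| "Rop m (s # L) r \<tau> = wfun \<tau> * (deriv (Rop m L r) \<tau> / tpi) -
     (disc m s - 1 / 8 - of_nat (length L)) * (jfun \<tau> * Rop m L r \<tau>)"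

text \<open>Inverting all numbers up to \<open>8 m\<close> makes the coefficients below units.\<close>

abbreviation NN :: "nat \<Rightarrow> nat" where "NN m \<equiv> fact (8 * m)"

lemma NN_inverse:
  assumes "j \<noteq> 0" "\<bar>j\<bar> \<le> 8 * int m" shows "(inverse (of_int j) :: complex) \<in> zloc (NN m)"
proof (rule zloc_inverse)
  have "nat \<bar>j\<bar> dvd NN m" using assms by (intro dvd_fact) auto
  hence "\<bar>j\<bar> dvd int (NN m)" by (simp add: nat_dvd_iff flip: int_dvd_int_iff)
  thus "j dvd int (NN m) ^ 1" by simp
qed simp

context
  fixes m :: nat
  assumes m: "m > 0"
begin

lemma NN_half: "1 / 2 \<in> (zloc (NN m) :: complex set)" and NN_8m: "1 / (8 * of_nat m) \<in> (zloc (NN m) :: complex set)"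
  using NN_inverse[of 2 m] NN_inverse[of "8 * int m" m] m by (simp_all add: inverse_eq_divide)

text \<open>A step lowers the exponent by 8m and multiplies the leading coefficient by the
  difference of the leading exponents of components r and s, which is (r^2 - s^2)/4m.\<close>

lemma qx_Rop:
  assumes r: "\<bar>r\<bar> < int m"
  shows "qx m (zloc (NN m)) (2 * r ^ 2 - int m - 8 * int m * int (length L))
     (of_int r * prod_list (map (\<lambda>s. (of_int r ^ 2 - of_int s ^ 2) / (4 * of_nat m)) L)) (Rop m L r)"
proof (induction L)
  case Nil
  have "qx m (zloc (NN m)) (2 * r ^ 2 + - int m) (of_int r * 1) (\<lambda>\<tau>. unary m r \<tau> * inverse (eta3 \<tau>))"
    by (intro qx_mult[OF m] qx_unary[OF m r] qx_eta3_inverse[OF m NN_half NN_8m])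
  moreover have "Rop m [] r = (\<lambda>\<tau>. unary m r \<tau> * inverse (eta3 \<tau>))" by (rule ext) simp
  ultimately show ?case by simp
next
  case (Cons s L)
  let ?e = "2 * r ^ 2 - int m - 8 * int m * int (length L)"
  let ?l = "of_int r * prod_list (map (\<lambda>s. (of_int r ^ 2 - of_int s ^ 2) / (4 * of_nat m)) L) :: complex"
  let ?k = "disc m s - 1 / 8 - of_nat (length L) :: complex"
  have k: "?k \<in> zloc (NN m)"
  proof -
    have "?k = 2 * of_int (s ^ 2) * (1 / (8 * of_nat m)) - 1 / 2 * (1 / 2) * (1 / 2) - of_nat (length L)" using m by (simp add: field_simps)
    also have "\<dots> \<in> zloc (NN m)" by (intro zloc_diff zloc_mult NN_half NN_8m zloc_of_int zloc_of_nat zloc_numeral)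
    finally show ?thesis .
  qed
  have 1: "qx m (zloc (NN m)) (- (8 * int m) + ?e) (1 * (of_int ?e / (8 * of_nat m) * ?l)) (\<lambda>\<tau>. wfun \<tau> * (deriv (Rop m L r) \<tau> / tpi))"
    by (intro qx_mult[OF m] qx_wfun[OF m NN_half NN_8m] qx_deriv[OF m Cons NN_8m])
  have 2: "qx m (zloc (NN m)) (- (8 * int m) + ?e) (?k * (1 * ?l)) (\<lambda>\<tau>. ?k * (jfun \<tau> * Rop m L r \<tau>))"
    by (intro qx_cmult[OF m k] qx_mult[OF m] qx_jfun[OF m NN_half NN_8m] Cons)
  have 3: "Rop m (s # L) r = (\<lambda>\<tau>. wfun \<tau> * (deriv (Rop m L r) \<tau> / tpi) - ?k * (jfun \<tau> * Rop m L r \<tau>))"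
    by (rule ext) simp
  have e: "- (8 * int m) + ?e = 2 * r ^ 2 - int m - 8 * int m * int (length (s # L))" by (simp add: algebra_simps)
  have "of_int ?e / (8 * of_nat m) - ?k = (of_int r ^ 2 - of_int s ^ 2) / (4 * of_nat m)" using m by (simp add: field_simps)
  moreover have "A - k = X \<Longrightarrow> 1 * (A * (a * P)) - k * (1 * (a * P)) = a * (X * P)" for A k X a P :: complex
    by (auto simp: algebra_simps)
  ultimately have l: "1 * (of_int ?e / (8 * of_nat m) * ?l) - ?k * (1 * ?l) = of_int r * prod_list (map (\<lambda>s. (of_int r ^ 2 - of_int s ^ 2) / (4 * of_nat m)) (s # L))"
    unfolding list.map prod_list.Cons by blast
  show ?case using qx_diff[OF m 1 2] unfolding e l 3 .
qed

lemma unary_middle: "unary m (int m) \<tau> = 0"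
proof -
  have e: "- int m + 2 * int m * 1 = int m" by simp
  have "unary m (int m) \<tau> = - unary m (int m) \<tau>" using unary_cong[OF m, of "- int m" 1 \<tau>] unfolding e unary_minus[OF m] .
  thus ?thesis by simp
qed

lemma unary_holomorphic: "unary m r holomorphic_on upper_half_plane"
proof -
  \<comment> \<open>The representative of r between -m + 1 and m. The end point m is outside the
    range of \<open>qx_unary\<close> and is treated by \<open>unary_middle\<close>.\<close>
  define r' where "r' = (r + int m - 1) mod (2 * int m) - int m + 1"
  have "(r + int m - 1) mod (2 * int m) = (r + int m - 1) - 2 * int m * ((r + int m - 1) div (2 * int m))" by (simp add: minus_mult_div_eq_mod)
  hence "r = r' + 2 * int m * ((r + int m - 1) div (2 * int m))" by (simp add: r'_def)
  hence eq: "unary m r = unary m r'" using unary_cong[OF m] by (metis ext)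
  have "0 \<le> (r + int m - 1) mod (2 * int m)" "(r + int m - 1) mod (2 * int m) < 2 * int m" using m by simp_all
  hence "\<bar>r'\<bar> < int m \<or> r' = int m" unfolding r'_def by linarith
  thus ?thesis
  proof
    assume "\<bar>r'\<bar> < int m"
    thus ?thesis unfolding eq by (rule qx_holomorphic[OF m qx_unary[OF m]])
  next
    assume "r' = int m"
    hence "unary m r' = (\<lambda>_. 0)" using unary_middle by (simp add: fun_eq_iff)
    thus ?thesis unfolding eq by simp
  qed
qed

lemma wfun_holomorphic: "wfun holomorphic_on upper_half_plane"
  and jfun_holomorphic: "jfun holomorphic_on upper_half_plane"
  and eta3_inverse_holomorphic: "(\<lambda>\<tau>. inverse (eta3 \<tau>)) holomorphic_on upper_half_plane"
  by (rule qx_holomorphic[OF m qx_wfun[OF m NN_half NN_8m]] qx_holomorphic[OF m qx_jfun[OF m NN_half NN_8m]]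
       qx_holomorphic[OF m qx_eta3_inverse[OF m NN_half NN_8m]])+

lemma Rop_holomorphic: "Rop m L r holomorphic_on upper_half_plane"
proof (induction L)
  case Nil
  have "Rop m [] r = (\<lambda>\<tau>. unary m r \<tau> * inverse (eta3 \<tau>))" by (rule ext) simp
  thus ?case using holomorphic_on_mult[OF unary_holomorphic eta3_inverse_holomorphic] by simp
next
  case (Cons s L)
  have "Rop m (s # L) r = (\<lambda>\<tau>. wfun \<tau> * (deriv (Rop m L r) \<tau> / tpi) -
     (disc m s - 1 / 8 - of_nat (length L)) * (jfun \<tau> * Rop m L r \<tau>))" by (rule ext) simp
  moreover have "\<dots> holomorphic_on upper_half_plane"
    by (intro holomorphic_intros wfun_holomorphic jfun_holomorphic Cons holomorphic_deriv open_upper_half_plane) auto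
  ultimately show ?case by simp
qed

lemma Rop_DERIV: "Im \<tau> > 0 \<Longrightarrow> (Rop m L r has_field_derivative deriv (Rop m L r) \<tau>) (at \<tau>)"
  by (rule holomorphic_derivI[OF Rop_holomorphic open_upper_half_plane]) simp

lemma Rop_tau_add_1:
  "Im \<tau> > 0 \<Longrightarrow> Rop m L r (\<tau> + 1) = (e2pi (disc m r) / e2pi (1 / 8)) * Rop m L r \<tau>"
proof (induction L arbitrary: \<tau>)
  case Nil
  show ?case unfolding Rop.simps unary_tau_add_1[OF m] eta3_add_1 inverse_mult_distrib divide_inverse by (simp only: mult_ac)
next
  case (Cons s L)
  let ?k = "e2pi (disc m r) / e2pi (1 / 8)"
  have "((\<lambda>\<tau>. Rop m L r (\<tau> + 1)) has_field_derivative deriv (Rop m L r) (\<tau> + 1)) (at \<tau>)"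
    using Rop_DERIV[of "\<tau> + 1" L r] Cons.prems by (simp add: DERIV_shift)
  moreover have "((\<lambda>\<tau>. Rop m L r (\<tau> + 1)) has_field_derivative ?k * deriv (Rop m L r) \<tau>) (at \<tau>)"
    by (rule has_field_derivative_transform_within_open[OF DERIV_cmult[OF Rop_DERIV[OF Cons.prems]] open_upper_half_plane])
       (use Cons in simp_all)
  ultimately have d: "deriv (Rop m L r) (\<tau> + 1) = ?k * deriv (Rop m L r) \<tau>" by (rule DERIV_unique)
  have "w * (K * D / p) - k * (j * (K * R)) = K * (w * (D / p) - k * (j * R))" for w K D p k j R :: complex by (simp add: right_diff_distrib mult_ac)
  thus ?case unfolding Rop.simps d Cons.IH[OF Cons.prems] wfun_add_1 jfun_add_1 .
qed

text \<open>The factor \<tau>^2 from differentiation at -1/\<tau> is cancelled by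
  \<open>wfun\<close>, of weight -2, and the coefficients of a step do not depend on the
  component.\<close>

lemma Rop_inversion:
  "Im \<tau> > 0 \<Longrightarrow> Rop m L r (- 1 / \<tau>) = \<i> / of_real (sqrt (2 * real m)) *
     (\<Sum>s\<in>res m. weil m r s * Rop m L s \<tau>)"
proof (induction L arbitrary: \<tau>)
  case Nil
  let ?S = "\<Sum>s\<in>res m. weil m r s * unary m s \<tau>"
  have "Rop m [] r (- 1 / \<tau>) = (\<tau> * rt (\<tau> / (2 * of_nat m)) / rt \<tau> ^ 3) * (?S * inverse (eta3 \<tau>))"
  proof -
    have "t * R * S * inverse (q * e) = (t * R / q) * (S * inverse e)" for t R S q e :: complex by (simp add: divide_inverse mult_ac)
    thus ?thesis unfolding Rop.simps unary_inversion[OF m Nil] eta3_inversion[OF Nil] .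
  qed
  also have "?S * inverse (eta3 \<tau>) = (\<Sum>s\<in>res m. weil m r s * Rop m [] s \<tau>)"
    unfolding sum_distrib_right Rop.simps by (simp only: mult.assoc)
  finally show ?case unfolding rt_ratio[OF Nil m] .
next
  case (Cons s' L)
  let ?e = "\<lambda>s. weil m r s"
  let ?R = "{0..<2 * int m}"
  let ?c = "\<i> / of_real (sqrt (2 * real m)) :: complex"
  let ?k = "disc m s' - 1 / 8 - of_nat (length L) :: complex"
  have nz: "\<tau> \<noteq> 0" using Cons.prems by auto
  have "((\<lambda>\<tau>. - 1 / \<tau>) has_field_derivative 1 / \<tau>\<^sup>2) (at \<tau>)"
    using nz by (auto intro!: derivative_eq_intros simp: power2_eq_square)
  from DERIV_chain2[OF Rop_DERIV[OF uhp_neg_inverse[OF Cons.prems]] this]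
  have "((\<lambda>\<tau>. Rop m L r (- 1 / \<tau>)) has_field_derivative deriv (Rop m L r) (- 1 / \<tau>) * (1 / \<tau>\<^sup>2)) (at \<tau>)" .
  moreover have "((\<lambda>\<tau>. Rop m L r (- 1 / \<tau>)) has_field_derivative ?c * (\<Sum>s\<in>?R. ?e s * deriv (Rop m L s) \<tau>)) (at \<tau>)"
  proof (rule has_field_derivative_transform_within_open[of "\<lambda>\<tau>. ?c * (\<Sum>s\<in>?R. ?e s * Rop m L s \<tau>)" _ _ upper_half_plane])
    show "((\<lambda>\<tau>. ?c * (\<Sum>s\<in>?R. ?e s * Rop m L s \<tau>)) has_field_derivative ?c * (\<Sum>s\<in>?R. ?e s * deriv (Rop m L s) \<tau>)) (at \<tau>)"
      by (intro DERIV_cmult DERIV_sum Rop_DERIV Cons.prems)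
    fix w assume "w \<in> upper_half_plane"
    hence "Im w > 0" by simp
    thus "?c * (\<Sum>s\<in>?R. ?e s * Rop m L s w) = Rop m L r (- 1 / w)" by (rule Cons.IH [symmetric])
  qed (use Cons.prems in simp_all)
  ultimately have "deriv (Rop m L r) (- 1 / \<tau>) * (1 / \<tau>\<^sup>2) = ?c * (\<Sum>s\<in>?R. ?e s * deriv (Rop m L s) \<tau>)" by (rule DERIV_unique)
  hence d: "deriv (Rop m L r) (- 1 / \<tau>) = \<tau>\<^sup>2 * (?c * (\<Sum>s\<in>?R. ?e s * deriv (Rop m L s) \<tau>))"
    using nz by (simp add: field_simps)
  have "Rop m (s' # L) r (- 1 / \<tau>) = wfun \<tau> / \<tau>\<^sup>2 * (\<tau>\<^sup>2 * (?c * (\<Sum>s\<in>?R. ?e s * deriv (Rop m L s) \<tau>)) / tpi) -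
      ?k * (jfun \<tau> * (?c * (\<Sum>s\<in>?R. ?e s * Rop m L s \<tau>)))"
    unfolding Rop.simps d wfun_inversion[OF Cons.prems] jfun_inversion[OF Cons.prems] Cons.IH[OF Cons.prems] by (rule refl)
  also have "wfun \<tau> / \<tau>\<^sup>2 * (\<tau>\<^sup>2 * (?c * (\<Sum>s\<in>?R. ?e s * deriv (Rop m L s) \<tau>)) / tpi) =
     ?c * (\<Sum>s\<in>?R. ?e s * (wfun \<tau> * (deriv (Rop m L s) \<tau> / tpi)))"
  proof -
    have "w / t * (t * (x * S) / p) = x * (w / p * S)" if "t \<noteq> 0" for w t x S p :: complex using that by simp
    hence "wfun \<tau> / \<tau>\<^sup>2 * (\<tau>\<^sup>2 * (?c * (\<Sum>s\<in>?R. ?e s * deriv (Rop m L s) \<tau>)) / tpi) =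
      ?c * (wfun \<tau> / tpi * (\<Sum>s\<in>?R. ?e s * deriv (Rop m L s) \<tau>))" using power_not_zero[OF nz, of 2] by blast
    also have "wfun \<tau> / tpi * (\<Sum>s\<in>?R. ?e s * deriv (Rop m L s) \<tau>) = (\<Sum>s\<in>?R. ?e s * (wfun \<tau> * (deriv (Rop m L s) \<tau> / tpi)))"
      unfolding sum_distrib_left by (rule sum.cong) (simp_all add: mult_ac)
    finally show ?thesis .
  qed
  also have "?k * (jfun \<tau> * (?c * (\<Sum>s\<in>?R. ?e s * Rop m L s \<tau>))) = ?c * (\<Sum>s\<in>?R. ?e s * (?k * (jfun \<tau> * Rop m L s \<tau>)))"
  proof -
    have "?c * (\<Sum>s\<in>?R. ?e s * (?k * (jfun \<tau> * Rop m L s \<tau>))) = ?c * (?k * jfun \<tau> * (\<Sum>s\<in>?R. ?e s * Rop m L s \<tau>))"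
      unfolding sum_distrib_left by (rule sum.cong) (simp_all only: mult_ac)
    thus ?thesis by (simp only: mult_ac)
  qed
  finally show ?case unfolding Rop.simps right_diff_distrib sum_subtractf .
qed

lemma Rop_cong: "Rop m L (r + 2 * int m * l) = Rop m L r"
proof (induction L)
  case Nil
  show ?case by (rule ext) (simp add: unary_cong[OF m])
next
  case (Cons s L)
  show ?case by (rule ext) (simp only: Rop.simps Cons)
qed

lemma Rop_minus: "Im \<tau> > 0 \<Longrightarrow> Rop m L (- r) \<tau> = - Rop m L r \<tau>"
proof (induction L arbitrary: \<tau>)
  case Nil
  show ?case by (simp add: unary_minus[OF m])
next
  case (Cons s L)
  have "(Rop m L (- r) has_field_derivative - deriv (Rop m L r) \<tau>) (at \<tau>)"
    by (rule has_field_derivative_transform_within_open[OF DERIV_minus[OF Rop_DERIV[OF Cons.prems]] open_upper_half_plane])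
       (use Cons in simp_all)
  hence d: "deriv (Rop m L (- r)) \<tau> = - deriv (Rop m L r) \<tau>" by (rule DERIV_imp_deriv)
  show ?case unfolding Rop.simps d Cons.IH[OF Cons.prems] by simp
qed

end

text \<open>Pairs r with 2m - r. Afterwards only 0 < r < m remain, where the leading terms of
  \<open>unary\<close> are known.\<close>

lemma sum_symmetric_residues:
  fixes P :: "int \<Rightarrow> complex"
  assumes m: "m > 0" and per: "\<And>r. P (r + 2 * int m) = P r" and even: "\<And>r. P (- r) = P r"
    and zero: "P 0 = 0" "P (int m) = 0"
  shows "(\<Sum>r\<in>res m. P r) = 2 * (\<Sum>r\<in>{1..<int m}. P r)"
proof -
  have "{0..<2 * int m} = insert 0 (insert (int m) ({1..<int m} \<union> {int m + 1..<2 * int m}))" using m by auto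
  hence "(\<Sum>r\<in>res m. P r) = (\<Sum>r\<in>{1..<int m} \<union> {int m + 1..<2 * int m}. P r)" using m by (simp add: zero)
  also have "\<dots> = (\<Sum>r\<in>{1..<int m}. P r) + (\<Sum>r\<in>{int m + 1..<2 * int m}. P r)" by (rule sum.union_disjoint) auto
  also have "(\<Sum>r\<in>{int m + 1..<2 * int m}. P r) = (\<Sum>r\<in>{1..<int m}. P r)"
  proof (rule sum.reindex_bij_witness[of _ "\<lambda>r. 2 * int m - r" "\<lambda>r. 2 * int m - r"])
    fix r show "P (2 * int m - r) = P r" using per[of "- r"] even[of r] by (simp add: add.commute)
  qed auto
  finally show ?thesis by simp
qed

context jacobi_form
begin

lemma hcomp_zero: "hcomp m c 0 \<tau> = 0" "hcomp m c (int m) \<tau> = 0"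
proof -
  show "hcomp m c 0 \<tau> = 0" using hcomp_minus[of 0 \<tau>] by simp
  have e: "- int m + 2 * int m * 1 = int m" by simp
  have "hcomp m c (int m) \<tau> = - hcomp m c (int m) \<tau>" using hcomp_cong[of "- int m" 1 \<tau>] unfolding e hcomp_minus .
  thus "hcomp m c (int m) \<tau> = 0" by simp
qed

text \<open>\<open>hcomp_inversion\<close> goes from -1/\<tau> to \<tau> and the law of
  \<open>G\<close> the other way, so after an exchange of sums the same matrix rebuilds
  \<open>G\<close> at -1/\<tau>, and two factors 1/\<tau> are left.\<close>

lemma pairing_inversion:
  assumes t: "Im \<tau> > 0"
    and G: "\<And>r. G r (- 1 / \<tau>) = \<tau> * rt (\<tau> / (2 * of_nat m)) * (\<Sum>s\<in>res m. weil m r s * G s \<tau>)"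
  shows "(\<Sum>r\<in>res m. hcomp m c r (- 1 / \<tau>) * G r (- 1 / \<tau>)) = \<tau>\<^sup>2 * (\<Sum>s\<in>res m. hcomp m c s \<tau> * G s \<tau>)"
proof -
  let ?R = "{0..<2 * int m}"
  let ?e = "\<lambda>r s. weil m r s"
  let ?k = "rt (\<tau> / (2 * of_nat m))"
  have nz: "\<tau> \<noteq> 0" using t by auto
  have "(\<Sum>s\<in>?R. hcomp m c s \<tau> * G s \<tau>) = (\<Sum>s\<in>?R. \<Sum>r\<in>?R. inverse \<tau> * ?k * (hcomp m c r (- 1 / \<tau>) * (?e r s * G s \<tau>)))"
  proof (rule sum.cong[OF refl])
    fix s
    show "hcomp m c s \<tau> * G s \<tau> = (\<Sum>r\<in>?R. inverse \<tau> * ?k * (hcomp m c r (- 1 / \<tau>) * (?e r s * G s \<tau>)))"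
      unfolding hcomp_inversion[OF t, of s] sum_distrib_left sum_distrib_right by (rule sum.cong) (simp_all only: mult_ac)
  qed
  also have "\<dots> = (\<Sum>r\<in>?R. \<Sum>s\<in>?R. inverse \<tau> * ?k * (hcomp m c r (- 1 / \<tau>) * (?e r s * G s \<tau>)))" by (rule sum.swap)
  also have "\<dots> = (\<Sum>r\<in>?R. inverse \<tau> * inverse \<tau> * (hcomp m c r (- 1 / \<tau>) * G r (- 1 / \<tau>)))"
  proof (rule sum.cong[OF refl])
    fix r
    have "(\<Sum>s\<in>?R. inverse \<tau> * ?k * (hcomp m c r (- 1 / \<tau>) * (?e r s * G s \<tau>))) = inverse \<tau> * ?k * (hcomp m c r (- 1 / \<tau>) * (\<Sum>s\<in>?R. ?e r s * G s \<tau>))"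
      by (simp only: sum_distrib_left)
    also have "\<dots> = inverse \<tau> * inverse \<tau> * (hcomp m c r (- 1 / \<tau>) * (\<tau> * ?k * (\<Sum>s\<in>?R. ?e r s * G s \<tau>)))"
      using nz by simp
    finally show "(\<Sum>s\<in>?R. inverse \<tau> * ?k * (hcomp m c r (- 1 / \<tau>) * (?e r s * G s \<tau>))) = inverse \<tau> * inverse \<tau> * (hcomp m c r (- 1 / \<tau>) * G r (- 1 / \<tau>))"
      unfolding G .
  qed
  also have "\<dots> = inverse \<tau> * inverse \<tau> * (\<Sum>r\<in>?R. hcomp m c r (- 1 / \<tau>) * G r (- 1 / \<tau>))"
    by (simp only: sum_distrib_left)
  finally have "(\<Sum>s\<in>?R. hcomp m c s \<tau> * G s \<tau>) = inverse \<tau> * inverse \<tau> * (\<Sum>r\<in>?R. hcomp m c r (- 1 / \<tau>) * G r (- 1 / \<tau>))" .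
  moreover have "X = inverse t * inverse t * Y \<Longrightarrow> t \<noteq> 0 \<Longrightarrow> Y = t\<^sup>2 * X" for X Y t :: complex
    by (simp add: field_simps power2_eq_square)
  ultimately show ?thesis using nz by blast
qed

text \<open>For B \<le> 1 the support lies in n \<ge> 0. The shift M is left free: it can be 2 r^2
  for a single component, or common to all of them.\<close>

lemma hcomp_fps:
  fixes M :: int
  assumes "B \<le> 1" and M: "2 * r ^ 2 \<le> M"
  defines "h \<equiv> Abs_fps (\<lambda>i. \<Sum>n\<in>{n\<in>{0..}. nat (8 * int m * n + (M - 2 * r ^ 2)) = i}. c n r)"
  shows "fps_conv_radius h \<ge> 1"
    and "Im \<tau> > 0 \<Longrightarrow> hcomp m c r \<tau> = qpow m (- M) \<tau> * eval_fps h (qpow m 1 \<tau>)"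
proof -
  have fin: "finite {n\<in>{0..}. nat (8 * int m * n + (M - 2 * r ^ 2)) = i}" for i
  proof (rule finite_subset)
    show "{n\<in>{0..}. nat (8 * int m * n + (M - 2 * r ^ 2)) = i} \<subseteq> {0..int i}"
    proof
      fix n assume "n \<in> {n\<in>{0..}. nat (8 * int m * n + (M - 2 * r ^ 2)) = i}"
      hence n: "n \<ge> 0" "nat (8 * int m * n + (M - 2 * r ^ 2)) = i" by auto
      have "8 * int m * n + (M - 2 * r ^ 2) \<le> int (nat (8 * int m * n + (M - 2 * r ^ 2)))" by simp
      moreover have "1 * n \<le> 8 * int m * n" using m n(1) by (intro mult_right_mono) auto
      ultimately show "n \<in> {0..int i}" using M n unfolding atLeastAtMost_iff by linarith
    qed
  qed simp
  have sum: "((\<lambda>n. c n r * qpow m (- M + int (nat (8 * int m * n + (M - 2 * r ^ 2)))) \<tau>) has_sum hcomp m c r \<tau>) {0..}" if t: "Im \<tau> > 0" for \<tau>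
  proof -
    have z: "c n r = 0" if "n < 0" for n
    proof (rule ccontr)
      assume "c n r \<noteq> 0"
      from support[OF this] have "0 \<le> 4 * int m * n + B" by (meson order_trans zero_le_power2)
      moreover have "4 * int m * n \<le> 4 * int m * (-1)" using that m by (intro mult_left_mono) auto
      ultimately show False using assms(1) m by simp
    qed
    have e: "c n r * qpow m (- M + int (nat (8 * int m * n + (M - 2 * r ^ 2)))) \<tau> = c n r * hexp m n r \<tau>" if "n \<ge> 0" for n
    proof -
      have "0 \<le> 8 * int m * n" using that by simp
      hence e1: "int (nat (8 * int m * n + (M - 2 * r ^ 2))) = 8 * int m * n + (M - 2 * r ^ 2)" using M by simp
      have "of_int (- M + (8 * int m * n + (M - 2 * r ^ 2))) * \<tau> / (8 * of_nat m) = of_int n * \<tau> - disc m r * \<tau>"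
        using m by (simp add: field_simps)
      thus ?thesis unfolding qpow_def[OF m] e1 by simp
    qed
    show ?thesis by (rule iffD2[OF has_sum_cong_neutral hcomp_has_sum[OF t]]) (use z e in auto)
  qed
  show "fps_conv_radius h \<ge> 1" unfolding h_def by (rule exponent_sum_fps(1)[OF m fin sum])
  show "hcomp m c r \<tau> = qpow m (- M) \<tau> * eval_fps h (qpow m 1 \<tau>)" if "Im \<tau> > 0"
    unfolding h_def by (rule exponent_sum_fps(2)[OF m fin sum that])
qed

end

text \<open>The leading coefficient in \<open>qx_Rop\<close>. It vanishes for r in \<open>L\<close>,
  and for the remaining r it will be a unit of Z[1/N].\<close>

definition poly_units :: "nat \<Rightarrow> int \<Rightarrow> int list \<Rightarrow> complex" where
  "poly_units m r L = of_int r * prod_list (map (\<lambda>s. (of_int r ^ 2 - of_int s ^ 2) / (4 * of_nat m)) L)"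

lemma zloc_inverse_prod_list:
  fixes q :: "'b \<Rightarrow> complex"
  assumes "\<And>s. s \<in> set L \<Longrightarrow> inverse (q s) \<in> zloc N \<and> q s \<noteq> 0"
  shows "inverse (prod_list (map q L)) \<in> zloc N \<and> prod_list (map q L) \<noteq> 0"
  using assms by (induction L) (auto intro: zloc_mult)

text \<open>The factors r, r - s and r + s are nonzero and smaller than 2m in absolute value, so
  they divide the factorial \<open>NN m\<close>.\<close>

lemma poly_units_inverse:
  assumes m: "m > 0" and r: "r \<in> {1..<int m}" and L: "set L \<subseteq> {1..<int m} - {r}"
  shows "inverse (poly_units m r L) \<in> zloc (NN m)" "poly_units m r L \<noteq> 0"
proof -
  have f: "inverse ((of_int r ^ 2 - of_int s ^ 2) / (4 * of_nat m)) \<in> (zloc (NN m) :: complex set) \<and> (of_int r ^ 2 - of_int s ^ 2) / (4 * of_nat m) \<noteq> (0 :: complex)" if "s \<in> set L" for s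
  proof -
    have s: "s \<in> {1..<int m}" "s \<noteq> r" using that L by auto
    have e: "(of_int r ^ 2 - of_int s ^ 2) / (4 * of_nat m) = of_int (r - s) * of_int (r + s) / (4 * of_nat m :: complex)"
      by (simp add: power2_eq_square algebra_simps)
    have "inverse ((of_int r ^ 2 - of_int s ^ 2) / (4 * of_nat m)) = 4 * of_nat m * inverse (of_int (r - s)) * (inverse (of_int (r + s)) :: complex)"
    proof -
      have "inverse (x * y / k) = k * inverse x * inverse y" for x y k :: complex by (simp add: divide_inverse mult_ac)
      thus ?thesis unfolding e .
    qed
    moreover have "inverse (of_int (r - s)) \<in> (zloc (NN m) :: complex set)" "inverse (of_int (r + s)) \<in> (zloc (NN m) :: complex set)"
      using r s by (intro NN_inverse; auto)+
    ultimately have "inverse ((of_int r ^ 2 - of_int s ^ 2) / (4 * of_nat m)) \<in> (zloc (NN m) :: complex set)"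
      by (simp only:) (intro zloc_mult zloc_of_nat zloc_numeral)
    moreover have "of_int (r - s) \<noteq> (0 :: complex)" "of_int (r + s) \<noteq> (0 :: complex)" using r s unfolding of_int_eq_0_iff by auto
    hence "(of_int r ^ 2 - of_int s ^ 2) / (4 * of_nat m) \<noteq> (0 :: complex)" unfolding e using m by simp
    ultimately show ?thesis by blast
  qed
  have "inverse (prod_list (map (\<lambda>s. (of_int r ^ 2 - of_int s ^ 2) / (4 * of_nat m)) L)) \<in> (zloc (NN m) :: complex set) \<and> prod_list (map (\<lambda>s. (of_int r ^ 2 - of_int s ^ 2) / (4 * of_nat m)) L) \<noteq> (0 :: complex)"
    using f by (rule zloc_inverse_prod_list)
  moreover have "inverse (of_int r) \<in> (zloc (NN m) :: complex set)" using r by (intro NN_inverse) auto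
  moreover have "of_int r \<noteq> (0 :: complex)" using r by simp
  ultimately show "inverse (poly_units m r L) \<in> zloc (NN m)" "poly_units m r L \<noteq> 0"
    unfolding poly_units_def inverse_mult_distrib mult_eq_0_iff de_Morgan_disj by (blast intro: zloc_mult)+
qed

lemma poly_units_zero: "r \<in> set L \<Longrightarrow> poly_units m r L = 0"
  unfolding poly_units_def by (auto simp: prod_list_zero_iff)

lemma eval_fps_sum_mult:
  fixes h g :: "'i \<Rightarrow> complex fps" and m :: nat
  assumes m: "m > 0" and "finite R" and h: "\<And>r. r \<in> R \<Longrightarrow> fps_conv_radius (h r) \<ge> 1"
    and g: "\<And>r. r \<in> R \<Longrightarrow> fps_conv_radius (g r) \<ge> 1"
  shows "fps_conv_radius (\<Sum>r\<in>R. h r * g r) \<ge> 1"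
    and "norm q < 1 \<Longrightarrow> eval_fps (\<Sum>r\<in>R. h r * g r) q = (\<Sum>r\<in>R. eval_fps (h r) q * eval_fps (g r) q)"
proof -
  have rhg: "fps_conv_radius (h r * g r) \<ge> 1" if "r \<in> R" for r
    using fps_conv_radius_mult[of "h r" "g r"] h[OF that] g[OF that] by (meson min.boundedI order_trans)
  have "fps_conv_radius (\<Sum>r\<in>A. h r * g r) \<ge> 1 \<and> (\<forall>q. norm q < 1 \<longrightarrow> eval_fps (\<Sum>r\<in>A. h r * g r) q = (\<Sum>r\<in>A. eval_fps (h r) q * eval_fps (g r) q))" if "A \<subseteq> R" "finite A" for A
    using that(2,1)
  proof (induction A rule: finite_induct)
    case (insert x A)
    have x: "x \<in> R" using insert by blast
    have 1: "fps_conv_radius (\<Sum>r\<in>A. h r * g r) \<ge> 1" using insert by blast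
    note 2 = rhg[OF x]
    have "fps_conv_radius (h x * g x + (\<Sum>r\<in>A. h r * g r)) \<ge> 1"
      using fps_conv_radius_add[of "h x * g x" "\<Sum>r\<in>A. h r * g r"] 1 2 by (meson min.boundedI order_trans)
    moreover have "eval_fps (h x * g x + (\<Sum>r\<in>A. h r * g r)) q = eval_fps (h x) q * eval_fps (g x) q + eval_fps (\<Sum>r\<in>A. h r * g r) q" if "norm q < 1" for q
      using ereal_less_radius[OF m 1 that] ereal_less_radius[OF m 2 that] ereal_less_radius[OF m h[OF x] that] ereal_less_radius[OF m g[OF x] that]
      by (simp add: eval_fps_add eval_fps_mult)
    ultimately show ?case using insert by simp
  qed simp
  from this[of R] assms(2) show "fps_conv_radius (\<Sum>r\<in>R. h r * g r) \<ge> 1"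
    "norm q < 1 \<Longrightarrow> eval_fps (\<Sum>r\<in>R. h r * g r) q = (\<Sum>r\<in>R. eval_fps (h r) q * eval_fps (g r) q)" by auto
qed

text \<open>Every coefficient is a combination, with coefficients in \<open>\<int>[1/N]\<close> that do not depend on
  the form, of finitely many of them: pair the form with \<open>\<eta>\<^sup>3 Rop L j\<^sup>k\<close>, where the operators kill
  the leading term of every component except the one of \<open>r0\<close>.\<close>

lemma coefficient_recursion:
  assumes m: "m > 0" and r0: "r0 \<in> {1..<int m}" and N: "N \<ge> m"
  shows "\<exists>\<kappa>. (\<forall>n r. \<kappa> n r \<in> zloc (NN m)) \<and>
    (\<forall>c. jform m 0 c \<longrightarrow> c (int N) r0 = (\<Sum>r\<in>{1..<int m}. \<Sum>n<N. \<kappa> n r * c (int n) r))"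
proof -
  obtain L where L: "set L = {1..<int m} - {r0}" "distinct L" using finite_distinct_list[of "{1..<int m} - {r0}"] by auto
  have "length L = card ({1..<int m} - {r0})" using L by (metis distinct_card)
  also have "\<dots> \<le> m" by (rule order_trans[OF card_mono[of "{1..<int m}"]]) auto
  finally have lL: "length L \<le> N" using N by simp
  \<comment> \<open>Powers of \<open>jfun\<close> bring the pole to order exactly N, of which the
    steps in \<open>L\<close> have contributed \<open>length L\<close>; N \<ge> m ensures that this
    is not too much.\<close>
  define k where "k = N - length L"
  \<comment> \<open>The factor \<open>eta3\<close> returns from weight 0 to the transformation law
    of \<open>unary\<close>, so that \<open>G\<close> pairs with a form to weight 2.\<close>
  define G where "G = (\<lambda>r \<tau>. eta3 \<tau> * Rop m L r \<tau> * jfun \<tau> ^ k)"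
  define R where "R = {1..<int m}"
  have qG: "qx m (zloc (NN m)) (2 * r ^ 2 - 8 * int m * int N) (poly_units m r L) (G r)" if "r \<in> R" for r
  proof -
    have "\<bar>r\<bar> < int m" using that by (auto simp: R_def)
    hence "qx m (zloc (NN m)) (int m + (2 * r ^ 2 - int m - 8 * int m * int (length L)) + int k * (- (8 * int m)))
       (1 * poly_units m r L * 1 ^ k) (G r)" unfolding G_def poly_units_def
      by (rule qx_mult[OF m qx_mult[OF m qx_eta3[OF m NN_half[OF m] NN_8m[OF m]] qx_Rop[OF m]] qx_power[OF m qx_jfun[OF m NN_half[OF m] NN_8m[OF m]]]])
    moreover have "int m + (2 * r ^ 2 - int m - 8 * int m * int (length L)) + int k * (- (8 * int m)) = 2 * r ^ 2 - 8 * int m * int N"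
      using lL by (simp add: k_def algebra_simps of_nat_diff)
    ultimately show ?thesis by (simp only: mult_1_left mult_1_right power_one)
  qed
  have "\<forall>r\<in>R. \<exists>g. (\<forall>n. fps_nth g n \<in> zloc (NN m)) \<and> fps_conv_radius g \<ge> 1 \<and> fps_nth g 0 = poly_units m r L \<and>
      (\<forall>\<tau>. Im \<tau> > 0 \<longrightarrow> G r \<tau> = qpow m (2 * r ^ 2 - 8 * int m * int N) \<tau> * eval_fps g (qpow m 1 \<tau>))"
    using qG unfolding qx_def[OF m] by blast
  then obtain g where g: "\<And>r n. r \<in> R \<Longrightarrow> fps_nth (g r) n \<in> zloc (NN m)" "\<And>r. r \<in> R \<Longrightarrow> fps_conv_radius (g r) \<ge> 1"
      "\<And>r. r \<in> R \<Longrightarrow> fps_nth (g r) 0 = poly_units m r L"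
      "\<And>r \<tau>. r \<in> R \<Longrightarrow> Im \<tau> > 0 \<Longrightarrow> G r \<tau> = qpow m (2 * r ^ 2 - 8 * int m * int N) \<tau> * eval_fps (g r) (qpow m 1 \<tau>)"
    by metis
  define u where "u = poly_units m r0 L"
  have u: "inverse u \<in> zloc (NN m)" "u \<noteq> 0" using poly_units_inverse[OF m r0] L(1) by (auto simp: u_def)
  \<comment> \<open>In the constant term of the pairing, \<open>c (int N) r\<close> has the factor
    \<open>poly_units m r L\<close>, which is 0 except for r = \<open>r0\<close>. Solving for the
    surviving term gives these coefficients.\<close>
  define \<kappa> where "\<kappa> = (\<lambda>n r. if r \<in> R then - (inverse u * fps_nth (g r) (8 * m * (N - n))) else 0)"
  have main: "c (int N) r0 = (\<Sum>r\<in>R. \<Sum>n<N. \<kappa> n r * c (int n) r)" if c: "jform m 0 c" for c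
  proof -
    interpret jacobi_form m 0 c by standard (use m c in auto)
    define F where "F = (\<lambda>\<tau>. \<Sum>r\<in>res m. hcomp m c r \<tau> * G r \<tau>)"
    have Gcong: "G (r + 2 * int m) \<tau> = G r \<tau>" for r \<tau> using Rop_cong[OF m, of L r 1] by (simp add: G_def)
    have Gminus: "G (- r) \<tau> = - G r \<tau>" if "Im \<tau> > 0" for r \<tau> using Rop_minus[OF m that] by (simp add: G_def)
    have F2: "F \<tau> = 2 * (\<Sum>r\<in>R. hcomp m c r \<tau> * G r \<tau>)" if t: "Im \<tau> > 0" for \<tau> unfolding F_def R_def
    proof (rule sum_symmetric_residues[OF m])
      fix r
      show "hcomp m c (r + 2 * int m) \<tau> * G (r + 2 * int m) \<tau> = hcomp m c r \<tau> * G r \<tau>"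
        using hcomp_cong[of r 1 \<tau>] by (simp add: Gcong)
      show "hcomp m c (- r) \<tau> * G (- r) \<tau> = hcomp m c r \<tau> * G r \<tau>" by (simp add: hcomp_minus Gminus[OF t])
    qed (simp_all add: hcomp_zero)
    have FT: "F (\<tau> + 1) = F \<tau>" if t: "Im \<tau> > 0" for \<tau> unfolding F_def
    proof (rule sum.cong[OF refl])
      fix r
      have "hcomp m c r (\<tau> + 1) * G r (\<tau> + 1) = (e2pi (- (of_int r ^ 2) / (4 * of_nat m)) * e2pi (disc m r)) * (e2pi (1 / 8) / e2pi (1 / 8)) * (hcomp m c r \<tau> * G r \<tau>)"
        unfolding hcomp_tau_add_1 G_def eta3_add_1 Rop_tau_add_1[OF m t] jfun_add_1 by (simp add: mult_ac)
      also have "e2pi (- (of_int r ^ 2) / (4 * of_nat m)) * e2pi (disc m r) = 1" unfolding e2pi_add [symmetric] by simp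
      finally show "hcomp m c r (\<tau> + 1) * G r (\<tau> + 1) = hcomp m c r \<tau> * G r \<tau>" by simp
    qed
    have FS: "F (- 1 / \<tau>) = \<tau>\<^sup>2 * F \<tau>" if t: "Im \<tau> > 0" for \<tau> unfolding F_def
    proof (rule pairing_inversion[OF t])
      fix r
      let ?S = "\<Sum>s\<in>res m. weil m r s * Rop m L s \<tau>"
      have nz: "rt \<tau> \<noteq> 0" using t by (intro rt_nz) auto
      have "G r (- 1 / \<tau>) = (rt \<tau> ^ 3 * eta3 \<tau>) * ((\<tau> * rt (\<tau> / (2 * of_nat m)) / rt \<tau> ^ 3) * ?S) * jfun \<tau> ^ k"
        unfolding G_def eta3_inversion[OF t] Rop_inversion[OF m t] jfun_inversion[OF t] rt_ratio[OF t m] by (rule refl)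
      also have "\<dots> = \<tau> * rt (\<tau> / (2 * of_nat m)) * (?S * (eta3 \<tau> * jfun \<tau> ^ k))"
      proof -
        have "(q * e) * ((x / q) * S) * j = x * (S * (e * j))" if "q \<noteq> 0" for q e x S j :: complex using that by simp
        moreover have "rt \<tau> ^ 3 \<noteq> 0" using nz by simp
        ultimately show ?thesis by blast
      qed
      also have "?S * (eta3 \<tau> * jfun \<tau> ^ k) = (\<Sum>s\<in>res m. weil m r s * G s \<tau>)"
        unfolding sum_distrib_right G_def by (rule sum.cong) (simp_all only: mult_ac)
      finally show "G r (- 1 / \<tau>) = \<tau> * rt (\<tau> / (2 * of_nat m)) * (\<Sum>s\<in>res m. weil m r s * G s \<tau>)" .
    qed
    define h where "h = (\<lambda>r. Abs_fps (\<lambda>i. \<Sum>n\<in>{n\<in>{0..}. nat (8 * int m * n + (2 * r ^ 2 - 2 * r ^ 2)) = i}. c n r))"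
    have h: "fps_conv_radius (h r) \<ge> 1" "Im \<tau> > 0 \<Longrightarrow> hcomp m c r \<tau> = qpow m (- (2 * r ^ 2)) \<tau> * eval_fps (h r) (qpow m 1 \<tau>)" for r \<tau>
      using hcomp_fps[of "r" "2 * r ^ 2"] unfolding h_def by auto
    have nat8: "nat (8 * int m * n) = 8 * m * nat n" if "n \<ge> 0" for n using that by (simp add: nat_mult_distrib)
    \<comment> \<open>With the shift 2 r^2 only multiples of 8m, i.e. integral powers of q,
      occur.\<close>
    have h_nth: "fps_nth (h r) i = (if 8 * m dvd i then c (int (i div (8 * m))) r else 0)" for r i
    proof (cases "8 * m dvd i")
      case True
      then obtain j where j: "i = 8 * m * j" by blast
      have e: "{n\<in>{0..}. nat (8 * int m * n + (2 * r ^ 2 - 2 * r ^ 2)) = i} = {int j}"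
      proof -
        have "nat (8 * int m * n) = i \<longleftrightarrow> n = int j" if nn: "n \<ge> 0" for n unfolding nat8[OF nn] j using m nn by auto
        thus ?thesis by auto
      qed
      have "i div (8 * m) = j" using m by (simp add: j)
      thus ?thesis unfolding h_def fps_nth_Abs_fps e using True by simp
    next
      case False
      have e: "{n\<in>{0..}. nat (8 * int m * n + (2 * r ^ 2 - 2 * r ^ 2)) = i} = {}"
      proof -
        have "nat (8 * int m * n) \<noteq> i" if nn: "n \<ge> 0" for n unfolding nat8[OF nn] using False by auto
        thus ?thesis by auto
      qed
      show ?thesis unfolding h_def fps_nth_Abs_fps e using False by simp
    qed
    define f where "f = (\<Sum>r\<in>R. h r * g r)"
    note hg = eval_fps_sum_mult[where R = R and h = h and g = g, OF m _ h(1) g(2)]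
    have fr: "fps_conv_radius f \<ge> 1" unfolding f_def by (rule hg(1)) (simp_all add: R_def)
    have Ff: "F \<tau> / 2 = qpow m (- int (8 * m * N)) \<tau> * eval_fps f (qpow m 1 \<tau>)" if t: "Im \<tau> > 0" for \<tau>
    proof -
      have "eval_fps f (qpow m 1 \<tau>) = (\<Sum>r\<in>R. eval_fps (h r) (qpow m 1 \<tau>) * eval_fps (g r) (qpow m 1 \<tau>))"
        unfolding f_def by (rule hg(2)) (simp_all add: R_def norm_qpow_less_1[OF m t])
      moreover have "hcomp m c r \<tau> * G r \<tau> = qpow m (- int (8 * m * N)) \<tau> * (eval_fps (h r) (qpow m 1 \<tau>) * eval_fps (g r) (qpow m 1 \<tau>))" if "r \<in> R" for r
      proof -
        have "qpow m (- (2 * r ^ 2)) \<tau> * qpow m (2 * r ^ 2 - 8 * int m * int N) \<tau> = qpow m (- int (8 * m * N)) \<tau>"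
          by (simp add: qpow_add[OF m, symmetric])
        moreover have "x * y = z \<Longrightarrow> (x * a) * (y * b) = z * (a * b)" for x y z a b :: complex by (metis mult.assoc mult.left_commute)
        ultimately show ?thesis unfolding h(2)[OF t] g(4)[OF that t] by blast
      qed
      hence "(\<Sum>r\<in>R. hcomp m c r \<tau> * G r \<tau>) = qpow m (- int (8 * m * N)) \<tau> * (\<Sum>r\<in>R. eval_fps (h r) (qpow m 1 \<tau>) * eval_fps (g r) (qpow m 1 \<tau>))"
        unfolding sum_distrib_left by (intro sum.cong refl)
      moreover have "2 * x / 2 = x" for x :: complex by simp
      ultimately show ?thesis unfolding F2[OF t] by (simp only:)
    qed
    have "fps_nth f (8 * m * N) = 0"
    proof (rule weight_2_constant_term[OF m fr, of "\<lambda>\<tau>. F \<tau> / 2"])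
      show "F (\<tau> + 1) / 2 = F \<tau> / 2" if "Im \<tau> > 0" for \<tau> using FT[OF that] by simp
      show "F (- 1 / \<tau>) / 2 = \<tau>\<^sup>2 * (F \<tau> / 2)" if "Im \<tau> > 0" for \<tau> using FS[OF that] by (simp del: divide_minus_left)
    qed (rule Ff)
    moreover have "fps_nth (h r * g r) (8 * m * N) = (\<Sum>n\<le>N. c (int n) r * fps_nth (g r) (8 * m * (N - n)))" for r
    proof -
      have "fps_nth (h r * g r) (8 * m * N) = (\<Sum>i=0..8 * m * N. fps_nth (h r) i * fps_nth (g r) (8 * m * N - i))" by (rule fps_mult_nth)
      also have "\<dots> = (\<Sum>i\<in>(\<lambda>n. 8 * m * n) ` {..N}. fps_nth (h r) i * fps_nth (g r) (8 * m * N - i))"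
      proof (rule sum.mono_neutral_right; clarify?)
        fix i assume i: "i \<in> {0..8 * m * N}" "i \<notin> (\<lambda>n. 8 * m * n) ` {..N}"
        have "\<not> 8 * m dvd i"
        proof
          assume "8 * m dvd i"
          then obtain a where "i = 8 * m * a" by blast
          thus False using i m by auto
        qed
        thus "fps_nth (h r) i * fps_nth (g r) (8 * m * N - i) = 0" by (simp add: h_nth)
      qed (use m in auto)
      also have "\<dots> = (\<Sum>n\<le>N. c (int n) r * fps_nth (g r) (8 * m * (N - n)))"
        by (subst sum.reindex) (use m in \<open>auto simp: inj_on_def h_nth diff_mult_distrib2\<close>)
      finally show ?thesis .
    qed
    ultimately have "(\<Sum>r\<in>R. \<Sum>n\<le>N. c (int n) r * fps_nth (g r) (8 * m * (N - n))) = 0" by (simp add: f_def fps_sum_nth)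
    moreover have "(\<Sum>r\<in>R. \<Sum>n\<le>N. c (int n) r * fps_nth (g r) (8 * m * (N - n))) = (\<Sum>r\<in>R. c (int N) r * fps_nth (g r) 0) + (\<Sum>r\<in>R. \<Sum>n<N. c (int n) r * fps_nth (g r) (8 * m * (N - n)))"
      unfolding sum.distrib [symmetric] by (rule sum.cong) (simp_all add: lessThan_Suc_atMost [symmetric] add.commute)
    moreover have "(\<Sum>r\<in>R. c (int N) r * fps_nth (g r) 0) = (\<Sum>r\<in>R. if r = r0 then c (int N) r0 * u else 0)"
      by (rule sum.cong) (use g(3) poly_units_zero[of _ L m] L(1) in \<open>auto simp: u_def R_def\<close>)
    moreover have "(\<Sum>r\<in>R. if r = r0 then c (int N) r0 * u else 0) = c (int N) r0 * u" using r0 by (simp add: R_def)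
    ultimately have "c (int N) r0 * u = - (\<Sum>r\<in>R. \<Sum>n<N. c (int n) r * fps_nth (g r) (8 * m * (N - n)))" by (simp add: add_eq_0_iff)
    hence "c (int N) r0 = inverse u * - (\<Sum>r\<in>R. \<Sum>n<N. c (int n) r * fps_nth (g r) (8 * m * (N - n)))"
      using u(2) by (simp add: field_simps)
    also have "\<dots> = (\<Sum>r\<in>R. \<Sum>n<N. \<kappa> n r * c (int n) r)" unfolding \<kappa>_def sum_negf [symmetric] sum_distrib_left
      by (intro sum.cong refl) (simp add: mult_ac)
    finally show ?thesis .
  qed
  show ?thesis
  proof (intro exI[of _ \<kappa>] conjI allI impI)
    show "\<kappa> n r \<in> zloc (NN m)" for n r using u g(1) by (auto simp: \<kappa>_def)
  qed (use main in \<open>simp add: R_def\<close>)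
qed

section \<open>From mock modular forms to Jacobi forms\<close>

lemma periodic_int:
  assumes "\<And>\<tau>. Im \<tau> > 0 \<Longrightarrow> G (\<tau> + 1) = G \<tau>" "Im \<tau> > 0"
  shows "G (\<tau> + of_int k) = (G \<tau> :: complex)"
proof (induction k rule: int_induct[of _ 0])
  case (step1 i)
  have "G (\<tau> + of_int i + 1) = G (\<tau> + of_int i)" by (rule assms(1)) (use assms(2) in simp)
  thus ?case using step1 by (simp add: add.assoc)
next
  case (step2 i)
  have "G (\<tau> + of_int (i - 1) + 1) = G (\<tau> + of_int (i - 1))" by (rule assms(1)) (use assms(2) in simp)
  moreover have "\<tau> + of_int (i - 1) + 1 = \<tau> + of_int i" by simp
  ultimately show ?case using step2 by simp
qed simp

text \<open>As a function of q = e(\<tau>), \<open>G\<close> is holomorphic on the punctured disc,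
  and the limit makes the singularity at 0 removable. The Fourier series is the Taylor series of the
  extension.\<close>

lemma periodic_fourier:
  assumes hol: "G holomorphic_on upper_half_plane" and per: "\<And>\<tau>. Im \<tau> > 0 \<Longrightarrow> G (\<tau> + 1) = G \<tau>"
    and lim: "((\<lambda>\<tau>. e2pi \<tau> * G \<tau>) \<longlongrightarrow> 0) (filtercomap Im at_top)"
  shows "\<exists>a. \<forall>\<tau>. Im \<tau> > 0 \<longrightarrow> ((\<lambda>j. a j * e2pi (of_nat j * \<tau>)) has_sum G \<tau>) UNIV"
proof -
  define T where "T = (\<lambda>q. Ln q / tpi)"
  define f where "f = (\<lambda>q. G (T q))"
  have eT: "e2pi (T q) = q" if "q \<noteq> 0" for q using that by (simp add: e2pi_def T_def)
  have ImT: "Im (T q) = - ln (norm q) / (2 * pi)" if "q \<noteq> 0" for q using that by (simp add: T_def Im_divide power2_eq_square)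
  have f: "f (e2pi \<tau>) = G \<tau>" if t: "Im \<tau> > 0" for \<tau>
  proof -
    have "e2pi (T (e2pi \<tau>) - \<tau>) = 1" by (simp add: e2pi_diff eT)
    then obtain k where "T (e2pi \<tau>) - \<tau> = of_int k" unfolding e2pi_eq_1_iff by (auto elim: Ints_cases)
    hence "T (e2pi \<tau>) = \<tau> + of_int k" by (simp add: algebra_simps)
    thus ?thesis using periodic_int[of G \<tau> k, OF per t] by (simp add: f_def)
  qed
  have "f holomorphic_on (ball 0 1 - {0})"
  proof -
    have "f field_differentiable at q0" if q0: "q0 \<in> ball 0 1 - {0}" for q0
    proof -
      \<comment> \<open>On this half-disc q/q0 avoids the cut of \<open>Ln\<close>, so
        \<open>T q0 + Ln (q / q0) / tpi\<close> is a holomorphic branch of the logarithm; by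
        periodicity the choice of the branch does not affect \<open>G\<close>.\<close>
      define U where "U = {q. norm q < 1 \<and> Re (q / q0) > 0}"
      have oU: "open U" unfolding U_def using q0 by (intro open_Collect_conj open_Collect_less continuous_intros) auto
      define g where "g = (\<lambda>q. G (T q0 + Ln (q / q0) / tpi))"
      have nz: "q0 \<noteq> 0" using q0 by simp
      have e: "e2pi (T q0 + Ln (q / q0) / tpi) = q" if "q \<in> U" for q
      proof -
        have "q / q0 \<noteq> 0" using that by (auto simp: U_def)
        hence "e2pi (Ln (q / q0) / tpi) = q / q0" using eT[of "q / q0"] unfolding T_def by blast
        thus ?thesis using nz unfolding e2pi_add eT[OF nz] by simp
      qed
      have im: "Im (T q0 + Ln (q / q0) / tpi) > 0" if "q \<in> U" for q
      proof -
        have "norm (e2pi (T q0 + Ln (q / q0) / tpi)) < 1" unfolding e[OF that] using that by (simp add: U_def)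
        hence "- 2 * pi * Im (T q0 + Ln (q / q0) / tpi) < 0" unfolding norm_e2pi exp_less_one_iff .
        thus ?thesis using pi_gt_zero by (simp only: mult_minus_left neg_less_0_iff_less zero_less_mult_iff) auto
      qed
      have "g holomorphic_on U" unfolding g_def
      proof (rule holomorphic_on_compose_gen[of _ _ G upper_half_plane, unfolded o_def])
        show "(\<lambda>q. T q0 + Ln (q / q0) / tpi) holomorphic_on U"
          using nz by (intro holomorphic_intros) (auto simp: U_def complex_nonpos_Reals_iff)
      qed (use hol im in auto)
      moreover have "g q = f q" if "q \<in> U" for q using f[OF im[OF that]] unfolding e[OF that] by (simp add: g_def)
      ultimately have "f holomorphic_on U" by (simp cong: holomorphic_cong)
      thus ?thesis using oU q0 by (intro holomorphic_on_imp_differentiable_at[of f U]) (auto simp: U_def)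
    qed
    thus ?thesis by (auto simp: holomorphic_on_def intro: field_differentiable_at_within)
  qed
  moreover have "((\<lambda>q. (q - 0) * f q) \<longlongrightarrow> 0) (at 0)"
  proof -
    have "filterlim (\<lambda>q::complex. - ln (norm q) / (2 * pi)) at_top (at 0)"
    proof -
      have "filterlim (\<lambda>q::complex. norm q) (at_right 0) (at 0)" by (auto simp: filterlim_at eventually_at_filter intro!: tendsto_eq_intros)
      hence "filterlim (\<lambda>q::complex. ln (norm q)) at_bot (at 0)" by (rule filterlim_compose[OF ln_at_0])
      hence "filterlim (\<lambda>q::complex. - ln (norm q)) at_top (at 0)" by (simp add: filterlim_uminus_at_bot)
      hence "filterlim (\<lambda>q::complex. 1 / (2 * pi) * - ln (norm q)) at_top (at 0)"
        by (rule filterlim_tendsto_pos_mult_at_top[OF tendsto_const, rotated]) simp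
      thus ?thesis by simp
    qed
    moreover have "\<forall>\<^sub>F q in at 0. - ln (norm q) / (2 * pi) = Im (T q)" using ImT by (auto simp: eventually_at_filter)
    ultimately have "filterlim (\<lambda>q. Im (T q)) at_top (at 0)" by (subst (asm) filterlim_cong[OF refl refl])
    hence "filterlim T (filtercomap Im at_top) (at 0)" by (simp add: filterlim_filtercomap_iff o_def)
    hence "((\<lambda>q. e2pi (T q) * G (T q)) \<longlongrightarrow> 0) (at 0)" by (rule filterlim_compose[OF lim])
    moreover have "\<forall>\<^sub>F q in at 0. e2pi (T q) * G (T q) = (q - 0) * f q" using eT by (auto simp: eventually_at_filter f_def)
    ultimately show ?thesis by (rule Lim_transform_eventually)
  qed
  ultimately obtain g where g: "g holomorphic_on ball 0 1" "\<And>z. z \<in> ball 0 1 - {0} \<Longrightarrow> g z = f z"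
    using holomorphic_on_extend_lim[of f "ball 0 1" 0] by auto
  define a where "a = (\<lambda>n. (deriv ^^ n) g 0 / fact n)"
  have s: "(\<lambda>n. a n * w ^ n) sums g w" if "norm w < 1" for w using holomorphic_power_series[OF g(1), of w] that by (simp add: a_def)
  have "((\<lambda>j. a j * e2pi (of_nat j * \<tau>)) has_sum G \<tau>) UNIV" if t: "Im \<tau> > 0" for \<tau>
  proof -
    have q: "norm (e2pi \<tau>) < 1" using t by (simp add: norm_e2pi)
    obtain r where r: "norm (e2pi \<tau>) < r" "r < 1" using dense[OF q] by auto
    have "r > 0" using r(1) by (meson le_less_trans norm_ge_zero)
    hence r': "norm (complex_of_real r) = r" by simp
    have "summable (\<lambda>n. norm (a n * e2pi \<tau> ^ n))" by (rule powser_insidea[OF sums_summable[OF s[of "of_real r"]]]) (use r r' in auto)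
    hence "((\<lambda>n. a n * e2pi \<tau> ^ n) has_sum g (e2pi \<tau>)) UNIV" by (rule norm_summable_imp_has_sum[OF _ s[OF q]])
    thus ?thesis using g(2)[of "e2pi \<tau>"] q f[OF t] by (simp add: e2pi_mult_of_nat)
  qed
  thus ?thesis by blast
qed

lemma component_fourier:
  fixes g :: "complex \<Rightarrow> complex" and r :: int
  assumes m: "m > 0" and hol: "g holomorphic_on upper_half_plane"
    and T: "\<And>\<tau>. Im \<tau> > 0 \<Longrightarrow> g (\<tau> + 1) = e2pi (- (of_int r ^ 2) / (4 * of_nat m)) * g \<tau>"
    and growth: "(\<lambda>\<tau>. e2pi (\<tau> / (4 * of_nat m)) * g \<tau>) \<in> O[filtercomap Im at_top](\<lambda>_. 1)"
  shows "\<exists>c. (\<forall>n. c n \<noteq> 0 \<longrightarrow> r ^ 2 \<le> 4 * int m * n + 1) \<and>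
     (\<forall>\<tau>. Im \<tau> > 0 \<longrightarrow> ((\<lambda>n. c n * hexp m n r \<tau>) has_sum g \<tau>) UNIV)"
proof -
  \<comment> \<open>The least integer with r^2 \<le> 4mk + 1, which is the ceiling of (r^2 -
    1)/4m.\<close>
  define k where "k = - ((1 - r ^ 2) div (4 * int m))"
  have k: "4 * int m * k \<ge> r ^ 2 - 1" "4 * int m * (k - 1) < r ^ 2 - 1"
  proof -
    have *: "(1 - r ^ 2) div (4 * int m) * (4 * int m) + (1 - r ^ 2) mod (4 * int m) = 1 - r ^ 2" by (rule div_mult_mod_eq)
    have "0 \<le> (1 - r ^ 2) mod (4 * int m)" "(1 - r ^ 2) mod (4 * int m) < 4 * int m" using m by auto
    thus "4 * int m * k \<ge> r ^ 2 - 1" "4 * int m * (k - 1) < r ^ 2 - 1" using * unfolding k_def by (simp_all add: algebra_simps)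
  qed
  define G where "G = (\<lambda>\<tau>. e2pi (disc m r * \<tau> - of_int k * \<tau>) * g \<tau>)"
  have "\<exists>a. \<forall>\<tau>. Im \<tau> > 0 \<longrightarrow> ((\<lambda>j. a j * e2pi (of_nat j * \<tau>)) has_sum G \<tau>) UNIV"
  proof (rule periodic_fourier[of G])
    show "G holomorphic_on upper_half_plane" unfolding G_def using hol by (intro holomorphic_intros)
    show "G (\<tau> + 1) = G \<tau>" if t: "Im \<tau> > 0" for \<tau>
    proof -
      let ?A = "disc m r :: complex"
      have "?A * (\<tau> + 1) - of_int k * (\<tau> + 1) = (?A * \<tau> - of_int k * \<tau>) + ?A + of_int (- k)" by (simp add: distrib_left)
      hence "e2pi (?A * (\<tau> + 1) - of_int k * (\<tau> + 1)) = e2pi (?A * \<tau> - of_int k * \<tau>) * e2pi ?A"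
        by (simp only: e2pi_add e2pi_of_int mult_1_right)
      moreover have "e2pi ?A * e2pi (- (of_int r ^ 2) / (4 * of_nat m)) = 1" unfolding e2pi_add [symmetric] by simp
      moreover have "x = u * v \<Longrightarrow> v * w = 1 \<Longrightarrow> x * (w * y) = u * y" for x y u v w :: complex by simp
      ultimately show ?thesis unfolding G_def T[OF t] by blast
    qed
    \<comment> \<open>Since k is minimal, q \<open>G\<close> is a positive power q^\<delta> times
      the bounded function q^(1/4m) g.\<close>
    define \<delta> where "\<delta> = real_of_int (r ^ 2 - 1 - 4 * int m * (k - 1)) / (4 * real m)"
    have d: "\<delta> > 0" unfolding \<delta>_def
    proof (rule divide_pos_pos)
      show "0 < real_of_int (r ^ 2 - 1 - 4 * int m * (k - 1))" unfolding of_int_0_less_iff using k(2) by linarith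
    qed (use m in auto)
    have Geq: "e2pi \<tau> * G \<tau> = e2pi (of_real \<delta> * \<tau>) * (e2pi (\<tau> / (4 * of_nat m)) * g \<tau>)" for \<tau>
    proof -
      have "\<tau> + (disc m r * \<tau> - of_int k * \<tau>) = of_real \<delta> * \<tau> + \<tau> / (4 * of_nat m)"
        using m by (simp add: \<delta>_def field_simps)
      hence "e2pi \<tau> * e2pi (disc m r * \<tau> - of_int k * \<tau>) = e2pi (of_real \<delta> * \<tau>) * e2pi (\<tau> / (4 * of_nat m))"
        unfolding e2pi_add [symmetric] by (rule arg_cong)
      thus ?thesis unfolding G_def mult.assoc [symmetric] by (rule arg_cong2[where f = "(*)"]) (rule refl)
    qed
    have e0: "((\<lambda>\<tau>. e2pi (of_real \<delta> * \<tau>)) \<longlongrightarrow> 0) (filtercomap Im at_top)"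
    proof (rule tendsto_norm_zero_cancel)
      have "filterlim (\<lambda>y::real. exp (- 2 * pi * (\<delta> * y))) (nhds 0) at_top"
      proof (rule filterlim_compose[OF exp_at_bot])
        have "filterlim (\<lambda>y::real. (2 * pi * \<delta>) * y) at_top at_top"
          using d by (intro filterlim_tendsto_pos_mult_at_top[OF tendsto_const _ filterlim_ident]) auto
        thus "filterlim (\<lambda>y::real. - 2 * pi * (\<delta> * y)) at_bot at_top" by (simp add: filterlim_uminus_at_top mult.assoc)
      qed
      from filterlim_compose[OF this filterlim_filtercomap[of Im at_top]]
      show "((\<lambda>\<tau>. norm (e2pi (of_real \<delta> * \<tau>))) \<longlongrightarrow> 0) (filtercomap Im at_top)" by (simp add: norm_e2pi)
    qed
    from growth obtain C where C: "\<forall>\<^sub>F \<tau> in filtercomap Im at_top. norm (e2pi (\<tau> / (4 * of_nat m)) * g \<tau>) \<le> C"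
      by (auto elim!: landau_o.bigE)
    show "((\<lambda>\<tau>. e2pi \<tau> * G \<tau>) \<longlongrightarrow> 0) (filtercomap Im at_top)" unfolding Geq
    proof (rule tendsto_0_le[of _ _ _ C])
      show "((\<lambda>\<tau>. e2pi (of_real \<delta> * \<tau>)) \<longlongrightarrow> 0) (filtercomap Im at_top)" by (rule e0)
      show "\<forall>\<^sub>F \<tau> in filtercomap Im at_top. norm (e2pi (of_real \<delta> * \<tau>) * (e2pi (\<tau> / (4 * of_nat m)) * g \<tau>)) \<le> norm (e2pi (of_real \<delta> * \<tau>)) * C"
        using C
      proof eventually_elim
        case (elim \<tau>)
        thus ?case unfolding norm_mult[of "e2pi (of_real \<delta> * \<tau>)"] by (intro mult_left_mono) auto
      qed
    qed
  qed
  then obtain a where a: "\<And>\<tau>. Im \<tau> > 0 \<Longrightarrow> ((\<lambda>j. a j * e2pi (of_nat j * \<tau>)) has_sum G \<tau>) UNIV" by blast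
  define c where "c = (\<lambda>n. if n \<ge> k then a (nat (n - k)) else 0)"
  have "((\<lambda>n. c n * hexp m n r \<tau>) has_sum g \<tau>) UNIV" if t: "Im \<tau> > 0" for \<tau>
  proof -
    let ?x = "of_int k * \<tau> - disc m r * \<tau>"
    have "((\<lambda>j. e2pi ?x * (a j * e2pi (of_nat j * \<tau>))) has_sum e2pi ?x * G \<tau>) UNIV" by (rule has_sum_cmult_right[OF a[OF t]])
    moreover have "e2pi ?x * G \<tau> = g \<tau>" unfolding G_def mult.assoc [symmetric] e2pi_add [symmetric] by simp
    ultimately have 1: "((\<lambda>j. e2pi ?x * (a j * e2pi (of_nat j * \<tau>))) has_sum g \<tau>) UNIV" by simp
    have 2: "((\<lambda>n. c n * hexp m n r \<tau>) has_sum g \<tau>) {k..}"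
    proof (rule iffD1[OF has_sum_reindex_bij_witness[of UNIV "\<lambda>n. nat (n - k)" "\<lambda>j. k + int j" "{k..}"] 1])
      fix j :: nat
      have "of_int (k + int j) * \<tau> - disc m r * \<tau> = ?x + of_nat j * \<tau>" by (simp add: distrib_right)
      hence "hexp m (k + int j) r \<tau> = e2pi ?x * e2pi (of_nat j * \<tau>)" by (simp only: e2pi_add)
      thus "c (k + int j) * hexp m (k + int j) r \<tau> = e2pi ?x * (a j * e2pi (of_nat j * \<tau>))" by (simp add: c_def)
    qed auto
    show ?thesis by (rule iffD1[OF has_sum_cong_neutral 2]) (auto simp: c_def)
  qed
  moreover have "r ^ 2 \<le> 4 * int m * n + 1" if "c n \<noteq> 0" for n
  proof -
    have "n \<ge> k" using that by (auto simp: c_def split: if_splits)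
    hence "4 * int m * k \<le> 4 * int m * n" by (intro mult_left_mono) auto
    thus ?thesis using k(1) by linarith
  qed
  ultimately show ?thesis by blast
qed

lemma Im_moebius:
  assumes "p * s - q * r = (1::int)" "Im \<tau> > 0"
  shows "Im ((of_int p * \<tau> + of_int q) / (of_int r * \<tau> + of_int s)) > 0" "of_int r * \<tau> + of_int s \<noteq> 0"
proof -
  show nz: "of_int r * \<tau> + of_int s \<noteq> 0"
  proof
    assume 0: "of_int r * \<tau> + of_int s = 0"
    have "Im (of_int r * \<tau> + of_int s) = of_int r * Im \<tau>" by simp
    hence "r = 0" using 0 assms(2) by simp
    moreover from this have "s = 0" using 0 by simp
    ultimately show False using assms(1) by simp
  qed
  have "Im ((of_int p * \<tau> + of_int q) / (of_int r * \<tau> + of_int s)) = real_of_int (p * s - q * r) * Im \<tau> / (norm (of_int r * \<tau> + of_int s))\<^sup>2"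
    by (simp add: Im_divide cmod_power2 algebra_simps)
  thus "Im ((of_int p * \<tau> + of_int q) / (of_int r * \<tau> + of_int s)) > 0" unfolding assms(1) using assms(2) nz by simp
qed

lemma periodic_mod:
  assumes "\<And>r. g (r + N) = (g r :: 'a)"
  shows "g (r mod N) = g (r :: int)"
proof -
  have "g (r + N * k) = g r" for k r
  proof (induction k arbitrary: r rule: int_induct[of _ 0])
    case (step1 i)
    have "g (r + N * (i + 1)) = g ((r + N * i) + N)" by (simp add: algebra_simps)
    thus ?case using step1 assms by simp
  next
    case (step2 i)
    have "g (r + N * (i - 1)) = g ((r + N * (i - 1)) + N)" using assms by simp
    also have "\<dots> = g (r + N * i)" by (simp add: algebra_simps)
    finally show ?case using step2 by simp
  qed simp
  from this[of "r mod N" "r div N"] show ?thesis by (simp add: add.commute)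
qed

text \<open>The elliptic law is uniqueness of Fourier coefficients for the equal components r and r
  + 2ml. Absolute convergence: for fixed \<tau> the row sums are periodic in r, hence bounded, and
  the theta terms are absolutely summable.\<close>

lemma jform_of_components:
  fixes g :: "int \<Rightarrow> complex \<Rightarrow> complex"
  assumes m: "m > 0"
    and sum: "\<And>r \<tau>. Im \<tau> > 0 \<Longrightarrow> ((\<lambda>n. c n r * hexp m n r \<tau>) has_sum g r \<tau>) UNIV"
    and per: "\<And>r. g (r + 2 * int m) = g r"
    and supp: "\<And>n r. c n r \<noteq> 0 \<Longrightarrow> r ^ 2 \<le> 4 * int m * n + B"
    and mod: "weight_half_modular m g"
  shows "jform m B c"
proof -
  have gmod: "g (r mod (2 * int m)) = g r" for r by (rule periodic_mod[where g = g, OF per])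
  have ell: "c (n + r * l + int m * l ^ 2) (r + 2 * int m * l) = c n r" for n r l
  proof -
    define r' where "r' = r + 2 * int m * l"
    define \<sigma> where "\<sigma> = (\<lambda>n. n + r * l + int m * l ^ 2)"
    have ex: "of_int (\<sigma> n) * \<tau> - disc m r' * \<tau> = of_int n * \<tau> - disc m r * \<tau>" for n and \<tau> :: complex
      unfolding \<sigma>_def r'_def using m by (simp add: field_simps power2_eq_square)
    have gr: "g r' = g r" using gmod[of r'] gmod[of r] by (simp add: r'_def)
    have s': "((\<lambda>n. c (\<sigma> n) r' * hexp m n r \<tau>) has_sum g r \<tau>) UNIV" if t: "Im \<tau> > 0" for \<tau>
    proof (rule iffD1[OF has_sum_reindex_bij_witness[of UNIV \<sigma> "\<lambda>n. n - r * l - int m * l ^ 2" UNIV] sum[OF t, of r', unfolded gr]])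
      fix n
      have \<sigma>: "\<sigma> (n - r * l - int m * l ^ 2) = n" by (simp add: \<sigma>_def)
      show "c (\<sigma> (n - r * l - int m * l ^ 2)) r' * hexp m (n - r * l - int m * l ^ 2) r \<tau> = c n r' * hexp m n r' \<tau>"
        unfolding ex[of "n - r * l - int m * l ^ 2", symmetric] \<sigma> ..
    qed (auto simp: \<sigma>_def)
    let ?a = "\<lambda>n. (c (\<sigma> n) r' - c n r) * e2pi (of_int n * \<i>)"
    have s0: "((\<lambda>n. ?a n * e2pi (of_int n * of_real x)) has_sum 0) UNIV" for x :: real
    proof -
      define \<tau> where "\<tau> = \<i> + of_real x"
      have t: "Im \<tau> > 0" by (simp add: \<tau>_def)
      let ?E = "e2pi (disc m r * \<tau>)"
      have "((\<lambda>n. ?E * (c (\<sigma> n) r' * hexp m n r \<tau> - c n r * hexp m n r \<tau>)) has_sum ?E * (g r \<tau> - g r \<tau>)) UNIV"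
        by (intro has_sum_cmult_right has_sum_diff s' sum t)
      moreover have "?E * (c (\<sigma> n) r' * hexp m n r \<tau> - c n r * hexp m n r \<tau>) = ?a n * e2pi (of_int n * of_real x)" for n
      proof -
        have "?E * hexp m n r \<tau> = e2pi (of_int n * \<i>) * e2pi (of_int n * of_real x)"
          unfolding e2pi_add [symmetric] by (simp add: \<tau>_def distrib_left)
        moreover have "E * y = u * v \<Longrightarrow> E * (a * y - b * y) = (a - b) * u * v" for E y u v a b :: complex
          by (metis left_diff_distrib mult.assoc mult.left_commute)
        ultimately show ?thesis by blast
      qed
      ultimately show ?thesis by simp
    qed
    have "?a n = 0"
    proof (rule exp_sum_unique[where a = ?a])
      show "?a summable_on UNIV" using s0[of 0] by (auto simp: summable_on_def)
    qed (rule s0)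
    thus ?thesis by (simp add: \<sigma>_def r'_def)
  qed
  have J3: "(\<lambda>(n, r). c n r * fexp n r \<tau> z) summable_on UNIV" if t: "Im \<tau> > 0" for \<tau> z
  proof -
    define E where "E = (\<lambda>r::int. kexp m r \<tau> * e2pi (of_int r * z))"
    define b where "b = (\<lambda>r n. c n r * hexp m n r \<tau>)"
    have be: "c n r * fexp n r \<tau> z = E r * b r n" for n r
    proof -
      have "of_int n * \<tau> + of_int r * z = \<tau> * of_int r ^ 2 / (4 * of_nat m) + of_int r * z + (of_int n * \<tau> - disc m r * \<tau>)" by simp
      thus ?thesis unfolding E_def b_def by (simp only: e2pi_add mult_ac)
    qed
    have bs: "(\<lambda>n. norm (b r n)) summable_on UNIV" for r
      using has_sum_imp_summable[OF sum[OF t, of r]] unfolding summable_on_iff_abs_summable_on_complex b_def .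
    define S where "S = (\<lambda>r. \<Sum>\<^sub>\<infinity>n. norm (b r n))"
    have Seq: "(\<Sum>\<^sub>\<infinity>n. norm (b r n)) = S r" for r by (simp add: S_def)
    have Sper: "S (r + 2 * int m) = S r" for r unfolding S_def
    proof (rule infsum_reindex_bij_witness[of _ "\<lambda>n. n + r + int m" "\<lambda>n. n - r - int m"])
      fix n :: int
      have "of_int n * \<tau> - disc m (r + 2 * int m) * \<tau> = of_int (n - r - int m) * \<tau> - disc m r * \<tau>"
        using m by (simp add: field_simps power2_eq_square)
      thus "norm (b r (n - r - int m)) = norm (b (r + 2 * int m) n)" using ell[of "n - r - int m" r 1] unfolding b_def by simp
    qed auto
    have Spos: "S r \<ge> 0" for r unfolding S_def by (rule infsum_nonneg) simp
    define K where "K = (\<Sum>r\<in>res m. S r)"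
    have SK: "S r \<le> K" for r
    proof -
      have "S (r mod (2 * int m)) \<le> K" unfolding K_def by (rule member_le_sum) (use m Spos in auto)
      thus ?thesis by (simp add: periodic_mod[of S, OF Sper])
    qed
    have Es: "(\<lambda>r. norm (E r)) summable_on UNIV"
      using theta_has_sum_UNIV[OF m t, of z UNIV] unfolding summable_on_iff_abs_summable_on_complex E_def .
    have "(\<lambda>x. norm (case x of (r, n) \<Rightarrow> E r * b r n)) summable_on (UNIV \<times> UNIV)"
      unfolding Infinite_Sum.abs_summable_on_Sigma_iff
    proof (intro conjI ballI)
      show "(\<lambda>n. norm (case (r, n) of (r, n) \<Rightarrow> E r * b r n)) summable_on UNIV" for r
        using summable_on_cmult_right[OF bs, of "norm (E r)" r] by (simp add: norm_mult)
      have "(\<lambda>r. norm (E r) * S r) summable_on UNIV"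
      proof (rule summable_on_comparison_test[OF summable_on_cmult_left[OF Es, of K]])
        show "norm (E r) * S r \<le> norm (E r) * K" for r using SK by (intro mult_left_mono) auto
      qed (use Spos in auto)
      thus "(\<lambda>r. norm (\<Sum>\<^sub>\<infinity>n. norm (case (r, n) of (r, n) \<Rightarrow> E r * b r n))) summable_on UNIV"
        unfolding split_conv norm_mult infsum_cmult_right' Seq using Spos by (simp add: abs_mult)
    qed
    hence "(\<lambda>(r, n). E r * b r n) summable_on UNIV" by (simp add: summable_on_iff_abs_summable_on_complex)
    thus ?thesis
      by (subst summable_on_reindex_bij_witness[of _ "\<lambda>(r, n). (n, r)" "\<lambda>(n, r). (r, n)" UNIV "\<lambda>(r, n). E r * b r n"]) (auto simp: be)
  qed
  interpret theta_expansion m c using ell J3 by unfold_locales (auto intro: m)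
  have pairing: "jphi c \<tau> z = theta_pairing m g \<tau> z" if t: "Im \<tau> > 0" for \<tau> z
    unfolding jphi_decomp[OF t] theta_pairing_def hcomp_def infsumI[OF sum[OF t]] ..
  show ?thesis unfolding jform_def
  proof (intro conjI allI impI)
    fix p q r s :: int and \<tau> z :: complex
    assume *: "p * s - q * r = 1" "Im \<tau> > 0"
    show "jact m p q r s c \<tau> z = jphi c \<tau> z" unfolding pairing[OF *(2)] pairing[OF Im_moebius(1)[OF *]]
      using mod * unfolding weight_half_modular_def Let_def by (auto simp del: of_nat_mult)
  qed (use supp ell J3 in auto)
qed

lemma weight_half_tau_add_1:
  assumes m: "m > 0" and per: "\<And>r. g (r + 2 * int m) = g r" and mod: "weight_half_modular m g" and t: "Im \<tau> > 0"
  shows "g r (\<tau> + 1) = e2pi (- (of_int r ^ 2) / (4 * of_nat m)) * g r \<tau>"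
proof -
  let ?e = "\<lambda>s. e2pi (disc m s)"
  have gmod: "g (r mod (2 * int m)) = g r" for r by (rule periodic_mod[where g = g, OF per])
  have "theta_pairing m g (\<tau> + 1) z = theta_pairing m g \<tau> z" for z
    using mod[unfolded weight_half_modular_def Let_def, rule_format, of 1 1 1 0 \<tau> z] t by simp
  hence "(\<Sum>s\<in>res m. (?e s * g s (\<tau> + 1) - g s \<tau>) * theta m s \<tau> z) = 0" for z
    unfolding theta_pairing_def theta_tau_add_1[OF m] left_diff_distrib sum_subtractf by (simp add: mult_ac)
  hence z: "?e s * g s (\<tau> + 1) - g s \<tau> = 0" if "s \<in> res m" for s
    using theta_independent[OF m t, of "\<lambda>s. ?e s * g s (\<tau> + 1) - g s \<tau>" s] that by simp
  define s where "s = r mod (2 * int m)"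
  have "?e s * g r (\<tau> + 1) = g r \<tau>" using z[of s] m by (simp add: s_def gmod)
  moreover have "?e s = ?e r" using e2pi_square_cong[of m s r] m by (simp add: s_def mod_eq_dvd_iff [symmetric])
  moreover have "e2pi (- (of_int r ^ 2) / (4 * of_nat m)) * ?e r = 1" unfolding e2pi_add [symmetric] by simp
  moreover have "e * G = y \<Longrightarrow> e = e' \<Longrightarrow> w * e' = 1 \<Longrightarrow> G = w * y" for e e' G y w :: complex by auto
  ultimately show ?thesis by blast
qed

lemma difference_jform:
  assumes m: "m > 0"
    and h: "mock_modular_form m S h" "optimal_growth m h"
    and h': "mock_modular_form m S h'" "optimal_growth m h'"
  shows "\<exists>c. jform m 1 c \<and> (\<forall>r \<tau>. Im \<tau> > 0 \<longrightarrow> hcomp m c r \<tau> = h r \<tau> - h' r \<tau>)"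
proof -
  define g where "g = (\<lambda>r \<tau>. h r \<tau> - h' r \<tau>)"
  have per: "g (r + 2 * int m) = g r" for r using h(1) h'(1) unfolding mock_modular_form_def g_def by (auto simp: fun_eq_iff)
  have g: "g r \<tau> = completion m S h r \<tau> - completion m S h' r \<tau>" for r \<tau> by (simp add: g_def completion_def)
  have pairing: "theta_pairing m g \<tau> z = theta_pairing m (completion m S h) \<tau> z - theta_pairing m (completion m S h') \<tau> z" for \<tau> z
    unfolding theta_pairing_def g by (simp add: left_diff_distrib sum_subtractf)
  have mod: "weight_half_modular m g" using h(1) h'(1) unfolding mock_modular_form_def weight_half_modular_def Let_def pairing right_diff_distrib
    by (auto simp del: of_nat_mult)
  define P where "P = (\<lambda>r c. (\<forall>n. c n \<noteq> 0 \<longrightarrow> r ^ 2 \<le> 4 * int m * n + 1) \<and>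
     (\<forall>\<tau>. Im \<tau> > 0 \<longrightarrow> ((\<lambda>n. c n * hexp m n r \<tau>) has_sum g r \<tau>) UNIV))"
  have "\<exists>c. P r c" for r unfolding P_def
  proof (rule component_fourier[OF m])
    show "g r holomorphic_on upper_half_plane" using h(1) h'(1) unfolding mock_modular_form_def g_def by (intro holomorphic_intros) auto
    show "g r (\<tau> + 1) = e2pi (- (of_int r ^ 2) / (4 * of_nat m)) * g r \<tau>" if "Im \<tau> > 0" for \<tau>
      by (rule weight_half_tau_add_1[OF m per mod that])
    have "(\<lambda>\<tau>. e2pi (\<tau> / (4 * of_nat m)) * h r \<tau> - e2pi (\<tau> / (4 * of_nat m)) * h' r \<tau>) \<in> O[filtercomap Im at_top](\<lambda>_. 1)"
      using h(2) h'(2) unfolding optimal_growth_def by (intro sum_in_bigo) auto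
    thus "(\<lambda>\<tau>. e2pi (\<tau> / (4 * of_nat m)) * g r \<tau>) \<in> O[filtercomap Im at_top](\<lambda>_. 1)"
      by (simp add: g_def right_diff_distrib)
  qed
  then obtain d where "\<And>r. P r (d r)" using choice[of P] by blast
  hence d: "\<And>r n. d r n \<noteq> 0 \<Longrightarrow> r ^ 2 \<le> 4 * int m * n + 1"
      "\<And>r \<tau>. Im \<tau> > 0 \<Longrightarrow> ((\<lambda>n. d r n * hexp m n r \<tau>) has_sum g r \<tau>) UNIV" unfolding P_def by blast+
  define c where "c = (\<lambda>n r. d r n)"
  have sum: "((\<lambda>n. c n r * hexp m n r \<tau>) has_sum g r \<tau>) UNIV" if "Im \<tau> > 0" for r \<tau>
    using d(2)[OF that] by (simp add: c_def)
  have "jform m 1 c" by (rule jform_of_components[OF m sum per _ mod]) (auto simp: c_def intro: d(1))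
  moreover have "hcomp m c r \<tau> = h r \<tau> - h' r \<tau>" if "Im \<tau> > 0" for r \<tau>
    unfolding hcomp_def infsumI[OF sum[OF that]] by (simp add: g_def)
  ultimately show ?thesis by blast
qed

text \<open>A nonempty subset orthogonal to its complement and of least cardinality is irreducible.
  This is how m > 0 is obtained from the Coxeter numbers.\<close>

lemma irreducible_component_exists:
  assumes "root_system X" "X \<noteq> {}"
  shows "irreducible_components X \<noteq> {}"
proof -
  define P where "P = (\<lambda>D. D \<noteq> {} \<and> D \<subseteq> X \<and> (\<forall>\<alpha>\<in>D. \<forall>\<beta>\<in>X - D. \<alpha> \<bullet> \<beta> = 0))"
  have fin: "finite X" using assms by (simp add: root_system_def)
  have "P X" using assms by (auto simp: P_def)
  then obtain C where C': "P C" "\<And>D. P D \<Longrightarrow> card C \<le> card D" using ex_has_least_nat[of P X card] by blast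
  note C = C'(1)[unfolded P_def]
  have "irreducible_roots C" unfolding irreducible_roots_def
  proof (intro conjI allI impI)
    fix D assume D: "D \<subseteq> C" "\<forall>\<alpha>\<in>D. \<forall>\<beta>\<in>C - D. \<alpha> \<bullet> \<beta> = 0"
    show "D = {} \<or> D = C"
    proof (rule disjCI)
      assume "D \<noteq> C"
      show "D = {}"
      proof (rule ccontr)
        assume "D \<noteq> {}"
        have "P D" unfolding P_def
        proof (intro conjI ballI)
          fix \<alpha> \<beta> assume a: "\<alpha> \<in> D" "\<beta> \<in> X - D"
          thus "\<alpha> \<bullet> \<beta> = 0" using C D by (cases "\<beta> \<in> C") auto
        qed (use \<open>D \<noteq> {}\<close> C D in auto)
        hence "card C \<le> card D" by (rule C'(2))
        moreover have "finite C" using C fin finite_subset by blast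
        hence "card D < card C" using D(1) \<open>D \<noteq> C\<close> by (intro psubset_card_mono) auto
        ultimately show False by simp
      qed
    qed
  qed (use C in auto)
  thus ?thesis using C unfolding irreducible_components_def by blast
qed

lemma residue_class_mod: "residue_class m (r mod (2 * int m)) = residue_class m r"
  using residue_class_cong[of m "r mod (2 * int m)" "r div (2 * int m)"] by (simp add: mult.commute)

lemma unary_mod: "m > 0 \<Longrightarrow> unary m (r mod (2 * int m)) \<tau> = unary m r \<tau>"
  by (simp only: unary_def residue_class_mod)

text \<open>Multiplication by a permutes the residues modulo 2m and, as a^2 = 1 modulo 4m, preserves
  \<open>weil\<close>. It is an automorphism of the finite quadratic module and so commutes with the
  inversion.\<close>

lemma unary_square_root_inversion:
  assumes m: "m > 0" and a: "4 * int m dvd a ^ 2 - 1" and t: "Im \<tau> > 0"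
  shows "unary m (a * r) (- 1 / \<tau>) = \<tau> * rt (\<tau> / (2 * of_nat m)) *
     (\<Sum>s\<in>res m. weil m r s * unary m (a * s) \<tau>)"
proof -
  let ?F = "\<lambda>s. weil m (a * r) s * unary m s \<tau>"
  have "(\<Sum>s\<in>res m. ?F (a * s)) = (\<Sum>s\<in>res m. ?F s)"
  proof (rule sum_residues_reindex)
    show "?F (s mod (2 * int m)) = ?F s" for s
      using e2pi_mult_cong[OF _ m, of s "s mod (2 * int m)" "a * r"] by (simp add: unary_mod[OF m] minus_mod_eq_mult_div)
    show "s mod (2 * int m) = s' mod (2 * int m)" if "(a * s) mod (2 * int m) = (a * s') mod (2 * int m)" for s s'
    proof -
      have "2 * int m dvd a * (a * s - a * s')" using that by (simp add: mod_eq_dvd_iff)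
      moreover have "2 * int m dvd 4 * int m" by simp
      hence "2 * int m dvd (a ^ 2 - 1) * (s - s')" by (rule dvd_mult2[OF dvd_trans[OF _ a]])
      ultimately have "2 * int m dvd a * (a * s - a * s') - (a ^ 2 - 1) * (s - s')" by (rule dvd_diff)
      also have "a * (a * s - a * s') - (a ^ 2 - 1) * (s - s') = s - s'" by (simp add: algebra_simps power2_eq_square)
      finally show ?thesis by (simp add: mod_eq_dvd_iff)
    qed
  qed (use m in auto)
  moreover have "?F (a * s) = weil m r s * unary m (a * s) \<tau>" for s
  proof -
    have "int (2 * m) dvd a ^ 2 * s - s"
    proof -
      have "2 * int m dvd 4 * int m" by simp
      hence "2 * int m dvd (a ^ 2 - 1) * s" using a by (meson dvd_mult2 dvd_trans)
      thus ?thesis by (simp add: left_diff_distrib)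
    qed
    from e2pi_mult_cong[OF this m, of r] show ?thesis by (simp add: power2_eq_square mult_ac)
  qed
  ultimately have "(\<Sum>s\<in>res m. weil m r s * unary m (a * s) \<tau>) = (\<Sum>s\<in>res m. ?F s)" by (simp only:)
  thus ?thesis unfolding unary_inversion[OF m t] by (simp only:)
qed

text \<open>The weight 2 form \<open>\<Sum>\<^sub>r h\<^sub>r S\<^sub>m\<^sub>,\<^sub>a\<^sub>r\<close> has constant term \<open>2 c(n, a)\<close> if \<open>a\<^sup>2 - 4mn = 1\<close>.\<close>

lemma (in jacobi_form) no_polar_term:
  assumes B: "B \<le> 1" and a: "a ^ 2 = 4 * int m * n0 + 1"
  shows "c n0 a = 0"
proof -
  define R where "R = {0..<2 * int m}"
  \<comment> \<open>A common shift: 2 r^2 \<le> 8 m^2 for all r < 2m.\<close>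
  define M where "M = 8 * m ^ 2"
  define F where "F = (\<lambda>\<tau>. \<Sum>r\<in>R. hcomp m c r \<tau> * unary m (a * r) \<tau>)"
  have aa: "4 * int m dvd a ^ 2 - 1" using a by simp
  define h where "h = (\<lambda>r. Abs_fps (\<lambda>i. \<Sum>n\<in>{n\<in>{0..}. nat (8 * int m * n + (int M - 2 * r ^ 2)) = i}. c n r))"
  define u where "u = (\<lambda>r. Abs_fps (\<lambda>i. \<Sum>k\<in>{k\<in>residue_class m (a * r). nat (2 * k ^ 2) = i}. of_int k :: complex))"
  have rM: "2 * r ^ 2 \<le> int M" if "r \<in> R" for r
  proof -
    have "r ^ 2 \<le> (2 * int m) ^ 2" using that by (intro power_mono) (auto simp: R_def)
    thus ?thesis by (simp add: M_def power_mult_distrib)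
  qed
  note h = hcomp_fps[OF B rM, folded h_def]
  have finu: "finite {k\<in>residue_class m (a * r). nat (2 * k ^ 2) = i}" for r i by (rule finite_fibre[OF m, where c = 0]) simp
  have sumu: "((\<lambda>k. of_int k * qpow m (0 + int (nat (2 * k ^ 2))) \<tau>) has_sum unary m (a * r) \<tau>) (residue_class m (a * r))" if "Im \<tau> > 0" for \<tau> r
    using unary_exponent[OF m that] by simp
  have ur: "fps_conv_radius (u r) \<ge> 1" if "r \<in> R" for r unfolding u_def by (rule exponent_sum_fps(1)[OF m finu sumu])
  have u: "unary m (a * r) \<tau> = qpow m 0 \<tau> * eval_fps (u r) (qpow m 1 \<tau>)" if t: "Im \<tau> > 0" for \<tau> r
    unfolding u_def by (rule exponent_sum_fps(2)[OF m finu sumu t])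
  define f where "f = (\<Sum>r\<in>R. h r * u r)"
  have hr: "fps_conv_radius (h r) \<ge> 1" if "r \<in> R" for r using h(1)[OF that] by (simp add: h_def)
  have finR: "finite R" by (simp add: R_def)
  have f: "fps_conv_radius f \<ge> 1" "norm q < 1 \<Longrightarrow> eval_fps f q = (\<Sum>r\<in>R. eval_fps (h r) q * eval_fps (u r) q)" for q
    unfolding f_def by (rule eval_fps_sum_mult[OF m finR hr ur]; assumption)+
  have "fps_nth f M = 0"
  proof (rule weight_2_constant_term[OF m f(1), of F])
    show "F \<tau> = qpow m (- int M) \<tau> * eval_fps f (qpow m 1 \<tau>)" if t: "Im \<tau> > 0" for \<tau>
    proof -
      have "F \<tau> = (\<Sum>r\<in>R. qpow m (- int M) \<tau> * (eval_fps (h r) (qpow m 1 \<tau>) * eval_fps (u r) (qpow m 1 \<tau>)))"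
        unfolding F_def
      proof (rule sum.cong[OF refl])
        fix r assume r: "r \<in> R"
        have "unary m (a * r) \<tau> = eval_fps (u r) (qpow m 1 \<tau>)" using u[OF t, of r] by (simp add: qpow_0[OF m])
        moreover have "hcomp m c r \<tau> = qpow m (- int M) \<tau> * eval_fps (h r) (qpow m 1 \<tau>)" using h(2)[OF r t] by (simp add: h_def)
        ultimately show "hcomp m c r \<tau> * unary m (a * r) \<tau> = qpow m (- int M) \<tau> * (eval_fps (h r) (qpow m 1 \<tau>) * eval_fps (u r) (qpow m 1 \<tau>))"
          by (simp only: mult.assoc)
      qed
      thus ?thesis using f(2)[OF norm_qpow_less_1[OF m t]] by (simp only: sum_distrib_left)
    qed
    show "F (\<tau> + 1) = F \<tau>" if "Im \<tau> > 0" for \<tau> unfolding F_def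
    proof (rule sum.cong[OF refl])
      fix r
      obtain b where b: "a ^ 2 = 4 * int m * b + 1" using a by blast
      have "of_int ((a * r) ^ 2) = (4 * of_nat m * of_int b + 1) * (of_int r ^ 2 :: complex)" unfolding power_mult_distrib b by simp
      hence "- (of_int r ^ 2) / (4 * of_nat m) + disc m (a * r) = (of_int (b * r ^ 2) :: complex)" using m by (simp add: field_simps)
      hence "e2pi (- (of_int r ^ 2) / (4 * of_nat m)) * e2pi (disc m (a * r)) = 1" unfolding e2pi_add [symmetric] by (simp only: e2pi_of_int)
      moreover have "x * y = 1 \<Longrightarrow> x * p * (y * q) = p * q" for x y p q :: complex by (metis mult.assoc mult.left_commute mult_1_left)
      ultimately show "hcomp m c r (\<tau> + 1) * unary m (a * r) (\<tau> + 1) = hcomp m c r \<tau> * unary m (a * r) \<tau>"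
        unfolding hcomp_tau_add_1 unary_tau_add_1[OF m] by blast
    qed
    show "F (- 1 / \<tau>) = \<tau>\<^sup>2 * F \<tau>" if t: "Im \<tau> > 0" for \<tau> unfolding F_def R_def
      by (rule pairing_inversion[OF t, where G = "\<lambda>r. unary m (a * r)"]) (rule unary_square_root_inversion[OF m aa t])
  qed
  moreover have "fps_nth (h r * u r) M = fps_nth (h r) (M - 2) * fps_nth (u r) 2" if r: "r \<in> R" for r
  proof -
    have M2: "M \<ge> 2" using m by (simp add: M_def power2_eq_square)
    \<comment> \<open>In the constant term a theta exponent 2 k^2 meets an exponent 8mn - 2 r^2
      \<ge> -2 of h_r, and k = 0 has coefficient 0, so only k = 1 and k = -1 can contribute.\<close>
    have "fps_nth (h r) (M - j) * fps_nth (u r) j = 0" if j: "j \<le> M" "j \<noteq> 2" for j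
    proof (rule ccontr)
      assume nz: "fps_nth (h r) (M - j) * fps_nth (u r) j \<noteq> 0"
      obtain n where n: "n \<ge> 0" "nat (8 * int m * n + (int M - 2 * r ^ 2)) = M - j" "c n r \<noteq> 0"
        using nz unfolding h_def mult_eq_0_iff de_Morgan_disj fps_nth_Abs_fps by (auto elim!: sum.not_neutral_contains_not_neutral)
      obtain k where k: "nat (2 * k ^ 2) = j" "k \<noteq> 0"
        using nz unfolding u_def mult_eq_0_iff de_Morgan_disj fps_nth_Abs_fps by (auto elim!: sum.not_neutral_contains_not_neutral)
      have "0 \<le> 8 * int m * n" using n by simp
      hence "8 * int m * n - 2 * r ^ 2 = - int j" using n(2) rM[OF r] j by linarith
      moreover have "int j = 2 * k ^ 2" unfolding k(1) [symmetric] by simp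
      ultimately have "2 * k ^ 2 \<le> 2" using support[OF n(3)] B by linarith
      moreover have "k ^ 2 \<noteq> 1" using k j by auto
      moreover have "k ^ 2 > 0" using k by simp
      ultimately show False by linarith
    qed
    hence "(\<Sum>i=0..M. fps_nth (h r) (M - i) * fps_nth (u r) i) = (\<Sum>i=0..M. if i = 2 then fps_nth (h r) (M - 2) * fps_nth (u r) 2 else 0)"
      by (intro sum.cong) auto
    moreover have "fps_nth (h r * u r) M = (\<Sum>i=0..M. fps_nth (u r) i * fps_nth (h r) (M - i))"
      unfolding mult.commute[of "h r"] by (rule fps_mult_nth)
    ultimately show ?thesis using M2 by (simp add: mult.commute)
  qed
  ultimately have 0: "(\<Sum>r\<in>R. fps_nth (h r) (M - 2) * fps_nth (u r) 2) = 0" by (simp add: f_def fps_sum_nth)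
  have dvda: "int (2 * m) dvd b - a * r \<longleftrightarrow> int (2 * m) dvd a * b - r" for b r
  proof -
    have 2: "int (2 * m) dvd a ^ 2 - 1" using a by simp
    have e: "a * b - r = a * (b - a * r) + (a ^ 2 - 1) * r" "b - a * r = a * (a * b - r) - (a ^ 2 - 1) * b"
      by (simp_all add: algebra_simps power2_eq_square)
    have "d dvd x \<Longrightarrow> d dvd A \<Longrightarrow> d dvd a * x + A * r" "d dvd y \<Longrightarrow> d dvd A \<Longrightarrow> d dvd a * y - A * b" for d x y A :: int
      by simp_all
    thus ?thesis using 2 e by metis
  qed
  have u2: "fps_nth (u r) 2 = (if int (2 * m) dvd a - r then 1 else 0) + (if int (2 * m) dvd - a - r then - 1 else 0)" for r
  proof -
    have "k \<in> {1, - 1}" if "nat (2 * k ^ 2) = 2" for k :: int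
    proof -
      have "k ^ 2 = 1" using that by linarith
      thus ?thesis by (simp add: power2_eq_1_iff)
    qed
    hence "{k\<in>residue_class m (a * r). nat (2 * k ^ 2) = 2} = {k\<in>{1, - 1}. int (2 * m) dvd k - a * r}" unfolding residue_class_iff by auto
    hence "fps_nth (u r) 2 = (\<Sum>k\<in>{k\<in>{1, - 1}. int (2 * m) dvd k - a * r}. of_int k)" by (simp add: u_def)
    also have "\<dots> = (\<Sum>k\<in>{1, - 1}. if int (2 * m) dvd k - a * r then of_int k else 0)" by (rule sum.inter_filter) simp
    finally show ?thesis unfolding dvda by simp
  qed
  \<comment> \<open>The elliptic law moves the polar coefficient at (n0, s) to the residue r of s
    modulo 2m, with n0 replaced by the n' of the same discriminant.\<close>
  have hval: "fps_nth (h (s mod (2 * int m))) (M - 2) = c n0 s" if s: "s ^ 2 = 4 * int m * n0 + 1" for s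
  proof -
    define r where "r = s mod (2 * int m)"
    define l where "l = s div (2 * int m)"
    have sr: "s = r + 2 * int m * l" by (simp add: r_def l_def)
    define n' where "n' = n0 - r * l - int m * l ^ 2"
    have r2: "r ^ 2 = 4 * int m * n' + 1" using s unfolding n'_def sr by (simp add: algebra_simps power2_eq_square)
    have cn: "c n' r = c n0 s" using elliptic[of n' r l] by (simp add: n'_def sr)
    have "n' \<ge> 0"
    proof (rule ccontr)
      assume "\<not> n' \<ge> 0"
      hence "4 * int m * n' \<le> 4 * int m * (-1)" using m by (intro mult_left_mono) auto
      thus False using r2 zero_le_power2[of r] m by linarith
    qed
    have "r \<in> R" using m by (simp add: r_def R_def)
    have M2: "int (M - 2) = int M - 2" using m by (simp add: M_def power2_eq_square of_nat_diff)
    have "{n\<in>{0..}. nat (8 * int m * n + (int M - 2 * r ^ 2)) = M - 2} = {n'}"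
    proof (intro equalityI subsetI)
      fix n assume "n \<in> {n\<in>{0..}. nat (8 * int m * n + (int M - 2 * r ^ 2)) = M - 2}"
      hence n: "n \<ge> 0" "nat (8 * int m * n + (int M - 2 * r ^ 2)) = M - 2" by auto
      hence "8 * int m * n \<ge> 0" by simp
      hence "8 * int m * n + (int M - 2 * r ^ 2) = int M - 2" using n(2) rM[OF \<open>r \<in> R\<close>] M2 by linarith
      hence "8 * int m * n = 8 * int m * n'" using r2 by simp
      thus "n \<in> {n'}" using m by simp
    next
      fix n assume "n \<in> {n'}"
      hence "8 * int m * n + (int M - 2 * r ^ 2) = int (M - 2)" using r2 M2 by simp
      thus "n \<in> {n\<in>{0..}. nat (8 * int m * n + (int M - 2 * r ^ 2)) = M - 2}" using \<open>n' \<ge> 0\<close> \<open>n \<in> {n'}\<close> by simp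
    qed
    thus ?thesis using cn by (simp add: h_def r_def [symmetric])
  qed
  have "(\<Sum>r\<in>R. fps_nth (h r) (M - 2) * fps_nth (u r) 2) =
      (\<Sum>r\<in>R. if int (2 * m) dvd a - r then fps_nth (h r) (M - 2) else 0) - (\<Sum>r\<in>R. if int (2 * m) dvd - a - r then fps_nth (h r) (M - 2) else 0)"
    unfolding sum_subtractf [symmetric] u2 by (rule sum.cong) auto
  also have "\<dots> = c n0 a - c n0 (- a)" unfolding R_def sum_residue[OF m] using hval[of a] hval[of "- a"] a by simp
  also have "\<dots> = 2 * c n0 a" by (simp add: odd_coeff)
  finally show ?thesis using 0 by simp
qed

lemma jform_0_of_1:
  assumes m: "m > 0" and c: "jform m 1 c"
  shows "jform m 0 c"
proof -
  interpret jacobi_form m 1 c by standard (use m c in auto)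
  have "r ^ 2 \<le> 4 * int m * n + 0" if "c n r \<noteq> 0" for n r using support[OF that] no_polar_term[of r n] that by fastforce
  thus ?thesis using c unfolding jform_def by blast
qed

section \<open>Hecke operators\<close>

lemma (in theta_expansion) jphi_elliptic:
  assumes t: "Im \<tau> > 0"
  shows "jphi c \<tau> (z + of_int l * \<tau> + of_int k) = e2pi (- (of_nat m * (of_int l ^ 2 * \<tau> + 2 * of_int l * z))) * jphi c \<tau> z"
proof -
  let ?E = "e2pi (- (of_nat m * (of_int l ^ 2 * \<tau> + 2 * of_int l * z)))"
  have "((\<lambda>x. ?E * (case x of (n, r) \<Rightarrow> c n r * fexp n r \<tau> z)) has_sum ?E * jphi c \<tau> z) UNIV"
    by (rule has_sum_cmult_right[OF jphi_has_sum[OF t]])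
  hence "((\<lambda>(n, r). c n r * fexp n r \<tau> (z + of_int l * \<tau> + of_int k)) has_sum ?E * jphi c \<tau> z) UNIV"
  proof (rule iffD1[OF has_sum_reindex_bij_witness[of UNIV "\<lambda>(n, r). (n + r * l + int m * l ^ 2, r + 2 * int m * l)"
        "\<lambda>(n, r). (n - r * l + int m * l ^ 2, r - 2 * int m * l)" UNIV], rotated -1])
    fix x :: "int \<times> int"
    obtain n' r' where x: "x = (n', r')" by force
    define n where "n = n' - r' * l + int m * l ^ 2"
    define r where "r = r' - 2 * int m * l"
    have n': "n' = n + r * l + int m * l ^ 2" "r' = r + 2 * int m * l" by (simp_all add: n_def r_def algebra_simps power2_eq_square)
    have "of_int n * \<tau> + of_int r * (z + of_int l * \<tau> + of_int k) = - (of_nat m * (of_int l ^ 2 * \<tau> + 2 * of_int l * z)) + (of_int n' * \<tau> + of_int r' * z) + of_int (r * k)"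
      unfolding n' by (simp add: algebra_simps power2_eq_square)
    hence "fexp n r \<tau> (z + of_int l * \<tau> + of_int k) = ?E * fexp n' r' \<tau> z" by (simp only: e2pi_add e2pi_of_int mult_1_right)
    moreover have "c n' r' = c n r" unfolding n' by (rule elliptic)
    ultimately show "(case case x of (n, r) \<Rightarrow> (n - r * l + int m * l ^ 2, r - 2 * int m * l) of
        (n, r) \<Rightarrow> c n r * fexp n r \<tau> (z + of_int l * \<tau> + of_int k)) =
        ?E * (case x of (n, r) \<Rightarrow> c n r * fexp n r \<tau> z)" by (simp add: x n_def r_def)
  qed (auto simp: algebra_simps power2_eq_square)
  with jphi_has_sum[OF t] show ?thesis by (rule has_sum_unique)
qed

text \<open>In the characteristics \<open>a\<close>, \<open>b\<close> the elliptic law becomes a character and \<open>SL\<^sub>2(\<int>)\<close> acts by a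
  linear substitution.\<close>

definition tilde :: "nat \<Rightarrow> (int \<Rightarrow> int \<Rightarrow> complex) \<Rightarrow> complex \<Rightarrow> complex \<Rightarrow> complex \<Rightarrow> complex" where
  "tilde m c \<tau> a b = e2pi (of_nat m * (a * (a * \<tau> + b))) * jphi c \<tau> (a * \<tau> + b)"

lemma (in theta_expansion) tilde_elliptic:
  assumes t: "Im \<tau> > 0"
  shows "tilde m c \<tau> (a + of_int l) (b + of_int k) = e2pi (- (of_nat m * (of_int l * b - of_int k * a))) * tilde m c \<tau> a b"
proof -
  have "(a + of_int l) * \<tau> + (b + of_int k) = (a * \<tau> + b) + of_int l * \<tau> + of_int k" by (simp add: algebra_simps)
  hence "tilde m c \<tau> (a + of_int l) (b + of_int k) =
      (e2pi (of_nat m * ((a + of_int l) * ((a + of_int l) * \<tau> + (b + of_int k)))) * e2pi (- (of_nat m * (of_int l ^ 2 * \<tau> + 2 * of_int l * (a * \<tau> + b))))) * jphi c \<tau> (a * \<tau> + b)"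
    unfolding tilde_def by (simp only: jphi_elliptic[OF t] mult.assoc)
  also have "e2pi (of_nat m * ((a + of_int l) * ((a + of_int l) * \<tau> + (b + of_int k)))) * e2pi (- (of_nat m * (of_int l ^ 2 * \<tau> + 2 * of_int l * (a * \<tau> + b)))) =
      e2pi (- (of_nat m * (of_int l * b - of_int k * a))) * e2pi (of_nat m * (a * (a * \<tau> + b)))"
  proof -
    have "of_nat m * ((a + of_int l) * ((a + of_int l) * \<tau> + (b + of_int k))) + - (of_nat m * (of_int l ^ 2 * \<tau> + 2 * of_int l * (a * \<tau> + b))) =
       - (of_nat m * (of_int l * b - of_int k * a)) + of_nat m * (a * (a * \<tau> + b)) + of_int (int m * l * k)"
      by (simp add: algebra_simps power2_eq_square)
    thus ?thesis by (simp only: e2pi_add [symmetric]) (simp only: e2pi_add e2pi_of_int mult_1_right)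
  qed
  finally show ?thesis by (simp only: tilde_def mult.assoc)
qed

text \<open>The exponential in \<open>tilde\<close> absorbs that of the weight 1 action: if z/j is
  the new argument, then a z/j = (a p + b r) z - r z^2/j.\<close>

lemma tilde_modular:
  assumes f: "\<And>z. jact m p q r s c \<tau> z = jphi c \<tau> z"
    and det: "p * s - q * r = (1::int)" and t: "Im \<tau> > 0"
  shows "tilde m c ((of_int p * \<tau> + of_int q) / (of_int r * \<tau> + of_int s)) a b =
    (of_int r * \<tau> + of_int s) * tilde m c \<tau> (a * of_int p + b * of_int r) (a * of_int q + b * of_int s)"
proof -
  define j where "j = of_int r * \<tau> + of_int s"
  have j: "j \<noteq> 0" unfolding j_def by (rule Im_moebius(2)[OF det t])
  define \<tau>' where "\<tau>' = (of_int p * \<tau> + of_int q) / j"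
  define z where "z = (a * of_int p + b * of_int r) * \<tau> + (a * of_int q + b * of_int s)"
  have zj: "a * \<tau>' + b = z / j"
  proof -
    have "z = a * (of_int p * \<tau> + of_int q) + b * j" by (simp add: z_def j_def algebra_simps)
    thus ?thesis using j by (simp add: \<tau>'_def field_simps)
  qed
  have ps: "of_int p * of_int s - of_int q * of_int r = (1 :: complex)" using arg_cong[OF det, of "of_int :: int \<Rightarrow> complex"] by simp
  have "a = (of_int p * of_int s - of_int q * of_int r) * a" by (simp add: ps)
  also have "\<dots> = (a * of_int p + b * of_int r) * j - of_int r * z" by (simp add: z_def j_def algebra_simps)
  finally have a: "a = (a * of_int p + b * of_int r) * j - of_int r * z" .
  have "e2pi (of_nat m * (a * (z / j))) = e2pi (of_nat m * ((a * of_int p + b * of_int r) * z)) * e2pi (- of_nat m * (of_int r * z ^ 2 / j))"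
  proof -
    have "a * (z / j) = (a * of_int p + b * of_int r) * z - of_int r * z ^ 2 / j" using j by (subst a) (simp add: field_simps power2_eq_square)
    thus ?thesis unfolding e2pi_add [symmetric] by (simp add: right_diff_distrib)
  qed
  moreover have "e2pi (- of_nat m * (of_int r * z ^ 2 / j)) * inverse j * jphi c \<tau>' (z / j) = jphi c \<tau> z"
    using f[of z] by (simp only: j_def \<tau>'_def)
  hence "e2pi (- of_nat m * (of_int r * z ^ 2 / j)) * jphi c \<tau>' (z / j) = j * jphi c \<tau> z" using j by (simp add: field_simps)
  moreover have "E = X * Y \<Longrightarrow> Y * P = j * Q \<Longrightarrow> E * P = j * (X * Q)" for E X Y P Q :: complex
    by (simp add: mult.assoc mult.left_commute)
  ultimately have "tilde m c \<tau>' a b = j * tilde m c \<tau> (a * of_int p + b * of_int r) (a * of_int q + b * of_int s)"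
    unfolding tilde_def zj z_def [symmetric] by blast
  thus ?thesis by (simp only: \<tau>'_def j_def)
qed

section \<open>Integral matrices of determinant p^2\<close>

type_synonym mat = "int \<times> int \<times> int \<times> int"

fun mmul :: "mat \<Rightarrow> mat \<Rightarrow> mat" where
  "mmul (A, B, C, D) (A', B', C', D') = (A * A' + B * C', A * B' + B * D', C * A' + D * C', C * B' + D * D')"

fun mdet :: "mat \<Rightarrow> int" where
  "mdet (A, B, C, D) = A * D - B * C"

fun madj :: "mat \<Rightarrow> mat" where
  "madj (A, B, C, D) = (D, - B, - C, A)"

fun jfac :: "mat \<Rightarrow> complex \<Rightarrow> complex" where
  "jfac (A, B, C, D) \<tau> = of_int C * \<tau> + of_int D"

fun mob :: "mat \<Rightarrow> complex \<Rightarrow> complex" where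
  "mob (A, B, C, D) \<tau> = (of_int A * \<tau> + of_int B) / (of_int C * \<tau> + of_int D)"

lemma mdet_mmul: "mdet (mmul M N) = mdet M * mdet N"
  by (cases M; cases N) (simp add: algebra_simps)

lemma mmul_assoc: "mmul (mmul L M) N = mmul L (mmul M N)"
  by (cases L; cases M; cases N) (simp add: algebra_simps)

lemma mmul_madj: "mdet M = 1 \<Longrightarrow> mmul (madj M) (mmul M N) = N" "mdet M = 1 \<Longrightarrow> mmul M (mmul (madj M) N) = N"
    "mdet M = 1 \<Longrightarrow> mmul (mmul N M) (madj M) = N" "mdet (madj M) = mdet M"
proof -
  show "mdet M = 1 \<Longrightarrow> mmul (madj M) (mmul M N) = N" unfolding mmul_assoc [symmetric] by (cases M; cases N) (simp add: algebra_simps)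
  show "mdet M = 1 \<Longrightarrow> mmul M (mmul (madj M) N) = N" unfolding mmul_assoc [symmetric] by (cases M; cases N) (simp add: algebra_simps)
  show "mdet M = 1 \<Longrightarrow> mmul (mmul N M) (madj M) = N" unfolding mmul_assoc by (cases M; cases N) (simp add: algebra_simps)
  show "mdet (madj M) = mdet M" by (cases M) (simp add: algebra_simps)
qed

lemma jfac_nz: "mdet N > 0 \<Longrightarrow> Im \<tau> > 0 \<Longrightarrow> jfac N \<tau> \<noteq> 0"
proof (cases N)
  case (fields A B C D)
  assume *: "mdet N > 0" "Im \<tau> > 0"
  show "jfac N \<tau> \<noteq> 0"
  proof
    assume 0: "jfac N \<tau> = 0"
    have "Im (jfac N \<tau>) = of_int C * Im \<tau>" by (simp add: fields)
    hence "C = 0" using 0 *(2) by simp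
    moreover from this have "D = 0" using 0 by (simp add: fields)
    ultimately show False using *(1) by (simp add: fields)
  qed
qed

lemma Im_mob: "mdet N > 0 \<Longrightarrow> Im \<tau> > 0 \<Longrightarrow> Im (mob N \<tau>) > 0"
proof (cases N)
  case (fields A B C D)
  assume *: "mdet N > 0" "Im \<tau> > 0"
  have nz: "jfac N \<tau> \<noteq> 0" by (rule jfac_nz[OF *])
  have "Im (mob N \<tau>) = real_of_int (mdet N) * Im \<tau> / (norm (jfac N \<tau>))\<^sup>2"
    by (simp add: fields Im_divide cmod_power2 algebra_simps)
  thus ?thesis using * nz by simp
qed

lemma mob_mmul:
  assumes "mdet N > 0" "Im \<tau> > 0"
  shows "mob (mmul M N) \<tau> = mob M (mob N \<tau>)" "jfac (mmul M N) \<tau> = jfac M (mob N \<tau>) * jfac N \<tau>"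
proof -
  obtain A B C D A' B' C' D' where e: "M = (A, B, C, D)" "N = (A', B', C', D')" using prod_cases4 by metis
  define j where "j = of_int C' * \<tau> + of_int D'"
  have j: "j \<noteq> 0" using jfac_nz[OF assms] by (simp add: e j_def)
  have 1: "(of_int X * \<tau>1 + of_int Y) * j = of_int (X * A' + Y * C') * \<tau> + of_int (X * B' + Y * D')" if "\<tau>1 = (of_int A' * \<tau> + of_int B') / j" for X Y \<tau>1
  proof -
    have "(of_int X * \<tau>1 + of_int Y) * j = of_int X * (\<tau>1 * j) + of_int Y * j" by (simp add: algebra_simps)
    also have "\<tau>1 * j = of_int A' * \<tau> + of_int B'" using that j by simp
    finally show ?thesis by (simp add: j_def algebra_simps)
  qed
  have m: "mob N \<tau> = (of_int A' * \<tau> + of_int B') / j" by (simp add: e j_def)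
  show "jfac (mmul M N) \<tau> = jfac M (mob N \<tau>) * jfac N \<tau>" using 1[OF m, of C D] by (simp add: e j_def)
  have "mob M (mob N \<tau>) = (of_int A * mob N \<tau> + of_int B) * j / ((of_int C * mob N \<tau> + of_int D) * j)" using j by (simp add: e)
  also have "\<dots> = mob (mmul M N) \<tau>" unfolding 1[OF m] by (simp add: e)
  finally show "mob (mmul M N) \<tau> = mob M (mob N \<tau>)" ..
qed

fun vmul1 :: "mat \<Rightarrow> complex \<Rightarrow> complex \<Rightarrow> complex" where
  "vmul1 (A, B, C, D) a b = a * of_int A + b * of_int C"

fun vmul2 :: "mat \<Rightarrow> complex \<Rightarrow> complex \<Rightarrow> complex" where
  "vmul2 (A, B, C, D) a b = a * of_int B + b * of_int D"

lemma vmul_mmul: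
  "vmul1 N (vmul1 M a b) (vmul2 M a b) = vmul1 (mmul M N) a b" "vmul2 N (vmul1 M a b) (vmul2 M a b) = vmul2 (mmul M N) a b"
  by (cases M; cases N; simp add: algebra_simps)+

lemma vmul_divide: "vmul1 M (a / k) (b / k) = vmul1 M a b / k" "vmul2 M (a / k) (b / k) = vmul2 M a b / k"
  by (cases M; simp add: add_divide_distrib)+

lemma madj_mmul: "madj (mmul M N) = mmul (madj N) (madj M)"
  by (cases M; cases N) (simp add: algebra_simps)

text \<open>The weight 1 action of N/p, which has determinant 1 when \<open>mdet N\<close> is p^2:
  its inverse is \<open>madj N\<close> divided by p, and p over \<open>jfac N\<close> is the
  automorphy factor.\<close>

definition slash :: "nat \<Rightarrow> (int \<Rightarrow> int \<Rightarrow> complex) \<Rightarrow> int \<Rightarrow> mat \<Rightarrow> complex \<Rightarrow> complex \<Rightarrow> complex \<Rightarrow> complex" where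
  "slash m c p N \<tau> a b = of_int p / jfac N \<tau> *
     tilde m c (mob N \<tau>) (vmul1 (madj N) a b / of_int p) (vmul2 (madj N) a b / of_int p)"

lemma (in jacobi_form) tilde_mob:
  assumes "mdet G = 1" "Im \<tau> > 0"
  shows "tilde m c (mob G \<tau>) a b = jfac G \<tau> * tilde m c \<tau> (vmul1 G a b) (vmul2 G a b)"
proof (cases G)
  case (fields p q r s)
  have det: "p * s - q * r = 1" using assms(1) by (simp add: fields)
  show ?thesis unfolding fields mob.simps jfac.simps vmul1.simps vmul2.simps by (rule tilde_modular[OF modular[OF det assms(2)] det assms(2)])
qed

lemma (in jacobi_form) slash_left:
  assumes G: "mdet G = 1" and N: "mdet N > 0" and t: "Im \<tau> > 0"
  shows "slash m c p (mmul G N) \<tau> a b = slash m c p N \<tau> a b"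
proof -
  have G0: "mdet G > 0" using G by simp
  have nz: "jfac G (mob N \<tau>) \<noteq> 0" by (rule jfac_nz[OF G0 Im_mob[OF N t]])
  have "madj (madj G) = G" by (cases G) simp
  hence "mmul (mmul (madj N) (madj G)) G = madj N" using mmul_madj(3)[of "madj G" "madj N"] G by (simp add: mmul_madj)
  hence v: "vmul1 G (vmul1 (madj (mmul G N)) a b / of_int p) (vmul2 (madj (mmul G N)) a b / of_int p) = vmul1 (madj N) a b / of_int p"
    "vmul2 G (vmul1 (madj (mmul G N)) a b / of_int p) (vmul2 (madj (mmul G N)) a b / of_int p) = vmul2 (madj N) a b / of_int p"
    unfolding vmul_divide vmul_mmul madj_mmul by simp_all
  show ?thesis unfolding slash_def mob_mmul[OF N t] tilde_mob[OF G Im_mob[OF N t]] v using nz by simp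
qed

lemma slash_right:
  assumes G: "mdet G = 1" and N: "mdet N > 0" and t: "Im \<tau> > 0"
  shows "slash m c p N (mob G \<tau>) a b = jfac G \<tau> * slash m c p (mmul N G) \<tau> (vmul1 G a b) (vmul2 G a b)"
proof -
  have G0: "mdet G > 0" using G by simp
  have nz: "jfac G \<tau> \<noteq> 0" by (rule jfac_nz[OF G0 t])
  have "mmul G (mmul (madj G) (madj N)) = madj N" by (rule mmul_madj(2)[OF G])
  hence v: "vmul1 (madj (mmul N G)) (vmul1 G a b) (vmul2 G a b) = vmul1 (madj N) a b"
    "vmul2 (madj (mmul N G)) (vmul1 G a b) (vmul2 G a b) = vmul2 (madj N) a b" unfolding vmul_mmul madj_mmul by simp_all
  show ?thesis unfolding slash_def v mob_mmul[OF G0 t] using nz by simp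
qed

lemma (in jacobi_form) slash_elliptic:
  assumes N: "mdet N = p ^ 2" and p: "p > 0" and t: "Im \<tau> > 0"
  shows "slash m c p N \<tau> (a + of_int (p * l)) (b + of_int (p * k)) = e2pi (- (of_nat m * of_int p * (of_int l * b - of_int k * a))) * slash m c p N \<tau> a b"
proof (cases N)
  case (fields A B C D)
  have N0: "mdet N > 0" using N p by simp
  have "of_int (A * D - B * C) = (of_int p ^ 2 :: complex)" using N by (simp add: fields)
  hence det: "of_int A * of_int D - of_int B * of_int C = (of_int p ^ 2 :: complex)" by simp
  have p0: "of_int p \<noteq> (0 :: complex)" using p by simp
  have v: "vmul1 (madj N) (a + of_int (p * l)) (b + of_int (p * k)) / of_int p = vmul1 (madj N) a b / of_int p + of_int (l * D - k * C)"
    "vmul2 (madj N) (a + of_int (p * l)) (b + of_int (p * k)) / of_int p = vmul2 (madj N) a b / of_int p + of_int (k * A - l * B)"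
    using p0 by (simp_all add: fields field_simps)
  have "of_int (l * D - k * C) * (vmul2 (madj N) a b / of_int p) - of_int (k * A - l * B) * (vmul1 (madj N) a b / of_int p) =
      (of_int A * of_int D - of_int B * of_int C) / of_int p * (of_int l * b - of_int k * a)"
    by (simp add: fields diff_divide_distrib [symmetric]) (simp add: algebra_simps)
  also have "\<dots> = of_int p * (of_int l * b - of_int k * a)" unfolding det using p0 by (simp add: power2_eq_square)
  finally have w: "of_nat m * (of_int (l * D - k * C) * (vmul2 (madj N) a b / of_int p) - of_int (k * A - l * B) * (vmul1 (madj N) a b / of_int p)) =
      of_nat m * of_int p * (of_int l * b - of_int k * a)" by (simp only: mult.assoc)
  show ?thesis unfolding slash_def v tilde_elliptic[OF Im_mob[OF N0 t]] w by (simp only: mult_ac)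
qed

text \<open>The Hermite normal forms of determinant p^2, one for each coset, the scalar matrix p
  included.\<close>

definition reps :: "int \<Rightarrow> mat set" where
  "reps p = insert (p ^ 2, 0, 0, 1) ((\<lambda>b. (p, b, 0, p)) ` {0..<p} \<union> (\<lambda>b. (1, b, 0, p ^ 2)) ` {0..<p ^ 2})"

text \<open>A Bezout relation for the first column yields a unimodular matrix that makes N upper
  triangular with the gcd in the corner; a translation then reduces the upper right entry modulo the
  lower right one.\<close>

lemma hermite_exists:
  assumes p: "prime p" and N: "mdet N = p ^ 2"
  shows "\<exists>G M. mdet G = 1 \<and> M \<in> reps p \<and> N = mmul G M"
proof -
  obtain A B C D where e: "N = (A, B, C, D)" using prod_cases4 by metis
  have p0: "p > 0" using p by (simp add: prime_gt_0_int)
  have det: "A * D - B * C = p ^ 2" using N by (simp add: e)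
  define g where "g = gcd A C"
  obtain u v where uv: "u * A + v * C = g" using bezout_int[of A C] by (auto simp: g_def)
  have "g \<noteq> 0" using det p0 by (auto simp: g_def)
  hence g: "g > 0" by (simp add: g_def)
  obtain A' C' where A': "A = g * A'" "C = g * C'" by (metis g_def gcd_dvd1 gcd_dvd2 dvd_def)
  have "g * (u * A' + v * C') = g * 1" using uv by (simp add: A' algebra_simps)
  hence uv': "u * A' + v * C' = 1" using g by (subst (asm) mult_cancel_left) auto
  define d where "d = A' * D - C' * B"
  have gd: "g * d = p ^ 2" using det by (simp add: d_def A' algebra_simps)
  define x where "x = u * B + v * D"
  define M :: mat where "M = (g, x mod d, 0, d)"
  define G where "G = mmul (1, - (x div d), 0, 1) (u, v, - C', A')"
  have "mdet G = 1" using uv' by (simp add: G_def mdet_mmul algebra_simps)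
  have "g dvd p ^ 2" using gd by (metis dvd_triv_left)
  then obtain i where "i \<le> 2" "g = p ^ i" using divides_primepow_weak[OF p, of g 2] g p0 by auto
  moreover have "i = 0 \<or> i = 1 \<or> i = 2" using \<open>i \<le> 2\<close> by auto
  ultimately have gc: "g = 1 \<and> d = p ^ 2 \<or> g = p \<and> d = p \<or> g = p ^ 2 \<and> d = 1" using gd p0 by (auto simp: power2_eq_square)
  have "M \<in> reps p" using gc p0 by (auto simp: M_def reps_def)
  moreover have "mmul G N = M"
  proof -
    have "mmul (u, v, - C', A') N = (g, x, 0, d)" using uv by (simp add: e d_def x_def) (simp add: A' algebra_simps)
    moreover have "x - x div d * d = x mod d" by (simp add: minus_div_mult_eq_mod)
    ultimately show ?thesis unfolding G_def mmul_assoc M_def by simp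
  qed
  hence "N = mmul (madj G) M" using mmul_madj(1)[OF \<open>mdet G = 1\<close>, of N] by simp
  moreover have "mdet (madj G) = 1" using \<open>mdet G = 1\<close> by (simp add: mmul_madj)
  ultimately show ?thesis by blast
qed

lemma hermite_unique:
  assumes p: "p > 0" and M: "M \<in> reps p" "M' \<in> reps p" and G: "mdet G = 1" "mmul G M = M'"
  shows "M = M'"
proof -
  have rep: "\<exists>a b d. M = (a, b, 0, d) \<and> a > 0 \<and> d > 0 \<and> 0 \<le> b \<and> b < d" if "M \<in> reps p" for M
    using that p by (auto simp: reps_def)
  obtain a b d where 1: "M = (a, b, 0, d)" "a > 0" "d > 0" "0 \<le> b" "b < d" using rep[OF M(1)] by blast
  obtain a' b' d' where 2: "M' = (a', b', 0, d')" "a' > 0" "0 \<le> b'" "b' < d'" using rep[OF M(2)] by blast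
  obtain x y z w where g: "G = (x, y, z, w)" using prod_cases4 by metis
  have eq: "x * a = a'" "x * b + y * d = b'" "z * a = 0" "z * b + w * d = d'" and det: "x * w - y * z = 1" using G by (auto simp: 1 2 g)
  have z: "z = 0" using eq(3) 1 by simp
  have "x > 0" using eq(1) 1 2 by (metis zero_less_mult_pos2)
  moreover have "x * w = 1" using det z by simp
  ultimately have xw: "x = 1" "w = 1" using zmult_eq_1_iff[of x w] by auto
  have "d = d'" using eq z xw by simp
  moreover have "b = b'"
  proof -
    have "b' mod d = b mod d" using eq(2) xw by (metis mod_mult_self1 mult_1)
    thus ?thesis using 1 2 \<open>d = d'\<close> by simp
  qed
  ultimately show ?thesis using 1 2 eq xw by simp
qed

lemma finite_reps: "finite (reps p)" by (simp add: reps_def)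

lemma mdet_reps: "M \<in> reps p \<Longrightarrow> mdet M = p ^ 2"
  by (auto simp: reps_def power2_eq_square)

context jacobi_form
begin

definition hecke_sum :: "int \<Rightarrow> complex \<Rightarrow> complex \<Rightarrow> complex \<Rightarrow> complex" where
  "hecke_sum p \<tau> a b = (\<Sum>M\<in>reps p. slash m c p M \<tau> a b)"

text \<open>Right multiplication by G permutes the cosets: the normal form \<open>\<theta> M\<close>
  of M G determines M, by \<open>hermite_unique\<close>.\<close>

lemma hecke_sum_modular:
  assumes p: "prime p" and G: "mdet G = 1" and t: "Im \<tau> > 0"
  shows "hecke_sum p (mob G \<tau>) a b = jfac G \<tau> * hecke_sum p \<tau> (vmul1 G a b) (vmul2 G a b)"
proof -
  have p0: "p > 0" using p by (simp add: prime_gt_0_int)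
  hence pos: "mdet M > 0" if "M \<in> reps p" for M using mdet_reps[OF that] by simp
  have "\<exists>L M'. mdet L = 1 \<and> M' \<in> reps p \<and> mmul M G = mmul L M'" if "M \<in> reps p" for M
    by (rule hermite_exists[OF p]) (simp add: mdet_mmul G mdet_reps[OF that])
  then obtain \<theta> \<Lambda> where th: "\<And>M. M \<in> reps p \<Longrightarrow> mdet (\<Lambda> M) = 1" "\<And>M. M \<in> reps p \<Longrightarrow> \<theta> M \<in> reps p"
      "\<And>M. M \<in> reps p \<Longrightarrow> mmul M G = mmul (\<Lambda> M) (\<theta> M)" by metis
  have inj: "inj_on \<theta> (reps p)"
  proof (rule inj_onI)
    fix M M' assume M: "M \<in> reps p" "M' \<in> reps p" "\<theta> M = \<theta> M'"
    define L where "L = mmul (\<Lambda> M') (madj (\<Lambda> M))"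
    have "mmul M' G = mmul L (mmul M G)" using M th(3)[of M] th(3)[of M'] by (simp add: L_def mmul_assoc mmul_madj(1)[OF th(1)])
    hence "mmul (mmul M' G) (madj G) = mmul L (mmul (mmul M G) (madj G))" by (simp add: mmul_assoc)
    hence "mmul L M = M'" unfolding mmul_madj(3)[OF G] ..
    moreover have "mdet L = 1" using M th(1) by (simp add: L_def mdet_mmul mmul_madj)
    ultimately show "M = M'" using hermite_unique[OF p0 M(1,2)] by blast
  qed
  have "\<theta> ` reps p = reps p" by (rule endo_inj_surj[OF finite_reps _ inj]) (use th in auto)
  hence "(\<Sum>M\<in>reps p. slash m c p M \<tau> (vmul1 G a b) (vmul2 G a b)) = (\<Sum>M\<in>reps p. slash m c p (\<theta> M) \<tau> (vmul1 G a b) (vmul2 G a b))"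
    using sum.reindex[OF inj, of "\<lambda>M. slash m c p M \<tau> (vmul1 G a b) (vmul2 G a b)"] by (simp add: o_def)
  also have "\<dots> = (\<Sum>M\<in>reps p. slash m c p (mmul M G) \<tau> (vmul1 G a b) (vmul2 G a b))"
    by (rule sum.cong) (use slash_left[OF th(1) pos[OF th(2)] t] th(3) in auto)
  finally show ?thesis unfolding hecke_sum_def by (simp add: slash_right[OF G pos t] sum_distrib_left [symmetric])
qed

lemma hecke_sum_elliptic:
  assumes p: "p > 0" and t: "Im \<tau> > 0"
  shows "hecke_sum p \<tau> (a + of_int (p * l)) (b + of_int (p * k)) = e2pi (- (of_nat m * of_int p * (of_int l * b - of_int k * a))) * hecke_sum p \<tau> a b"
  unfolding hecke_sum_def sum_distrib_left by (rule sum.cong) (simp_all only: slash_elliptic[OF mdet_reps p t])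

text \<open>The exponential inverts the multiplier of the elliptic law, so that a summand depends on
  l and k modulo p only.\<close>

definition hecke_average :: "int \<Rightarrow> complex \<Rightarrow> complex \<Rightarrow> complex \<Rightarrow> complex" where
  "hecke_average p \<tau> a b = (\<Sum>(l, k)\<in>{0..<p} \<times> {0..<p}. e2pi (of_nat m * (of_int l * b - of_int k * a)) * hecke_sum p \<tau> (a + of_int l) (b + of_int k))"

end

lemma sum_residue_pairs_reindex:
  fixes F :: "int \<times> int \<Rightarrow> complex"
  assumes det: "A * D - B * C = (1::int)" and p: "p > 0" and F: "\<And>l k. F (l mod p, k mod p) = F (l, k)"
  shows "(\<Sum>(l, k)\<in>{0..<p} \<times> {0..<p}. F (l * A + k * C, l * B + k * D)) = (\<Sum>x\<in>{0..<p} \<times> {0..<p}. F x)"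
proof -
  let ?f = "\<lambda>(l, k). ((l * A + k * C) mod p, (l * B + k * D) mod p)"
  let ?S = "{0..<p} \<times> {0..<p}"
  have inj: "inj_on ?f ?S"
  proof (rule inj_onI; clarify)
    fix l k l' k' assume lk: "l \<in> {0..<p}" "l' \<in> {0..<p}" "k \<in> {0..<p}" "k' \<in> {0..<p}"
      and e: "(l * A + k * C) mod p = (l' * A + k' * C) mod p" "(l * B + k * D) mod p = (l' * B + k' * D) mod p"
    have 1: "p dvd (l * A + k * C) - (l' * A + k' * C)" "p dvd (l * B + k * D) - (l' * B + k' * D)" using e by (auto simp: mod_eq_dvd_iff)
    have "p dvd D * ((l * A + k * C) - (l' * A + k' * C)) - C * ((l * B + k * D) - (l' * B + k' * D))"
      "p dvd A * ((l * B + k * D) - (l' * B + k' * D)) - B * ((l * A + k * C) - (l' * A + k' * C))" using 1 by (blast intro: dvd_diff dvd_mult)+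
    moreover have "D * ((l * A + k * C) - (l' * A + k' * C)) - C * ((l * B + k * D) - (l' * B + k' * D)) = (A * D - B * C) * (l - l')"
      "A * ((l * B + k * D) - (l' * B + k' * D)) - B * ((l * A + k * C) - (l' * A + k' * C)) = (A * D - B * C) * (k - k')"
      by (simp_all add: algebra_simps)
    ultimately have "p dvd l - l'" "p dvd k - k'" by (simp_all add: det)
    hence "l mod p = l' mod p" "k mod p = k' mod p" by (simp_all add: mod_eq_dvd_iff)
    thus "l = l' \<and> k = k'" using lk by simp
  qed
  have "?f ` ?S = ?S" by (rule endo_inj_surj[OF _ _ inj]) (use p in auto)
  hence "(\<Sum>x\<in>?S. F x) = (\<Sum>x\<in>?S. F (?f x))" using sum.reindex[OF inj, of F] by (simp add: o_def)
  also have "\<dots> = (\<Sum>(l, k)\<in>?S. F (l * A + k * C, l * B + k * D))" by (rule sum.cong) (auto simp: F)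
  finally show ?thesis ..
qed

lemma (in jacobi_form) hecke_average_modular:
  assumes p: "prime p" and G: "mdet G = 1" and t: "Im \<tau> > 0"
  shows "hecke_average p (mob G \<tau>) a b = jfac G \<tau> * hecke_average p \<tau> (vmul1 G a b) (vmul2 G a b)"
proof -
  obtain A B C D where g: "G = (A, B, C, D)" using prod_cases4 by metis
  have det: "A * D - B * C = 1" using G by (simp add: g)
  have p0: "p > 0" using p by (simp add: prime_gt_0_int)
  define a' where "a' = vmul1 G a b"
  define b' where "b' = vmul2 G a b"
  define F where "F = (\<lambda>(l, k). e2pi (of_nat m * (of_int l * b' - of_int k * a')) * hecke_sum p \<tau> (a' + of_int l) (b' + of_int k))"
  have per: "F (l mod p, k mod p) = F (l, k)" for l k
  proof -
    define l0 where "l0 = l mod p" define l1 where "l1 = l div p"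
    define k0 where "k0 = k mod p" define k1 where "k1 = k div p"
    have lk: "l = l0 + p * l1" "k = k0 + p * k1" by (simp_all add: l0_def l1_def k0_def k1_def)
    have h: "hecke_sum p \<tau> (a' + of_int l) (b' + of_int k) = e2pi (- (of_nat m * of_int p * (of_int l1 * (b' + of_int k0) - of_int k1 * (a' + of_int l0)))) * hecke_sum p \<tau> (a' + of_int l0) (b' + of_int k0)"
      using hecke_sum_elliptic[OF p0 t, of "a' + of_int l0" l1 "b' + of_int k0" k1] by (simp add: lk add.assoc)
    have "of_nat m * (of_int l * b' - of_int k * a') + - (of_nat m * of_int p * (of_int l1 * (b' + of_int k0) - of_int k1 * (a' + of_int l0))) =
        of_nat m * (of_int l0 * b' - of_int k0 * a') + of_int (int m * p * (k1 * l0 - l1 * k0))" by (simp add: lk algebra_simps)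
    hence "e2pi (of_nat m * (of_int l * b' - of_int k * a')) * e2pi (- (of_nat m * of_int p * (of_int l1 * (b' + of_int k0) - of_int k1 * (a' + of_int l0)))) =
        e2pi (of_nat m * (of_int l0 * b' - of_int k0 * a'))" by (simp only: e2pi_add [symmetric]) (simp only: e2pi_add e2pi_of_int mult_1_right)
    hence "F (l, k) = F (l0, k0)" unfolding F_def split_conv h by (simp only: mult.assoc [symmetric])
    thus ?thesis by (simp add: l0_def k0_def)
  qed
  \<comment> \<open>The exponent is the symplectic form of (l, k) and (a, b), invariant under
    substitutions of determinant 1; hence G only permutes the summands.\<close>
  have 2: "of_int l * b - of_int k * a = of_int (l * A + k * C) * b' - of_int (l * B + k * D) * a'" for l k
  proof -
    have "of_int (l * A + k * C) * b' - of_int (l * B + k * D) * a' = of_int (A * D - B * C) * (of_int l * b - of_int k * a)"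
      by (simp add: a'_def b'_def g algebra_simps)
    thus ?thesis by (simp add: det)
  qed
  have 3: "vmul1 G (a + of_int l) (b + of_int k) = a' + of_int (l * A + k * C)" "vmul2 G (a + of_int l) (b + of_int k) = b' + of_int (l * B + k * D)" for l k
    by (simp_all add: a'_def b'_def g algebra_simps)
  have "hecke_average p (mob G \<tau>) a b = (\<Sum>(l, k)\<in>{0..<p} \<times> {0..<p}. jfac G \<tau> * F (l * A + k * C, l * B + k * D))"
    unfolding hecke_average_def by (rule sum.cong[OF refl], clarify) (simp only: F_def split_conv hecke_sum_modular[OF p G t] 2 3 mult.left_commute)
  also have "\<dots> = jfac G \<tau> * (\<Sum>(l, k)\<in>{0..<p} \<times> {0..<p}. F (l * A + k * C, l * B + k * D))"
    unfolding sum_distrib_left by (rule sum.cong) auto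
  also have "\<dots> = jfac G \<tau> * (\<Sum>x\<in>{0..<p} \<times> {0..<p}. F x)" unfolding sum_residue_pairs_reindex[OF det p0 per] ..
  finally show ?thesis unfolding hecke_average_def F_def a'_def b'_def .
qed

lemma sum_roots_of_unity:
  fixes n N :: int
  assumes N: "N > 0"
  shows "(\<Sum>b\<in>{0..<N}. e2pi (of_int n * of_int b / of_int N)) = (if N dvd n then of_int N else 0)"
proof -
  define \<omega> where "\<omega> = e2pi (of_int n / of_int N)"
  have "{0..<N} = int ` {..<nat N}" using N by (auto simp: image_iff intro!: bexI[of _ "nat _"])
  hence "(\<Sum>b\<in>{0..<N}. e2pi (of_int n * of_int b / of_int N)) = (\<Sum>j<nat N. e2pi (of_int n * of_int (int j) / of_int N))"
    by (simp add: sum.reindex)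
  also have "\<dots> = (\<Sum>j<nat N. \<omega> ^ j)" by (rule sum.cong) (auto simp: \<omega>_def e2pi_mult_of_nat [symmetric] mult.commute)
  also have "\<dots> = (if N dvd n then of_int N else 0)"
  proof (cases "\<omega> = 1")
    case True
    then obtain k where "of_int n / of_int N = (of_int k :: complex)" unfolding \<omega>_def e2pi_eq_1_iff by (auto elim: Ints_cases)
    hence "(of_int n :: complex) = of_int (k * N)" using N by (simp add: field_simps)
    hence "n = k * N" by (simp only: of_int_eq_iff)
    thus ?thesis using True N by simp
  next
    case False
    have "\<not> N dvd n"
    proof
      assume "N dvd n"
      then obtain k where "n = N * k" by blast
      hence "\<omega> = e2pi (of_int k)" using N by (simp add: \<omega>_def)
      thus False using False by simp
    qed
    moreover have "\<omega> ^ nat N = 1"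
    proof -
      have "of_nat (nat N) * (of_int n / of_int N) = (of_int n :: complex)" using N by simp
      thus ?thesis unfolding \<omega>_def e2pi_mult_of_nat [symmetric] by simp
    qed
    ultimately show ?thesis using False by (simp add: geometric_sum)
  qed
  finally show ?thesis .
qed

lemma has_sum_dilate:
  fixes f :: "int \<Rightarrow> int \<Rightarrow> complex"
  assumes "a > 0" "b > 0"
  shows "((\<lambda>(n, r). f (a * n) (b * r)) has_sum S) UNIV \<longleftrightarrow> ((\<lambda>(n, r). if a dvd n \<and> b dvd r then f n r else 0) has_sum S) UNIV"
proof -
  have "((\<lambda>(n, r). f (a * n) (b * r)) has_sum S) UNIV \<longleftrightarrow> ((\<lambda>(n, r). f n r) has_sum S) {(n, r). a dvd n \<and> b dvd r}"
    by (rule has_sum_reindex_bij_witness[of _ "\<lambda>(n, r). (n div a, r div b)" "\<lambda>(n, r). (a * n, b * r)"]) (use assms in auto)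
  also have "\<dots> \<longleftrightarrow> ((\<lambda>(n, r). if a dvd n \<and> b dvd r then f n r else 0) has_sum S) UNIV"
    by (rule has_sum_cong_neutral) (auto split: if_splits)
  finally show ?thesis .
qed

text \<open>\<open>hecke\<close> is what the average of a form over the matrices of determinant \<open>p\<^sup>2\<close> and over the
  translations by \<open>p\<close>-division points does to the Fourier coefficients.\<close>

definition hecke_beta :: "int \<Rightarrow> (int \<Rightarrow> int \<Rightarrow> complex) \<Rightarrow> int \<Rightarrow> int \<Rightarrow> complex" where
  "hecke_beta p c n r = c (p ^ 2 * n) (p * r) + (if p dvd n then c n r else 0) +
     (if p ^ 2 dvd n \<and> p dvd r then c (n div p ^ 2) (r div p) else 0)"

definition hecke :: "nat \<Rightarrow> int \<Rightarrow> (int \<Rightarrow> int \<Rightarrow> complex) \<Rightarrow> int \<Rightarrow> int \<Rightarrow> complex" where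
  "hecke m p c n r = (\<Sum>l\<in>{0..<p}. hecke_beta p c (n - r * l + int m * l ^ 2) (r - 2 * int m * l))"

section \<open>Fourier coefficients of the Hecke average\<close>

context jacobi_form
begin

text \<open>The contributions of the three kinds of matrices in \<open>reps\<close>, after the
  common exponential of \<open>tilde\<close> has been taken out.\<close>

definition hecke_upper :: "int \<Rightarrow> complex \<Rightarrow> complex \<Rightarrow> complex" where
  "hecke_upper p \<tau> z = of_int p * jphi c (of_int p ^ 2 * \<tau>) (of_int p * z) + (\<Sum>b\<in>{0..<p}. jphi c (\<tau> + of_int b / of_int p) z) +
     (\<Sum>b\<in>{0..<p ^ 2}. jphi c ((\<tau> + of_int b) / of_int p ^ 2) (z / of_int p)) / of_int p"

text \<open>For triangular matrices the condition A D = p^2 makes the exponential of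
  \<open>tilde\<close> independent of the matrix.\<close>

lemma slash_upper:
  assumes "A * D = p ^ 2" "p > 0"
  shows "slash m c p (A, E, 0, D) \<tau> a b = e2pi (of_nat m * (a * (a * \<tau> + b))) *
    (of_int p / of_int D * jphi c ((of_int A * \<tau> + of_int E) / of_int D) (of_int A * (a * \<tau> + b) / of_int p))"
proof -
  have AD: "of_int A * of_int D = (of_int p ^ 2 :: complex)" using arg_cong[OF assms(1), of "of_int :: int \<Rightarrow> complex"] by simp
  have p: "of_int p \<noteq> (0 :: complex)" using assms(2) by simp
  have D: "of_int D \<noteq> (0 :: complex)" using assms by (cases "D = 0") auto
  have 1: "(a * of_int D) / of_int p * ((of_int A * \<tau> + of_int E) / of_int D) + (b * of_int A - a * of_int E) / of_int p = of_int A * (a * \<tau> + b) / of_int p"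
    using p D by (simp add: field_simps)
  have "(a * of_int D) / of_int p * (of_int A * (a * \<tau> + b) / of_int p) = (of_int A * of_int D) * (a * (a * \<tau> + b)) / of_int p ^ 2"
    by (simp add: power2_eq_square)
  also have "\<dots> = a * (a * \<tau> + b)" unfolding AD using p by simp
  finally have 2: "(a * of_int D) / of_int p * (of_int A * (a * \<tau> + b) / of_int p) = a * (a * \<tau> + b)" .
  have v: "vmul1 (madj (A, E, 0, D)) a b = a * of_int D" "vmul2 (madj (A, E, 0, D)) a b = b * of_int A - a * of_int E"
    "jfac (A, E, 0, D) \<tau> = of_int D" "mob (A, E, 0, D) \<tau> = (of_int A * \<tau> + of_int E) / of_int D" by simp_all
  show ?thesis unfolding slash_def tilde_def v 1 2 by (simp only: mult_ac)
qed

lemma hecke_sum_eq: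
  assumes p: "p > 1"
  shows "hecke_sum p \<tau> a b = e2pi (of_nat m * (a * (a * \<tau> + b))) * hecke_upper p \<tau> (a * \<tau> + b)"
proof -
  let ?e = "e2pi (of_nat m * (a * (a * \<tau> + b)))"
  let ?z = "a * \<tau> + b"
  have p0: "p > 0" and pz: "of_int p \<noteq> (0 :: complex)" using p by auto
  have pp: "p ^ 2 \<noteq> 1" "p ^ 2 \<noteq> p" using p by (auto simp: power2_eq_square zmult_eq_1_iff)
  have "hecke_sum p \<tau> a b = slash m c p (p ^ 2, 0, 0, 1) \<tau> a b + ((\<Sum>b'\<in>{0..<p}. slash m c p (p, b', 0, p) \<tau> a b) + (\<Sum>b'\<in>{0..<p ^ 2}. slash m c p (1, b', 0, p ^ 2) \<tau> a b))"
  proof -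
    have "hecke_sum p \<tau> a b = slash m c p (p ^ 2, 0, 0, 1) \<tau> a b + (\<Sum>M\<in>(\<lambda>b. (p, b, 0, p)) ` {0..<p} \<union> (\<lambda>b. (1, b, 0, p ^ 2)) ` {0..<p ^ 2}. slash m c p M \<tau> a b)"
      unfolding hecke_sum_def reps_def by (rule sum.insert) (use p pp in auto)
    also have "(\<Sum>M\<in>(\<lambda>b. (p, b, 0, p)) ` {0..<p} \<union> (\<lambda>b. (1, b, 0, p ^ 2)) ` {0..<p ^ 2}. slash m c p M \<tau> a b) =
        (\<Sum>M\<in>(\<lambda>b. (p, b, 0, p)) ` {0..<p}. slash m c p M \<tau> a b) + (\<Sum>M\<in>(\<lambda>b. (1, b, 0, p ^ 2)) ` {0..<p ^ 2}. slash m c p M \<tau> a b)"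
      by (rule sum.union_disjoint) (use p in auto)
    finally show ?thesis by (simp add: sum.reindex inj_on_def)
  qed
  also have "slash m c p (p ^ 2, 0, 0, 1) \<tau> a b = ?e * (of_int p * jphi c (of_int p ^ 2 * \<tau>) (of_int p * ?z))"
    unfolding slash_upper[of "p ^ 2" 1 p, OF mult_1_right p0] using pz by (simp add: power2_eq_square)
  also have "(\<Sum>b'\<in>{0..<p}. slash m c p (p, b', 0, p) \<tau> a b) = ?e * (\<Sum>b'\<in>{0..<p}. jphi c (\<tau> + of_int b' / of_int p) ?z)"
    unfolding slash_upper[of p p p, OF power2_eq_square [symmetric] p0] sum_distrib_left using pz by (simp add: add_divide_distrib)
  also have "(\<Sum>b'\<in>{0..<p ^ 2}. slash m c p (1, b', 0, p ^ 2) \<tau> a b) = ?e * ((\<Sum>b\<in>{0..<p ^ 2}. jphi c ((\<tau> + of_int b) / of_int p ^ 2) (?z / of_int p)) / of_int p)"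
    unfolding slash_upper[of 1 "p ^ 2" p, OF mult_1_left p0] sum_distrib_left sum_divide_distrib using pz by (simp add: power2_eq_square)
  finally show ?thesis unfolding hecke_upper_def by (simp only: distrib_left add.assoc)
qed

definition hecke_z :: "int \<Rightarrow> complex \<Rightarrow> complex \<Rightarrow> complex" where
  "hecke_z p \<tau> z = (\<Sum>l\<in>{0..<p}. e2pi (of_nat m * (of_int l ^ 2 * \<tau> + 2 * of_int l * z)) * (\<Sum>k\<in>{0..<p}. hecke_upper p \<tau> (z + of_int l * \<tau> + of_int k)))"

lemma hecke_average_eq:
  assumes p: "p > 1"
  shows "hecke_average p \<tau> a b = e2pi (of_nat m * (a * (a * \<tau> + b))) * hecke_z p \<tau> (a * \<tau> + b)"
proof -
  define z where "z = a * \<tau> + b"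
  have "e2pi (of_nat m * (of_int l * b - of_int k * a)) * hecke_sum p \<tau> (a + of_int l) (b + of_int k) =
      e2pi (of_nat m * (a * z)) * (e2pi (of_nat m * (of_int l ^ 2 * \<tau> + 2 * of_int l * z)) * hecke_upper p \<tau> (z + of_int l * \<tau> + of_int k))" for l k
  proof -
    have z': "(a + of_int l) * \<tau> + (b + of_int k) = z + of_int l * \<tau> + of_int k" by (simp add: z_def algebra_simps)
    have "of_nat m * (of_int l * b - of_int k * a) + of_nat m * ((a + of_int l) * (z + of_int l * \<tau> + of_int k)) =
       of_nat m * (a * z) + of_nat m * (of_int l ^ 2 * \<tau> + 2 * of_int l * z) + of_int (int m * l * k)"
      by (simp add: z_def algebra_simps power2_eq_square)
    hence "e2pi (of_nat m * (of_int l * b - of_int k * a)) * e2pi (of_nat m * ((a + of_int l) * (z + of_int l * \<tau> + of_int k))) =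
       e2pi (of_nat m * (a * z)) * e2pi (of_nat m * (of_int l ^ 2 * \<tau> + 2 * of_int l * z))"
      by (simp only: e2pi_add [symmetric]) (simp only: e2pi_add e2pi_of_int mult_1_right)
    thus ?thesis unfolding hecke_sum_eq[OF p] z' by (simp only: mult.assoc [symmetric])
  qed
  thus ?thesis unfolding hecke_average_def hecke_z_def z_def [symmetric] sum.cartesian_product [symmetric] by (simp only: sum_distrib_left)
qed

text \<open>Orthogonality of characters: the sums over b, and over k where z is divided by p, select
  the required divisibilities. The three facts treat (1, b, 0, p^2), (p, b, 0, p) and (p^2, 0, 0, 1)
  in this order.\<close>

lemma hecke_beta_has_sum:
  assumes p: "p > 1" and t: "Im \<tau> > 0"
  shows "((\<lambda>(n, r). hecke_beta p c n r * fexp n r \<tau> z) has_sum (\<Sum>k\<in>{0..<p}. hecke_upper p \<tau> (z + of_int k)) / of_int p ^ 2) UNIV"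
proof -
  have pz: "of_int p \<noteq> (0 :: complex)" "p > 0" "p ^ 2 > 0" using p by auto
  have pinv: "of_int p ^ 2 * (of_int p * (inverse (of_int p) * inverse (of_int p ^ 2))) = (1 :: complex)"
    "of_int p * (of_int p * inverse (of_int p ^ 2)) = (1 :: complex)" using pz(1) by (simp_all add: field_simps power2_eq_square)
  have t1: "Im ((\<tau> + of_int b) / of_int p ^ 2) > 0" for b
  proof -
    have "(\<tau> + of_int b) / of_int p ^ 2 = (\<tau> + of_int b) / of_real (of_int (p ^ 2))" by simp
    moreover have "Im ((\<tau> + of_int b) / of_real (of_int (p ^ 2))) = Im \<tau> / of_int (p ^ 2)" unfolding Im_divide_of_real by simp
    ultimately show ?thesis using t pz by simp
  qed
  have t2: "Im (\<tau> + of_int b / of_int p) > 0" for b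
  proof -
    have "Im (of_int b / of_real (of_int p)) = Im (of_int b) / of_int p" unfolding Im_divide_of_real ..
    thus ?thesis using t by simp
  qed
  have t3: "Im (of_int p ^ 2 * \<tau>) > 0"
  proof -
    have "of_int p ^ 2 * \<tau> = of_real (of_int (p ^ 2)) * \<tau>" by simp
    moreover have "Im (of_real (of_int (p ^ 2)) * \<tau>) = of_int (p ^ 2) * Im \<tau>" by simp
    ultimately show ?thesis using t pz by simp
  qed
  have 1: "((\<lambda>(n, r). c (p ^ 2 * n) (p * r) * fexp n r \<tau> z) has_sum
     (\<Sum>k\<in>{0..<p}. (\<Sum>b\<in>{0..<p ^ 2}. jphi c ((\<tau> + of_int b) / of_int p ^ 2) ((z + of_int k) / of_int p)) / of_int p) / of_int p ^ 2) UNIV"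
  proof -
    let ?e = "\<lambda>n r b k. fexp n r ((\<tau> + of_int b) / of_int p ^ 2) ((z + of_int k) / of_int p)"
    define f where "f = (\<lambda>n r. c n r * fexp n r (\<tau> / of_int p ^ 2) (z / of_int p))"
    have "((\<lambda>x. (\<Sum>k\<in>{0..<p}. (\<Sum>b\<in>{0..<p ^ 2}. case x of (n, r) \<Rightarrow> c n r * ?e n r b k) * inverse (of_int p)) * inverse (of_int p ^ 2)) has_sum
       (\<Sum>k\<in>{0..<p}. (\<Sum>b\<in>{0..<p ^ 2}. jphi c ((\<tau> + of_int b) / of_int p ^ 2) ((z + of_int k) / of_int p)) * inverse (of_int p)) * inverse (of_int p ^ 2)) UNIV"
      by (intro has_sum_cmult_left has_sum_sum jphi_has_sum t1)
    moreover have "(\<Sum>k\<in>{0..<p}. (\<Sum>b\<in>{0..<p ^ 2}. case x of (n, r) \<Rightarrow> c n r * ?e n r b k) * inverse (of_int p)) * inverse (of_int p ^ 2) =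
        (case x of (n, r) \<Rightarrow> if p ^ 2 dvd n \<and> p dvd r then f n r else 0)" for x
    proof -
      obtain n r where x: "x = (n, r)" by force
      have e: "?e n r b k = fexp n r (\<tau> / of_int p ^ 2) (z / of_int p) * (e2pi (of_int n * of_int b / of_int (p ^ 2)) * e2pi (of_int r * of_int k / of_int p))" for b k
        unfolding e2pi_add [symmetric] by (rule arg_cong[of _ _ e2pi]) (simp add: add_divide_distrib distrib_left)
      have "(\<Sum>k\<in>{0..<p}. (\<Sum>b\<in>{0..<p ^ 2}. c n r * ?e n r b k) * inverse (of_int p)) * inverse (of_int p ^ 2) =
         f n r * ((\<Sum>b\<in>{0..<p ^ 2}. e2pi (of_int n * of_int b / of_int (p ^ 2))) * (\<Sum>k\<in>{0..<p}. e2pi (of_int r * of_int k / of_int p))) * (inverse (of_int p) * inverse (of_int p ^ 2))"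
        unfolding e f_def sum_product unfolding sum_distrib_left sum_distrib_right by (subst sum.swap) (simp only: mult_ac)
      also have "\<dots> = (if p ^ 2 dvd n \<and> p dvd r then f n r else 0)"
        unfolding sum_roots_of_unity[OF pz(2)] sum_roots_of_unity[OF pz(3)] using pinv by (simp add: mult.assoc)
      finally show ?thesis by (simp only: x split_conv)
    qed
    ultimately have "((\<lambda>(n, r). if p ^ 2 dvd n \<and> p dvd r then f n r else 0) has_sum
       (\<Sum>k\<in>{0..<p}. (\<Sum>b\<in>{0..<p ^ 2}. jphi c ((\<tau> + of_int b) / of_int p ^ 2) ((z + of_int k) / of_int p)) * inverse (of_int p)) * inverse (of_int p ^ 2)) UNIV"
      by (simp only:)
    hence "((\<lambda>(n, r). f (p ^ 2 * n) (p * r)) has_sum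
       (\<Sum>k\<in>{0..<p}. (\<Sum>b\<in>{0..<p ^ 2}. jphi c ((\<tau> + of_int b) / of_int p ^ 2) ((z + of_int k) / of_int p)) * inverse (of_int p)) * inverse (of_int p ^ 2)) UNIV"
      unfolding has_sum_dilate[OF pz(3,2)] .
    moreover have "of_int (p ^ 2 * n) * (\<tau> / of_int p ^ 2) + of_int (p * r) * (z / of_int p) = of_int n * \<tau> + of_int r * z" for n r
      using pz(1) by simp
    ultimately show ?thesis unfolding f_def divide_inverse by (simp only:)
  qed
  have 2: "((\<lambda>(n, r). (if p dvd n then c n r else 0) * fexp n r \<tau> z) has_sum
     (\<Sum>k\<in>{0..<p}. \<Sum>b\<in>{0..<p}. jphi c (\<tau> + of_int b / of_int p) (z + of_int k)) / of_int p ^ 2) UNIV"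
  proof -
    let ?e = "\<lambda>n r b k. fexp n r (\<tau> + of_int b / of_int p) (z + of_int k)"
    have "((\<lambda>x. (\<Sum>k\<in>{0..<p}. \<Sum>b\<in>{0..<p}. case x of (n, r) \<Rightarrow> c n r * ?e n r b k) * inverse (of_int p ^ 2)) has_sum
       (\<Sum>k\<in>{0..<p}. \<Sum>b\<in>{0..<p}. jphi c (\<tau> + of_int b / of_int p) (z + of_int k)) * inverse (of_int p ^ 2)) UNIV"
      by (intro has_sum_cmult_left has_sum_sum jphi_has_sum t2)
    moreover have "(\<Sum>k\<in>{0..<p}. \<Sum>b\<in>{0..<p}. case x of (n, r) \<Rightarrow> c n r * ?e n r b k) * inverse (of_int p ^ 2) =
        (case x of (n, r) \<Rightarrow> (if p dvd n then c n r else 0) * fexp n r \<tau> z)" for x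
    proof -
      obtain n r where x: "x = (n, r)" by force
      have e: "?e n r b k = fexp n r \<tau> z * e2pi (of_int n * of_int b / of_int p)" for b k
      proof -
        have "of_int n * (\<tau> + of_int b / of_int p) + of_int r * (z + of_int k) = of_int n * \<tau> + of_int r * z + of_int n * of_int b / of_int p + of_int (r * k)"
          by (simp add: distrib_left)
        thus ?thesis by (simp only: e2pi_add e2pi_of_int mult_1_right)
      qed
      have "(\<Sum>k\<in>{0..<p}. \<Sum>b\<in>{0..<p}. c n r * ?e n r b k) * inverse (of_int p ^ 2) =
         c n r * fexp n r \<tau> z * (\<Sum>b\<in>{0..<p}. e2pi (of_int n * of_int b / of_int p)) * (of_int p * inverse (of_int p ^ 2))"
        unfolding e sum_distrib_left [symmetric] using pz by simp
      also have "\<dots> = (if p dvd n then c n r else 0) * fexp n r \<tau> z"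
        unfolding sum_roots_of_unity[OF pz(2)] using pinv by (simp add: mult.assoc)
      finally show ?thesis by (simp only: x split_conv)
    qed
    ultimately show ?thesis unfolding divide_inverse by (simp only:)
  qed
  have 3: "((\<lambda>(n, r). (if p ^ 2 dvd n \<and> p dvd r then c (n div p ^ 2) (r div p) else 0) * fexp n r \<tau> z) has_sum
     (\<Sum>k\<in>{0..<p}. of_int p * jphi c (of_int p ^ 2 * \<tau>) (of_int p * (z + of_int k))) / of_int p ^ 2) UNIV"
  proof -
    define f where "f = (\<lambda>n r. c (n div p ^ 2) (r div p) * fexp n r \<tau> z)"
    have "((\<lambda>(n, r). f (p ^ 2 * n) (p * r)) has_sum jphi c (of_int p ^ 2 * \<tau>) (of_int p * z)) UNIV"
      using jphi_has_sum[OF t3, of "of_int p * z"] pz by (simp add: f_def mult_ac)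
    hence "((\<lambda>(n, r). if p ^ 2 dvd n \<and> p dvd r then f n r else 0) has_sum jphi c (of_int p ^ 2 * \<tau>) (of_int p * z)) UNIV"
      unfolding has_sum_dilate[OF pz(3,2)] .
    moreover have "(\<lambda>(n, r). if p ^ 2 dvd n \<and> p dvd r then f n r else 0) = (\<lambda>(n, r). (if p ^ 2 dvd n \<and> p dvd r then c (n div p ^ 2) (r div p) else 0) * fexp n r \<tau> z)"
      by (auto simp: fun_eq_iff f_def)
    moreover have "(\<Sum>k\<in>{0..<p}. of_int p * jphi c (of_int p ^ 2 * \<tau>) (of_int p * (z + of_int k))) / of_int p ^ 2 = jphi c (of_int p ^ 2 * \<tau>) (of_int p * z)"
    proof -
      have "jphi c (of_int p ^ 2 * \<tau>) (of_int p * (z + of_int k)) = jphi c (of_int p ^ 2 * \<tau>) (of_int p * z)" for k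
        using jphi_elliptic[OF t3, of "of_int p * z" 0 "p * k"] by (simp add: distrib_left)
      thus ?thesis using pz by (simp add: power2_eq_square)
    qed
    ultimately show ?thesis by (simp only:)
  qed
  have "((\<lambda>x. (case x of (n, r) \<Rightarrow> c (p ^ 2 * n) (p * r) * fexp n r \<tau> z) +
      (case x of (n, r) \<Rightarrow> (if p dvd n then c n r else 0) * fexp n r \<tau> z) +
      (case x of (n, r) \<Rightarrow> (if p ^ 2 dvd n \<and> p dvd r then c (n div p ^ 2) (r div p) else 0) * fexp n r \<tau> z)) has_sum
      (\<Sum>k\<in>{0..<p}. hecke_upper p \<tau> (z + of_int k)) / of_int p ^ 2) UNIV"
    using has_sum_add[OF has_sum_add[OF 1 2] 3] unfolding hecke_upper_def sum.distrib add_divide_distrib by (simp only: add_ac)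
  thus ?thesis by (rule iffD1[OF has_sum_cong, rotated]) (auto simp: hecke_beta_def distrib_right)
qed

text \<open>A translation of z by l \<tau> amounts to replacing (n, r) by (n - r l + m l^2, r - 2 m
  l), which keeps the discriminant.\<close>

lemma hecke_has_sum:
  assumes p: "p > 1" and t: "Im \<tau> > 0"
  shows "((\<lambda>(n, r). hecke m p c n r * fexp n r \<tau> z) has_sum hecke_z p \<tau> z / of_int p ^ 2) UNIV"
proof -
  let ?E = "\<lambda>l. e2pi (of_nat m * (of_int l ^ 2 * \<tau> + 2 * of_int l * z))"
  let ?S = "\<lambda>l. (\<Sum>k\<in>{0..<p}. hecke_upper p \<tau> (z + of_int l * \<tau> + of_int k)) / of_int p ^ 2"
  have "((\<lambda>(n, r). hecke_beta p c (n - r * l + int m * l ^ 2) (r - 2 * int m * l) * fexp n r \<tau> z) has_sum ?E l * ?S l) UNIV" for l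
  proof (rule iffD1[OF has_sum_reindex_bij_witness[of UNIV "\<lambda>(n, r). (n - r * l + int m * l ^ 2, r - 2 * int m * l)"
        "\<lambda>(n, r). (n + r * l + int m * l ^ 2, r + 2 * int m * l)" UNIV] has_sum_cmult_right[OF hecke_beta_has_sum[OF p t, of "z + of_int l * \<tau>"], of "?E l"]])
    fix x :: "int \<times> int"
    obtain n r where x: "x = (n, r)" by force
    have "of_int (n + r * l + int m * l ^ 2) * \<tau> + of_int (r + 2 * int m * l) * z =
        of_nat m * (of_int l ^ 2 * \<tau> + 2 * of_int l * z) + (of_int n * \<tau> + of_int r * (z + of_int l * \<tau>))" by (simp add: algebra_simps)
    hence e: "fexp (n + r * l + int m * l ^ 2) (r + 2 * int m * l) \<tau> z = ?E l * fexp n r \<tau> (z + of_int l * \<tau>)" by (simp only: e2pi_add)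
    have n: "n + r * l + int m * l ^ 2 - (r + 2 * int m * l) * l + int m * l ^ 2 = n" "r + 2 * int m * l - 2 * int m * l = r"
      by (simp_all add: algebra_simps power2_eq_square)
    show "(case case x of (n, r) \<Rightarrow> (n + r * l + int m * l ^ 2, r + 2 * int m * l) of
         (n, r) \<Rightarrow> hecke_beta p c (n - r * l + int m * l ^ 2) (r - 2 * int m * l) * fexp n r \<tau> z) =
       ?E l * (case x of (n, r) \<Rightarrow> hecke_beta p c n r * fexp n r \<tau> (z + of_int l * \<tau>))"
      unfolding x split_conv n e by (simp only: mult.left_commute)
  qed (auto simp: algebra_simps power2_eq_square)
  hence "((\<lambda>x. \<Sum>l\<in>{0..<p}. case x of (n, r) \<Rightarrow> hecke_beta p c (n - r * l + int m * l ^ 2) (r - 2 * int m * l) * fexp n r \<tau> z) has_sum (\<Sum>l\<in>{0..<p}. ?E l * ?S l)) UNIV"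
    by (intro has_sum_sum)
  moreover have "(\<Sum>l\<in>{0..<p}. ?E l * ?S l) = hecke_z p \<tau> z / of_int p ^ 2" unfolding hecke_z_def by (subst sum_divide_distrib) simp
  moreover have "(\<lambda>x. \<Sum>l\<in>{0..<p}. case x of (n, r) \<Rightarrow> hecke_beta p c (n - r * l + int m * l ^ 2) (r - 2 * int m * l) * fexp n r \<tau> z) =
      (\<lambda>(n, r). hecke m p c n r * fexp n r \<tau> z)" by (auto simp: fun_eq_iff hecke_def sum_distrib_right)
  ultimately show ?thesis by simp
qed

text \<open>The divisibility conditions in \<open>hecke_beta\<close> are stable under multiples of p
  only; the sum over l in \<open>hecke\<close> completes the elliptic law.\<close>

lemma hecke_beta_elliptic:
  assumes "p > 0"
  shows "hecke_beta p c (n + r * (p * k) + int m * (p * k) ^ 2) (r + 2 * int m * (p * k)) = hecke_beta p c n r"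
proof -
  have 1: "c (p ^ 2 * (n + r * (p * k) + int m * (p * k) ^ 2)) (p * (r + 2 * int m * (p * k))) = c (p ^ 2 * n) (p * r)"
    using elliptic[of "p ^ 2 * n" "p * r" "p * (p * k)"] by (simp add: algebra_simps power2_eq_square)
  have 2: "c (n + r * (p * k) + int m * (p * k) ^ 2) (r + 2 * int m * (p * k)) = c n r" by (rule elliptic)
  have 3: "p dvd n + r * (p * k) + int m * (p * k) ^ 2 \<longleftrightarrow> p dvd n"
  proof -
    have "n + r * (p * k) + int m * (p * k) ^ 2 = n + p * (r * k + int m * p * k ^ 2)" by (simp add: algebra_simps power2_eq_square)
    thus ?thesis by (simp only: dvd_add_left_iff dvd_triv_left)
  qed
  have 4: "p dvd r + 2 * int m * (p * k) \<longleftrightarrow> p dvd r"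
  proof -
    have "r + 2 * int m * (p * k) = r + p * (2 * int m * k)" by simp
    thus ?thesis by (simp only: dvd_add_times_triv_right_iff dvd_add_left_iff dvd_triv_left)
  qed
  have 5: "p ^ 2 dvd n + r * (p * k) + int m * (p * k) ^ 2 \<longleftrightarrow> p ^ 2 dvd n"
    "c ((n + r * (p * k) + int m * (p * k) ^ 2) div p ^ 2) ((r + 2 * int m * (p * k)) div p) = c (n div p ^ 2) (r div p)" if pr: "p dvd r" and pn: "p ^ 2 dvd n \<or> p ^ 2 dvd n + r * (p * k) + int m * (p * k) ^ 2"
  proof -
    obtain r' where r: "r = p * r'" using pr by (elim dvdE)
    have e: "n + r * (p * k) + int m * (p * k) ^ 2 = n + p ^ 2 * (r' * k + int m * k ^ 2)" by (simp add: r algebra_simps power2_eq_square)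
    show d: "p ^ 2 dvd n + r * (p * k) + int m * (p * k) ^ 2 \<longleftrightarrow> p ^ 2 dvd n" unfolding e by (simp only: dvd_add_left_iff dvd_triv_left)
    have "p ^ 2 dvd n" using pn d by blast
    then obtain n' where n: "n = p ^ 2 * n'" by (elim dvdE)
    have "n + r * (p * k) + int m * (p * k) ^ 2 = p ^ 2 * (n' + r' * k + int m * k ^ 2)" "r + 2 * int m * (p * k) = p * (r' + 2 * int m * k)"
      by (simp_all add: n r algebra_simps power2_eq_square)
    hence q: "(n + r * (p * k) + int m * (p * k) ^ 2) div p ^ 2 = n' + r' * k + int m * k ^ 2" "(r + 2 * int m * (p * k)) div p = r' + 2 * int m * k"
      using assms by simp_all
    have "n div p ^ 2 = n'" "r div p = r'" using assms by (simp_all add: n r)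
    thus "c ((n + r * (p * k) + int m * (p * k) ^ 2) div p ^ 2) ((r + 2 * int m * (p * k)) div p) = c (n div p ^ 2) (r div p)"
      unfolding q by (simp add: elliptic)
  qed
  show ?thesis unfolding hecke_beta_def 1 2 3 4 using 5 by auto
qed

lemma hecke_elliptic:
  assumes p: "p > 0"
  shows "hecke m p c (n + r * l + int m * l ^ 2) (r + 2 * int m * l) = hecke m p c n r"
proof -
  define F where "F = (\<lambda>l. hecke_beta p c (n - r * l + int m * l ^ 2) (r - 2 * int m * l))"
  have "hecke m p c (n + r * l + int m * l ^ 2) (r + 2 * int m * l) = (\<Sum>k\<in>{0..<p}. F (k - l))" unfolding hecke_def F_def
    by (intro sum.cong refl arg_cong2[where f = "hecke_beta p c"]) (simp_all add: algebra_simps power2_eq_square)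
  also have "\<dots> = (\<Sum>k\<in>{0..<p}. F k)"
  proof (rule sum_residues_reindex[OF p])
    show "F (k mod p) = F k" for k
    proof -
      define j where "j = k div p"
      define i where "i = k mod p"
      have k: "k = i + p * j" by (simp add: i_def j_def)
      have "F k = hecke_beta p c ((n - r * i + int m * i ^ 2) + (r - 2 * int m * i) * (p * (- j)) + int m * (p * (- j)) ^ 2) ((r - 2 * int m * i) + 2 * int m * (p * (- j)))"
        unfolding F_def by (intro arg_cong2[where f = "hecke_beta p c"]) (simp_all add: k algebra_simps power2_eq_square)
      also have "\<dots> = F i" unfolding hecke_beta_elliptic[OF p] F_def ..
      finally show ?thesis by (simp add: i_def)
    qed
    show "k mod p = k' mod p" if "(k - l) mod p = (k' - l) mod p" for k k' using that by (simp add: mod_eq_dvd_iff)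
  qed
  finally show ?thesis by (simp add: F_def hecke_def)
qed

end

lemma jform_hecke:
  assumes m: "m > 0" and c: "jform m 0 c" and p: "prime p"
  shows "jform m 0 (hecke m p c)"
proof -
  interpret jacobi_form m 0 c by standard (use m c in auto)
  have p1: "p > 1" using p by (rule prime_gt_1_int)
  hence p0: "p > 0" "of_int p \<noteq> (0 :: complex)" by auto
  have phi: "jphi (hecke m p c) \<tau> z = hecke_z p \<tau> z / of_int p ^ 2" if "Im \<tau> > 0" for \<tau> z
    unfolding jphi_def by (rule infsumI[OF hecke_has_sum[OF p1 that]])
  show ?thesis unfolding jform_def
  proof (intro conjI allI impI)
    fix n r
    assume "hecke m p c n r \<noteq> 0"
    then obtain l where l: "hecke_beta p c (n - r * l + int m * l ^ 2) (r - 2 * int m * l) \<noteq> 0"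
      unfolding hecke_def by (auto elim: sum.not_neutral_contains_not_neutral)
    define n' where "n' = n - r * l + int m * l ^ 2"
    define r' where "r' = r - 2 * int m * l"
    have D: "r ^ 2 - 4 * int m * n = r' ^ 2 - 4 * int m * n'" by (simp add: n'_def r'_def algebra_simps power2_eq_square)
    have "r' ^ 2 \<le> 4 * int m * n'"
    proof -
      have "c (p ^ 2 * n') (p * r') \<noteq> 0 \<or> c n' r' \<noteq> 0 \<or> (p ^ 2 dvd n' \<and> p dvd r' \<and> c (n' div p ^ 2) (r' div p) \<noteq> 0)"
        using l unfolding n'_def [symmetric] r'_def [symmetric] hecke_beta_def by (auto split: if_splits)
      thus ?thesis
      proof (elim disjE conjE)
        assume "c (p ^ 2 * n') (p * r') \<noteq> 0"
        from support[OF this] have "p ^ 2 * r' ^ 2 \<le> p ^ 2 * (4 * int m * n')" by (simp add: power_mult_distrib algebra_simps)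
        thus ?thesis using p0 by (subst (asm) mult_le_cancel_left_pos) auto
      next
        assume "c n' r' \<noteq> 0"
        from support[OF this] show ?thesis by simp
      next
        assume d: "p ^ 2 dvd n'" "p dvd r'" "c (n' div p ^ 2) (r' div p) \<noteq> 0"
        obtain n1 r1 where e: "n' = p ^ 2 * n1" "r' = p * r1" using d by (auto elim!: dvdE)
        have "c n1 r1 \<noteq> 0" using d(3) p0 by (simp add: e)
        from support[OF this] have "p ^ 2 * r1 ^ 2 \<le> p ^ 2 * (4 * int m * n1)" by (intro mult_left_mono) auto
        thus ?thesis by (simp add: e power_mult_distrib algebra_simps)
      qed
    qed
    thus "r ^ 2 \<le> 4 * int m * n + 0" using D by linarith
  next
    fix n r l show "hecke m p c (n + r * l + int m * l ^ 2) (r + 2 * int m * l) = hecke m p c n r" by (rule hecke_elliptic[OF p0(1)])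
  next
    fix \<tau> z :: complex assume "Im \<tau> > 0"
    from hecke_has_sum[OF p1 this] show "(\<lambda>(n, r). hecke m p c n r * fexp n r \<tau> z) summable_on UNIV" by (rule has_sum_imp_summable)
  next
    fix P Q R S :: int and \<tau> z :: complex
    assume det: "P * S - Q * R = 1" and t: "Im \<tau> > 0"
    define j where "j = of_int R * \<tau> + of_int S"
    have j: "j \<noteq> 0" unfolding j_def by (rule Im_moebius(2)[OF det t])
    define \<tau>' where "\<tau>' = (of_int P * \<tau> + of_int Q) / j"
    have t': "Im \<tau>' > 0" unfolding \<tau>'_def j_def by (rule Im_moebius(1)[OF det t])
    have PS: "of_int P * of_int S - of_int Q * of_int R = (1 :: complex)" using arg_cong[OF det, of "of_int :: int \<Rightarrow> complex"] by simp
    have G: "mdet (P, Q, R, S) = 1" "mob (P, Q, R, S) \<tau> = \<tau>'" "jfac (P, Q, R, S) \<tau> = j" using det by (simp_all add: \<tau>'_def j_def)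
    \<comment> \<open>These characteristics are taken to (0, z) by the matrix, so
      \<open>tilde\<close> at the image is the form itself, while at (a, b) it carries the
      exponential of the weight 1 action.\<close>
    define a where "a = - of_int R * z"
    define b where "b = of_int P * z"
    have v: "vmul1 (P, Q, R, S) a b = 0" "vmul2 (P, Q, R, S) a b = z"
    proof -
      have "vmul2 (P, Q, R, S) a b = (of_int P * of_int S - of_int Q * of_int R) * z" by (simp add: a_def b_def algebra_simps)
      thus "vmul2 (P, Q, R, S) a b = z" by (simp add: PS)
    qed (simp add: a_def b_def)
    have "a * (of_int P * \<tau> + of_int Q) + b * j = (of_int P * of_int S - of_int Q * of_int R) * z" by (simp add: a_def b_def j_def algebra_simps)
    hence "a * (of_int P * \<tau> + of_int Q) + b * j = z" by (simp add: PS)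
    hence w: "a * \<tau>' + b = z / j" using j by (simp add: \<tau>'_def field_simps)
    have "hecke_average p \<tau>' a b = j * hecke_average p \<tau> 0 z" using hecke_average_modular[OF p G(1) t, of a b] unfolding G v .
    hence "e2pi (of_nat m * (a * (z / j))) * hecke_z p \<tau>' (z / j) = j * hecke_z p \<tau> z" unfolding hecke_average_eq[OF p1] w by simp
    moreover have "of_nat m * (a * (z / j)) = - of_nat m * (of_int R * z ^ 2 / j)" by (simp add: a_def power2_eq_square)
    ultimately have h: "e2pi (- of_nat m * (of_int R * z ^ 2 / j)) * hecke_z p \<tau>' (z / j) = j * hecke_z p \<tau> z" by simp
    have "e2pi (- of_nat m * (of_int R * z ^ 2 / j)) * inverse j * jphi (hecke m p c) \<tau>' (z / j) = jphi (hecke m p c) \<tau> z"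
    proof -
      have "X * H = j * K \<Longrightarrow> X * inverse j * (H / q) = K / q" for X H K q :: complex using j by (simp add: field_simps)
      thus ?thesis unfolding phi[OF t] phi[OF t'] using h by blast
    qed
    thus "e2pi (- of_nat m * (of_int R * z ^ 2 / (of_int R * \<tau> + of_int S))) * inverse (of_int R * \<tau> + of_int S) *
        jphi (hecke m p c) ((of_int P * \<tau> + of_int Q) / (of_int R * \<tau> + of_int S)) (z / (of_int R * \<tau> + of_int S)) = jphi (hecke m p c) \<tau> z"
      by (simp only: j_def \<tau>'_def)
  qed
qed

lemma
  assumes "jform m B c"
  shows jform_support: "c n r \<noteq> 0 \<Longrightarrow> r ^ 2 \<le> 4 * int m * n + B"
    and jform_elliptic: "c (n + r * l + int m * l ^ 2) (r + 2 * int m * l) = c n r"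
    and jform_summable: "Im \<tau> > 0 \<Longrightarrow> (\<lambda>(n, r). c n r * fexp n r \<tau> z) summable_on UNIV"
    and jform_modular: "p * s - q * t = 1 \<Longrightarrow> Im \<tau> > 0 \<Longrightarrow>
        jact m p q t s c \<tau> z = jphi c \<tau> z"
  using assms unfolding jform_def by blast+

lemma jform_combination:
  assumes c: "jform m B c" and c': "jform m B c'"
  shows "jform m B (\<lambda>n r. a * c n r + b * c' n r)"
proof -
  let ?c = "\<lambda>n r. a * c n r + b * c' n r"
  let ?e = "\<lambda>\<tau> z (n, r). fexp n r \<tau> z"
  have hs: "((\<lambda>(n, r). ?c n r * fexp n r \<tau> z) has_sum a * jphi c \<tau> z + b * jphi c' \<tau> z) UNIV" if t: "Im \<tau> > 0" for \<tau> z
  proof -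
    have "((\<lambda>x. a * (case x of (n, r) \<Rightarrow> c n r * fexp n r \<tau> z) + b * (case x of (n, r) \<Rightarrow> c' n r * fexp n r \<tau> z)) has_sum a * jphi c \<tau> z + b * jphi c' \<tau> z) UNIV"
      unfolding jphi_def by (intro has_sum_add has_sum_cmult_right has_sum_infsum jform_summable[OF c t] jform_summable[OF c' t])
    thus ?thesis by (rule iffD1[OF has_sum_cong, rotated]) (auto simp: algebra_simps)
  qed
  have phi: "jphi ?c \<tau> z = a * jphi c \<tau> z + b * jphi c' \<tau> z" if "Im \<tau> > 0" for \<tau> z
    using infsumI[OF hs[OF that]] by (simp add: jphi_def)
  show ?thesis unfolding jform_def
  proof (intro conjI allI impI)
    fix n r assume "?c n r \<noteq> 0"
    hence "c n r \<noteq> 0 \<or> c' n r \<noteq> 0" by auto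
    thus "r ^ 2 \<le> 4 * int m * n + B" using jform_support[OF c] jform_support[OF c'] by blast
  next
    fix n r l
    have "c (n + r * l + int m * l ^ 2) (r + 2 * int m * l) = c n r" "c' (n + r * l + int m * l ^ 2) (r + 2 * int m * l) = c' n r"
      by (rule jform_elliptic[OF c] jform_elliptic[OF c'])+
    thus "?c (n + r * l + int m * l ^ 2) (r + 2 * int m * l) = ?c n r" by simp
  next
    fix \<tau> z :: complex assume "Im \<tau> > 0"
    from hs[OF this] show "(\<lambda>(n, r). ?c n r * fexp n r \<tau> z) summable_on UNIV" by (rule has_sum_imp_summable)
  next
    fix P Q R S :: int and \<tau> z :: complex
    assume det: "P * S - Q * R = 1" and t: "Im \<tau> > 0"
    let ?j = "of_int R * \<tau> + of_int S"
    let ?X = "e2pi (- of_nat m * (of_int R * z ^ 2 / ?j)) * inverse ?j"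
    have 1: "?X * jphi c ((of_int P * \<tau> + of_int Q) / ?j) (z / ?j) = jphi c \<tau> z"
      "?X * jphi c' ((of_int P * \<tau> + of_int Q) / ?j) (z / ?j) = jphi c' \<tau> z" by (rule jform_modular[OF c det t] jform_modular[OF c' det t])+
    have "X * u = u' \<Longrightarrow> X * v = v' \<Longrightarrow> X * (a * u + b * v) = a * u' + b * v'" for X u v u' v' :: complex
      by (auto simp: algebra_simps)
    thus "?X * jphi ?c ((of_int P * \<tau> + of_int Q) / ?j) (z / ?j) = jphi ?c \<tau> z"
      unfolding phi[OF t] phi[OF Im_moebius(1)[OF det t]] using 1 by blast
  qed
qed

section \<open>Coefficients at primes not dividing the discriminant\<close>

lemma sum_closed:
  assumes "0 \<in> I" "\<And>x y. x \<in> I \<Longrightarrow> y \<in> I \<Longrightarrow> x + y \<in> I" "\<And>i. i \<in> S \<Longrightarrow> f i \<in> I"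
  shows "sum f S \<in> I"
  using assms(3) by (induction S rule: infinite_finite_induct) (auto intro: assms)

lemma hecke_in:
  assumes "0 \<in> I" "\<And>x y. x \<in> I \<Longrightarrow> y \<in> I \<Longrightarrow> x + y \<in> I" "\<And>n r. c n r \<in> I"
  shows "hecke m p c n r \<in> I"
proof -
  have "hecke_beta p c n r \<in> I" for n r unfolding hecke_beta_def using assms by auto
  thus ?thesis unfolding hecke_def using assms by (intro sum_closed) auto
qed

lemma hecke_linear: "hecke m p (\<lambda>n r. a * c n r + b * c' n r) n r = a * hecke m p c n r + b * hecke m p c' n r"
proof -
  have "hecke_beta p (\<lambda>n r. a * c n r + b * c' n r) n r = a * hecke_beta p c n r + b * hecke_beta p c' n r" for n r
    by (simp add: hecke_beta_def algebra_simps)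
  thus ?thesis unfolding hecke_def by (simp add: sum.distrib sum_distrib_left)
qed

lemma unique_linear_solution:
  fixes a b p :: int
  assumes "coprime a p" "p > 0"
  shows "\<exists>x0\<in>{0..<p}. \<forall>x\<in>{0..<p}. p dvd a * x - b \<longleftrightarrow> x = x0"
proof -
  obtain i where i: "[a * i = 1] (mod p)" using cong_solve_coprime_int[OF assms(1)] by auto
  define x0 where "x0 = (i * b) mod p"
  have "[a * x0 = b] (mod p)"
  proof -
    have "[a * x0 = a * (i * b)] (mod p)" by (simp add: x0_def cong_def mod_mult_right_eq)
    also have "a * (i * b) = a * i * b" by simp
    also have "[a * i * b = 1 * b] (mod p)" by (rule cong_mult[OF i cong_refl])
    finally show ?thesis by simp
  qed
  show ?thesis
  proof (intro bexI[of _ x0] ballI)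
    fix x assume x: "x \<in> {0..<p}"
    have "p dvd a * x - b \<longleftrightarrow> [a * x = b] (mod p)" by (simp add: cong_iff_dvd_diff)
    also have "\<dots> \<longleftrightarrow> [a * x = a * x0] (mod p)" using \<open>[a * x0 = b] (mod p)\<close> by (meson cong_sym cong_trans)
    also have "\<dots> \<longleftrightarrow> [x = x0] (mod p)" using assms(1) by (rule cong_mult_lcancel)
    also have "\<dots> \<longleftrightarrow> x = x0" using x assms(2) by (simp add: x0_def cong_def)
    finally show "p dvd a * x - b \<longleftrightarrow> x = x0" .
  qed (use assms in \<open>simp add: x0_def\<close>)
qed

text \<open>Multiplication by 4m, a unit modulo p, completes the square: the condition becomes (2ml
  - r)^2 = D modulo p.\<close>

lemma card_quadratic_roots:
  fixes p :: int and m :: nat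
  assumes p: "prime p" "\<not> p dvd 2 * int m" and D: "\<not> p dvd r ^ 2 - 4 * int m * n"
  shows "int (card {l\<in>{0..<p}. p dvd n - r * l + int m * l ^ 2}) = 1 + Legendre (r ^ 2 - 4 * int m * n) p"
proof -
  define D where "D = r ^ 2 - 4 * int m * n"
  define S where "S = {l\<in>{0..<p}. p dvd n - r * l + int m * l ^ 2}"
  have p0: "p > 0" using p by (simp add: prime_gt_0_int)
  have cop: "coprime (2 * int m) p" using p by (metis coprime_commute prime_imp_coprime)
  have p2: "\<not> p dvd 2" using p by (meson dvd_mult2)
  have "\<not> p dvd 4 * int m"
  proof
    assume "p dvd 4 * int m"
    hence "p dvd 2 * (2 * int m)" by simp
    thus False using p p2 by (metis prime_dvd_multD)
  qed
  moreover have "4 * int m * (n - r * l + int m * l ^ 2) = (2 * int m * l - r) ^ 2 - D" for l by (simp add: D_def algebra_simps power2_eq_square)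
  ultimately have S: "l \<in> S \<longleftrightarrow> l \<in> {0..<p} \<and> p dvd (2 * int m * l - r) ^ 2 - D" for l
    unfolding S_def using p(1) by (metis (no_types, lifting) dvd_mult mem_Collect_eq prime_dvd_multD)
  have D0: "\<not> [D = 0] (mod p)" using D by (simp add: D_def cong_0_iff)
  show ?thesis
  proof (cases "QuadRes p D")
    case True
    then obtain s where s: "[s ^ 2 = D] (mod p)" by (auto simp: QuadRes_def)
    have ps: "\<not> p dvd s"
    proof
      assume "p dvd s"
      hence "[s ^ 2 = 0] (mod p)" by (simp add: cong_0_iff power2_eq_square)
      thus False using s D0 by (meson cong_sym cong_trans)
    qed
    obtain x where x: "x \<in> {0..<p}" "\<And>l. l \<in> {0..<p} \<Longrightarrow> p dvd 2 * int m * l - (r + s) \<longleftrightarrow> l = x"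
      using unique_linear_solution[OF cop p0, of "r + s"] by blast
    obtain y where y: "y \<in> {0..<p}" "\<And>l. l \<in> {0..<p} \<Longrightarrow> p dvd 2 * int m * l - (r - s) \<longleftrightarrow> l = y"
      using unique_linear_solution[OF cop p0, of "r - s"] by blast
    have "x \<noteq> y"
    proof
      assume "x = y"
      hence "p dvd (2 * int m * x - (r - s)) - (2 * int m * x - (r + s))" using x y by (blast intro: dvd_diff)
      hence "p dvd 2 * s" by simp
      thus False using p ps p2 by (metis prime_dvd_multD)
    qed
    moreover have "S = {x, y}"
    proof -
      have "p dvd (2 * int m * l - r) ^ 2 - D \<longleftrightarrow> p dvd 2 * int m * l - (r + s) \<or> p dvd 2 * int m * l - (r - s)" for l
      proof -
        have "p dvd s ^ 2 - D" using s by (simp add: cong_iff_dvd_diff)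
        moreover have "(2 * int m * l - r) ^ 2 - D = (2 * int m * l - (r + s)) * (2 * int m * l - (r - s)) + (s ^ 2 - D)"
          by (simp add: algebra_simps power2_eq_square)
        ultimately have "p dvd (2 * int m * l - r) ^ 2 - D \<longleftrightarrow> p dvd (2 * int m * l - (r + s)) * (2 * int m * l - (r - s))"
          by (simp only: dvd_add_left_iff)
        thus ?thesis using p(1) by (simp add: prime_dvd_mult_iff)
      qed
      thus ?thesis using S x y by auto
    qed
    ultimately have "card S = 2" by simp
    thus ?thesis using True D0 unfolding D_def [symmetric] S_def [symmetric] by (simp add: Legendre_def)
  next
    case False
    have "S = {}"
    proof (rule ccontr)
      assume "S \<noteq> {}"
      then obtain l where "p dvd (2 * int m * l - r) ^ 2 - D" using S by auto
      hence "QuadRes p D" unfolding QuadRes_def by (auto simp: cong_iff_dvd_diff)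
      thus False using False by simp
    qed
    thus ?thesis using False D0 unfolding D_def [symmetric] S_def [symmetric] by (simp add: Legendre_def)
  qed
qed

context jacobi_form
begin

lemma hecke_first_terms:
  "(\<Sum>l\<in>{0..<p}. c (p ^ 2 * (n - r * l + int m * l ^ 2)) (p * (r - 2 * int m * l))) = of_int (int (nat p)) * c (p ^ 2 * n) (p * r)"
proof -
  have "c (p ^ 2 * (n - r * l + int m * l ^ 2)) (p * (r - 2 * int m * l)) = c (p ^ 2 * n) (p * r)" for l
    using elliptic[of "p ^ 2 * n" "p * r" "- (p * l)"] by (simp add: algebra_simps power2_eq_square)
  thus ?thesis by simp
qed

text \<open>The last summand of \<open>hecke_beta\<close> would require that p divides D. The middle
  one occurs as often as the quadratic polynomial in l has roots, which is 1 plus the Legendre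
  symbol; this 1 is the reason for subtracting \<open>c\<close>.\<close>

lemma hecke_unramified:
  assumes p: "prime p" "\<not> p dvd 2 * int m" and D: "\<not> p dvd r ^ 2 - 4 * int m * n"
  shows "hecke m p c n r - c n r = of_int p * c (p ^ 2 * n) (p * r) + of_int (Legendre (r ^ 2 - 4 * int m * n) p) * c n r"
proof -
  have p0: "p > 0" using p by (simp add: prime_gt_0_int)
  have b: "hecke_beta p c (n - r * l + int m * l ^ 2) (r - 2 * int m * l) =
      c (p ^ 2 * (n - r * l + int m * l ^ 2)) (p * (r - 2 * int m * l)) + (if p dvd n - r * l + int m * l ^ 2 then c n r else 0)" for l
  proof -
    have "\<not> (p ^ 2 dvd n - r * l + int m * l ^ 2 \<and> p dvd r - 2 * int m * l)"
    proof
      assume a: "p ^ 2 dvd n - r * l + int m * l ^ 2 \<and> p dvd r - 2 * int m * l"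
      have "p dvd n - r * l + int m * l ^ 2" using a by (meson dvd_trans dvd_power zero_less_numeral)
      hence "p dvd (r - 2 * int m * l) * (r - 2 * int m * l) - 4 * int m * (n - r * l + int m * l ^ 2)" using a by (blast intro: dvd_diff dvd_mult)
      also have "(r - 2 * int m * l) * (r - 2 * int m * l) - 4 * int m * (n - r * l + int m * l ^ 2) = r ^ 2 - 4 * int m * n" by (simp add: algebra_simps power2_eq_square)
      finally show False using D by simp
    qed
    moreover have "c (n - r * l + int m * l ^ 2) (r - 2 * int m * l) = c n r" using elliptic[of n r "- l"] by simp
    ultimately show ?thesis by (auto simp: hecke_beta_def)
  qed
  have "(\<Sum>l\<in>{0..<p}. if p dvd n - r * l + int m * l ^ 2 then c n r else 0) = of_int (int (card {l\<in>{0..<p}. p dvd n - r * l + int m * l ^ 2})) * c n r"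
    by (simp add: sum.inter_filter [symmetric])
  also have "\<dots> = (1 + of_int (Legendre (r ^ 2 - 4 * int m * n) p)) * c n r" unfolding card_quadratic_roots[OF p D] by simp
  finally show ?thesis unfolding hecke_def b sum.distrib hecke_first_terms using p0 by (simp add: algebra_simps)
qed

text \<open>At (p^2 n, p r) the polynomial in l reduces to m l^2 modulo p, so the divisibility
  conditions can hold for l = 0 only.\<close>

lemma hecke_multiple:
  assumes p: "prime p" "\<not> p dvd 2 * int m"
  shows "hecke m p c (p ^ 2 * n) (p * r) - c (p ^ 2 * n) (p * r) = of_int p * c (p ^ 2 * (p ^ 2 * n)) (p * (p * r)) + c n r"
proof -
  have p0: "p > 0" using p by (simp add: prime_gt_0_int)
  have pm: "\<not> p dvd int m" using p by (meson dvd_mult)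
  have b: "hecke_beta p c (p ^ 2 * n - p * r * l + int m * l ^ 2) (p * r - 2 * int m * l) =
      c (p ^ 2 * (p ^ 2 * n - p * r * l + int m * l ^ 2)) (p * (p * r - 2 * int m * l)) + (if l = 0 then c (p ^ 2 * n) (p * r) + c n r else 0)" if l: "l \<in> {0..<p}" for l
  proof (cases "l = 0")
    case False
    hence pl: "\<not> p dvd l" using l by (auto dest: zdvd_imp_le)
    have "\<not> p dvd p ^ 2 * n - p * r * l + int m * l ^ 2"
    proof
      assume a: "p dvd p ^ 2 * n - p * r * l + int m * l ^ 2"
      have "p dvd (p ^ 2 * n - p * r * l + int m * l ^ 2) - p * (p * n - r * l)" by (rule dvd_diff[OF a]) simp
      hence "p dvd int m * l ^ 2" by (simp add: algebra_simps power2_eq_square)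
      hence "p dvd int m \<or> p dvd l ^ 2" using p(1) by (simp add: prime_dvd_mult_iff)
      thus False using pm pl p(1) by (auto dest: prime_dvd_power)
    qed
    moreover from this have "\<not> p ^ 2 dvd p ^ 2 * n - p * r * l + int m * l ^ 2" by (meson dvd_trans dvd_power zero_less_numeral)
    ultimately show ?thesis using False by (simp add: hecke_beta_def)
  qed (use p0 in \<open>simp add: hecke_beta_def\<close>)
  have "hecke m p c (p ^ 2 * n) (p * r) = (\<Sum>l\<in>{0..<p}. c (p ^ 2 * (p ^ 2 * n - p * r * l + int m * l ^ 2)) (p * (p * r - 2 * int m * l)) + (if l = 0 then c (p ^ 2 * n) (p * r) + c n r else 0))"
    unfolding hecke_def by (rule sum.cong[OF refl b])
  also have "\<dots> = of_int p * c (p ^ 2 * (p ^ 2 * n)) (p * (p * r)) + (c (p ^ 2 * n) (p * r) + c n r)"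
    unfolding sum.distrib hecke_first_terms using p0 by simp
  finally show ?thesis by simp
qed

end

text \<open>\<open>coefficient_recursion\<close> applies from n = m on; negative n have no
  coefficients, and oddness and the elliptic law reduce to 0 < r < m. The set I is abstract because
  {0} gives that finitely many coefficients determine a form, and the p-adic sets give
  integrality.\<close>

lemma coefficients_in:
  assumes m: "m > 0" and c: "jform m 0 c"
    and I: "0 \<in> I" "\<And>x y. x \<in> I \<Longrightarrow> y \<in> I \<Longrightarrow> x + y \<in> I" "\<And>a x. a \<in> zloc (NN m) \<Longrightarrow> x \<in> I \<Longrightarrow> a * x \<in> I"
    and small: "\<And>n r. n < m \<Longrightarrow> r \<in> {1..<int m} \<Longrightarrow> c (int n) r \<in> I"
  shows "c n r \<in> I"
proof -
  interpret jacobi_form m 0 c by standard (use m c in auto)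
  have 1: "c (int N) r \<in> I" if "r \<in> {1..<int m}" for N r using that
  proof (induction N arbitrary: r rule: less_induct)
    case (less N)
    show ?case
    proof (cases "N < m")
      case False
      then obtain \<kappa> where k: "\<And>n r. \<kappa> n r \<in> zloc (NN m)" "c (int N) r = (\<Sum>r\<in>{1..<int m}. \<Sum>n<N. \<kappa> n r * c (int n) r)"
        using coefficient_recursion[OF m less.prems, of N] c by auto
      show ?thesis unfolding k(2) using less.IH k(1) by (intro sum_closed I) auto
    qed (use small less.prems in auto)
  qed
  have neg: "c n r = 0" if "n < 0" for n r
  proof (rule ccontr)
    assume "c n r \<noteq> 0"
    from order_trans[OF zero_le_power2 support[OF this]] have "0 \<le> 4 * int m * n" by simp
    thus False using that m by (simp add: zero_le_mult_iff)
  qed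
  have 2: "c n r \<in> I" if "r \<in> {1..<int m}" for n r using 1[OF that, of "nat n"] neg[of n r] I(1) by (cases "n \<ge> 0") auto
  have minus: "- x \<in> I" if "x \<in> I" for x using I(3)[OF zloc_of_int[of "-1"] that] by simp
  have 3: "c n r \<in> I" if "\<bar>r\<bar> \<le> int m" for n r
  proof -
    consider "r = 0" | "r \<in> {1..<int m}" | "- r \<in> {1..<int m}" | "r = int m" | "r = - int m" using \<open>\<bar>r\<bar> \<le> int m\<close> by fastforce
    thus ?thesis
    proof cases
      case 1 thus ?thesis using odd_coeff[of n 0] I(1) by simp
    next
      case 2 thus ?thesis by (rule \<open>\<And>n r. r \<in> {1..<int m} \<Longrightarrow> c n r \<in> I\<close>)
    next
      case 3 thus ?thesis using 2[of "- r" n] minus odd_coeff[of n "- r"] by simp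
    next
      case 4
      have "c n (int m) = 0" using elliptic[of n "- int m" 1] odd_coeff[of n "int m"] by simp
      thus ?thesis using 4 I(1) by simp
    next
      case 5
      have "c n (int m) = 0" using elliptic[of n "- int m" 1] odd_coeff[of n "int m"] by simp
      thus ?thesis using 5 I(1) odd_coeff[of n "int m"] by simp
    qed
  qed
  define l where "l = (r + int m) div (2 * int m)"
  define r0 where "r0 = (r + int m) mod (2 * int m) - int m"
  have r: "r = r0 + 2 * int m * l" using div_mult_mod_eq[of "r + int m" "2 * int m"] by (simp add: l_def r0_def algebra_simps)
  have "0 \<le> (r + int m) mod (2 * int m)" "(r + int m) mod (2 * int m) < 2 * int m" using m by auto
  hence "\<bar>r0\<bar> \<le> int m" by (auto simp: r0_def)
  moreover have "c n r = c (n - r0 * l - int m * l ^ 2) r0" using elliptic[of "n - r0 * l - int m * l ^ 2" r0 l] by (simp add: r)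
  ultimately show ?thesis using 3 by simp
qed

lemma Legendre_square: "\<not> p dvd a \<Longrightarrow> Legendre a p * Legendre a p = 1"
  by (simp add: Legendre_def cong_0_iff)

text \<open>The operator \<open>T = hecke - 1\<close> is injective modulo \<open>p\<close> on a finite set of residues, hence
  every form is congruent to \<open>T\<^sup>k c\<close> with \<open>k > 0\<close>. As \<open>u\<^sub>0 T = p u\<^sub>1\<close> and
  \<open>u\<^sub>j\<^sub>+\<^sub>1 T = p u\<^sub>j\<^sub>+\<^sub>2 + u\<^sub>j\<close>, the functionals \<open>u\<^sub>j\<close> take values in \<open>p\<^sup>e\<close> for all \<open>e\<close>. The sets
  \<open>I e\<close> play the role of the multiples of \<open>p\<^sup>e\<close>.\<close>

lemma hecke_padic:
  fixes I :: "nat \<Rightarrow> complex set"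
  assumes m: "m > 0" and p: "prime p" "\<not> p dvd 2 * int m" and D: "\<not> p dvd r0 ^ 2 - 4 * int m * n0"
    and I0: "\<And>e. 0 \<in> I e" and Iadd: "\<And>e x y. x \<in> I e \<Longrightarrow> y \<in> I e \<Longrightarrow> x + y \<in> I e"
    and Imult: "\<And>e a x. a \<in> zloc (NN m) \<Longrightarrow> x \<in> I e \<Longrightarrow> a * x \<in> I e"
    and Ip: "\<And>e x. of_int p * x \<in> I (Suc e) \<longleftrightarrow> x \<in> I e"
    and \<rho>: "\<And>x. x \<in> I 0 \<Longrightarrow> \<rho> x \<in> {0..<p}" "\<And>x y. x \<in> I 0 \<Longrightarrow> y \<in> I 0 \<Longrightarrow> \<rho> x = \<rho> y \<Longrightarrow> x - y \<in> I 1"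
    and c: "jform m 0 c" and cI: "\<And>n r. c n r \<in> I 0"
  shows "c (p ^ 2 * n0) (p * r0) - of_int (Legendre (r0 ^ 2 - 4 * int m * n0) p) * c n0 r0 \<in> I e"
proof -
  define \<eta> where "\<eta> = Legendre (r0 ^ 2 - 4 * int m * n0) p"
  have p0: "of_int p \<noteq> (0 :: complex)" using p by auto
  have Idiff: "x - y \<in> I e" if "x \<in> I e" "y \<in> I e" for x y e using Iadd[OF that(1) Imult[OF zloc_of_int[of "-1"] that(2)]] by simp
  define W where "W = {c. jform m 0 c \<and> (\<forall>n r. c n r \<in> I 0)}"
  define T where "T = (\<lambda>c n r. hecke m p c n r - (c n r :: complex))"
  define sub :: "(int \<Rightarrow> int \<Rightarrow> complex) \<Rightarrow> (int \<Rightarrow> int \<Rightarrow> complex) \<Rightarrow> int \<Rightarrow> int \<Rightarrow> complex" where "sub = (\<lambda>c d n r. c n r - d n r)"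
  have Wsub: "sub c d \<in> W" if "c \<in> W" "d \<in> W" for c d
    using that jform_combination[of m 0 c d 1 "-1"] Idiff unfolding W_def sub_def by simp
  have WT: "T c \<in> W" if "c \<in> W" for c
  proof -
    have "(\<lambda>n r. hecke m p c n r) \<in> W" using that jform_hecke[OF m _ p(1)] hecke_in[of "I 0" c m p, OF I0 Iadd] unfolding W_def by simp
    from Wsub[OF this that] show ?thesis by (simp add: T_def sub_def)
  qed
  have WTn: "(T ^^ k) c \<in> W" if "c \<in> W" for c k by (induction k) (use that WT in auto)
  have Tsub: "T (sub c d) = sub (T c) (T d)" for c d using hecke_linear[of m p 1 c "-1" d] by (simp add: T_def sub_def fun_eq_iff)
  have rec: "T c (p ^ 2 * n) (p * r) = of_int p * c (p ^ 2 * (p ^ 2 * n)) (p * (p * r)) + c n r"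
    and first: "T c n0 r0 = of_int p * c (p ^ 2 * n0) (p * r0) + of_int \<eta> * c n0 r0" if "c \<in> W" for c n r
  proof -
    interpret jacobi_form m 0 c by standard (use m that in \<open>auto simp: W_def\<close>)
    show "T c (p ^ 2 * n) (p * r) = of_int p * c (p ^ 2 * (p ^ 2 * n)) (p * (p * r)) + c n r" unfolding T_def by (rule hecke_multiple[OF p])
    show "T c n0 r0 = of_int p * c (p ^ 2 * n0) (p * r0) + of_int \<eta> * c n0 r0" unfolding T_def \<eta>_def by (rule hecke_unramified[OF p D])
  qed
  \<comment> \<open>Congruence modulo p of all coefficients.\<close>
  define cong1 where "cong1 = (\<lambda>c d :: int \<Rightarrow> int \<Rightarrow> complex. \<forall>n r. sub c d n r \<in> I 1)"
  have inj: "cong1 c d" if cd: "c \<in> W" "d \<in> W" and h: "cong1 (T c) (T d)" for c d unfolding cong1_def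
  proof (intro allI)
    fix n r
    note w = Wsub[OF cd]
    \<comment> \<open>The value of T at (p^2 n, p r) recovers the coefficient at (n, r) up to a
      multiple of p: this is the injectivity of T modulo p.\<close>
    have "sub c d n r = sub (T c) (T d) (p ^ 2 * n) (p * r) - of_int p * sub c d (p ^ 2 * (p ^ 2 * n)) (p * (p * r))"
      using rec[OF w, of n r] unfolding Tsub by simp
    moreover have "of_int p * sub c d (p ^ 2 * (p ^ 2 * n)) (p * (p * r)) \<in> I (Suc 0)" unfolding Ip using w by (simp add: W_def)
    ultimately show "sub c d n r \<in> I 1" using h Idiff unfolding cong1_def by simp
  qed
  have injn: "cong1 ((T ^^ i) c) ((T ^^ i) d) \<Longrightarrow> cong1 c d" if cd: "c \<in> W" "d \<in> W" for c d i
  proof (induction i)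
    case (Suc i)
    have "cong1 ((T ^^ i) c) ((T ^^ i) d)" by (rule inj[OF WTn WTn]) (use cd Suc.prems in auto)
    thus ?case by (rule Suc.IH)
  qed simp
  have period: "\<exists>k. cong1 c ((T ^^ Suc k) c)" if c: "c \<in> W" for c
  proof -
    let ?X = "{..<m} \<times> {1..<int m}"
    \<comment> \<open>Pigeonhole principle: residues of finitely many coefficients determine a form
      modulo p, so two iterates of T agree modulo p, and injectivity removes the common
      iterations.\<close>
    define F where "F = (\<lambda>i. \<lambda>x\<in>?X. \<rho> ((T ^^ i) c (int (fst x)) (snd x)))"
    have "range F \<subseteq> (\<Pi>\<^sub>E x\<in>?X. {0..<p})" using WTn[OF c] \<rho>(1) unfolding F_def W_def by (auto simp: PiE_def Pi_def)
    hence "finite (range F)" by (rule finite_subset) (intro finite_PiE; simp)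
    hence "\<not> inj F" using finite_imageD infinite_UNIV_nat by blast
    then obtain i j where ij: "i < j" "F i = F j" unfolding inj_def by (metis linorder_neqE_nat)
    define d where "d = sub ((T ^^ i) c) ((T ^^ j) c)"
    have dW: "d \<in> W" unfolding d_def by (intro Wsub WTn c)
    have "d n r \<in> I 1" for n r
    proof (rule coefficients_in[OF m, of d])
      show "d (int n) r \<in> I 1" if nr: "n < m" "r \<in> {1..<int m}" for n r
      proof -
        have "F i (n, r) = F j (n, r)" using ij by simp
        hence "\<rho> ((T ^^ i) c (int n) r) = \<rho> ((T ^^ j) c (int n) r)" using nr by (simp add: F_def)
        moreover have "(T ^^ i) c (int n) r \<in> I 0" "(T ^^ j) c (int n) r \<in> I 0" using WTn[OF c] by (auto simp: W_def)
        ultimately show ?thesis unfolding d_def sub_def using \<rho>(2) by blast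
      qed
    qed (use dW I0 Iadd Imult in \<open>auto simp: W_def\<close>)
    hence "cong1 ((T ^^ i) c) ((T ^^ j) c)" by (simp add: cong1_def d_def)
    moreover have "(T ^^ j) c = (T ^^ i) ((T ^^ Suc (j - i - 1)) c)" using ij(1) funpow_add[of i "Suc (j - i - 1)" T] by simp
    ultimately have "cong1 c ((T ^^ Suc (j - i - 1)) c)" using injn[OF c WTn[OF c], of i] by metis
    thus ?thesis by blast
  qed
  define a where "a = (\<lambda>j c. c (p ^ (2 * j) * n0) (p ^ j * r0) :: complex)"
  \<comment> \<open>The deviation from the expected law a_(j+1) = \<eta> a_j.\<close>
  define u where "u = (\<lambda>j c. a (Suc j) c - of_int \<eta> * a j c)"
  have a0: "a 0 (T c) = of_int p * a 1 c + of_int \<eta> * a 0 c" if "c \<in> W" for c using first[OF that] by (simp add: a_def)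
  have a1: "a (Suc j) (T c) = of_int p * a (Suc (Suc j)) c + a j c" if "c \<in> W" for c j
    using rec[OF that, of "p ^ (2 * j) * n0" "p ^ j * r0"] by (simp add: a_def power2_eq_square mult_ac)
  \<comment> \<open>Since \<eta>^2 = 1, the terms without a factor p cancel.\<close>
  have u0: "u 0 (T c) = of_int p * u 1 c" if "c \<in> W" for c
  proof -
    have "of_int \<eta> * of_int \<eta> = (1 :: complex)" using Legendre_square[OF D] unfolding \<eta>_def of_int_mult [symmetric] by simp
    hence "of_int \<eta> * (of_int p * a 1 c + of_int \<eta> * a 0 c) = of_int p * of_int \<eta> * a 1 c + a 0 c"
      by (simp add: distrib_left mult.assoc [symmetric])
    thus ?thesis unfolding u_def a0[OF that] a1[OF that] by (simp add: algebra_simps)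
  qed
  have u1: "u (Suc j) (T c) = of_int p * u (Suc (Suc j)) c + u j c" if "c \<in> W" for c j unfolding u_def a1[OF that] by (simp add: algebra_simps)
  have usub: "u j (sub c d) = u j c - u j d" for j c d by (simp add: u_def a_def sub_def algebra_simps)
  \<comment> \<open>Write c = c' + p d with c' in the image of T. The value at c' is covered by the
    assumption \<open>T\<close>, and p times a value in \<open>I e\<close> lies in
    \<open>I (Suc e)\<close>.\<close>
  have key: "u j c \<in> I (Suc e)" if c: "c \<in> W" and IH: "\<And>j c. c \<in> W \<Longrightarrow> u j c \<in> I e" and T: "\<And>c. c \<in> W \<Longrightarrow> u j (T c) \<in> I (Suc e)" for j c e
  proof -
    obtain k where k: "cong1 c ((T ^^ Suc k) c)" using period[OF c] by blast
    define c' where "c' = (T ^^ Suc k) c"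
    have c': "c' = T ((T ^^ k) c)" "c' \<in> W" using WTn[OF c, of "Suc k"] by (simp_all add: c'_def)
    define d where "d = (\<lambda>n r. inverse (of_int p) * sub c c' n r + 0 * c n r)"
    have pd: "sub c c' = (\<lambda>n r. of_int p * d n r)" using p0 by (simp add: d_def fun_eq_iff)
    have "jform m 0 d" unfolding d_def by (rule jform_combination) (use Wsub[OF c c'(2)] c in \<open>auto simp: W_def\<close>)
    moreover have "d n r \<in> I 0" for n r
    proof -
      have "of_int p * d n r \<in> I (Suc 0)" using k unfolding cong1_def c'_def [symmetric] pd One_nat_def by blast
      thus ?thesis unfolding Ip .
    qed
    ultimately have "d \<in> W" by (simp add: W_def)
    hence "of_int p * u j d \<in> I (Suc e)" unfolding Ip by (rule IH)
    moreover have "u j (sub c c') = of_int p * u j d" unfolding pd by (simp add: u_def a_def algebra_simps)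
    moreover have "u j c' \<in> I (Suc e)" unfolding c'(1) by (rule T[OF WTn[OF c]])
    ultimately have "u j (sub c c') + u j c' \<in> I (Suc e)" by (intro Iadd) simp_all
    thus ?thesis by (simp add: usub)
  qed
  \<comment> \<open>The outer induction on e treats all j at once. The inner one on j starts with
    \<open>u0\<close> and proceeds by \<open>u1\<close>.\<close>
  have "\<And>j c. c \<in> W \<Longrightarrow> u j c \<in> I e" for e
  proof (induction e)
    case (0 j c)
    have "a j c \<in> I 0" for j using 0 by (simp add: a_def W_def)
    thus ?case unfolding u_def by (intro Idiff Imult zloc_of_int)
  next
    case (Suc e j c)
    show ?case using Suc.prems
    proof (induction j arbitrary: c)
      case (0 c)
      show ?case
      proof (rule key[OF 0 Suc.IH])
        show "u 0 (T c) \<in> I (Suc e)" if "c \<in> W" for c unfolding u0[OF that] Ip by (rule Suc.IH[OF that])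
      qed
    next
      case step: (Suc j c)
      show ?case
      proof (rule key[OF step.prems Suc.IH])
        show "u (Suc j) (T c) \<in> I (Suc e)" if "c \<in> W" for c unfolding u1[OF that] by (intro Iadd step.IH that iffD2[OF Ip] Suc.IH)
      qed
    qed
  qed
  moreover have "c \<in> W" using c cI by (simp add: W_def)
  ultimately have "u 0 c \<in> I e" by blast
  thus ?thesis by (simp add: u_def a_def \<eta>_def power2_eq_square)
qed

text \<open>Over the rationals x0 extends to a basis of the complex numbers. Such a functional
  brings coefficients into \<open>rat\<close>, where divisibility by powers of p has a
  meaning.\<close>

lemma rational_functional:
  assumes "x0 \<noteq> 0"
  shows "\<exists>\<pi> :: complex \<Rightarrow> rat. (\<forall>x y. \<pi> (x + y) = \<pi> x + \<pi> y) \<and> (\<forall>q x. \<pi> (of_rat q * x) = q * \<pi> x) \<and> \<pi> x0 \<noteq> 0"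
proof -
  interpret V: vector_space "\<lambda>(q::rat) (x::complex). of_rat q * x" by standard (auto simp: of_rat_add of_rat_mult algebra_simps)
  interpret R: vector_space "(*) :: rat \<Rightarrow> rat \<Rightarrow> rat" by standard (auto simp: algebra_simps)
  interpret VR: vector_space_pair "\<lambda>(q::rat) (x::complex). of_rat q * x" "(*) :: rat \<Rightarrow> rat \<Rightarrow> rat" ..
  have "V.independent {x0}" using assms by simp
  then obtain g where g: "Vector_Spaces.linear (\<lambda>(q::rat) (x::complex). of_rat q * x) (*) g" "g x0 = 1"
    using VR.linear_independent_extend[of "{x0}" "\<lambda>_. 1"] by auto
  interpret g: Vector_Spaces.linear "\<lambda>(q::rat) (x::complex). of_rat q * x" "(*)" g by (rule g(1))
  show ?thesis by (intro exI[of _ g]) (use g(2) in \<open>simp add: g.add g.scale\<close>)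
qed

lemma zloc_complex_rational:
  assumes "x \<in> (zloc N :: complex set)" "N > 0"
  shows "\<exists>y\<in>zloc N. x = of_rat y"
proof -
  obtain a k where a: "x * of_nat N ^ k = of_int a" using assms(1) by (auto simp: zloc_def)
  show ?thesis
  proof (intro bexI[of _ "of_int a / of_nat N ^ k"])
    show "x = of_rat (of_int a / of_nat N ^ k)" using a assms(2) by (simp add: of_rat_divide of_rat_power field_simps)
    show "of_int a / of_nat N ^ k \<in> (zloc N :: rat set)" unfolding zloc_def using assms(2) by (intro CollectI exI[of _ a] exI[of _ k]) simp
  qed
qed

lemma zloc_residue:
  fixes x :: rat
  assumes x: "x \<in> zloc N" and p: "p > 0" "coprime (int N) p"
  shows "\<exists>i\<in>{0..<p}. \<exists>a\<in>zloc N. x - of_int i = of_int p * a"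
proof -
  obtain a k where a: "x * of_nat N ^ k = of_int a" using x by (auto simp: zloc_def)
  have "N \<noteq> 0 \<or> p = 1" using p by (cases "N = 0") auto
  show ?thesis
  proof (cases "p = 1")
    case True
    show ?thesis by (intro bexI[of _ 0] bexI[of _ x]) (use True x in auto)
  next
    case False
    hence N: "N > 0" using \<open>N \<noteq> 0 \<or> p = 1\<close> by simp
    have "coprime (int N ^ k) p" using p(2) by simp
    then obtain i where i: "i \<in> {0..<p}" "p dvd int N ^ k * i - a" using unique_linear_solution[of "int N ^ k" p a] p by blast
    then obtain b where b: "int N ^ k * i - a = p * b" by (elim dvdE)
    have "(of_nat N ^ k :: rat) * of_int i - of_int a = of_int p * of_int b" using arg_cong[OF b, of "of_int :: int \<Rightarrow> rat"] by simp
    hence "(x - of_int i) * of_nat N ^ k = of_int p * of_int (- b)" using a by (simp add: algebra_simps)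
    hence "x - of_int i = of_int p * (of_int (- b) / of_nat N ^ k)" using N by (simp add: field_simps)
    moreover have "of_int (- b) / of_nat N ^ k \<in> (zloc N :: rat set)" unfolding zloc_def using N by (intro CollectI exI[of _ "- b"] exI[of _ k]) simp
    ultimately show ?thesis using i(1) by blast
  qed
qed

lemma zloc_padic_zero:
  fixes x :: rat
  assumes p: "prime p" "\<not> p dvd int N" and x: "\<And>e. \<exists>a\<in>zloc N. x = of_int p ^ e * a"
  shows "x = 0"
proof -
  have N: "N > 0" using p by (cases N) auto
  have p1: "p > 1" using p by (simp add: prime_gt_1_int)
  obtain a k where a: "x * of_nat N ^ k = of_int a" using x[of 0] by (auto simp: zloc_def)
  have "p ^ e dvd a" for e
  proof -
    obtain y where y: "y \<in> zloc N" "x = of_int p ^ e * y" using x by blast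
    then obtain b j where b: "y * of_nat N ^ j = of_int b" by (auto simp: zloc_def)
    have "of_int (a * int N ^ j) = (x * of_nat N ^ k) * of_nat N ^ j" using a by simp
    also have "\<dots> = of_int p ^ e * (y * of_nat N ^ j) * of_nat N ^ k" by (simp add: y(2) mult_ac)
    also have "\<dots> = of_int (p ^ e * b * int N ^ k)" unfolding b by simp
    finally have "a * int N ^ j = p ^ e * b * int N ^ k" by (simp only: of_int_eq_iff)
    hence "p ^ e dvd a * int N ^ j" by simp
    moreover have "coprime (p ^ e) (int N ^ j)" using p by (simp add: prime_imp_coprime)
    ultimately show ?thesis by (simp add: coprime_dvd_mult_left_iff)
  qed
  hence "p ^ nat \<bar>a\<bar> dvd a" .
  moreover have "\<bar>a\<bar> < p ^ nat \<bar>a\<bar>"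
  proof -
    have "nat \<bar>a\<bar> < 2 ^ nat \<bar>a\<bar>" by (rule less_exp)
    hence "int (nat \<bar>a\<bar>) < 2 ^ nat \<bar>a\<bar>" by (metis of_nat_less_iff of_nat_numeral of_nat_power)
    also have "\<dots> \<le> p ^ nat \<bar>a\<bar>" using p1 by (intro power_mono) auto
    finally show ?thesis by simp
  qed
  ultimately have "a = 0" using dvd_imp_le_int[of a "p ^ nat \<bar>a\<bar>"] by auto
  thus ?thesis using a N by simp
qed

text \<open>If the difference x0 of the two sides were nonzero, a rational functional not vanishing
  at x0 would map it to an element of Z[1/N] divisible by all powers of p. As p > 8m, it does not
  divide N.\<close>

lemma unramified_coefficient:
  assumes m: "m > 0" and p: "prime p" "p > 8 * int m" and D: "\<not> p dvd r0 ^ 2 - 4 * int m * n0" and c: "jform m 0 c"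
  shows "c (p ^ 2 * n0) (p * r0) = of_int (Legendre (r0 ^ 2 - 4 * int m * n0) p) * c n0 r0"
proof (rule ccontr)
  define x0 where "x0 = c (p ^ 2 * n0) (p * r0) - of_int (Legendre (r0 ^ 2 - 4 * int m * n0) p) * c n0 r0"
  assume "\<not> ?thesis"
  hence "x0 \<noteq> 0" by (simp add: x0_def)
  then obtain \<pi>0 :: "complex \<Rightarrow> rat" where pi0: "\<And>x y. \<pi>0 (x + y) = \<pi>0 x + \<pi>0 y" "\<And>q x. \<pi>0 (of_rat q * x) = q * \<pi>0 x" "\<pi>0 x0 \<noteq> 0"
    using rational_functional by blast
  let ?X = "{..<m} \<times> {1..<int m}"
  \<comment> \<open>A common denominator of the finitely many values that generate all others over
    Z[1/N]; p may divide it.\<close>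
  define d where "d = (\<Prod>(n, r)\<in>?X. snd (quotient_of (\<pi>0 (c (int n) r))))"
  have dpos: "d > 0" unfolding d_def by (intro prod_pos) (auto simp: quotient_of_denom_pos')
  define \<pi> where "\<pi> = (\<lambda>x. of_int d * \<pi>0 x)"
  have pi: "\<pi> (x + y) = \<pi> x + \<pi> y" "\<pi> (of_rat q * x) = q * \<pi> x" for x y q by (simp_all add: \<pi>_def pi0 distrib_left)
  have pi_0: "\<pi> 0 = 0" using pi(2)[of 0 0] by simp
  have pi_int: "\<pi> (of_int i * x) = of_int i * \<pi> x" for i x using pi(2)[of "of_int i" x] by simp
  have pi_diff: "\<pi> (x - y) = \<pi> x - \<pi> y" for x y using pi(1)[of "x - y" y] by simp
  have small: "\<pi> (c (int n) r) \<in> zloc (NN m)" if "(n, r) \<in> ?X" for n r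
  proof -
    define y where "y = \<pi>0 (c (int n) r)"
    have "snd (quotient_of y) dvd d" unfolding d_def y_def using dvd_prodI[OF _ that, of "\<lambda>(n, r). snd (quotient_of (\<pi>0 (c (int n) r)))"] by simp
    then obtain b where "d = snd (quotient_of y) * b" by (elim dvdE)
    moreover have "y = of_int (fst (quotient_of y)) / of_int (snd (quotient_of y))" by (rule quotient_of_div) simp
    moreover have "snd (quotient_of y) \<noteq> 0" using quotient_of_denom_pos'[of y] by simp
    moreover have "dd = s * b \<Longrightarrow> y = of_int f / of_int s \<Longrightarrow> s \<noteq> 0 \<Longrightarrow> of_int dd * y = of_int (b * f)" for dd s b f :: int by simp
    ultimately have "of_int d * y = of_int (b * fst (quotient_of y))" by blast
    thus ?thesis unfolding \<pi>_def y_def [symmetric] by (simp del: of_int_mult)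
  qed
  define I where "I = (\<lambda>e. {x. \<exists>a\<in>zloc (NN m). \<pi> x = of_int p ^ e * a})"
  have cop: "\<not> p dvd int (NN m)"
  proof
    assume "p dvd int (NN m)"
    hence "nat p dvd fact (8 * m)" using p by (metis int_dvd_int_iff int_nat_eq prime_ge_0_int)
    moreover have "prime (nat p)" using p(1) by simp
    ultimately have "nat p \<le> 8 * m" by (simp add: prime_dvd_fact_iff)
    thus False using p(2) by linarith
  qed
  have cop': "coprime (int (NN m)) p" using p(1) cop by (metis coprime_commute prime_imp_coprime)
  have p0: "p > 0" using p by simp
  have p2m: "\<not> p dvd 2 * int m"
  proof
    assume "p dvd 2 * int m"
    hence "p \<le> 2 * int m" using m by (intro zdvd_imp_le) auto
    thus False using p m by simp
  qed
  have I0: "0 \<in> I e" for e by (auto simp: I_def pi_0 intro!: bexI[of _ 0])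
  have Iadd: "x + y \<in> I e" if xy: "x \<in> I e" "y \<in> I e" for x y e
  proof -
    obtain a b where "a \<in> zloc (NN m)" "\<pi> x = of_int p ^ e * a" "b \<in> zloc (NN m)" "\<pi> y = of_int p ^ e * b"
      using xy unfolding I_def by blast
    thus ?thesis unfolding I_def by (intro CollectI bexI[of _ "a + b"]) (auto simp: pi distrib_left)
  qed
  have Imult: "a * x \<in> I e" if ax: "a \<in> zloc (NN m)" "x \<in> I e" for a x e
  proof -
    obtain a' where "a' \<in> zloc (NN m)" "a = of_rat a'" using zloc_complex_rational[OF ax(1)] by auto
    moreover obtain b where "b \<in> zloc (NN m)" "\<pi> x = of_int p ^ e * b" using ax(2) by (auto simp: I_def)
    ultimately show ?thesis unfolding I_def by (intro CollectI bexI[of _ "a' * b"]) (auto simp: pi mult.left_commute)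
  qed
  have Ip: "of_int p * x \<in> I (Suc e) \<longleftrightarrow> x \<in> I e" for x e using p0 by (simp add: I_def pi_int mult.assoc)
  \<comment> \<open>The residue modulo p of \<open>\<pi> x\<close> in Z[1/N], as an integer from 0
    to p - 1.\<close>
  define P where "P = (\<lambda>x i. i \<in> {0..<p} \<and> (\<exists>a\<in>zloc (NN m). \<pi> x - of_int i = of_int p * a))"
  define \<rho> where "\<rho> = (\<lambda>x. SOME i. P x i)"
  have rho: "P x (\<rho> x)" if "x \<in> I 0" for x
  proof -
    have "\<pi> x \<in> zloc (NN m)" using that by (auto simp: I_def)
    hence "\<exists>i. P x i" unfolding P_def using zloc_residue[OF _ p0 cop'] by blast
    thus ?thesis unfolding \<rho>_def by (rule someI_ex)
  qed
  have rho1: "\<rho> x \<in> {0..<p}" if "x \<in> I 0" for x using rho[OF that] by (simp add: P_def)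
  have rho2: "x - y \<in> I 1" if xy: "x \<in> I 0" "y \<in> I 0" "\<rho> x = \<rho> y" for x y
  proof -
    obtain a b where "a \<in> zloc (NN m)" "\<pi> x - of_int (\<rho> x) = of_int p * a" "b \<in> zloc (NN m)" "\<pi> y - of_int (\<rho> y) = of_int p * b"
      using rho[OF xy(1)] rho[OF xy(2)] by (auto simp: P_def)
    thus ?thesis unfolding I_def using xy(3) by (intro CollectI bexI[of _ "a - b"]) (auto simp: pi_diff algebra_simps)
  qed
  have cI: "c n r \<in> I 0" for n r by (rule coefficients_in[OF m c I0 Iadd Imult]) (use small in \<open>auto simp: I_def\<close>)
  have "x0 \<in> I e" for e unfolding x0_def by (rule hecke_padic[OF m p(1) p2m D I0 Iadd Imult Ip rho1 rho2 c cI])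
  hence "\<exists>a\<in>zloc (NN m). \<pi> x0 = of_int p ^ e * a" for e by (auto simp: I_def)
  hence "\<pi> x0 = 0" by (rule zloc_padic_zero[OF p(1) cop])
  thus False using pi0(3) dpos by (simp add: \<pi>_def)
qed

lemma hecke_eigenvalue:
  assumes m: "m > 0" and p: "prime p" "p > 8 * int m" and D: "\<not> p dvd r ^ 2 - 4 * int m * n" and c: "jform m 0 c"
  shows "hecke m p c n r - c n r = of_int ((p + 1) * Legendre (r ^ 2 - 4 * int m * n) p) * c n r"
proof -
  interpret jacobi_form m 0 c by standard (use m c in auto)
  have p2m: "\<not> p dvd 2 * int m"
  proof
    assume "p dvd 2 * int m"
    hence "p \<le> 2 * int m" using m by (intro zdvd_imp_le) auto
    thus False using p m by simp
  qed
  show ?thesis unfolding hecke_unramified[OF p(1) p2m D] unramified_coefficient[OF m p D c] by (simp add: algebra_simps)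
qed

section \<open>Isolating discriminants\<close>

lemma Legendre_pm1: "Legendre a p = 0 \<or> Legendre a p = 1 \<or> Legendre a p = -1"
  by (simp add: Legendre_def)

lemma Legendre_eq_0_iff: "Legendre a p = 0 \<longleftrightarrow> p dvd a"
  by (simp add: Legendre_def cong_0_iff)

lemma cong_pm1_eq:
  fixes x y p :: int
  assumes "[x = y] (mod p)" "p > 2" "x \<in> {-1, 0, 1}" "y \<in> {-1, 0, 1}"
  shows "x = y"
proof -
  have "p dvd x - y" using assms(1) by (simp add: cong_iff_dvd_diff)
  moreover have "\<bar>x - y\<bar> < p" using assms by auto
  ultimately have "x - y = 0" using dvd_imp_le_int[of "x - y" p] by auto
  thus ?thesis by simp
qed

text \<open>By Euler's criterion both sides are congruent modulo p, and values among -1, 0, 1 that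
  are congruent modulo p > 2 coincide.\<close>

lemma Legendre_mult:
  assumes "prime (p :: int)" "p > 2"
  shows "Legendre (a * b) p = Legendre a p * Legendre b p"
proof -
  define q where "q = nat p"
  have q: "prime q" "2 < q" "p = int q" using assms by (auto simp: q_def)
  have "[Legendre (a * b) p = (a * b) ^ ((q - 1) div 2)] (mod p)" unfolding q(3) by (rule euler_criterion[OF q(1,2)])
  moreover have "[Legendre a p * Legendre b p = a ^ ((q - 1) div 2) * b ^ ((q - 1) div 2)] (mod p)"
    unfolding q(3) by (intro cong_mult euler_criterion[OF q(1,2)])
  ultimately have "[Legendre (a * b) p = Legendre a p * Legendre b p] (mod p)" unfolding power_mult_distrib by (meson cong_sym cong_trans)
  thus ?thesis using assms(2)
  proof (rule cong_pm1_eq)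
    show "Legendre (a * b) p \<in> {-1, 0, 1}" using Legendre_pm1[of "a * b" p] by blast
    show "Legendre a p * Legendre b p \<in> {-1, 0, 1}" using Legendre_pm1[of a p] Legendre_pm1[of b p] by (elim disjE) simp_all
  qed
qed

lemma Legendre_cong: "[a = b] (mod p) \<Longrightarrow> Legendre a p = Legendre b p"
proof -
  assume ab: "[a = b] (mod p)"
  have "QuadRes p a = QuadRes p b" unfolding QuadRes_def using ab by (meson cong_sym cong_trans)
  moreover have "[a = 0] (mod p) = [b = 0] (mod p)" using ab by (meson cong_sym cong_trans)
  ultimately show ?thesis by (simp add: Legendre_def)
qed

lemma Legendre_1: "p > 1 \<Longrightarrow> Legendre 1 p = 1"
proof -
  assume "p > 1"
  hence "\<not> [1 = 0] (mod p)" by (simp add: cong_0_iff)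
  moreover have "QuadRes p 1" unfolding QuadRes_def by (intro exI[of _ 1]) simp
  ultimately show ?thesis by (simp add: Legendre_def)
qed

text \<open>Otherwise squaring would be a surjective, hence injective, self-map of the nonzero
  residues; but 1 and p - 1 have the same square.\<close>

lemma nonresidue_exists:
  assumes p: "prime (p :: int)" "p > 2"
  shows "\<exists>u. Legendre u p = -1"
proof (rule ccontr)
  assume n: "\<nexists>u. Legendre u p = -1"
  let ?S = "{1..p - 1}"
  have sub: "(\<lambda>x. x ^ 2 mod p) ` ?S \<subseteq> ?S"
  proof clarify
    fix x assume x: "x \<in> ?S"
    hence "\<not> p dvd x" by (auto dest: zdvd_imp_le)
    hence "\<not> p dvd x ^ 2" using p(1) prime_dvd_power by blast
    hence "x ^ 2 mod p \<noteq> 0" by (simp add: dvd_eq_mod_eq_0)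
    moreover have "x ^ 2 mod p \<ge> 0" "x ^ 2 mod p < p" using p by auto
    ultimately show "x ^ 2 mod p \<in> ?S" by simp
  qed
  have "?S \<subseteq> (\<lambda>x. x ^ 2 mod p) ` ?S"
  proof
    fix u assume u: "u \<in> ?S"
    hence pu: "\<not> p dvd u" by (auto dest: zdvd_imp_le)
    hence "Legendre u p = 1" using n Legendre_pm1[of u p] Legendre_eq_0_iff[of u p] by auto
    hence "QuadRes p u" by (auto simp: Legendre_def split: if_splits)
    then obtain y where y: "[y ^ 2 = u] (mod p)" by (auto simp: QuadRes_def)
    have "\<not> p dvd y"
    proof
      assume "p dvd y"
      hence "p dvd y ^ 2" by (simp add: power2_eq_square)
      thus False using y pu by (simp add: cong_dvd_iff)
    qed
    hence "y mod p \<noteq> 0" by (simp add: dvd_eq_mod_eq_0)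
    moreover have "y mod p \<ge> 0" "y mod p < p" using p by auto
    ultimately have "y mod p \<in> ?S" by simp
    moreover have "(y mod p) ^ 2 mod p = u"
    proof -
      have "(y mod p) ^ 2 mod p = u mod p" using y by (simp add: power_mod cong_def)
      thus ?thesis using u by simp
    qed
    ultimately show "u \<in> (\<lambda>x. x ^ 2 mod p) ` ?S" by (intro image_eqI[of _ _ "y mod p"]) auto
  qed
  hence "inj_on (\<lambda>x. x ^ 2 mod p) ?S" using sub by (intro eq_card_imp_inj_on) (auto simp: subset_antisym)
  moreover have "1 ^ 2 mod p = (p - 1) ^ 2 mod p"
  proof -
    have "(p - 1) ^ 2 = 1 ^ 2 + p * (p - 2)" by (simp add: power2_eq_square algebra_simps)
    thus ?thesis by (metis mod_mult_self2)
  qed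
  ultimately have "1 = p - 1" using p by (auto dest!: inj_onD[of _ _ 1 "p - 1"])
  thus False using p by simp
qed

text \<open>Gauss's lemma: the numbers 2, 4, ..., p - 1 are already reduced modulo p, and the parity
  of the number of those above (p - 1)/2 depends on p modulo 8.\<close>

lemma Legendre_2:
  assumes p: "prime (p :: int)" "p > 2"
  shows "Legendre 2 p = (if p mod 8 \<in> {1, 7} then 1 else -1)"
proof -
  define q where "q = nat p"
  have q: "prime q" "2 < q" "p = int q" using p by (auto simp: q_def)
  have "\<not> p dvd 2" using p by (auto dest: zdvd_imp_le)
  interpret GAUSS q 2
  proof
    show "[2 \<noteq> 0] (mod int q)" using \<open>\<not> p dvd 2\<close> unfolding q(3) cong_0_iff .
  qed (use q(1,2) in simp_all)
  define h where "h = (p - 1) div 2"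
  have ph: "p = 2 * h + 1" using p_eq2 by (simp add: h_def q)
  have "B = (\<lambda>x. x * 2) ` {0<..h}" by (simp add: B_def A_def h_def q)
  moreover have "C = B"
  proof -
    have "x mod int q = x" if xB: "x \<in> B" for x
    proof -
      obtain y where "x = y * 2" "0 < y" "y \<le> h" using xB unfolding \<open>B = (\<lambda>x. x * 2) ` {0<..h}\<close> by auto
      thus ?thesis unfolding q(3) [symmetric] using ph by (intro mod_pos_pos_trivial) linarith+
    qed
    thus ?thesis by (simp add: C_def)
  qed
  ultimately have "E = (\<lambda>x. x * 2) ` {h div 2<..h}" unfolding E_def using p q(3) by (auto simp: h_def)
  hence "card E = card {h div 2<..h}" by (simp add: card_image inj_on_def)
  also have "\<dots> = nat (h - h div 2)" by simp
  finally have L: "Legendre 2 p = (-1) ^ nat (h - h div 2)" using gauss_lemma q by simp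
  define k where "k = p div 8"
  have pk: "p = 8 * k + p mod 8" by (simp add: k_def)
  have "k \<ge> 0" using p by (simp add: k_def)
  have "odd p" using ph by simp
  hence "p mod 8 = 1 \<or> p mod 8 = 3 \<or> p mod 8 = 5 \<or> p mod 8 = 7" by presburger
  thus ?thesis
  proof (elim disjE)
    assume e: "p mod 8 = 1"
    hence "h = 4 * k" using pk ph by linarith
    hence "nat (h - h div 2) = 2 * nat k" using \<open>k \<ge> 0\<close> by simp
    thus ?thesis using e L by simp
  next
    assume e: "p mod 8 = 3"
    hence "h = 4 * k + 1" using pk ph by linarith
    hence "nat (h - h div 2) = 2 * nat k + 1" using \<open>k \<ge> 0\<close> by simp
    thus ?thesis using e L by simp
  next
    assume e: "p mod 8 = 5"
    hence "h = 4 * k + 2" using pk ph by linarith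
    hence "nat (h - h div 2) = 2 * nat k + 1" using \<open>k \<ge> 0\<close> by simp
    thus ?thesis using e L by simp
  next
    assume e: "p mod 8 = 7"
    hence "h = 4 * k + 3" using pk ph by linarith
    hence "nat (h - h div 2) = 2 * (nat k + 1)" using \<open>k \<ge> 0\<close> by simp
    thus ?thesis using e L by simp
  qed
qed

text \<open>The Jacobi symbol \<open>(l/u)\<close> for a prime \<open>l\<close> and odd \<open>u\<close>, in its reciprocal form.\<close>

definition jacobi :: "int \<Rightarrow> int \<Rightarrow> int" where
  "jacobi l u = (if l = 2 then if u mod 8 \<in> {1, 7} then 1 else -1
     else Legendre u l * (if l mod 4 = 3 \<and> u mod 4 = 3 then -1 else 1))"

lemma jacobi_mult:
  assumes l: "prime l" and u: "odd u" and v: "odd v"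
  shows "jacobi l (u * v) = jacobi l u * jacobi l v"
proof (cases "l = 2")
  case True
  have odd8: "w mod 8 = 1 \<or> w mod 8 = 3 \<or> w mod 8 = 5 \<or> w mod 8 = 7" if "odd w" for w :: int using that by presburger
  have e: "(u * v) mod 8 = (u mod 8) * (v mod 8) mod 8" by (rule mod_mult_eq [symmetric])
  show ?thesis using odd8[OF u] odd8[OF v] unfolding jacobi_def e by (elim disjE) (simp_all add: True)
next
  case False
  have l2: "l > 2" using l False prime_ge_2_int[of l] by linarith
  have odd4: "w mod 4 = 1 \<or> w mod 4 = 3" if "odd w" for w :: int using that by presburger
  have e: "(u * v) mod 4 = (u mod 4) * (v mod 4) mod 4" by (rule mod_mult_eq [symmetric])
  show ?thesis using odd4[OF u] odd4[OF v] unfolding jacobi_def e Legendre_mult[OF l l2] by (elim disjE) (simp_all add: False)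
qed

lemma jacobi_prime:
  assumes l: "prime l" and q: "prime q" "q > 2" "q \<noteq> l"
  shows "jacobi l q = Legendre l q"
proof (cases "l = 2")
  case True
  thus ?thesis using Legendre_2[OF q(1,2)] by (simp add: jacobi_def)
next
  case False
  have l2: "l > 2" using l False prime_ge_2_int[of l] by linarith
  have odd: "odd l" "odd q" using l q l2 by (auto simp: prime_odd_int)
  have rec: "Legendre q l * Legendre l q = (-1) ^ nat ((q - 1) div 2 * ((l - 1) div 2))"
  proof (rule Quadratic_Reciprocity_int)
    show "prime (nat q)" "prime (nat l)" using l q by simp_all
  qed (fact l2 q(2,3))+
  have nd: "\<not> q dvd l" "\<not> l dvd q" using primes_dvd_imp_eq[OF l q(1)] primes_dvd_imp_eq[OF q(1) l] q(3) by auto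
  have L: "Legendre q l \<in> {1, -1}" "Legendre l q \<in> {1, -1}"
    using Legendre_pm1[of q l] Legendre_pm1[of l q] Legendre_eq_0_iff[of q l] Legendre_eq_0_iff[of l q] nd by auto
  have "even (nat ((q - 1) div 2 * ((l - 1) div 2))) \<longleftrightarrow> \<not> (l mod 4 = 3 \<and> q mod 4 = 3)"
  proof -
    have "(q - 1) div 2 * ((l - 1) div 2) \<ge> 0" using l2 q by simp
    hence "even (nat ((q - 1) div 2 * ((l - 1) div 2))) \<longleftrightarrow> even ((q - 1) div 2 * ((l - 1) div 2))" by (simp add: even_nat_iff)
    also have "\<dots> \<longleftrightarrow> even ((q - 1) div 2) \<or> even ((l - 1) div 2)" by (rule even_mult_iff)
    also have "even ((q - 1) div 2) \<longleftrightarrow> q mod 4 \<noteq> 3" using odd(2) by presburger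
    also have "even ((l - 1) div 2) \<longleftrightarrow> l mod 4 \<noteq> 3" using odd(1) by presburger
    finally show ?thesis by blast
  qed
  hence "Legendre q l * Legendre l q = (if l mod 4 = 3 \<and> q mod 4 = 3 then -1 else 1)" unfolding rec by simp
  thus ?thesis using L False by (auto simp: jacobi_def)
qed

text \<open>An integer n is built that is 1 modulo 8 and modulo all numbers up to a bound that are
  prime to l, but is a nonresidue modulo l. By reciprocity the symbol (A/n) is -1, and by
  multiplicativity in n some prime factor of n has a symbol other than 1.\<close>

lemma nonresidue_prime:
  fixes A l :: int
  assumes l: "prime l" "l > 2" and A: "A > 0" "odd (multiplicity l A)"
  shows "\<exists>p. prime p \<and> p > K \<and> Legendre A p = -1"
proof -
  define N where "N = max l (max K A)"
  \<comment> \<open>Prime factors of n = 1 + P t exceed N: smaller ones divide P, except l, and l is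
    excluded because n is a nonresidue. The 8 settles the conditions modulo 4 and 8 in
    \<open>jacobi\<close>.\<close>
  define P where "P = 8 * (\<Prod>k\<in>{k\<in>{1..N}. \<not> l dvd k}. k)"
  have fin: "finite {k\<in>{1..N}. \<not> l dvd k}" by (rule finite_subset[of _ "{1..N}"]) auto
  have dvdP: "k dvd P" if k: "k \<in> {1..N}" "\<not> l dvd k" for k
  proof -
    have "k dvd (\<Prod>k\<in>{k\<in>{1..N}. \<not> l dvd k}. k)" by (rule dvd_prodI[OF fin]) (use k in simp)
    thus ?thesis unfolding P_def by (rule dvd_mult)
  qed
  have "\<not> l dvd P"
  proof
    assume "l dvd P"
    hence "l dvd 2 ^ 3 \<or> l dvd (\<Prod>k\<in>{k\<in>{1..N}. \<not> l dvd k}. k)" using l(1) unfolding P_def by (simp add: prime_dvd_mult_iff)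
    moreover have "\<not> l dvd 2 ^ 3" using l prime_dvd_power[of l 2 3] zdvd_imp_le[of l 2] by auto
    moreover have "\<not> l dvd (\<Prod>k\<in>{k\<in>{1..N}. \<not> l dvd k}. k)" unfolding prime_dvd_prod_iff[OF fin l(1)] by simp
    ultimately show False by blast
  qed
  hence cop: "coprime P l" using l(1) by (metis coprime_commute prime_imp_coprime)
  obtain u where u: "Legendre u l = -1" using nonresidue_exists[OF l] by blast
  obtain t where t: "t \<in> {0..<l}" "l dvd P * t - (u - 1)" using unique_linear_solution[OF cop, of "u - 1"] l by auto
  define n where "n = 1 + P * t"
  have P0: "P > 0" unfolding P_def by (intro mult_pos_pos prod_pos) auto
  have "P * t \<ge> 0" using P0 t by (intro mult_nonneg_nonneg) auto
  hence n0: "n > 0" by (simp add: n_def)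
  have nP: "n mod k = 1 mod k" if "k dvd P" for k using that by (auto simp: n_def mult.assoc elim!: dvdE)
  have nl: "Legendre n l = -1"
  proof -
    have "[n = u] (mod l)" using t(2) by (simp add: cong_iff_dvd_diff n_def algebra_simps)
    thus ?thesis using Legendre_cong u by simp
  qed
  have "8 dvd P" by (simp add: P_def)
  hence n8: "n mod 8 = 1" and n4: "n mod 4 = 1" and n2: "odd n"
    using nP[of 8] nP[of 4] nP[of 2] dvd_trans[of 4 8 P] dvd_trans[of 2 8 P] by (auto simp: odd_iff_mod_2_eq_one)
  have big: "q > N" if q: "prime q" "q dvd n" for q
  proof (rule ccontr)
    assume "\<not> q > N"
    hence qN: "q \<in> {1..N}" using prime_ge_1_int[OF q(1)] by simp
    show False
    proof (cases "l dvd q")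
      case True
      hence "q = l" using primes_dvd_imp_eq[OF l(1) q(1)] by simp
      thus False using nl q(2) Legendre_eq_0_iff[of n l] by simp
    next
      case False
      have "n mod q = 1 mod q" by (rule nP[OF dvdP[OF qN False]])
      hence "1 mod q = 0" using q(2) by (simp add: dvd_eq_mod_eq_0)
      thus False using prime_gt_1_int[OF q(1)] by simp
    qed
  qed
  \<comment> \<open>The symbol (A/x) in reciprocal form, defined for composite x; on primes above N
    it is the Legendre symbol of A.\<close>
  define F where "F = (\<lambda>x. \<Prod>l'\<in>#prime_factorization A. jacobi l' x)"
  have Fq: "F q = Legendre A q" if q: "prime q" "q > N" for q
  proof -
    have q2: "q > 2" using q l by (simp add: N_def)
    have "F q = (\<Prod>l'\<in>#prime_factorization A. Legendre l' q)" unfolding F_def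
    proof (rule arg_cong[of _ _ prod_mset], rule image_mset_cong)
      fix l' assume l': "l' \<in># prime_factorization A"
      hence "prime l'" "l' dvd A" by auto
      hence "l' \<le> A" using A by (intro zdvd_imp_le) auto
      thus "jacobi l' q = Legendre l' q" using q q2 \<open>prime l'\<close> by (intro jacobi_prime) (auto simp: N_def)
    qed
    also have "\<dots> = Legendre (\<Prod>\<^sub># (prime_factorization A)) q"
    proof -
      have "(\<Prod>l'\<in>#M. Legendre l' q) = Legendre (\<Prod>\<^sub># M) q" for M
        by (induction M) (use Legendre_1[of q] q2 in \<open>auto simp: Legendre_mult[OF q(1) q2]\<close>)
      thus ?thesis .
    qed
    also have "\<Prod>\<^sub># (prime_factorization A) = A" using A by (simp add: prod_mset_prime_factorization_int)
    finally show ?thesis .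
  qed
  have Fmult: "F (x * y) = F x * F y" if "odd x" "odd y" for x y
  proof -
    have "F (x * y) = (\<Prod>l'\<in>#prime_factorization A. jacobi l' x * jacobi l' y)"
      unfolding F_def by (rule arg_cong[of _ _ prod_mset], rule image_mset_cong) (use that in \<open>auto intro: jacobi_mult\<close>)
    thus ?thesis unfolding F_def prod_mset.distrib .
  qed
  have "F n = -1"
  proof -
    \<comment> \<open>Only the prime factor l of A contributes -1, and it occurs an odd number of
      times.\<close>
    have "F n = (\<Prod>l'\<in>#prime_factorization A. if l' = l then -1 else 1)" unfolding F_def
    proof (rule arg_cong[of _ _ prod_mset], rule image_mset_cong)
      fix l' assume l': "l' \<in># prime_factorization A"
      hence p': "prime l'" "l' dvd A" by auto
      hence "l' \<le> A" using A by (intro zdvd_imp_le) auto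
      hence "l' \<in> {1..N}" using prime_ge_1_int[OF p'(1)] by (simp add: N_def)
      show "jacobi l' n = (if l' = l then -1 else 1)"
      proof (cases "l' = l")
        case True thus ?thesis using l nl n4 by (simp add: jacobi_def)
      next
        case False
        hence "\<not> l dvd l'" using primes_dvd_imp_eq[OF l(1) p'(1)] by auto
        hence "[n = 1] (mod l')" using nP[OF dvdP[OF \<open>l' \<in> {1..N}\<close>]] by (simp add: cong_def)
        hence "Legendre n l' = 1" using Legendre_cong Legendre_1[OF prime_gt_1_int[OF p'(1)]] by simp
        thus ?thesis using False n8 n4 by (simp add: jacobi_def)
      qed
    qed
    also have "\<dots> = (-1) ^ count (prime_factorization A) l"
    proof -
      have "(\<Prod>l'\<in>#M. if l' = l then -1 else (1::int)) = (-1) ^ count M l" for M by (induction M) auto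
      thus ?thesis .
    qed
    also have "count (prime_factorization A) l = multiplicity l A" using l by (simp add: count_prime_factorization_prime)
    finally show ?thesis using A(2) by simp
  qed
  have "\<exists>q. prime q \<and> q dvd n \<and> F q \<noteq> 1"
  proof (rule ccontr)
    assume no: "\<nexists>q. prime q \<and> q dvd n \<and> F q \<noteq> 1"
    have "\<forall>q\<in>#M. prime q \<and> F q = 1 \<and> odd q \<Longrightarrow> F (\<Prod>\<^sub># M) = 1 \<and> odd (\<Prod>\<^sub># M)" for M
    proof (induction M)
      case empty
      have "F 1 = F 1 * F 1" using Fmult[of 1 1] by simp
      moreover have "F 1 \<noteq> 0"
      proof -
        have "F 1 * F n \<noteq> 0" using Fmult[of 1 n] n2 \<open>F n = -1\<close> by simp
        thus ?thesis by auto
      qed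
      ultimately show ?case by simp
    next
      case (add q M)
      thus ?case by (simp add: Fmult)
    qed
    moreover have "\<forall>q\<in>#prime_factorization n. prime q \<and> F q = 1 \<and> odd q" using no n2 by (auto intro: dvd_trans)
    moreover have "\<Prod>\<^sub># (prime_factorization n) = n" using n0 by (simp add: prod_mset_prime_factorization_int)
    ultimately have "F n = 1" by fastforce
    thus False using \<open>F n = -1\<close> by simp
  qed
  then obtain q where q: "prime q" "q dvd n" "F q \<noteq> 1" by blast
  have qN: "q > N" by (rule big[OF q(1,2)])
  have "\<not> q dvd A" using A qN by (auto simp: N_def dest: zdvd_imp_le)
  hence "Legendre A q = -1" using Fq[OF q(1) qN] q(3) Legendre_pm1[of A q] Legendre_eq_0_iff[of A q] by auto
  thus ?thesis using q(1) qN by (intro exI[of _ q]) (simp add: N_def)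
qed

text \<open>The restrictions of V to Y form a space of dimension at most the cardinality of X, so
  finitely many of the conditions f y = 0 imply all. In the induction, the passage to the functions
  vanishing at x costs at most one further point.\<close>

lemma finitely_many_conditions:
  fixes V :: "('y \<Rightarrow> complex) set"
  assumes "finite X" "\<And>f g a b. f \<in> V \<Longrightarrow> g \<in> V \<Longrightarrow> (\<lambda>y. a * f y + b * g y) \<in> V"
    and "\<And>f y. f \<in> V \<Longrightarrow> \<forall>x\<in>X. f x = 0 \<Longrightarrow> y \<in> Y \<Longrightarrow> f y = 0"
  shows "\<exists>S\<subseteq>Y. finite S \<and> (\<forall>f\<in>V. (\<forall>s\<in>S. f s = 0) \<longrightarrow> (\<forall>y\<in>Y. f y = 0))"
  using assms
proof (induction X arbitrary: V rule: finite_induct)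
  case empty
  show ?case by (intro exI[of _ "{}"]) (use empty(2) in auto)
next
  case (insert x X)
  define V' where "V' = {f \<in> V. f x = 0}"
  have "\<exists>S\<subseteq>Y. finite S \<and> (\<forall>f\<in>V'. (\<forall>s\<in>S. f s = 0) \<longrightarrow> (\<forall>y\<in>Y. f y = 0))"
  proof (rule insert.IH)
    show "(\<lambda>y. a * f y + b * g y) \<in> V'" if "f \<in> V'" "g \<in> V'" for f g a b using that insert.prems(1) by (simp add: V'_def)
    show "f y = 0" if "f \<in> V'" "\<forall>x\<in>X. f x = 0" "y \<in> Y" for f y using that insert.prems(2)[of f y] by (simp add: V'_def)
  qed
  then obtain S where S: "S \<subseteq> Y" "finite S" "\<And>f y. f \<in> V' \<Longrightarrow> \<forall>s\<in>S. f s = 0 \<Longrightarrow> y \<in> Y \<Longrightarrow> f y = 0" by blast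
  show ?case
  proof (cases "\<forall>f\<in>V. (\<forall>s\<in>S. f s = 0) \<longrightarrow> (\<forall>y\<in>Y. f y = 0)")
    case True thus ?thesis using S by blast
  next
    case False
    then obtain f0 b where f0: "f0 \<in> V" "\<forall>s\<in>S. f0 s = 0" "b \<in> Y" "f0 b \<noteq> 0" by blast
    have "f0 x \<noteq> 0" using S(3)[of f0 b] f0 by (auto simp: V'_def)
    \<comment> \<open>Subtracting the multiple of \<open>f0\<close> with the same value at x leads
      into V', and vanishing at b then forces this multiple to be 0.\<close>
    have "f y = 0" if f: "f \<in> V" "\<forall>s\<in>insert b S. f s = 0" "y \<in> Y" for f y
    proof -
      define g where "g = (\<lambda>y. 1 * f y + (- (f x / f0 x)) * f0 y)"
      have "g \<in> V'" unfolding V'_def g_def using insert.prems(1)[OF f(1) f0(1), of 1 "- (f x / f0 x)"] \<open>f0 x \<noteq> 0\<close> by simp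
      moreover have "\<forall>s\<in>S. g s = 0" using f f0 by (simp add: g_def)
      ultimately have "g b = 0" using S(3) f0(3) by blast
      hence "f x = 0" using f f0 \<open>f0 x \<noteq> 0\<close> by (simp add: g_def)
      hence "f \<in> V'" using f by (simp add: V'_def)
      thus ?thesis using S(3) f by blast
    qed
    hence "\<forall>f\<in>V. (\<forall>s\<in>insert b S. f s = 0) \<longrightarrow> (\<forall>y\<in>Y. f y = 0)" by blast
    moreover have "insert b S \<subseteq> Y" "finite (insert b S)" using S(1,2) f0(3) by simp_all
    ultimately show ?thesis by blast
  qed
qed

text \<open>If the Legendre symbols of the discriminants of
  \<open>(n0, r0)\<close> and \<open>(n1, r1)\<close> at \<open>p\<close> differ, subtracting from \<open>hecke\<close> its eigenvalue at \<open>(n1, r1)\<close>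
  kills the second coefficient but not the first.\<close>

lemma kill_finitely_many:
  assumes m: "m > 0" and l: "prime l" "l > 2" and c: "jform m 0 c" and c0: "c n0 r0 \<noteq> 0"
    and odd: "odd (multiplicity l (4 * int m * n0 - r0 ^ 2))"
    and S: "finite S" "\<And>n r. (n, r) \<in> S \<Longrightarrow> 4 * int m * n - r ^ 2 > 0 \<and> even (multiplicity l (4 * int m * n - r ^ 2))"
  shows "\<exists>f. jform m 0 f \<and> f n0 r0 \<noteq> 0 \<and> (\<forall>x\<in>S. f (fst x) (snd x) = 0)"
  using S
proof (induction S rule: finite_induct)
  case empty
  show ?case by (intro exI[of _ c]) (use c c0 in simp)
next
  case (insert x S)
  have "\<exists>f. jform m 0 f \<and> f n0 r0 \<noteq> 0 \<and> (\<forall>x\<in>S. f (fst x) (snd x) = 0)"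
    by (rule insert.IH) (rule insert.prems, simp)
  then obtain f where f: "jform m 0 f" "f n0 r0 \<noteq> 0" "\<forall>x\<in>S. f (fst x) (snd x) = 0" by blast
  obtain n1 r1 where x: "x = (n1, r1)" by force
  define E where "E = (\<lambda>n r. 4 * int m * n - r ^ 2)"
  have E1: "E n1 r1 > 0" "even (multiplicity l (E n1 r1))" using insert.prems[of n1 r1] by (auto simp: x E_def)
  have E0: "E n0 r0 > 0"
  proof -
    have "E n0 r0 \<ge> 0" using jform_support[OF c c0] by (simp add: E_def)
    moreover have "E n0 r0 \<noteq> 0" using odd by (auto simp: E_def)
    ultimately show ?thesis by simp
  qed
  \<comment> \<open>Odd plus even: \<open>nonresidue_prime\<close> applies to the product and gives
    a p at which the symbols of the two discriminants differ.\<close>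
  have "odd (multiplicity l (E n0 r0 * E n1 r1))"
  proof -
    have "odd (multiplicity l (E n0 r0))" using odd by (simp add: E_def)
    moreover have "multiplicity l (E n0 r0 * E n1 r1) = multiplicity l (E n0 r0) + multiplicity l (E n1 r1)"
      by (rule prime_elem_multiplicity_mult_distrib) (use l E0 E1 in simp_all)
    ultimately show ?thesis using E1(2) by simp
  qed
  note oddE = this
  have posE: "E n0 r0 * E n1 r1 > 0" using E0 E1 by simp
  \<comment> \<open>The maximum bounds 8m and all -D involved. A prime beyond it divides none of
    them, so \<open>hecke_eigenvalue\<close> applies to each.\<close>
  define Z where "Z = insert (8 * int m) ((\<lambda>(n, r). E n r) ` insert (n0, r0) (insert x S))"
  define K where "K = Max Z"
  have finZ: "finite Z" using insert(1) by (simp add: Z_def)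
  have Kle: "8 * int m \<le> K" "\<And>n r. (n, r) \<in> insert (n0, r0) (insert x S) \<Longrightarrow> E n r \<le> K"
  proof -
    show "8 * int m \<le> K" unfolding K_def by (rule Max_ge[OF finZ]) (simp add: Z_def)
    show "E n r \<le> K" if nr: "(n, r) \<in> insert (n0, r0) (insert x S)" for n r
    proof -
      have "(case (n, r) of (n, r) \<Rightarrow> E n r) \<in> Z" unfolding Z_def by (intro insertI2 imageI nr)
      thus ?thesis unfolding K_def by (intro Max_ge[OF finZ]) simp
    qed
  qed
  obtain p where p: "prime p" "p > K" "Legendre (E n0 r0 * E n1 r1) p = -1" using nonresidue_prime[OF l posE oddE, of K] by blast
  have p8: "p > 8 * int m" using Kle(1) p by simp
  have p2: "p > 2" using p8 m by linarith
  define L where "L = (\<lambda>n r. Legendre (r ^ 2 - 4 * int m * n) p)"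
  have ndvd: "\<not> p dvd r ^ 2 - 4 * int m * n" if "(n, r) \<in> insert (n0, r0) (insert x S)" for n r
  proof
    assume "p dvd r ^ 2 - 4 * int m * n"
    hence "p dvd - (r ^ 2 - 4 * int m * n)" by (simp only: dvd_minus_iff)
    hence "p dvd E n r" by (simp add: E_def)
    moreover have "E n r > 0" using that E0 E1 insert.prems[of n r] by (auto simp: x E_def)
    ultimately have "p \<le> E n r" by (intro zdvd_imp_le)
    thus False using Kle(2)[OF that] p(2) by simp
  qed
  have "L n0 r0 * L n1 r1 = -1"
  proof -
    have "(r0 ^ 2 - 4 * int m * n0) * (r1 ^ 2 - 4 * int m * n1) = E n0 r0 * E n1 r1" by (simp add: E_def algebra_simps)
    thus ?thesis using Legendre_mult[OF p(1) p2, of "r0 ^ 2 - 4 * int m * n0" "r1 ^ 2 - 4 * int m * n1"] p(3) by (simp add: L_def)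
  qed
  have L: "L n0 r0 \<noteq> L n1 r1"
  proof
    assume "L n0 r0 = L n1 r1"
    hence "L n1 r1 * L n1 r1 = -1" using \<open>L n0 r0 * L n1 r1 = -1\<close> by simp
    thus False using zero_le_square[of "L n1 r1"] by linarith
  qed
  define f' where "f' = (\<lambda>n r. 1 * hecke m p f n r + (- (1 + of_int ((p + 1) * L n1 r1))) * f n r)"
  have "jform m 0 f'" unfolding f'_def by (rule jform_combination[OF jform_hecke[OF m f(1) p(1)] f(1)])
  moreover have f': "f' n r = of_int ((p + 1) * (L n r - L n1 r1)) * f n r" if "(n, r) \<in> insert (n0, r0) (insert x S)" for n r
    using hecke_eigenvalue[OF m p(1) p8 ndvd[OF that] f(1)] unfolding f'_def L_def by (simp add: algebra_simps)
  moreover have "f' n0 r0 \<noteq> 0"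
  proof -
    have "(p + 1) * (L n0 r0 - L n1 r1) \<noteq> 0" using L p2 by simp
    hence "(of_int ((p + 1) * (L n0 r0 - L n1 r1)) :: complex) \<noteq> 0" unfolding of_int_eq_0_iff .
    thus ?thesis using f'[of n0 r0] f(2) by simp
  qed
  moreover have z: "f' n r = 0" if nr: "(n, r) \<in> insert x S" for n r
  proof (cases "(n, r) \<in> S")
    case True thus ?thesis using f'[of n r] bspec[OF f(3) True] by simp
  next
    case False thus ?thesis using f'[of n r] nr by (simp add: x)
  qed
  moreover have "\<forall>y\<in>insert x S. f' (fst y) (snd y) = 0" by (intro ballI z) (simp only: prod.collapse)
  ultimately show ?case by (intro exI[of _ f'] conjI)
qed

text \<open>There are infinitely many coefficients to remove, but finitely many of them control the
  rest, because a form is determined by finitely many coefficients.\<close>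

lemma isolate_parity:
  assumes m: "m > 0" and l: "prime l" "l > 2" and c: "jform m 0 c" and c0: "c n0 r0 \<noteq> 0"
    and odd: "odd (multiplicity l (4 * int m * n0 - r0 ^ 2))"
  shows "\<exists>f. jform m 0 f \<and> f n0 r0 \<noteq> 0 \<and>
    (\<forall>n r. f n r \<noteq> 0 \<longrightarrow> 4 * int m * n - r ^ 2 = 0 \<or> odd (multiplicity l (4 * int m * n - r ^ 2)))"
proof -
  define V where "V = {g. jform m 0 (\<lambda>n r. g (n, r))}"
  define X where "X = (\<lambda>(n, r). (int n, r)) ` ({..<m} \<times> {1..<int m})"
  define Y where "Y = {x. 4 * int m * fst x - snd x ^ 2 > 0 \<and> even (multiplicity l (4 * int m * fst x - snd x ^ 2))}"
  have "\<exists>S\<subseteq>Y. finite S \<and> (\<forall>f\<in>V. (\<forall>s\<in>S. f s = 0) \<longrightarrow> (\<forall>y\<in>Y. f y = 0))"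
  proof (rule finitely_many_conditions)
    show "finite X" by (simp add: X_def)
    show "(\<lambda>y. a * f y + b * g y) \<in> V" if "f \<in> V" "g \<in> V" for f g a b
      using that jform_combination[of m 0 "\<lambda>n r. f (n, r)" "\<lambda>n r. g (n, r)" a b] unfolding V_def mem_Collect_eq by blast
    show "f y = 0" if f: "f \<in> V" "\<forall>x\<in>X. f x = 0" for f y
    proof -
      have j: "jform m 0 (\<lambda>n r. f (n, r))" using f(1) by (simp only: V_def mem_Collect_eq)
      have "f (n, r) \<in> {0}" for n r by (rule coefficients_in[OF m j]) (use f(2) in \<open>auto simp: X_def\<close>)
      thus ?thesis by (cases y) simp
    qed
  qed
  then obtain S where S: "S \<subseteq> Y" "finite S" "\<And>f y. f \<in> V \<Longrightarrow> \<forall>s\<in>S. f s = 0 \<Longrightarrow> y \<in> Y \<Longrightarrow> f y = 0" by blast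
  have "4 * int m * n - r ^ 2 > 0 \<and> even (multiplicity l (4 * int m * n - r ^ 2))" if "(n, r) \<in> S" for n r
    using subsetD[OF S(1) that] by (simp add: Y_def)
  from kill_finitely_many[OF m l c c0 odd S(2) this]
  obtain f where f: "jform m 0 f" "f n0 r0 \<noteq> 0" "\<forall>x\<in>S. f (fst x) (snd x) = 0" by blast
  define g where "g = (\<lambda>x. f (fst x) (snd x))"
  have gV: "g \<in> V" using f(1) by (simp add: V_def g_def)
  have gS: "\<forall>s\<in>S. g s = 0" using f(3) by (simp add: g_def)
  have par: "4 * int m * n - r ^ 2 = 0 \<or> odd (multiplicity l (4 * int m * n - r ^ 2))" if fn: "f n r \<noteq> 0" for n r
  proof (rule ccontr)
    assume a: "\<not> ?thesis"
    have "4 * int m * n - r ^ 2 \<ge> 0" using jform_support[OF f(1) fn] by simp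
    hence "(n, r) \<in> Y" using a by (simp add: Y_def)
    from S(3)[OF gV gS this] show False using fn by (simp add: g_def)
  qed
  show ?thesis by (rule exI[of _ f], rule conjI[OF f(1) conjI[OF f(2)]], intro allI impI, rule par)
qed

section \<open>Vanishing\<close>

context jacobi_form
begin

lemma hcomp_eq_0: "(\<And>n. c n r = 0) \<Longrightarrow> hcomp m c r \<tau> = 0"
  unfolding hcomp_def by simp

text \<open>Uniqueness of Fourier coefficients on the line Im \<tau> = 1.\<close>

lemma hcomp_nonzero:
  assumes "c n r \<noteq> 0"
  shows "\<exists>\<tau>. Im \<tau> > 0 \<and> hcomp m c r \<tau> \<noteq> 0"
proof (rule ccontr)
  assume no: "\<nexists>\<tau>. Im \<tau> > 0 \<and> hcomp m c r \<tau> \<noteq> 0"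
  let ?a = "\<lambda>n. c n r * e2pi (of_int n * \<i>)"
  have s0: "((\<lambda>n. ?a n * e2pi (of_int n * of_real x)) has_sum 0) UNIV" for x :: real
  proof -
    define \<tau> where "\<tau> = \<i> + of_real x"
    have t: "Im \<tau> > 0" by (simp add: \<tau>_def)
    let ?E = "e2pi (disc m r * \<tau>)"
    have "((\<lambda>n. ?E * (c n r * hexp m n r \<tau>)) has_sum ?E * 0) UNIV"
      using has_sum_cmult_right[OF hcomp_has_sum[OF t, of r], of ?E] no t by auto
    moreover have "?E * (c n r * hexp m n r \<tau>) = ?a n * e2pi (of_int n * of_real x)" for n
    proof -
      have "?E * hexp m n r \<tau> = e2pi (of_int n * \<i>) * e2pi (of_int n * of_real x)"
        unfolding e2pi_add [symmetric] by (simp add: \<tau>_def distrib_left)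
      moreover have "E * y = u * v \<Longrightarrow> E * (a * y) = a * u * v" for E y u v a :: complex by (metis mult.assoc mult.left_commute)
      ultimately show ?thesis by blast
    qed
    ultimately show ?thesis by (simp only: mult_zero_right)
  qed
  have "?a n = 0"
  proof (rule exp_sum_unique[where a = ?a])
    show "?a summable_on UNIV" using s0[of 0] by (auto simp: summable_on_def)
  qed (rule s0)
  thus False using assms by simp
qed

text \<open>With k = 2m/g the inversion formula gives h_(s+k) = h_s. Under \<tau> + 1 the two have
  the phases of (s + k)^2 and s^2, which must agree modulo 4m when h_s is nonzero; for s =
  \<open>r0\<close>, a multiple of g, this says that 2g divides k.\<close>

lemma support_divisor:
  assumes g: "g > 0" "g dvd 2 * int m" and supp: "\<And>n r. c n r \<noteq> 0 \<Longrightarrow> g dvd r" and c0: "c n0 r0 \<noteq> 0"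
  shows "g ^ 2 dvd int m"
proof -
  obtain k where k: "2 * int m = g * k" using g(2) by (elim dvdE)
  have k0: "k \<noteq> 0" using k m by auto
  have kc: "of_int k / (2 * of_nat m) = (1 / of_int g :: complex)"
  proof -
    have "2 * of_nat m = (of_int g * of_int k :: complex)" using arg_cong[OF k, of "of_int :: int \<Rightarrow> complex"] by simp
    thus ?thesis using g(1) k0 by simp
  qed
  have shift: "hcomp m c (s + k) \<tau> = hcomp m c s \<tau>" if t: "Im \<tau> > 0" for s \<tau> unfolding hcomp_inversion[OF t]
  proof (intro arg_cong[of _ _ "\<lambda>x. inverse \<tau> * rt (\<tau> / (2 * of_nat m)) * x"] sum.cong refl)
    fix r
    show "weil m r (s + k) * hcomp m c r (- 1 / \<tau>) = weil m r s * hcomp m c r (- 1 / \<tau>)"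
    proof (cases "g dvd r")
      case True
      then obtain r' where r': "r = g * r'" by (elim dvdE)
      have "- (of_int r * of_int (s + k)) / (2 * of_nat m) = - (of_int r * of_int s) / (2 * of_nat m) + - (of_int r * (of_int k / (2 * of_nat m)) :: complex)"
        by (simp add: distrib_left add_divide_distrib diff_divide_distrib)
      also have "of_int r * (of_int k / (2 * of_nat m)) = (of_int r' :: complex)" unfolding kc using g(1) by (simp add: r')
      finally have ex: "- (of_int r * of_int (s + k)) / (2 * of_nat m) = - (of_int r * of_int s) / (2 * of_nat m) + - (of_int r' :: complex)" .
      show ?thesis unfolding ex by (simp only: e2pi_add e2pi_minus e2pi_of_int inverse_1 mult_1_right)
    next
      case False
      hence "hcomp m c r (- 1 / \<tau>) = 0" using supp by (intro hcomp_eq_0) blast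
      thus ?thesis by simp
    qed
  qed
  obtain \<tau> where t: "Im \<tau> > 0" "hcomp m c r0 \<tau> \<noteq> 0" using hcomp_nonzero[OF c0] by blast
  have t1: "Im (\<tau> + 1) > 0" using t by simp
  have "e2pi (- (of_int (r0 + k) ^ 2) / (4 * of_nat m)) * hcomp m c r0 \<tau> = e2pi (- (of_int r0 ^ 2) / (4 * of_nat m)) * hcomp m c r0 \<tau>"
    using hcomp_tau_add_1[of "r0 + k" \<tau>, unfolded shift[OF t(1)] shift[OF t1], symmetric] hcomp_tau_add_1[of r0 \<tau>] by (rule trans)
  hence "e2pi (- (of_int (r0 + k) ^ 2) / (4 * of_nat m)) / e2pi (- (of_int r0 ^ 2) / (4 * of_nat m)) = 1" using t(2) by simp
  hence "- (of_int (r0 + k) ^ 2) / (4 * of_nat m) - - (of_int r0 ^ 2) / (4 * of_nat m) \<in> (\<int> :: complex set)"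
    unfolding e2pi_diff [symmetric] e2pi_eq_1_iff .
  then obtain j where "- (of_int (r0 + k) ^ 2) / (4 * of_nat m) - - (of_int r0 ^ 2) / (4 * of_nat m) = (of_int j :: complex)" by (auto elim: Ints_cases)
  hence "of_int (r0 ^ 2 - (r0 + k) ^ 2) = (of_int (4 * int m * j) :: complex)" using m by (simp add: field_simps)
  hence "r0 ^ 2 - (r0 + k) ^ 2 = 4 * int m * j" by (simp only: of_int_eq_iff)
  moreover obtain s1 where s1: "r0 = g * s1" using supp[OF c0] by (elim dvdE)
  moreover have "4 * int m = 2 * (g * k)" using k by simp
  ultimately have "k * (- (2 * g * s1 + k)) = k * (2 * g * j)" by (simp add: algebra_simps power2_eq_square)
  hence "- (2 * g * s1 + k) = 2 * g * j" using k0 mult_cancel_left[of k] by blast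
  hence "k = 2 * g * (- j - s1)" by (simp add: algebra_simps)
  hence "2 * int m = g * (2 * g * (- j - s1))" using k by (simp only:)
  hence "2 * int m = 2 * (g ^ 2 * (- j - s1))" by (simp add: power2_eq_square)
  hence "int m = g ^ 2 * (- j - s1)" by simp
  thus ?thesis by simp
qed

end

text \<open>Valuations of different parity are never equal, so no cancellation occurs and the
  valuation of the sum is the smaller one.\<close>

lemma power_dvd_sum_parity:
  fixes l x y :: int
  assumes l: "prime l" and s: "l ^ s dvd x + y"
    and x: "x = 0 \<or> even (multiplicity l x)" and y: "y = 0 \<or> odd (multiplicity l y)"
  shows "l ^ s dvd x" "l ^ s dvd y"
proof -
  have iff: "l ^ n dvd z \<longleftrightarrow> n \<le> multiplicity l z" if "z \<noteq> 0" for n z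
    by (rule power_dvd_iff_le_multiplicity[OF that]) (use l not_prime_unit in blast)
  have "l ^ s dvd x"
  proof (cases "x = 0 \<or> y = 0")
    case True thus ?thesis using s by auto
  next
    case False
    hence nz: "x \<noteq> 0" "y \<noteq> 0" by auto
    have ne: "multiplicity l x \<noteq> multiplicity l y" using x y nz by auto
    show ?thesis
    proof (rule ccontr)
      assume "\<not> l ^ s dvd x"
      hence xs: "multiplicity l x < s" unfolding iff[OF nz(1)] by simp
      show False
      proof (cases "multiplicity l y < multiplicity l x")
        case True
        have "l ^ Suc (multiplicity l y) dvd x" unfolding iff[OF nz(1)] using True by simp
        moreover have "l ^ Suc (multiplicity l y) dvd x + y" by (rule dvd_trans[OF le_imp_power_dvd s]) (use True xs in simp)
        ultimately have "l ^ Suc (multiplicity l y) dvd y" by (simp only: dvd_add_right_iff)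
        thus False unfolding iff[OF nz(2)] by simp
      next
        case F: False
        have "l ^ Suc (multiplicity l x) dvd y" unfolding iff[OF nz(2)] using F ne by simp
        moreover have "l ^ Suc (multiplicity l x) dvd x + y" by (rule dvd_trans[OF le_imp_power_dvd s]) (use xs in simp)
        ultimately have "l ^ Suc (multiplicity l x) dvd x" by (simp only: dvd_add_left_iff)
        thus False unfolding iff[OF nz(1)] by simp
      qed
    qed
  qed
  thus "l ^ s dvd x" .
  thus "l ^ s dvd y" using s by (simp only: dvd_add_right_iff)
qed

text \<open>Doubling E changes the parity of the exponent of 2 and of no other prime, so E or 2E is
  a square.\<close>

lemma square_or_twice_square:
  fixes E :: int
  assumes E: "E > 0" and ev: "\<And>l. prime l \<Longrightarrow> l > 2 \<Longrightarrow> even (multiplicity l E)"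
  shows "\<exists>f. E = f ^ 2 \<or> E = 2 * f ^ 2"
proof -
  have sq: "\<exists>f. x = f ^ 2" if "x > 0" "\<And>l. prime l \<Longrightarrow> even (multiplicity l x)" for x :: int
  proof -
    have "is_nth_power 2 (normalize x)" unfolding is_nth_power_conv_multiplicity[OF zero_less_numeral] using that by simp
    thus ?thesis using that(1) unfolding is_nth_power_def by auto
  qed
  have l2: "l > 2" if "prime l" "l \<noteq> 2" for l :: int using prime_ge_2_int[OF that(1)] that(2) by simp
  show ?thesis
  proof (cases "even (multiplicity 2 E)")
    case True
    hence "even (multiplicity l E)" if "prime l" for l using ev l2 that by (cases "l = 2") auto
    thus ?thesis using sq[OF E] by blast
  next
    case False
    have "even (multiplicity l (2 * E))" if "prime l" for l
    proof (cases "l = 2")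
      case True
      have "multiplicity 2 (2 * E) = Suc (multiplicity 2 E)" using E by (intro multiplicity_times_same) auto
      thus ?thesis using True False by simp
    next
      case ne: False
      have "prime (2 :: int)" by simp
      hence "\<not> l dvd 2" using primes_dvd_imp_eq[OF that] ne by blast
      hence "multiplicity l 2 = 0" by (rule not_dvd_imp_multiplicity_0)
      moreover have "multiplicity l (2 * E) = multiplicity l 2 + multiplicity l E" by (rule prime_elem_multiplicity_mult_distrib) (use that E in auto)
      ultimately show ?thesis using ev[OF that l2[OF that ne]] by simp
    qed
    then obtain g where g: "2 * E = g ^ 2" using sq[of "2 * E"] E by auto
    hence "even (g ^ 2)" by (metis dvd_triv_left)
    hence "even g" by simp
    then obtain f where "g = 2 * f" by (elim dvdE)
    hence "E = 2 * f ^ 2" using g by (simp add: power2_eq_square)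
    thus ?thesis by blast
  qed
qed

text \<open>Squares are 0 or 1 modulo 4, so divisibility by 4 forces r and f to be even, and a
  factor 4 can be removed.\<close>

lemma power_4_descent:
  fixes r f e :: int
  assumes e: "e = 1 \<or> e = 2" and d: "4 ^ t dvd r ^ 2 + e * f ^ 2"
  shows "2 ^ t dvd r"
  using d
proof (induction t arbitrary: r f)
  case (Suc t)
  have d4: "4 dvd r ^ 2 + e * f ^ 2" by (rule dvd_trans[OF _ Suc.prems]) simp
  have sq: "x ^ 2 mod 4 = (if even x then 0 else 1)" for x :: int
  proof (cases "even x")
    case True
    then obtain y where "x = 2 * y" by (elim dvdE)
    hence "x ^ 2 = 4 * y ^ 2" by (simp add: power2_eq_square)
    thus ?thesis using True by simp
  next
    case False
    then obtain y where "x = 2 * y + 1" by (elim oddE)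
    hence "x ^ 2 = 1 + 4 * (y ^ 2 + y)" by (simp add: power2_eq_square algebra_simps)
    hence "x ^ 2 mod 4 = 1 mod 4" by (simp only: mod_mult_self2)
    thus ?thesis using False by simp
  qed
  have "(r ^ 2 mod 4 + e * (f ^ 2 mod 4)) mod 4 = 0"
  proof -
    have "(r ^ 2 mod 4 + e * (f ^ 2 mod 4)) mod 4 = (r ^ 2 + e * f ^ 2) mod 4"
      unfolding cong_def [symmetric] by (intro cong_add cong_mult) (simp_all add: cong_def)
    thus ?thesis using d4 by simp
  qed
  hence "even r \<and> even f" using e unfolding sq by (cases "even r"; cases "even f") auto
  then obtain r' f' where rf: "r = 2 * r'" "f = 2 * f'" by (auto elim!: evenE)
  have "4 * 4 ^ t dvd 4 * (r' ^ 2 + e * f' ^ 2)" using Suc.prems by (simp add: rf power_mult_distrib algebra_simps)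
  hence "4 ^ t dvd r' ^ 2 + e * f' ^ 2" by (subst (asm) dvd_mult_cancel_left) auto
  from Suc.IH[OF this] show ?case by (simp add: rf)
qed simp

text \<open>On the support \<open>4mn\<close> is \<open>r\<^sup>2 + f\<^sup>2\<close> or \<open>r\<^sup>2 + 2f\<^sup>2\<close>, so that \<open>r\<close> is divisible by a large power of 2.\<close>

lemma no_even_forms:
  assumes m: "m > 0" and c: "jform m 0 c"
    and ev: "\<And>n r l. c n r \<noteq> 0 \<Longrightarrow> prime l \<Longrightarrow> l > 2 \<Longrightarrow> 4 * int m * n - r ^ 2 = 0 \<or> even (multiplicity l (4 * int m * n - r ^ 2))"
  shows "c n0 r0 = 0"
proof (rule ccontr)
  assume c0: "c n0 r0 \<noteq> 0"
  interpret jacobi_form m 0 c by standard (use m c in auto)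
  \<comment> \<open>The exponent of 4 in 4m. If 2^t divides every r in the support, then 4^t divides
    m by \<open>support_divisor\<close>, and 4^(t+1) divides 4m.\<close>
  define t where "t = multiplicity 4 (4 * int m)"
  have t: "4 ^ t dvd 4 * int m" unfolding t_def by (rule multiplicity_dvd)
  have nz: "4 * int m \<noteq> 0" and nu: "\<not> is_unit (4 :: int)" using m by simp_all
  note iff4 = power_dvd_iff_le_multiplicity[OF nz nu]
  have t': "\<not> 4 ^ Suc t dvd 4 * int m" unfolding iff4 t_def by simp
  have t1: "t \<ge> 1" unfolding t_def iff4 [symmetric] by simp
  have "2 ^ t dvd r" if cn: "c n r \<noteq> 0" for n r
  proof -
    define E where "E = 4 * int m * n - r ^ 2"
    have "E \<ge> 0" using support[OF cn] by (simp add: E_def)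
    have "\<exists>f e. (e = 1 \<or> e = 2) \<and> E = e * f ^ 2"
    proof (cases "E = 0")
      case True thus ?thesis by (intro exI[of _ 0] exI[of _ 1]) simp
    next
      case False
      hence "E > 0" using \<open>E \<ge> 0\<close> by simp
      moreover have "even (multiplicity l E)" if "prime l" "l > 2" for l using ev[OF cn that] False by (simp add: E_def)
      ultimately obtain f where "E = f ^ 2 \<or> E = 2 * f ^ 2" using square_or_twice_square by blast
      thus ?thesis
      proof
        assume "E = f ^ 2" thus ?thesis by (intro exI[of _ f] exI[of _ 1]) simp
      next
        assume "E = 2 * f ^ 2" thus ?thesis by (intro exI[of _ f] exI[of _ 2]) simp
      qed
    qed
    then obtain f e where fe: "e = 1 \<or> e = 2" "E = e * f ^ 2" by blast
    have "r ^ 2 + e * f ^ 2 = 4 * int m * n" using fe(2) by (simp add: E_def)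
    hence "4 ^ t dvd r ^ 2 + e * f ^ 2" using t by simp
    thus ?thesis by (rule power_4_descent[OF fe(1)])
  qed
  \<comment> \<open>From 4^t dvd 4m follows 2^(2t-1) dvd 2m, and t \<le> 2t - 1 because t \<ge>
    1.\<close>
  moreover have "2 ^ t dvd 2 * int m"
  proof -
    obtain t2 where t2: "t = Suc t2" using t1 by (cases t) auto
    have "(4 :: int) ^ t = (2 * 2) ^ t" by simp
    also have "\<dots> = 2 * (2 ^ t2 * 2 ^ t)" unfolding power_mult_distrib by (simp add: t2)
    finally have "2 * (2 ^ t2 * 2 ^ t) dvd 2 * (2 * int m)" using t by (simp add: mult.assoc)
    hence "2 ^ t2 * 2 ^ t dvd 2 * int m" by (subst (asm) dvd_mult_cancel_left) simp
    thus ?thesis by (rule dvd_mult_right)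
  qed
  ultimately have "(2 ^ t) ^ 2 dvd int m" using c0 by (intro support_divisor) auto
  hence "4 ^ t dvd int m" by (simp add: power_mult [symmetric] mult.commute power2_eq_square power_mult_distrib [symmetric])
  hence "4 ^ Suc t dvd 4 * int m" by simp
  thus False using t' by blast
qed

section \<open>The invariant norm and its decay\<close>

context jacobi_form
begin

text \<open>The pointwise Petersson norm without its factor y^(1/2), whose absence accounts for
  \<open>norm \<tau>\<close> in \<open>hnorm_inversion\<close>.\<close>

definition hnorm :: "complex \<Rightarrow> real" where
  "hnorm \<tau> = (\<Sum>r\<in>res m. (norm (hcomp m c r \<tau>))\<^sup>2)"

lemma hnorm_tau_add_1: "hnorm (\<tau> + 1) = hnorm \<tau>"
proof -
  have "norm (e2pi (- (of_int r ^ 2) / (4 * of_nat m))) = 1" for r :: int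
  proof -
    have "- (of_int r ^ 2) / (4 * of_nat m) = (of_real (- (of_int r ^ 2) / (4 * of_nat m)) :: complex)" by simp
    hence "Im (- (of_int r ^ 2) / (4 * of_nat m)) = 0" by (simp only: Im_complex_of_real)
    thus ?thesis unfolding norm_e2pi by simp
  qed
  thus ?thesis unfolding hnorm_def hcomp_tau_add_1 norm_mult by simp
qed

text \<open>Parseval's identity for the finite Fourier transform \<open>weil\<close>, together with
  the absolute value of the factor in \<open>hcomp_inversion\<close>.\<close>

lemma hnorm_inversion:
  assumes t: "Im \<tau> > 0"
  shows "hnorm (- 1 / \<tau>) = norm \<tau> * hnorm \<tau>"
proof -
  let ?R = "{0..<2 * int m}"
  let ?e = "\<lambda>r s. weil m r s"
  have M: "2 * int m > 0" using m by simp
  define x where "x = (\<lambda>r. hcomp m c r (- 1 / \<tau>))"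
  have xr: "hcomp m c r (- 1 / \<tau>) = x r" for r by (simp only: x_def)
  have nt: "norm \<tau> > 0" using t by auto
  have cnj: "cnj (?e r s) = e2pi (of_int r * of_int s / (2 * of_nat m))" for r s :: int
  proof -
    have "cnj (tpi * (- (of_int r * of_int s) / (2 * of_nat m))) = tpi * (of_int r * of_int s / (2 * of_nat m))" by simp
    thus ?thesis unfolding e2pi_def exp_cnj by (rule arg_cong)
  qed
  have orth: "(\<Sum>s\<in>?R. ?e r s * cnj (?e r' s)) = (if r = r' then of_nat (2 * m) else 0)" if r: "r \<in> ?R" "r' \<in> ?R" for r r'
  proof -
    have "?e r s * cnj (?e r' s) = e2pi (of_int (r' - r) * of_int s / of_int (2 * int m))" for s
      unfolding cnj e2pi_add [symmetric] by (rule arg_cong[of _ _ e2pi]) (simp add: algebra_simps diff_divide_distrib)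
    hence "(\<Sum>s\<in>?R. ?e r s * cnj (?e r' s)) = (if 2 * int m dvd r' - r then of_int (2 * int m) else 0)"
      using sum_roots_of_unity[OF M, of "r' - r"] by (simp only:)
    moreover have "2 * int m dvd r' - r \<longleftrightarrow> r = r'"
    proof
      assume "2 * int m dvd r' - r"
      hence "r' mod (2 * int m) = r mod (2 * int m)" by (simp add: mod_eq_dvd_iff)
      thus "r = r'" using r by simp
    qed simp
    ultimately show ?thesis by simp
  qed
  have "of_real (\<Sum>s\<in>?R. (norm (\<Sum>r\<in>?R. ?e r s * x r))\<^sup>2) = (\<Sum>s\<in>?R. \<Sum>r\<in>?R. \<Sum>r'\<in>?R. x r * cnj (x r') * (?e r s * cnj (?e r' s)))"
    unfolding of_real_sum complex_norm_square cnj_sum sum_product by (intro sum.cong refl) (simp add: mult_ac)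
  also have "\<dots> = (\<Sum>r\<in>?R. \<Sum>r'\<in>?R. \<Sum>s\<in>?R. x r * cnj (x r') * (?e r s * cnj (?e r' s)))"
    by (subst sum.swap) (intro sum.cong refl sum.swap)
  also have "\<dots> = (\<Sum>r\<in>?R. \<Sum>r'\<in>?R. if r = r' then of_nat (2 * m) * (x r * cnj (x r)) else 0)"
    unfolding sum_distrib_left [symmetric] by (intro sum.cong refl, simp only: orth) simp
  also have "\<dots> = of_real (2 * real m * hnorm (- 1 / \<tau>))"
    unfolding hnorm_def xr of_real_mult of_real_sum complex_norm_square by (simp add: sum_distrib_left)
  finally have pars: "(\<Sum>s\<in>?R. (norm (\<Sum>r\<in>?R. ?e r s * x r))\<^sup>2) = 2 * real m * hnorm (- 1 / \<tau>)"
    by (simp only: of_real_eq_iff)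
  have k: "(norm (inverse \<tau> * rt (\<tau> / (2 * of_nat m))))\<^sup>2 = inverse (norm \<tau>) / (2 * real m)"
  proof -
    have "(norm (rt (\<tau> / (2 * of_nat m))))\<^sup>2 = norm (rt (\<tau> / (2 * of_nat m)) ^ 2)" by (simp add: norm_power)
    also have "\<dots> = norm \<tau> / (2 * real m)" unfolding rt_squared by (simp add: norm_mult norm_divide)
    finally have E: "(norm (rt (\<tau> / (2 * of_nat m))))\<^sup>2 = norm \<tau> / (2 * real m)" .
    show ?thesis unfolding norm_mult power_mult_distrib norm_inverse E using nt by (simp add: power2_eq_square)
  qed
  have "hnorm \<tau> = (\<Sum>s\<in>?R. (norm (inverse \<tau> * rt (\<tau> / (2 * of_nat m))))\<^sup>2 * (norm (\<Sum>r\<in>?R. ?e r s * x r))\<^sup>2)"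
    unfolding hnorm_def x_def by (rule sum.cong[OF refl]) (subst hcomp_inversion[OF t], simp only: norm_mult power_mult_distrib)
  also have "\<dots> = inverse (norm \<tau>) / (2 * real m) * (2 * real m * hnorm (- 1 / \<tau>))" unfolding k sum_distrib_left [symmetric] pars ..
  finally show ?thesis using nt m by (simp add: field_simps)
qed

text \<open>The group generated by \<open>SL\<^sub>2(\<int>)\<close> and the translation by \<open>1/l\<close> contains \<open>\<tau> \<mapsto> l\<^sup>2\<tau>\<close>.\<close>

lemma hnorm_dilation:
  fixes l :: nat
  assumes l: "l > 0" and inv: "\<And>\<tau>. Im \<tau> > 0 \<Longrightarrow> hnorm (\<tau> + 1 / of_nat l) = hnorm \<tau>" and t: "Im \<tau> > 0"
  shows "hnorm (of_nat l ^ 2 * \<tau>) = hnorm \<tau> / real l"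
proof -
  have lz: "of_nat l \<noteq> (0 :: complex)" using l by simp
  have tz: "\<tau> \<noteq> 0" "norm \<tau> > 0" using t by auto
  have shift: "hnorm (\<tau> + of_int k) = hnorm \<tau>" if "Im \<tau> > 0" for k \<tau>
    using periodic_int[of "\<lambda>\<tau>. of_real (hnorm \<tau>)" \<tau> k] that hnorm_tau_add_1 by simp
  \<comment> \<open>The chain is \<tau>, \<sigma> = \<tau> + 1/l, -1/\<sigma>, w = -1/\<sigma> + l,
    -1/w, and finally -1/w + 1/l = -1/(l^2 \<tau>). The norms picked up at the inversions combine by
    w \<sigma> = l \<tau>.\<close>
  define \<sigma> where "\<sigma> = \<tau> + 1 / of_nat l"
  have "Im (1 / of_nat l :: complex) = 0" by (simp add: Im_divide)
  hence s: "Im \<sigma> > 0" using t by (simp add: \<sigma>_def)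
  hence sz: "\<sigma> \<noteq> 0" "norm \<sigma> > 0" by auto
  define w where "w = - 1 / \<sigma> + of_int (int l)"
  have w: "Im w > 0" using uhp_neg_inverse[OF s] by (simp add: w_def)
  have "w * \<sigma> = -1 + of_nat l * \<sigma>" using sz(1) by (simp add: w_def left_diff_distrib)
  also have "\<dots> = of_nat l * \<tau>" using lz by (simp add: \<sigma>_def distrib_left)
  finally have ws: "w * \<sigma> = of_nat l * \<tau>" .
  have wz: "w \<noteq> 0" using w by auto
  have "norm w * norm \<sigma> = real l * norm \<tau>" using arg_cong[OF ws, of norm] by (simp add: norm_mult)
  have t2: "Im (of_nat l ^ 2 * \<tau>) > 0"
  proof -
    have "of_nat l ^ 2 * \<tau> = of_real (real l ^ 2) * \<tau>" by simp
    moreover have "Im (of_real (real l ^ 2) * \<tau>) = real l ^ 2 * Im \<tau>" by (simp only: Im_complex_of_real Re_complex_of_real times_complex.sel mult_zero_left add_0_right)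
    ultimately show ?thesis using t l by simp
  qed
  have e: "- 1 / w + 1 / of_nat l = - 1 / (of_nat l ^ 2 * \<tau>)"
  proof -
    have "- 1 / w = - \<sigma> / (of_nat l * \<tau>)" unfolding ws [symmetric] using sz wz by (simp add: field_simps)
    moreover have "\<sigma> / (of_nat l * \<tau>) = 1 / of_nat l + 1 / (of_nat l ^ 2 * \<tau>)"
      using tz(1) lz by (simp add: \<sigma>_def add_divide_distrib power2_eq_square)
    ultimately show ?thesis by (simp only: minus_divide_left [symmetric]) simp
  qed
  have "norm (of_nat l ^ 2 * \<tau>) * hnorm (of_nat l ^ 2 * \<tau>) = hnorm (- 1 / w + 1 / of_nat l)"
    unfolding e by (rule hnorm_inversion[OF t2, symmetric])
  also have "\<dots> = hnorm (- 1 / w)" by (rule inv[OF uhp_neg_inverse[OF w]])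
  also have "\<dots> = norm w * hnorm w" by (rule hnorm_inversion[OF w])
  also have "hnorm w = hnorm (- 1 / \<sigma>)" unfolding w_def by (rule shift[OF uhp_neg_inverse[OF s]])
  also have "\<dots> = norm \<sigma> * hnorm \<sigma>" by (rule hnorm_inversion[OF s])
  also have "hnorm \<sigma> = hnorm \<tau>" unfolding \<sigma>_def by (rule inv[OF t])
  finally have "norm (of_nat l ^ 2 * \<tau>) * hnorm (of_nat l ^ 2 * \<tau>) = (norm w * norm \<sigma>) * hnorm \<tau>" by (simp only: mult.assoc)
  hence "real l ^ 2 * norm \<tau> * hnorm (of_nat l ^ 2 * \<tau>) = real l * norm \<tau> * hnorm \<tau>"
    unfolding \<open>norm w * norm \<sigma> = real l * norm \<tau>\<close> by (simp add: norm_mult norm_power)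
  thus ?thesis using tz(2) l by (simp add: field_simps power2_eq_square)
qed

end

text \<open>For B = 0 the exponents 8mn - 2 r^2 on the support are nonnegative, so the components
  are bounded at infinity.\<close>

lemma (in jacobi_form) hcomp_power_series:
  assumes B: "B = 0"
  shows "\<exists>f. fps_conv_radius f \<ge> 1 \<and> (\<forall>\<tau>. Im \<tau> > 0 \<longrightarrow> hcomp m c r \<tau> = eval_fps f (qpow m 1 \<tau>))"
proof -
  define K where "K = {n. r ^ 2 \<le> 4 * int m * n}"
  define d where "d = (\<lambda>n. nat (2 * (4 * int m * n - r ^ 2)))"
  have d: "int (d n) = 2 * (4 * int m * n - r ^ 2)" if "n \<in> K" for n
  proof -
    have "r ^ 2 \<le> 4 * int m * n" using that unfolding K_def by (rule CollectD)
    hence "0 \<le> 4 * int m * n - r ^ 2" by (rule diff_ge_0_iff_ge[THEN iffD2])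
    hence "0 \<le> 2 * (4 * int m * n - r ^ 2)" by (rule mult_nonneg_nonneg[OF zero_le_numeral])
    thus ?thesis unfolding d_def by (rule nat_0_le)
  qed
  have "inj_on d K"
  proof (rule inj_onI)
    fix n n' assume "n \<in> K" "n' \<in> K" "d n = d n'"
    hence "2 * (4 * int m * n - r ^ 2) = 2 * (4 * int m * n' - r ^ 2)" using d[of n] d[of n'] by metis
    thus "n = n'" using m by simp
  qed
  hence fin: "finite {n\<in>K. d n = i}" for i
  proof -
    have "inj_on d {n\<in>K. d n = i}" using \<open>inj_on d K\<close> by (rule inj_on_subset) auto
    thus ?thesis by (rule inj_on_finite[of _ _ "{i}"]) auto
  qed
  have sum: "((\<lambda>n. c n r * qpow m (0 + int (d n)) \<tau>) has_sum hcomp m c r \<tau>) K" if t: "Im \<tau> > 0" for \<tau>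
  proof (rule iffD2[OF has_sum_cong_neutral hcomp_has_sum[OF t]])
    fix n assume n: "n \<in> K \<inter> UNIV"
    hence "int (d n) = 2 * (4 * int m * n - r ^ 2)" using d by blast
    moreover have "of_int (2 * (4 * int m * n - r ^ 2)) * \<tau> / (8 * of_nat m) = of_int n * \<tau> - disc m r * \<tau>"
      using m by (simp add: field_simps)
    ultimately show "c n r * qpow m (0 + int (d n)) \<tau> = c n r * hexp m n r \<tau>" unfolding qpow_def[OF m] by (simp only: add_0_left)
  next
    fix n assume "n \<in> UNIV - K"
    hence "c n r = 0" using support[of n r] B by (auto simp: K_def)
    thus "c n r * hexp m n r \<tau> = 0" by simp
  qed auto
  show ?thesis
  proof (intro exI[of _ "Abs_fps (\<lambda>i. \<Sum>n\<in>{n\<in>K. d n = i}. c n r)"] conjI allI impI)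
    show "fps_conv_radius (Abs_fps (\<lambda>i. \<Sum>n\<in>{n\<in>K. d n = i}. c n r)) \<ge> 1" by (rule exponent_sum_fps(1)[OF m fin sum])
    show "hcomp m c r \<tau> = eval_fps (Abs_fps (\<lambda>i. \<Sum>n\<in>{n\<in>K. d n = i}. c n r)) (qpow m 1 \<tau>)" if "Im \<tau> > 0" for \<tau>
      using exponent_sum_fps(2)[OF m fin sum that] by (simp add: qpow_0[OF m])
  qed
qed

lemma eval_fps_LIMSEQ_0:
  fixes f :: "complex fps"
  assumes "fps_conv_radius f \<ge> 1" "q \<longlonglongrightarrow> 0"
  shows "(\<lambda>k. eval_fps f (q k)) \<longlonglongrightarrow> fps_nth f 0"
proof -
  have "0 < fps_conv_radius f" by (rule less_le_trans[OF _ assms(1)]) simp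
  hence "isCont (eval_fps f) 0" using continuous_on_eval_fps[of f] by (subst (asm) continuous_on_eq_continuous_at) (auto simp: zero_ereal_def)
  from isCont_tendsto_compose[OF this assms(2)] show ?thesis by (simp add: eval_fps_at_0)
qed

text \<open>By \<open>hnorm_dilation\<close> the norm at l^(2k) \<tau> is that at \<tau> divided by
  l^k. It tends to 0, so all h_r vanish at infinity; but then it decays exponentially in l^(2k),
  which is too fast unless it is 0.\<close>

lemma (in jacobi_form) hnorm_zero:
  fixes l :: nat
  assumes B: "B = 0" and l: "l > 1" and inv: "\<And>\<tau>. Im \<tau> > 0 \<Longrightarrow> hnorm (\<tau> + 1 / of_nat l) = hnorm \<tau>" and t: "Im \<tau> > 0"
  shows "hnorm \<tau> = 0"
proof -
  have "\<forall>r. \<exists>f. fps_conv_radius f \<ge> 1 \<and> (\<forall>\<tau>. Im \<tau> > 0 \<longrightarrow> hcomp m c r \<tau> = eval_fps f (qpow m 1 \<tau>))"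
    using hcomp_power_series[OF B] by blast
  then obtain f where f: "\<And>r. fps_conv_radius (f r) \<ge> 1" "\<And>r \<tau>. Im \<tau> > 0 \<Longrightarrow> hcomp m c r \<tau> = eval_fps (f r) (qpow m 1 \<tau>)"
    by metis
  define N where "N = (\<lambda>k. l ^ (2 * k))"
  define q where "q = qpow m 1 \<tau>"
  have q: "norm q < 1" unfolding q_def by (rule norm_qpow_less_1[OF m t])
  have tN: "Im (of_nat (N k) * \<tau>) > 0" for k using t l by (simp add: N_def)
  have qN: "qpow m 1 (of_nat (N k) * \<tau>) = q ^ N k" for k
    using qpow_nat[OF m, of "N k" \<tau>] unfolding q_def qpow_def[OF m] by (simp add: mult.assoc)
  have dil: "hnorm (of_nat (N k) * \<tau>) = hnorm \<tau> / real l ^ k" for k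
  proof (induction k)
    case (Suc k)
    have e: "of_nat (N (Suc k)) * \<tau> = of_nat l ^ 2 * (of_nat (N k) * \<tau>)" by (simp add: N_def power2_eq_square mult_ac)
    have "hnorm (of_nat l ^ 2 * (of_nat (N k) * \<tau>)) = hnorm (of_nat (N k) * \<tau>) / real l"
      by (rule hnorm_dilation[OF _ inv tN]) (use l in simp_all)
    thus ?case unfolding e Suc by (simp add: mult.commute)
  qed (simp add: N_def)
  have Nlim: "filterlim N at_top sequentially"
  proof -
    have "filterlim (\<lambda>k. 2 * k) at_top sequentially" by (rule filterlim_subseq) (simp add: strict_mono_def)
    moreover have "filterlim (\<lambda>k. l ^ k) at_top sequentially"
      by (rule filterlim_subseq) (use l in \<open>auto simp: strict_mono_def power_strict_increasing\<close>)
    ultimately show ?thesis unfolding N_def by (rule filterlim_compose[rotated])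
  qed
  have q0: "(\<lambda>k. q ^ N k) \<longlonglongrightarrow> 0" by (rule filterlim_compose[OF LIMSEQ_power_zero[OF q] Nlim])
  have H: "hnorm \<tau> = real l ^ k * (\<Sum>r\<in>res m. (norm (eval_fps (f r) (q ^ N k)))\<^sup>2)" for k
  proof -
    have "hnorm (of_nat (N k) * \<tau>) = (\<Sum>r\<in>res m. (norm (eval_fps (f r) (q ^ N k)))\<^sup>2)" unfolding hnorm_def f(2)[OF tN] qN ..
    thus ?thesis using dil[of k] l by (simp add: field_simps)
  qed
  have "f r $ 0 = 0" if r: "r \<in> res m" for r
  proof -
    have "(\<lambda>k. \<Sum>r\<in>res m. (norm (eval_fps (f r) (q ^ N k)))\<^sup>2) \<longlonglongrightarrow> (\<Sum>r\<in>res m. (norm (f r $ 0))\<^sup>2)"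
      by (intro tendsto_intros eval_fps_LIMSEQ_0 f q0)
    moreover have "(\<lambda>k. hnorm \<tau> * (1 / real l) ^ k) \<longlonglongrightarrow> hnorm \<tau> * 0"
      by (intro tendsto_mult tendsto_const LIMSEQ_power_zero) (use l in simp)
    moreover have "(\<Sum>r\<in>res m. (norm (eval_fps (f r) (q ^ N k)))\<^sup>2) = hnorm \<tau> * (1 / real l) ^ k" for k
      using H[of k] l by (simp add: power_one_over field_simps)
    ultimately have "(\<Sum>r\<in>res m. (norm (f r $ 0))\<^sup>2) = 0" using LIMSEQ_unique by fastforce
    hence "(norm (f r $ 0))\<^sup>2 = 0" using r by (subst (asm) sum_nonneg_eq_0_iff) auto
    thus ?thesis by simp
  qed
  hence shift: "eval_fps (f r) (q ^ N k) = q ^ N k * eval_fps (fps_shift 1 (f r)) (q ^ N k)" if "r \<in> res m" for r k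
  proof -
    have z: "norm (q ^ N k) < 1" using q l by (simp add: norm_power power_less_one_iff N_def)
    have "f r = fps_X * fps_shift 1 (f r)" using \<open>\<And>r. r \<in> res m \<Longrightarrow> f r $ 0 = 0\<close>[OF that]
      by (intro fps_ext) (simp add: fps_X_mult_nth)
    hence "eval_fps (f r) (q ^ N k) = eval_fps (fps_X * fps_shift 1 (f r)) (q ^ N k)" by simp
    also have "\<dots> = eval_fps fps_X (q ^ N k) * eval_fps (fps_shift 1 (f r)) (q ^ N k)"
      by (rule eval_fps_mult) (use ereal_less_radius[OF m f(1)[of r] z] in auto)
    finally show ?thesis by simp
  qed
  \<comment> \<open>After one factor q^N has been split off from each component, l^k times the
    square of its norm still tends to 0, while the whole expression is the constant
    \<open>hnorm \<tau>\<close>.\<close>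
  have "(\<lambda>k. (real l ^ k * (norm q ^ N k) ^ 2) * (\<Sum>r\<in>res m. (norm (eval_fps (fps_shift 1 (f r)) (q ^ N k)))\<^sup>2)) \<longlonglongrightarrow> 0 * (\<Sum>r\<in>res m. (norm (fps_shift 1 (f r) $ 0))\<^sup>2)"
  proof (intro tendsto_mult tendsto_sum tendsto_power tendsto_norm eval_fps_LIMSEQ_0 q0)
    show "(\<lambda>k. real l ^ k * (norm q ^ N k) ^ 2) \<longlonglongrightarrow> 0"
    proof (rule Lim_null_comparison)
      show "(\<lambda>k. of_nat (N k) * norm q ^ N k) \<longlonglongrightarrow> 0"
        by (rule filterlim_compose[OF powser_times_n_limit_0 Nlim]) (use q in simp)
      show "\<forall>\<^sub>F k in sequentially. norm (real l ^ k * (norm q ^ N k) ^ 2) \<le> of_nat (N k) * norm q ^ N k"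
      proof (intro always_eventually allI)
        fix k
        have "real l ^ k \<le> real l ^ (2 * k)" using l by (intro power_increasing) auto
        moreover have "(norm q ^ N k) ^ 2 \<le> norm q ^ N k" using q by (simp add: power2_eq_square mult_left_le power_le_one)
        ultimately have "real l ^ k * (norm q ^ N k) ^ 2 \<le> real l ^ (2 * k) * norm q ^ N k" by (intro mult_mono) auto
        thus "norm (real l ^ k * (norm q ^ N k) ^ 2) \<le> of_nat (N k) * norm q ^ N k" by (simp add: N_def)
      qed
    qed
  qed (simp add: f)
  moreover have "(real l ^ k * (norm q ^ N k) ^ 2) * (\<Sum>r\<in>res m. (norm (eval_fps (fps_shift 1 (f r)) (q ^ N k)))\<^sup>2) = hnorm \<tau>" for k
  proof -
    have "(\<Sum>r\<in>res m. (norm (eval_fps (f r) (q ^ N k)))\<^sup>2) = (\<Sum>r\<in>res m. (norm q ^ N k) ^ 2 * (norm (eval_fps (fps_shift 1 (f r)) (q ^ N k)))\<^sup>2)"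
      by (rule sum.cong[OF refl]) (simp only: shift norm_mult norm_power power_mult_distrib)
    thus ?thesis using H[of k] by (simp only: sum_distrib_left mult.assoc)
  qed
  ultimately have "(\<lambda>k::nat. hnorm \<tau>) \<longlonglongrightarrow> 0" by simp
  thus ?thesis by (simp add: LIMSEQ_const_iff)
qed

text \<open>Let s be the exponent of l in m. As l^s divides 4mn = r^2 + (4mn - r^2), where the
  exponents of l in the two summands have opposite parity, it divides both. For odd s it follows
  that l^(s+1) divides r^2, against \<open>support_divisor\<close>. For even s it follows that
  l^(s+1) divides 4mn - r^2, so for fixed r all n in the support agree modulo l.\<close>

lemma no_odd_prime_forms:
  assumes m: "m > 0" and l: "prime l" "l > 2" and c: "jform m 0 c"
    and par: "\<And>n r. c n r \<noteq> 0 \<Longrightarrow> 4 * int m * n - r ^ 2 = 0 \<or> odd (multiplicity l (4 * int m * n - r ^ 2))"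
  shows "c n0 r0 = 0"
proof (rule ccontr)
  assume c0: "c n0 r0 \<noteq> 0"
  interpret jacobi_form m 0 c by standard (use m c in auto)
  have l0: "\<not> is_unit l" using l not_prime_unit by blast
  have mz: "int m \<noteq> 0" using m by simp
  define s where "s = multiplicity l (int m)"
  have sm: "l ^ s dvd int m" unfolding s_def by (rule multiplicity_dvd)
  have sm': "\<not> l ^ Suc s dvd int m" unfolding power_dvd_iff_le_multiplicity[OF mz l0] s_def by simp
  have dv: "l ^ s dvd r ^ 2" "l ^ s dvd 4 * int m * n - r ^ 2" if cn: "c n r \<noteq> 0" for n r
  proof -
    have "l ^ s dvd r ^ 2 + (4 * int m * n - r ^ 2)" using sm by simp
    moreover have "r ^ 2 = 0 \<or> even (multiplicity l (r ^ 2))" using prime_elem_multiplicity_power_distrib[of l r 2] l by (cases "r = 0") auto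
    ultimately show "l ^ s dvd r ^ 2" "l ^ s dvd 4 * int m * n - r ^ 2" using power_dvd_sum_parity[OF l(1) _ _ par[OF cn]] by blast+
  qed
  have p0: "l > 0" using l by simp
  show False
  proof (cases "odd s")
    case True
    then obtain t where t: "s = 2 * t + 1" by (elim oddE)
    have "l ^ Suc t dvd r" if cn: "c n r \<noteq> 0" for n r
    proof (cases "r = 0")
      case False
      have "s \<le> multiplicity l (r ^ 2)" using dv(1)[OF cn] power_dvd_iff_le_multiplicity[of "r ^ 2" l s] False l0 by simp
      also have "\<dots> = 2 * multiplicity l r" by (rule prime_elem_multiplicity_power_distrib) (use l False in auto)
      finally have "Suc t \<le> multiplicity l r" using t by simp
      thus ?thesis unfolding power_dvd_iff_le_multiplicity[OF False l0] .
    qed simp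
    moreover have "l ^ Suc t dvd 2 * int m" by (rule dvd_mult, rule dvd_trans[OF _ sm], rule le_imp_power_dvd) (simp add: t)
    ultimately have "(l ^ Suc t) ^ 2 dvd int m" using c0 p0 by (intro support_divisor) auto
    moreover have "(l ^ Suc t) ^ 2 = l ^ Suc s" by (simp add: t power2_eq_square mult_2 power_add)
    ultimately show False using sm' by simp
  next
    case False
    obtain m0 where m0: "int m = l ^ s * m0" using sm by (elim dvdE)
    have "\<not> l dvd m0"
    proof
      assume "l dvd m0"
      hence "l ^ s * l dvd int m" unfolding m0 by (rule mult_dvd_mono[OF dvd_refl])
      thus False using sm' by (simp add: mult.commute)
    qed
    moreover have "\<not> l dvd 4"
    proof
      assume "l dvd 4"
      hence "l dvd 2 ^ 2" by simp
      hence "l dvd 2" using l(1) prime_dvd_power by blast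
      thus False using l(2) by (auto dest: zdvd_imp_le)
    qed
    ultimately have lm0: "\<not> l dvd 4 * m0" using l(1) by (simp add: prime_dvd_mult_iff)
    have dv': "l ^ Suc s dvd 4 * int m * n - r ^ 2" if cn: "c n r \<noteq> 0" for n r
    proof (cases "4 * int m * n - r ^ 2 = 0")
      case F: False
      have "s \<le> multiplicity l (4 * int m * n - r ^ 2)" using dv(2)[OF cn] power_dvd_iff_le_multiplicity[OF F l0] by simp
      moreover have "odd (multiplicity l (4 * int m * n - r ^ 2))" using par[OF cn] F by simp
      ultimately have "Suc s \<le> multiplicity l (4 * int m * n - r ^ 2)" using False by (metis Suc_leI le_neq_implies_less)
      thus ?thesis unfolding power_dvd_iff_le_multiplicity[OF F l0] .
    qed simp
    define L where "L = nat l"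
    have L: "int L = l" "L > 1" using l by (auto simp: L_def)
    have lc: "of_int l = (of_nat L :: complex)" using L(1) by (metis of_int_of_nat_eq)
    have Lz: "of_nat L \<noteq> (0 :: complex)" using L by simp
    have "norm (hcomp m c r (\<tau> + 1 / of_nat L)) = norm (hcomp m c r \<tau>)" if t: "Im \<tau> > 0" for r \<tau>
    proof (cases "\<exists>n. c n r \<noteq> 0")
      case True
      then obtain n1 where n1: "c n1 r \<noteq> 0" by blast
      \<comment> \<open>The common phase: for n = n1 + l j, the translation by 1/l multiplies the
        term by e((n1 - r^2/4m)/l) e(j), and e(j) = 1.\<close>
      define w where "w = e2pi ((of_int n1 - disc m r) / of_nat L)"
      have nw: "norm w = 1"
      proof -
        have "(of_int n1 - disc m r) / of_nat L = (of_real ((of_int n1 - of_int r ^ 2 / (4 * of_nat m)) / of_nat L) :: complex)" by simp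
        hence "Im ((of_int n1 - disc m r) / of_nat L) = 0" by (simp only: Im_complex_of_real)
        thus ?thesis unfolding w_def norm_e2pi by simp
      qed
      have "hcomp m c r (\<tau> + 1 / of_nat L) = (\<Sum>\<^sub>\<infinity>n. w * (c n r * hexp m n r \<tau>))" unfolding hcomp_def
      proof (rule infsum_cong)
        fix n
        show "c n r * hexp m n r (\<tau> + 1 / of_nat L) = w * (c n r * hexp m n r \<tau>)"
        proof (cases "c n r = 0")
          case nz: False
          have "l ^ Suc s dvd (4 * int m * n - r ^ 2) - (4 * int m * n1 - r ^ 2)" by (rule dvd_diff[OF dv'[OF nz] dv'[OF n1]])
          also have "(4 * int m * n - r ^ 2) - (4 * int m * n1 - r ^ 2) = l ^ s * (4 * m0 * (n - n1))" unfolding m0 by (simp add: algebra_simps)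
          finally have "l ^ s * l dvd l ^ s * (4 * m0 * (n - n1))" by (simp add: mult.commute)
          hence "l dvd 4 * m0 * (n - n1)" using p0 by (subst (asm) dvd_mult_cancel_left) simp
          hence "l dvd n - n1" using lm0 l(1) by (simp add: prime_dvd_mult_iff)
          then obtain j where j: "n = n1 + l * j" by (metis add.commute diff_add_cancel dvd_def)
          have "of_int n * (\<tau> + 1 / of_nat L) - disc m r * (\<tau> + 1 / of_nat L) =
              (of_int n1 - disc m r) / of_nat L + (of_int n * \<tau> - disc m r * \<tau>) + of_int j"
          proof -
            have "(of_int n :: complex) = of_int n1 + of_nat L * of_int j" unfolding j by (simp add: lc)
            hence q: "of_int n / of_nat L = (of_int n1 / of_nat L + of_int j :: complex)" using Lz by (simp add: add_divide_distrib)
            have "u * (t + 1 / z) - a * (t + 1 / z) = (v - a) / z + (u * t - a * t) + b" if "u / z = v / z + b" for u v a b t z :: complex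
              using that by (simp add: distrib_left diff_divide_distrib)
            from this[OF q] show ?thesis .
          qed
          hence "hexp m n r (\<tau> + 1 / of_nat L) = w * hexp m n r \<tau>" unfolding w_def by (simp only: e2pi_add e2pi_of_int mult_1_right)
          thus ?thesis by (simp only: mult.left_commute)
        qed simp
      qed
      also have "\<dots> = w * hcomp m c r \<tau>" unfolding hcomp_def by (rule infsum_cmult_right')
      finally show ?thesis by (simp add: norm_mult nw)
    next
      case False
      thus ?thesis using hcomp_eq_0[of r] by simp
    qed
    hence inv: "hnorm (\<tau> + 1 / of_nat L) = hnorm \<tau>" if "Im \<tau> > 0" for \<tau> using that unfolding hnorm_def by simp
    obtain \<tau> where t: "Im \<tau> > 0" "hcomp m c r0 \<tau> \<noteq> 0" using hcomp_nonzero[OF c0] by blast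
    have "hnorm \<tau> = 0" by (rule hnorm_zero[OF refl L(2) inv t(1)])
    moreover have "r0 mod (2 * int m) \<in> res m" using m by simp
    ultimately have "(norm (hcomp m c (r0 mod (2 * int m)) \<tau>))\<^sup>2 = 0" unfolding hnorm_def by (subst (asm) sum_nonneg_eq_0_iff) auto
    thus False using t(2) by (simp add: hcomp_mod)
  qed
qed

lemma no_weight_1_forms:
  assumes m: "m > 0" and c: "jform m 0 c"
  shows "c n r = 0"
proof (cases "\<exists>n r l. c n r \<noteq> 0 \<and> prime l \<and> l > 2 \<and> odd (multiplicity l (4 * int m * n - r ^ 2))")
  case True
  then obtain n1 r1 l where l: "c n1 r1 \<noteq> 0" "prime l" "l > 2" "odd (multiplicity l (4 * int m * n1 - r1 ^ 2))" by blast
  obtain f where f: "jform m 0 f" "f n1 r1 \<noteq> 0"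
      "\<forall>n r. f n r \<noteq> 0 \<longrightarrow> 4 * int m * n - r ^ 2 = 0 \<or> odd (multiplicity l (4 * int m * n - r ^ 2))"
    using isolate_parity[OF m l(2,3) c l(1,4)] by blast
  have "f n1 r1 = 0" by (rule no_odd_prime_forms[OF m l(2,3) f(1)]) (rule f(3)[rule_format])
  thus ?thesis using f(2) by simp
next
  case False
  show ?thesis by (rule no_even_forms[OF m c]) (use False in blast)
qed

theorem corollary4p2:
  fixes X :: "'a::euclidean_space set" and m :: nat
    and h h' :: "int \<Rightarrow> complex \<Rightarrow> complex"
  assumes "root_system X" and "X \<noteq> {}" and "simply_laced X"
    and "\<forall>C\<in>irreducible_components X. has_coxeter_number C m"
    and "mock_modular_form m (umbral_shadow m X) h" and "optimal_growth m h"
    and "mock_modular_form m (umbral_shadow m X) h'" and "optimal_growth m h'"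
  shows "\<forall>r. \<forall>\<tau>\<in>upper_half_plane. h r \<tau> = h' r \<tau>"
proof -
  have m: "m > 0" using irreducible_component_exists[OF assms(1,2)] assms(4) unfolding has_coxeter_number_def by blast
  obtain c where c: "jform m 1 c" "\<And>r \<tau>. Im \<tau> > 0 \<Longrightarrow> hcomp m c r \<tau> = h r \<tau> - h' r \<tau>"
    using difference_jform[OF m assms(5-8)] by blast
  have "c n r = 0" for n r by (rule no_weight_1_forms[OF m jform_0_of_1[OF m c(1)]])
  thus ?thesis using c(2) by (simp add: hcomp_def)
qed

end
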